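(* There is an adjoint biequivalence consisting of 2-functors $\mathrm{F}\colon \mathbf{CompCat}\to\mathbf{GCwF}^{\cong}$ and $\mathrm{G}\colon \mathbf{GCwF}^{\cong}\to\mathbf{CompCat}$ between the 2-category $\mathbf{CompCat}$ of comprehension categories and lax morphisms and the 2-category $\mathbf{GCwF}^{\cong}$ of generalised categories with families and loose gcwf morphisms, such that $\mathrm{G}\circ\mathrm{F}=\mathrm{Id}$. Moreover, the biequivalence restricts to the wide 2-full sub-2-categories $\mathbf{CompCat}_{\mathbf{ps}}$ and $\mathbf{GCwF}^{\cong}_{\mathbf{ps}}$ on the pseudo morphisms.
   Context: "Wide" means with the same 0-cells; "2-full" means with all 2-cells between the retained 1-cells. An adjoint biequivalence consists of 2-functors in both directions, together with a pseudo-natural unit and counit whose components are equivalences and which satisfy the triangle identities (up to invertible modification). **Fibrations.** "Fibration" means Grothendieck fibration. Standing assumption: every fibration is equipped with a cleavage, but morphisms are not required to preserve cleavages. The 2-category $\mathbf{Fib}$: 0-cells are fibrations $p\colon\mathcal E\to\mathcal B$; a 1-cell $p\to p'$ is a pair of functors $(B\colon\mathcal B\to\mathcal B',\,E\colon\mathcal E\to\mathcal E')$ with $p'E=Bp$ and $E$ preserving cartesian arrows; a 2-cell $(B_1,E_1)\Rightarrow(B_2,E_2)$ is a pair of natural transformations $(\psi\colon B_1\Rightarrow B_2,\ \phi\colon E_1\Rightarrow E_2)$ with $p'\phi=\psi p$. **Comprehension categories.** $\mathcal B^2$ is the arrow category. A comprehension category $(p,\chi)$ is a fibration $p\colon\mathcal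 E\to\mathcal B$ with a functor $\chi\colon\mathcal E\to\mathcal B^2$ such that $\mathrm{cod}\circ\chi=p$ and $\chi$ maps $p$-cartesian arrows to pullback squares ($\mathcal B$ need not have a terminal object). A lax morphism $(p,\chi)\to(p',\chi')$ is a triple $(B,H,\zeta)$ with $(B,H)\colon p\to p'$ a 1-cell in $\mathbf{Fib}$ and $\zeta\colon B^2\chi\Rightarrow\chi'H$ a natural transformation with $\mathrm{cod}\,\zeta=\mathrm{id}_{Bp}$; it is pseudo if $\zeta$ is invertible. Composition: $(B_2B_1,H_2H_1,(\zeta_2H_1)(B_2^2\zeta_1))$. $\mathbf{CompCat}$ has these as 0- and 1-cells; a 2-cell $(B_1,H_1,\zeta_1)\Rightarrow(B_2,H_2,\zeta_2)$ is a 2-cell $(\psi,\phi)\colon(B_1,H_1)\Rightarrow(B_2,H_2)$ in $\mathbf{Fib}$ with $\chi'\phi\circ\zeta_1=\zeta_2\circ\psi^2\chi$. **Generalised categories with families.** A gcwf $(u,\dot u,\Sigma\dashv\Delta)$ consists of fibrations $u\colon\mathcal U\to\mathcal B$ and $\dot u\colon\dot{\mathcal U}\to\mathcal B$, a functor $\Sigma\colon\dot{\mathcal U}\to\mathcal U$ with $u\Sigma=\dot u$ preserving cartesian arrows, and a right adjoint $\Delta$ of $\Sigma$ (not required to commute with the fibrations) such that all components of the unit are $\dot u$-cartesian and all components of the counit are $u$-cartesian. A loose gcwf morphism $(u,\dot u,\Sigma\dashv\Delta)\to(u',\dot u',\Sigma'\dashv\Delta')$ is a quadruple $(C,H,\dot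 H,\zeta)$ with $(C,H)\colon u\to u'$ and $(C,\dot H)\colon\dot u\to\dot u'$ 1-cells in $\mathbf{Fib}$ and $\zeta\colon\Sigma'\dot H\Rightarrow H\Sigma$ a natural isomorphism with $u'$-vertical components. Its mate is $\zeta^\#:=(\Delta'H\epsilon)(\Delta'\zeta\Delta)(\eta'\dot H\Delta)\colon\dot H\Delta\Rightarrow\Delta'H$, where $\epsilon$ is the counit of $\Sigma\dashv\Delta$ and $\eta'$ the unit of $\Sigma'\dashv\Delta'$; the morphism is pseudo if $\zeta^\#$ is invertible. Composition is componentwise on functors, with isomorphism $(H_2\zeta_1)(\zeta_2\dot H_1)$. $\mathbf{GCwF}^{\cong}$ has gcwfs as 0-cells and loose gcwf morphisms as 1-cells; a 2-cell $(C_1,H_1,\dot H_1,\zeta_1)\to(C_2,H_2,\dot H_2,\zeta_2)$ is a triple $(\psi\colon C_1\Rightarrow C_2,\phi\colon H_1\Rightarrow H_2,\dot\phi\colon\dot H_1\Rightarrow\dot H_2)$ such that $(\psi,\phi)$ and $(\psi,\dot\phi)$ are 2-cells in $\mathbf{Fib}$ and $\phi\Sigma\circ\zeta_1=\zeta_2\circ\Sigma'\dot\phi$. *)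

theory Defs
  imports Main "HOL-Library.FuncSet"
begin

section \<open>Categories, functors and natural transformations\<close>

text \<open>
  All structures carry their sources and targets, and all functions that are part of a structure
  take the value \<^const>\<open>undefined\<close> outside the carriers.  Hence equality of records is equality
  of functors (natural transformations, \dots) in the usual mathematical sense.
\<close>

record ('o, 'a) cat =
  Obj :: "'o set"
  Arr :: "'a set"
  Dom :: "'a \<Rightarrow> 'o"
  Cod :: "'a \<Rightarrow> 'o"
  Ide :: "'o \<Rightarrow> 'a"
  Comp :: "'a \<Rightarrow> 'a \<Rightarrow> 'a"  \<comment> \<open>\<open>Comp C g f\<close> is \<open>g\<close> after \<open>f\<close>\<close>

definition Hom :: "('o, 'a) cat \<Rightarrow> 'o \<Rightarrow> 'o \<Rightarrow> 'a set" where
  "Hom C x y = {f \<in> Arr C. Dom C f = x \<and> Cod C f = y}"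

locale category =
  fixes C :: "('o, 'a) cat"
  assumes Dom_in: "f \<in> Arr C \<Longrightarrow> Dom C f \<in> Obj C"
    and Cod_in: "f \<in> Arr C \<Longrightarrow> Cod C f \<in> Obj C"
    and Ide_in: "x \<in> Obj C \<Longrightarrow> Ide C x \<in> Hom C x x"
    and Comp_in: "f \<in> Hom C x y \<Longrightarrow> g \<in> Hom C y z \<Longrightarrow> Comp C g f \<in> Hom C x z"
    and Comp_Ide_left: "f \<in> Hom C x y \<Longrightarrow> Comp C (Ide C y) f = f"
    and Comp_Ide_right: "f \<in> Hom C x y \<Longrightarrow> Comp C f (Ide C x) = f"
    and Comp_assoc: "f \<in> Hom C w x \<Longrightarrow> g \<in> Hom C x y \<Longrightarrow> h \<in> Hom C y z \<Longrightarrow>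
      Comp C h (Comp C g f) = Comp C (Comp C h g) f"
    and Dom_ext: "Dom C \<in> extensional (Arr C)"
    and Cod_ext: "Cod C \<in> extensional (Arr C)"
    and Ide_ext: "Ide C \<in> extensional (Obj C)"
    and Comp_ext: "\<not> (f \<in> Arr C \<and> g \<in> Arr C \<and> Cod C f = Dom C g) \<Longrightarrow> Comp C g f = undefined"

definition is_iso :: "('o, 'a) cat \<Rightarrow> 'a \<Rightarrow> bool" where
  "is_iso C f \<longleftrightarrow> f \<in> Arr C \<and>
    (\<exists>g \<in> Hom C (Cod C f) (Dom C f).
       Comp C g f = Ide C (Dom C f) \<and> Comp C f g = Ide C (Cod C f))"

record ('o, 'a, 'p, 'b) ftr =
  FDom :: "('o, 'a) cat"
  FCod :: "('p, 'b) cat"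
  FObj :: "'o \<Rightarrow> 'p"
  FArr :: "'a \<Rightarrow> 'b"

locale cat_functor =
  fixes F :: "('o, 'a, 'p, 'b) ftr"
  assumes FDom_category: "category (FDom F)"
    and FCod_category: "category (FCod F)"
    and FObj_in: "x \<in> Obj (FDom F) \<Longrightarrow> FObj F x \<in> Obj (FCod F)"
    and FArr_in: "f \<in> Hom (FDom F) x y \<Longrightarrow> FArr F f \<in> Hom (FCod F) (FObj F x) (FObj F y)"
    and FArr_Ide: "x \<in> Obj (FDom F) \<Longrightarrow> FArr F (Ide (FDom F) x) = Ide (FCod F) (FObj F x)"
    and FArr_Comp: "f \<in> Hom (FDom F) x y \<Longrightarrow> g \<in> Hom (FDom F) y z \<Longrightarrow>
      FArr F (Comp (FDom F) g f) = Comp (FCod F) (FArr F g) (FArr F f)"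
    and FObj_ext: "FObj F \<in> extensional (Obj (FDom F))"
    and FArr_ext: "FArr F \<in> extensional (Arr (FDom F))"

definition id_ftr :: "('o, 'a) cat \<Rightarrow> ('o, 'a, 'o, 'a) ftr" where
  "id_ftr C = \<lparr>FDom = C, FCod = C, FObj = restrict id (Obj C), FArr = restrict id (Arr C)\<rparr>"

definition comp_ftr ::
  "('p, 'b, 'q, 'c) ftr \<Rightarrow> ('o, 'a, 'p, 'b) ftr \<Rightarrow> ('o, 'a, 'q, 'c) ftr" (infixr "\<circ>\<^sub>c" 75) where
  "G \<circ>\<^sub>c F = \<lparr>FDom = FDom F, FCod = FCod G,
     FObj = restrict (FObj G \<circ> FObj F) (Obj (FDom F)),
     FArr = restrict (FArr G \<circ> FArr F) (Arr (FDom F))\<rparr>"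

record ('o, 'a, 'p, 'b) ntr =
  NDom :: "('o, 'a, 'p, 'b) ftr"
  NCod :: "('o, 'a, 'p, 'b) ftr"
  NComp :: "'o \<Rightarrow> 'b"

locale nat_trans =
  fixes \<alpha> :: "('o, 'a, 'p, 'b) ntr"
  assumes NDom_functor: "cat_functor (NDom \<alpha>)"
    and NCod_functor: "cat_functor (NCod \<alpha>)"
    and FDom_eq: "FDom (NCod \<alpha>) = FDom (NDom \<alpha>)"
    and FCod_eq: "FCod (NCod \<alpha>) = FCod (NDom \<alpha>)"
    and NComp_in: "x \<in> Obj (FDom (NDom \<alpha>)) \<Longrightarrow>
      NComp \<alpha> x \<in> Hom (FCod (NDom \<alpha>)) (FObj (NDom \<alpha>) x) (FObj (NCod \<alpha>) x)"
    and naturality: "f \<in> Hom (FDom (NDom \<alpha>)) x y \<Longrightarrow>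
      Comp (FCod (NDom \<alpha>)) (FArr (NCod \<alpha>) f) (NComp \<alpha> x) =
      Comp (FCod (NDom \<alpha>)) (NComp \<alpha> y) (FArr (NDom \<alpha>) f)"
    and NComp_ext: "NComp \<alpha> \<in> extensional (Obj (FDom (NDom \<alpha>)))"

definition nat_from_to ::
  "('o, 'a, 'p, 'b) ntr \<Rightarrow> ('o, 'a, 'p, 'b) ftr \<Rightarrow> ('o, 'a, 'p, 'b) ftr \<Rightarrow> bool" where
  "nat_from_to \<alpha> F G \<longleftrightarrow> nat_trans \<alpha> \<and> NDom \<alpha> = F \<and> NCod \<alpha> = G"

definition nat_iso :: "('o, 'a, 'p, 'b) ntr \<Rightarrow> bool" where
  "nat_iso \<alpha> \<longleftrightarrow> nat_trans \<alpha> \<and>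
    (\<forall>x \<in> Obj (FDom (NDom \<alpha>)). is_iso (FCod (NDom \<alpha>)) (NComp \<alpha> x))"

definition id_nat :: "('o, 'a, 'p, 'b) ftr \<Rightarrow> ('o, 'a, 'p, 'b) ntr" where
  "id_nat F = \<lparr>NDom = F, NCod = F,
     NComp = restrict (\<lambda>x. Ide (FCod F) (FObj F x)) (Obj (FDom F))\<rparr>"

definition vcomp_nat ::
  "('o, 'a, 'p, 'b) ntr \<Rightarrow> ('o, 'a, 'p, 'b) ntr \<Rightarrow> ('o, 'a, 'p, 'b) ntr" (infixl "\<bullet>" 65) where
  "\<beta> \<bullet> \<alpha> = \<lparr>NDom = NDom \<alpha>, NCod = NCod \<beta>,
     NComp = restrict (\<lambda>x. Comp (FCod (NDom \<alpha>)) (NComp \<beta> x) (NComp \<alpha> x)) (Obj (FDom (NDom \<alpha>)))\<rparr>"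

text \<open>The whiskerings \<open>F \<cdot>\<^sub>l \<alpha>\<close> (components \<open>F \<alpha>\<^sub>x\<close>) and \<open>\<alpha> \<cdot>\<^sub>r F\<close> (components
  \<open>\<alpha>\<^bsub>F x\<^esub>\<close>).\<close>

definition lwhisker ::
  "('p, 'b, 'q, 'c) ftr \<Rightarrow> ('o, 'a, 'p, 'b) ntr \<Rightarrow> ('o, 'a, 'q, 'c) ntr" (infixr "\<cdot>\<^sub>l" 73) where
  "F \<cdot>\<^sub>l \<alpha> = \<lparr>NDom = F \<circ>\<^sub>c NDom \<alpha>, NCod = F \<circ>\<^sub>c NCod \<alpha>,
     NComp = restrict (\<lambda>x. FArr F (NComp \<alpha> x)) (Obj (FDom (NDom \<alpha>)))\<rparr>"

definition rwhisker ::
  "('p, 'b, 'q, 'c) ntr \<Rightarrow> ('o, 'a, 'p, 'b) ftr \<Rightarrow> ('o, 'a, 'q, 'c) ntr" (infixl "\<cdot>\<^sub>r" 74) where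
  "\<alpha> \<cdot>\<^sub>r F = \<lparr>NDom = NDom \<alpha> \<circ>\<^sub>c F, NCod = NCod \<alpha> \<circ>\<^sub>c F,
     NComp = restrict (\<lambda>x. NComp \<alpha> (FObj F x)) (Obj (FDom F))\<rparr>"

definition hcomp_nat ::
  "('p, 'b, 'q, 'c) ntr \<Rightarrow> ('o, 'a, 'p, 'b) ntr \<Rightarrow> ('o, 'a, 'q, 'c) ntr" (infixr "\<star>" 73) where
  "\<beta> \<star> \<alpha> = (\<beta> \<cdot>\<^sub>r NCod \<alpha>) \<bullet> (NDom \<beta> \<cdot>\<^sub>l \<alpha>)"


section \<open>Arrow categories\<close>

text \<open>An arrow \<open>f \<rightarrow> g\<close> of the arrow category is a tuple \<open>(f, g, h, k)\<close> with \<open>g \<circ> h = k \<circ> f\<close>.\<close>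

definition arrow_cat :: "('o, 'a) cat \<Rightarrow> ('a, 'a \<times> 'a \<times> 'a \<times> 'a) cat" where
  "arrow_cat B =
    (let S = {(f, g, h, k). f \<in> Arr B \<and> g \<in> Arr B \<and> h \<in> Hom B (Dom B f) (Dom B g) \<and>
                k \<in> Hom B (Cod B f) (Cod B g) \<and> Comp B g h = Comp B k f}
     in \<lparr>Obj = Arr B, Arr = S,
         Dom = restrict (\<lambda>(f, g, h, k). f) S,
         Cod = restrict (\<lambda>(f, g, h, k). g) S,
         Ide = restrict (\<lambda>f. (f, f, Ide B (Dom B f), Ide B (Cod B f))) (Arr B),
         Comp = (\<lambda>(f', g', h', k') (f, g, h, k).
           if (f', g', h', k') \<in> S \<and> (f, g, h, k) \<in> S \<and> g = f'
           then (f, g', Comp B h' h, Comp B k' k) else undefined)\<rparr>)"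

definition cod_ftr :: "('o, 'a) cat \<Rightarrow> ('a, 'a \<times> 'a \<times> 'a \<times> 'a, 'o, 'a) ftr" where
  "cod_ftr B = \<lparr>FDom = arrow_cat B, FCod = B, FObj = restrict (Cod B) (Arr B),
     FArr = restrict (\<lambda>(f, g, h, k). k) (Arr (arrow_cat B))\<rparr>"

definition arrow_ftr ::
  "('o, 'a, 'p, 'b) ftr \<Rightarrow> ('a, 'a \<times> 'a \<times> 'a \<times> 'a, 'b, 'b \<times> 'b \<times> 'b \<times> 'b) ftr" where
  "arrow_ftr F = \<lparr>FDom = arrow_cat (FDom F), FCod = arrow_cat (FCod F),
     FObj = restrict (FArr F) (Arr (FDom F)),
     FArr = restrict (\<lambda>(f, g, h, k). (FArr F f, FArr F g, FArr F h, FArr F k))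
       (Arr (arrow_cat (FDom F)))\<rparr>"

definition arrow_nat ::
  "('o, 'a, 'p, 'b) ntr \<Rightarrow> ('a, 'a \<times> 'a \<times> 'a \<times> 'a, 'b, 'b \<times> 'b \<times> 'b \<times> 'b) ntr" where
  "arrow_nat \<alpha> = \<lparr>NDom = arrow_ftr (NDom \<alpha>), NCod = arrow_ftr (NCod \<alpha>),
     NComp = restrict
       (\<lambda>f. (FArr (NDom \<alpha>) f, FArr (NCod \<alpha>) f,
             NComp \<alpha> (Dom (FDom (NDom \<alpha>)) f), NComp \<alpha> (Cod (FDom (NDom \<alpha>)) f)))
       (Arr (FDom (NDom \<alpha>)))\<rparr>"

definition is_pullback :: "('o, 'a) cat \<Rightarrow> 'a \<times> 'a \<times> 'a \<times> 'a \<Rightarrow> bool" where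
  "is_pullback B s \<longleftrightarrow> s \<in> Arr (arrow_cat B) \<and>
    (case s of (f, g, h, k) \<Rightarrow>
      \<forall>z \<in> Obj B. \<forall>a \<in> Hom B z (Dom B g). \<forall>b \<in> Hom B z (Cod B f).
        Comp B g a = Comp B k b \<longrightarrow>
        (\<exists>!m. m \<in> Hom B z (Dom B f) \<and> Comp B h m = a \<and> Comp B f m = b))"


section \<open>Fibrations\<close>

definition cartesian :: "('o, 'a, 'p, 'b) ftr \<Rightarrow> 'a \<Rightarrow> bool" where
  "cartesian p f \<longleftrightarrow> f \<in> Arr (FDom p) \<and>
    (\<forall>g \<in> Arr (FDom p). \<forall>w \<in> Hom (FCod p) (FObj p (Dom (FDom p) g)) (FObj p (Dom (FDom p) f)).
       Cod (FDom p) g = Cod (FDom p) f \<and> Comp (FCod p) (FArr p f) w = FArr p g \<longrightarrow>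
       (\<exists>!h. h \<in> Hom (FDom p) (Dom (FDom p) g) (Dom (FDom p) f) \<and>
             FArr p h = w \<and> Comp (FDom p) f h = g))"

record ('o, 'a, 'p, 'b) fib =
  Fun :: "('o, 'a, 'p, 'b) ftr"
  Lift :: "'b \<Rightarrow> 'o \<Rightarrow> 'a"

abbreviation Tot :: "('o, 'a, 'p, 'b) fib \<Rightarrow> ('o, 'a) cat" where "Tot p \<equiv> FDom (Fun p)"
abbreviation Base :: "('o, 'a, 'p, 'b) fib \<Rightarrow> ('p, 'b) cat" where "Base p \<equiv> FCod (Fun p)"

text \<open>A fibration is equipped with a cleavage: \<open>Lift p w e\<close> is the chosen cartesian arrow over
  \<open>w\<close> with codomain \<open>e\<close>.  The cleavage is neither normal nor split.\<close>

locale fibration =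
  fixes p :: "('o, 'a, 'p, 'b) fib"
  assumes Fun_functor: "cat_functor (Fun p)"
    and Lift_cartesian: "e \<in> Obj (Tot p) \<Longrightarrow> w \<in> Arr (Base p) \<Longrightarrow> Cod (Base p) w = FObj (Fun p) e \<Longrightarrow>
      cartesian (Fun p) (Lift p w e) \<and> Cod (Tot p) (Lift p w e) = e \<and>
      FArr (Fun p) (Lift p w e) = w"
    and Lift_ext: "\<not> (e \<in> Obj (Tot p) \<and> w \<in> Arr (Base p) \<and> Cod (Base p) w = FObj (Fun p) e) \<Longrightarrow>
      Lift p w e = undefined"

definition fib_cell1 ::
  "('o, 'a, 'p, 'b) fib \<Rightarrow> ('o', 'a', 'p', 'b') fib \<Rightarrow>
   ('p, 'b, 'p', 'b') ftr \<Rightarrow> ('o, 'a, 'o', 'a') ftr \<Rightarrow> bool" where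
  "fib_cell1 p p' B E \<longleftrightarrow> fibration p \<and> fibration p' \<and>
    cat_functor B \<and> FDom B = Base p \<and> FCod B = Base p' \<and>
    cat_functor E \<and> FDom E = Tot p \<and> FCod E = Tot p' \<and>
    Fun p' \<circ>\<^sub>c E = B \<circ>\<^sub>c Fun p \<and>
    (\<forall>f. cartesian (Fun p) f \<longrightarrow> cartesian (Fun p') (FArr E f))"

text \<open>The relation ``\<open>(\<psi>, \<phi>)\<close> is a 2-cell \<open>(B\<^sub>1, E\<^sub>1) \<Rightarrow> (B\<^sub>2, E\<^sub>2) : p \<rightarrow> p'\<close> of fibrations''.\<close>

definition fib_cell2 ::
  "('o, 'a, 'p, 'b) fib \<Rightarrow> ('o', 'a', 'p', 'b') fib \<Rightarrow>
   ('p, 'b, 'p', 'b') ftr \<Rightarrow> ('o, 'a, 'o', 'a') ftr \<Rightarrow>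
   ('p, 'b, 'p', 'b') ftr \<Rightarrow> ('o, 'a, 'o', 'a') ftr \<Rightarrow>
   ('p, 'b, 'p', 'b') ntr \<Rightarrow> ('o, 'a, 'o', 'a') ntr \<Rightarrow> bool" where
  "fib_cell2 p p' B1 E1 B2 E2 \<psi> \<phi> \<longleftrightarrow>
    fib_cell1 p p' B1 E1 \<and> fib_cell1 p p' B2 E2 \<and>
    nat_from_to \<psi> B1 B2 \<and> nat_from_to \<phi> E1 E2 \<and> Fun p' \<cdot>\<^sub>l \<phi> = \<psi> \<cdot>\<^sub>r Fun p"


section \<open>Strict 2-categories and adjoint biequivalences\<close>

record ('o, 'm, 'c) two_cat =
  Cell0 :: "'o set"
  Cell1 :: "'m set"
  Cell2 :: "'c set"
  Src1 :: "'m \<Rightarrow> 'o"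
  Tgt1 :: "'m \<Rightarrow> 'o"
  Src2 :: "'c \<Rightarrow> 'm"
  Tgt2 :: "'c \<Rightarrow> 'm"
  Id1 :: "'o \<Rightarrow> 'm"
  Comp1 :: "'m \<Rightarrow> 'm \<Rightarrow> 'm"
  Id2 :: "'m \<Rightarrow> 'c"
  VComp :: "'c \<Rightarrow> 'c \<Rightarrow> 'c"
  HComp :: "'c \<Rightarrow> 'c \<Rightarrow> 'c"

definition Hom1 :: "('o, 'm, 'c) two_cat \<Rightarrow> 'o \<Rightarrow> 'o \<Rightarrow> 'm set" where
  "Hom1 K X Y = {f \<in> Cell1 K. Src1 K f = X \<and> Tgt1 K f = Y}"

definition Hom2 :: "('o, 'm, 'c) two_cat \<Rightarrow> 'm \<Rightarrow> 'm \<Rightarrow> 'c set" where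
  "Hom2 K f g = {\<alpha> \<in> Cell2 K. Src2 K \<alpha> = f \<and> Tgt2 K \<alpha> = g}"

locale two_category =
  fixes K :: "('o, 'm, 'c) two_cat"
  assumes Src1_in: "f \<in> Cell1 K \<Longrightarrow> Src1 K f \<in> Cell0 K"
    and Tgt1_in: "f \<in> Cell1 K \<Longrightarrow> Tgt1 K f \<in> Cell0 K"
    and Src2_in: "\<alpha> \<in> Cell2 K \<Longrightarrow> Src2 K \<alpha> \<in> Cell1 K"
    and Tgt2_in: "\<alpha> \<in> Cell2 K \<Longrightarrow> Tgt2 K \<alpha> \<in> Cell1 K"
    and Src1_Tgt2: "\<alpha> \<in> Cell2 K \<Longrightarrow> Src1 K (Tgt2 K \<alpha>) = Src1 K (Src2 K \<alpha>)"
    and Tgt1_Tgt2: "\<alpha> \<in> Cell2 K \<Longrightarrow> Tgt1 K (Tgt2 K \<alpha>) = Tgt1 K (Src2 K \<alpha>)"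
    and Id1_in: "X \<in> Cell0 K \<Longrightarrow> Id1 K X \<in> Hom1 K X X"
    and Comp1_in: "f \<in> Hom1 K X Y \<Longrightarrow> g \<in> Hom1 K Y Z \<Longrightarrow> Comp1 K g f \<in> Hom1 K X Z"
    and Comp1_Id_left: "f \<in> Hom1 K X Y \<Longrightarrow> Comp1 K (Id1 K Y) f = f"
    and Comp1_Id_right: "f \<in> Hom1 K X Y \<Longrightarrow> Comp1 K f (Id1 K X) = f"
    and Comp1_assoc: "f \<in> Hom1 K W X \<Longrightarrow> g \<in> Hom1 K X Y \<Longrightarrow> h \<in> Hom1 K Y Z \<Longrightarrow>
      Comp1 K h (Comp1 K g f) = Comp1 K (Comp1 K h g) f"
    and Id2_in: "f \<in> Cell1 K \<Longrightarrow> Id2 K f \<in> Hom2 K f f"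
    and VComp_in: "\<alpha> \<in> Hom2 K f g \<Longrightarrow> \<beta> \<in> Hom2 K g h \<Longrightarrow> VComp K \<beta> \<alpha> \<in> Hom2 K f h"
    and VComp_Id_left: "\<alpha> \<in> Hom2 K f g \<Longrightarrow> VComp K (Id2 K g) \<alpha> = \<alpha>"
    and VComp_Id_right: "\<alpha> \<in> Hom2 K f g \<Longrightarrow> VComp K \<alpha> (Id2 K f) = \<alpha>"
    and VComp_assoc: "\<alpha> \<in> Hom2 K e f \<Longrightarrow> \<beta> \<in> Hom2 K f g \<Longrightarrow> \<gamma> \<in> Hom2 K g h \<Longrightarrow>
      VComp K \<gamma> (VComp K \<beta> \<alpha>) = VComp K (VComp K \<gamma> \<beta>) \<alpha>"
    and HComp_in: "f \<in> Hom1 K X Y \<Longrightarrow> g \<in> Hom1 K Y Z \<Longrightarrow> \<alpha> \<in> Hom2 K f f' \<Longrightarrow> \<beta> \<in> Hom2 K g g' \<Longrightarrow>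
      HComp K \<beta> \<alpha> \<in> Hom2 K (Comp1 K g f) (Comp1 K g' f')"
    and HComp_Id_left: "f \<in> Hom1 K X Y \<Longrightarrow> \<alpha> \<in> Hom2 K f f' \<Longrightarrow>
      HComp K (Id2 K (Id1 K Y)) \<alpha> = \<alpha>"
    and HComp_Id_right: "f \<in> Hom1 K X Y \<Longrightarrow> \<alpha> \<in> Hom2 K f f' \<Longrightarrow>
      HComp K \<alpha> (Id2 K (Id1 K X)) = \<alpha>"
    and HComp_assoc: "f \<in> Hom1 K W X \<Longrightarrow> g \<in> Hom1 K X Y \<Longrightarrow> h \<in> Hom1 K Y Z \<Longrightarrow>
      \<alpha> \<in> Hom2 K f f' \<Longrightarrow> \<beta> \<in> Hom2 K g g' \<Longrightarrow> \<gamma> \<in> Hom2 K h h' \<Longrightarrow>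
      HComp K \<gamma> (HComp K \<beta> \<alpha>) = HComp K (HComp K \<gamma> \<beta>) \<alpha>"
    and HComp_Id2: "f \<in> Hom1 K X Y \<Longrightarrow> g \<in> Hom1 K Y Z \<Longrightarrow>
      HComp K (Id2 K g) (Id2 K f) = Id2 K (Comp1 K g f)"
    and interchange: "f \<in> Hom1 K X Y \<Longrightarrow> g \<in> Hom1 K Y Z \<Longrightarrow>
      \<alpha> \<in> Hom2 K f f' \<Longrightarrow> \<alpha>' \<in> Hom2 K f' f'' \<Longrightarrow> \<beta> \<in> Hom2 K g g' \<Longrightarrow> \<beta>' \<in> Hom2 K g' g'' \<Longrightarrow>
      HComp K (VComp K \<beta>' \<beta>) (VComp K \<alpha>' \<alpha>) = VComp K (HComp K \<beta>' \<alpha>') (HComp K \<beta> \<alpha>)"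

definition invertible2 :: "('o, 'm, 'c) two_cat \<Rightarrow> 'c \<Rightarrow> bool" where
  "invertible2 K \<alpha> \<longleftrightarrow> \<alpha> \<in> Cell2 K \<and>
    (\<exists>\<beta> \<in> Hom2 K (Tgt2 K \<alpha>) (Src2 K \<alpha>).
       VComp K \<beta> \<alpha> = Id2 K (Src2 K \<alpha>) \<and> VComp K \<alpha> \<beta> = Id2 K (Tgt2 K \<alpha>))"

definition isomorphic1 :: "('o, 'm, 'c) two_cat \<Rightarrow> 'm \<Rightarrow> 'm \<Rightarrow> bool" where
  "isomorphic1 K f g \<longleftrightarrow> (\<exists>\<alpha> \<in> Hom2 K f g. invertible2 K \<alpha>)"

definition equivalence1 :: "('o, 'm, 'c) two_cat \<Rightarrow> 'm \<Rightarrow> bool" where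
  "equivalence1 K f \<longleftrightarrow> f \<in> Cell1 K \<and>
    (\<exists>g \<in> Hom1 K (Tgt1 K f) (Src1 K f).
       isomorphic1 K (Id1 K (Src1 K f)) (Comp1 K g f) \<and>
       isomorphic1 K (Comp1 K f g) (Id1 K (Tgt1 K f)))"

definition wide_2full_sub :: "('o, 'm, 'c) two_cat \<Rightarrow> ('m \<Rightarrow> bool) \<Rightarrow> ('o, 'm, 'c) two_cat" where
  "wide_2full_sub K P = K
    \<lparr>Cell1 := {f \<in> Cell1 K. P f}, Cell2 := {\<alpha> \<in> Cell2 K. P (Src2 K \<alpha>) \<and> P (Tgt2 K \<alpha>)}\<rparr>"

record ('o, 'm, 'c, 'p, 'n, 'd) two_ftr =
  Map0 :: "'o \<Rightarrow> 'p"
  Map1 :: "'m \<Rightarrow> 'n"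
  Map2 :: "'c \<Rightarrow> 'd"

locale two_functor = K: two_category K + L: two_category L
  for K :: "('o, 'm, 'c) two_cat" and L :: "('p, 'n, 'd) two_cat" +
  fixes F :: "('o, 'm, 'c, 'p, 'n, 'd) two_ftr"
  assumes Map0_in: "X \<in> Cell0 K \<Longrightarrow> Map0 F X \<in> Cell0 L"
    and Map1_in: "f \<in> Hom1 K X Y \<Longrightarrow> Map1 F f \<in> Hom1 L (Map0 F X) (Map0 F Y)"
    and Map2_in: "\<alpha> \<in> Hom2 K f g \<Longrightarrow> Map2 F \<alpha> \<in> Hom2 L (Map1 F f) (Map1 F g)"
    and Map1_Id1: "X \<in> Cell0 K \<Longrightarrow> Map1 F (Id1 K X) = Id1 L (Map0 F X)"
    and Map1_Comp1: "f \<in> Hom1 K X Y \<Longrightarrow> g \<in> Hom1 K Y Z \<Longrightarrow>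
      Map1 F (Comp1 K g f) = Comp1 L (Map1 F g) (Map1 F f)"
    and Map2_Id2: "f \<in> Cell1 K \<Longrightarrow> Map2 F (Id2 K f) = Id2 L (Map1 F f)"
    and Map2_VComp: "\<alpha> \<in> Hom2 K f g \<Longrightarrow> \<beta> \<in> Hom2 K g h \<Longrightarrow>
      Map2 F (VComp K \<beta> \<alpha>) = VComp L (Map2 F \<beta>) (Map2 F \<alpha>)"
    and Map2_HComp: "f \<in> Hom1 K X Y \<Longrightarrow> g \<in> Hom1 K Y Z \<Longrightarrow> \<alpha> \<in> Hom2 K f f' \<Longrightarrow> \<beta> \<in> Hom2 K g g' \<Longrightarrow>
      Map2 F (HComp K \<beta> \<alpha>) = HComp L (Map2 F \<beta>) (Map2 F \<alpha>)"

definition id_two_ftr :: "('o, 'm, 'c, 'o, 'm, 'c) two_ftr" where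
  "id_two_ftr = \<lparr>Map0 = id, Map1 = id, Map2 = id\<rparr>"

definition comp_two_ftr ::
  "('p, 'n, 'd, 'q, 'k, 'e) two_ftr \<Rightarrow> ('o, 'm, 'c, 'p, 'n, 'd) two_ftr \<Rightarrow>
   ('o, 'm, 'c, 'q, 'k, 'e) two_ftr" where
  "comp_two_ftr G F = \<lparr>Map0 = Map0 G \<circ> Map0 F, Map1 = Map1 G \<circ> Map1 F, Map2 = Map2 G \<circ> Map2 F\<rparr>"

text \<open>2-functors are not normalised outside the cells of their source (so that the restriction to
  a sub-2-category is given by the same record); their equality is agreement on cells.\<close>

definition two_ftr_eq ::
  "('o, 'm, 'c) two_cat \<Rightarrow> ('o, 'm, 'c, 'p, 'n, 'd) two_ftr \<Rightarrow>
   ('o, 'm, 'c, 'p, 'n, 'd) two_ftr \<Rightarrow> bool" where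
  "two_ftr_eq K F G \<longleftrightarrow>
    (\<forall>X \<in> Cell0 K. Map0 F X = Map0 G X) \<and>
    (\<forall>f \<in> Cell1 K. Map1 F f = Map1 G f) \<and>
    (\<forall>\<alpha> \<in> Cell2 K. Map2 F \<alpha> = Map2 G \<alpha>)"

text \<open>Pseudo-natural transformations \<open>\<sigma> : F \<Rightarrow> G\<close> with components \<open>\<sigma>\<^sub>X : F X \<rightarrow> G X\<close> and invertible
  2-cells \<open>\<sigma>\<^sub>f : G f \<circ> \<sigma>\<^sub>X \<Rightarrow> \<sigma>\<^sub>Y \<circ> F f\<close> for \<open>f : X \<rightarrow> Y\<close>.\<close>

record ('o, 'm, 'n, 'd) pseudo_nat =
  PObj :: "'o \<Rightarrow> 'n"
  PArr :: "'m \<Rightarrow> 'd"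

locale pseudo_natural = F: two_functor K L F + G: two_functor K L G
  for K :: "('o, 'm, 'c) two_cat" and L :: "('p, 'n, 'd) two_cat"
    and F G :: "('o, 'm, 'c, 'p, 'n, 'd) two_ftr" +
  fixes \<sigma> :: "('o, 'm, 'n, 'd) pseudo_nat"
  assumes PObj_in: "X \<in> Cell0 K \<Longrightarrow> PObj \<sigma> X \<in> Hom1 L (Map0 F X) (Map0 G X)"
    and PArr_in: "f \<in> Hom1 K X Y \<Longrightarrow>
      PArr \<sigma> f \<in> Hom2 L (Comp1 L (Map1 G f) (PObj \<sigma> X)) (Comp1 L (PObj \<sigma> Y) (Map1 F f))"
    and PArr_invertible: "f \<in> Cell1 K \<Longrightarrow> invertible2 L (PArr \<sigma> f)"
    and PArr_Id1: "X \<in> Cell0 K \<Longrightarrow> PArr \<sigma> (Id1 K X) = Id2 L (PObj \<sigma> X)"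
    and PArr_Comp1: "f \<in> Hom1 K X Y \<Longrightarrow> g \<in> Hom1 K Y Z \<Longrightarrow>
      PArr \<sigma> (Comp1 K g f) =
      VComp L (HComp L (PArr \<sigma> g) (Id2 L (Map1 F f))) (HComp L (Id2 L (Map1 G g)) (PArr \<sigma> f))"
    and PArr_natural: "f \<in> Hom1 K X Y \<Longrightarrow> \<alpha> \<in> Hom2 K f g \<Longrightarrow>
      VComp L (HComp L (Id2 L (PObj \<sigma> Y)) (Map2 F \<alpha>)) (PArr \<sigma> f) =
      VComp L (PArr \<sigma> g) (HComp L (Map2 G \<alpha>) (Id2 L (PObj \<sigma> X)))"

definition id_pseudo ::
  "('p, 'n, 'd) two_cat \<Rightarrow> ('o, 'm, 'c, 'p, 'n, 'd) two_ftr \<Rightarrow> ('o, 'm, 'n, 'd) pseudo_nat" where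
  "id_pseudo L F = \<lparr>PObj = (\<lambda>X. Id1 L (Map0 F X)), PArr = (\<lambda>f. Id2 L (Map1 F f))\<rparr>"

text \<open>Vertical composition; \<open>K\<close> is needed to find the source and target of a 1-cell \<open>f\<close>.\<close>

definition vcomp_pseudo ::
  "('o, 'm, 'c) two_cat \<Rightarrow> ('p, 'n, 'd) two_cat \<Rightarrow>
   ('o, 'm, 'n, 'd) pseudo_nat \<Rightarrow> ('o, 'm, 'n, 'd) pseudo_nat \<Rightarrow> ('o, 'm, 'n, 'd) pseudo_nat" where
  "vcomp_pseudo K L \<tau> \<sigma> =
    \<lparr>PObj = (\<lambda>X. Comp1 L (PObj \<tau> X) (PObj \<sigma> X)),
     PArr = (\<lambda>f. VComp L (HComp L (Id2 L (PObj \<tau> (Tgt1 K f))) (PArr \<sigma> f))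
                          (HComp L (PArr \<tau> f) (Id2 L (PObj \<sigma> (Src1 K f)))))\<rparr>"

definition lwhisker_pseudo ::
  "('p, 'n, 'd, 'q, 'k, 'e) two_ftr \<Rightarrow> ('o, 'm, 'n, 'd) pseudo_nat \<Rightarrow> ('o, 'm, 'k, 'e) pseudo_nat" where
  "lwhisker_pseudo H \<sigma> = \<lparr>PObj = Map1 H \<circ> PObj \<sigma>, PArr = Map2 H \<circ> PArr \<sigma>\<rparr>"

definition rwhisker_pseudo ::
  "('p, 'n, 'k, 'e) pseudo_nat \<Rightarrow> ('o, 'm, 'c, 'p, 'n, 'd) two_ftr \<Rightarrow> ('o, 'm, 'k, 'e) pseudo_nat" where
  "rwhisker_pseudo \<sigma> H = \<lparr>PObj = PObj \<sigma> \<circ> Map0 H, PArr = PArr \<sigma> \<circ> Map1 H\<rparr>"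

definition invertible_modification ::
  "('o, 'm, 'c) two_cat \<Rightarrow> ('p, 'n, 'd) two_cat \<Rightarrow>
   ('o, 'm, 'c, 'p, 'n, 'd) two_ftr \<Rightarrow> ('o, 'm, 'c, 'p, 'n, 'd) two_ftr \<Rightarrow>
   ('o, 'm, 'n, 'd) pseudo_nat \<Rightarrow> ('o, 'm, 'n, 'd) pseudo_nat \<Rightarrow> ('o \<Rightarrow> 'd) \<Rightarrow> bool" where
  "invertible_modification K L F G \<sigma> \<tau> m \<longleftrightarrow>
    pseudo_natural K L F G \<sigma> \<and> pseudo_natural K L F G \<tau> \<and>
    (\<forall>X \<in> Cell0 K. m X \<in> Hom2 L (PObj \<sigma> X) (PObj \<tau> X) \<and> invertible2 L (m X)) \<and>
    (\<forall>X Y. \<forall>f \<in> Hom1 K X Y.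
       VComp L (HComp L (m Y) (Id2 L (Map1 F f))) (PArr \<sigma> f) =
       VComp L (PArr \<tau> f) (HComp L (Id2 L (Map1 G f)) (m X)))"

locale adjoint_biequivalence =
  F: two_functor K L F + G: two_functor L K G +
  unit: pseudo_natural K K id_two_ftr "comp_two_ftr G F" \<eta> +
  counit: pseudo_natural L L "comp_two_ftr F G" id_two_ftr \<epsilon>
  for K :: "('o, 'm, 'c) two_cat" and L :: "('p, 'n, 'd) two_cat"
    and F :: "('o, 'm, 'c, 'p, 'n, 'd) two_ftr" and G :: "('p, 'n, 'd, 'o, 'm, 'c) two_ftr"
    and \<eta> :: "('o, 'm, 'm, 'c) pseudo_nat" and \<epsilon> :: "('p, 'n, 'n, 'd) pseudo_nat" +
  assumes unit_equivalence: "X \<in> Cell0 K \<Longrightarrow> equivalence1 K (PObj \<eta> X)"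
    and counit_equivalence: "Y \<in> Cell0 L \<Longrightarrow> equivalence1 L (PObj \<epsilon> Y)"
    and triangle_F: "\<exists>s. invertible_modification K L F F
      (vcomp_pseudo K L (rwhisker_pseudo \<epsilon> F) (lwhisker_pseudo F \<eta>)) (id_pseudo L F) s"
    and triangle_G: "\<exists>t. invertible_modification L K G G
      (vcomp_pseudo L K (lwhisker_pseudo G \<epsilon>) (rwhisker_pseudo \<eta> G)) (id_pseudo K G) t"


section \<open>The 2-category of comprehension categories\<close>

text \<open>From here on, a category has its objects and arrows in one type \<open>'u\<close>, which plays the role
  of the universe of small sets.  An infinite \<open>'u\<close> admits an injection \<open>'u \<times> 'u \<Rightarrow> 'u\<close>, so it is
  closed under constructions such as categories of coalgebras.\<close>

type_synonym 'u scat = "('u, 'u) cat"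
type_synonym 'u sftr = "('u, 'u, 'u, 'u) ftr"
type_synonym 'u sntr = "('u, 'u, 'u, 'u) ntr"
type_synonym 'u sfib = "('u, 'u, 'u, 'u) fib"
type_synonym 'u chi_ftr = "('u, 'u, 'u, 'u \<times> 'u \<times> 'u \<times> 'u) ftr"
type_synonym 'u chi_ntr = "('u, 'u, 'u, 'u \<times> 'u \<times> 'u \<times> 'u) ntr"

record 'u compcat =
  CFib :: "'u sfib"
  CChi :: "'u chi_ftr"

locale comprehension_category =
  fixes X :: "'u compcat"
  assumes CFib_fibration: "fibration (CFib X)"
    and CChi_functor: "cat_functor (CChi X)"
    and CChi_FDom: "FDom (CChi X) = Tot (CFib X)"
    and CChi_FCod: "FCod (CChi X) = arrow_cat (Base (CFib X))"
    and cod_CChi: "cod_ftr (Base (CFib X)) \<circ>\<^sub>c CChi X = Fun (CFib X)"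
    and CChi_pullback: "cartesian (Fun (CFib X)) f \<Longrightarrow>
      is_pullback (Base (CFib X)) (FArr (CChi X) f)"

record 'u compmor =
  CSrc :: "'u compcat"
  CTgt :: "'u compcat"
  CBase :: "'u sftr"
  CTot :: "'u sftr"
  CZeta :: "'u chi_ntr"

definition comp_lax_morphism :: "'u compmor \<Rightarrow> bool" where
  "comp_lax_morphism M \<longleftrightarrow>
    comprehension_category (CSrc M) \<and> comprehension_category (CTgt M) \<and>
    fib_cell1 (CFib (CSrc M)) (CFib (CTgt M)) (CBase M) (CTot M) \<and>
    nat_from_to (CZeta M) (arrow_ftr (CBase M) \<circ>\<^sub>c CChi (CSrc M)) (CChi (CTgt M) \<circ>\<^sub>c CTot M) \<and>
    cod_ftr (Base (CFib (CTgt M))) \<cdot>\<^sub>l CZeta M = id_nat (CBase M \<circ>\<^sub>c Fun (CFib (CSrc M)))"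

definition comp_pseudo :: "'u compmor \<Rightarrow> bool" where
  "comp_pseudo M \<longleftrightarrow> nat_iso (CZeta M)"

record 'u compcell =
  CDom2 :: "'u compmor"
  CCod2 :: "'u compmor"
  CPsi :: "'u sntr"
  CPhi :: "'u sntr"

definition comp_cell2 :: "'u compcell \<Rightarrow> bool" where
  "comp_cell2 \<alpha> \<longleftrightarrow>
    (let M = CDom2 \<alpha>; N = CCod2 \<alpha> in
     comp_lax_morphism M \<and> comp_lax_morphism N \<and> CSrc N = CSrc M \<and> CTgt N = CTgt M \<and>
     fib_cell2 (CFib (CSrc M)) (CFib (CTgt M)) (CBase M) (CTot M) (CBase N) (CTot N)
       (CPsi \<alpha>) (CPhi \<alpha>) \<and>
     (CChi (CTgt M) \<cdot>\<^sub>l CPhi \<alpha>) \<bullet> CZeta M = CZeta N \<bullet> (arrow_nat (CPsi \<alpha>) \<cdot>\<^sub>r CChi (CSrc M)))"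

definition comp_id1 :: "'u compcat \<Rightarrow> 'u compmor" where
  "comp_id1 X = \<lparr>CSrc = X, CTgt = X, CBase = id_ftr (Base (CFib X)),
     CTot = id_ftr (Tot (CFib X)), CZeta = id_nat (CChi X)\<rparr>"

definition comp_comp1 :: "'u compmor \<Rightarrow> 'u compmor \<Rightarrow> 'u compmor" where
  "comp_comp1 N M = \<lparr>CSrc = CSrc M, CTgt = CTgt N,
     CBase = CBase N \<circ>\<^sub>c CBase M, CTot = CTot N \<circ>\<^sub>c CTot M,
     CZeta = (CZeta N \<cdot>\<^sub>r CTot M) \<bullet> (arrow_ftr (CBase N) \<cdot>\<^sub>l CZeta M)\<rparr>"

definition CompCat :: "('u compcat, 'u compmor, 'u compcell) two_cat" where
  "CompCat =
    \<lparr>Cell0 = {X. comprehension_category X},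
     Cell1 = {M. comp_lax_morphism M},
     Cell2 = {\<alpha>. comp_cell2 \<alpha>},
     Src1 = CSrc, Tgt1 = CTgt, Src2 = CDom2, Tgt2 = CCod2,
     Id1 = comp_id1, Comp1 = comp_comp1,
     Id2 = (\<lambda>M. \<lparr>CDom2 = M, CCod2 = M, CPsi = id_nat (CBase M), CPhi = id_nat (CTot M)\<rparr>),
     VComp = (\<lambda>\<beta> \<alpha>. \<lparr>CDom2 = CDom2 \<alpha>, CCod2 = CCod2 \<beta>,
       CPsi = CPsi \<beta> \<bullet> CPsi \<alpha>, CPhi = CPhi \<beta> \<bullet> CPhi \<alpha>\<rparr>),
     HComp = (\<lambda>\<beta> \<alpha>. \<lparr>CDom2 = comp_comp1 (CDom2 \<beta>) (CDom2 \<alpha>),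
       CCod2 = comp_comp1 (CCod2 \<beta>) (CCod2 \<alpha>),
       CPsi = CPsi \<beta> \<star> CPsi \<alpha>, CPhi = CPhi \<beta> \<star> CPhi \<alpha>\<rparr>)\<rparr>"

definition CompCat_ps :: "('u compcat, 'u compmor, 'u compcell) two_cat" where
  "CompCat_ps = wide_2full_sub CompCat comp_pseudo"

section \<open>The 2-category of generalised categories with families\<close>

record 'u gcwf =
  GU :: "'u sfib"
  GUd :: "'u sfib"
  GSig :: "'u sftr"
  GDel :: "'u sftr"
  GEta :: "'u sntr"
  GEps :: "'u sntr"

definition adjunction ::
  "('o, 'a, 'p, 'b) ftr \<Rightarrow> ('p, 'b, 'o, 'a) ftr \<Rightarrow>
   ('o, 'a, 'o, 'a) ntr \<Rightarrow> ('p, 'b, 'p, 'b) ntr \<Rightarrow> bool" where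
  "adjunction L R \<eta> \<epsilon> \<longleftrightarrow> cat_functor L \<and> cat_functor R \<and> FDom R = FCod L \<and> FCod R = FDom L \<and>
    nat_from_to \<eta> (id_ftr (FDom L)) (R \<circ>\<^sub>c L) \<and> nat_from_to \<epsilon> (L \<circ>\<^sub>c R) (id_ftr (FDom R)) \<and>
    (\<epsilon> \<cdot>\<^sub>r L) \<bullet> (L \<cdot>\<^sub>l \<eta>) = id_nat L \<and> (R \<cdot>\<^sub>l \<epsilon>) \<bullet> (\<eta> \<cdot>\<^sub>r R) = id_nat R"

locale generalised_cwf =
  fixes W :: "'u gcwf"
  assumes GU_fibration: "fibration (GU W)"
    and GUd_fibration: "fibration (GUd W)"
    and GBase_eq: "Base (GUd W) = Base (GU W)"
    and GSig_FDom: "FDom (GSig W) = Tot (GUd W)"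
    and GSig_FCod: "FCod (GSig W) = Tot (GU W)"
    and GAdj: "adjunction (GSig W) (GDel W) (GEta W) (GEps W)"
    and GSig_over: "Fun (GU W) \<circ>\<^sub>c GSig W = Fun (GUd W)"
    and GSig_cartesian: "cartesian (Fun (GUd W)) f \<Longrightarrow> cartesian (Fun (GU W)) (FArr (GSig W) f)"
    and GEta_cartesian: "a \<in> Obj (Tot (GUd W)) \<Longrightarrow> cartesian (Fun (GUd W)) (NComp (GEta W) a)"
    and GEps_cartesian: "A \<in> Obj (Tot (GU W)) \<Longrightarrow> cartesian (Fun (GU W)) (NComp (GEps W) A)"

record 'u gmor =
  GSrc :: "'u gcwf"
  GTgt :: "'u gcwf"
  GC :: "'u sftr"
  GH :: "'u sftr"
  GHd :: "'u sftr"
  GZeta :: "'u sntr"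

definition gcwf_loose_morphism :: "'u gmor \<Rightarrow> bool" where
  "gcwf_loose_morphism M \<longleftrightarrow>
    generalised_cwf (GSrc M) \<and> generalised_cwf (GTgt M) \<and>
    fib_cell1 (GU (GSrc M)) (GU (GTgt M)) (GC M) (GH M) \<and>
    fib_cell1 (GUd (GSrc M)) (GUd (GTgt M)) (GC M) (GHd M) \<and>
    nat_from_to (GZeta M) (GSig (GTgt M) \<circ>\<^sub>c GHd M) (GH M \<circ>\<^sub>c GSig (GSrc M)) \<and>
    nat_iso (GZeta M) \<and>
    (\<forall>a \<in> Obj (Tot (GUd (GSrc M))).
       FArr (Fun (GU (GTgt M))) (NComp (GZeta M) a) =
       Ide (Base (GU (GTgt M))) (FObj (GC M) (FObj (Fun (GUd (GSrc M))) a)))"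

definition gcwf_mate :: "'u gmor \<Rightarrow> 'u sntr" where
  "gcwf_mate M =
    (GDel (GTgt M) \<cdot>\<^sub>l GH M \<cdot>\<^sub>l GEps (GSrc M)) \<bullet>
    (GDel (GTgt M) \<cdot>\<^sub>l (GZeta M \<cdot>\<^sub>r GDel (GSrc M))) \<bullet>
    (GEta (GTgt M) \<cdot>\<^sub>r (GHd M \<circ>\<^sub>c GDel (GSrc M)))"

definition gcwf_pseudo :: "'u gmor \<Rightarrow> bool" where
  "gcwf_pseudo M \<longleftrightarrow> nat_iso (gcwf_mate M)"

record 'u gcell =
  GDom2 :: "'u gmor"
  GCod2 :: "'u gmor"
  GPsi :: "'u sntr"
  GPhi :: "'u sntr"
  GPhid :: "'u sntr"

definition gcwf_cell2 :: "'u gcell \<Rightarrow> bool" where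
  "gcwf_cell2 \<alpha> \<longleftrightarrow>
    (let M = GDom2 \<alpha>; N = GCod2 \<alpha> in
     gcwf_loose_morphism M \<and> gcwf_loose_morphism N \<and> GSrc N = GSrc M \<and> GTgt N = GTgt M \<and>
     fib_cell2 (GU (GSrc M)) (GU (GTgt M)) (GC M) (GH M) (GC N) (GH N) (GPsi \<alpha>) (GPhi \<alpha>) \<and>
     fib_cell2 (GUd (GSrc M)) (GUd (GTgt M)) (GC M) (GHd M) (GC N) (GHd N) (GPsi \<alpha>) (GPhid \<alpha>) \<and>
     (GPhi \<alpha> \<cdot>\<^sub>r GSig (GSrc M)) \<bullet> GZeta M = GZeta N \<bullet> (GSig (GTgt M) \<cdot>\<^sub>l GPhid \<alpha>))"

definition gcwf_id1 :: "'u gcwf \<Rightarrow> 'u gmor" where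
  "gcwf_id1 W = \<lparr>GSrc = W, GTgt = W, GC = id_ftr (Base (GU W)), GH = id_ftr (Tot (GU W)),
     GHd = id_ftr (Tot (GUd W)), GZeta = id_nat (GSig W)\<rparr>"

definition gcwf_comp1 :: "'u gmor \<Rightarrow> 'u gmor \<Rightarrow> 'u gmor" where
  "gcwf_comp1 N M = \<lparr>GSrc = GSrc M, GTgt = GTgt N, GC = GC N \<circ>\<^sub>c GC M, GH = GH N \<circ>\<^sub>c GH M,
     GHd = GHd N \<circ>\<^sub>c GHd M, GZeta = (GH N \<cdot>\<^sub>l GZeta M) \<bullet> (GZeta N \<cdot>\<^sub>r GHd M)\<rparr>"

definition GCwF :: "('u gcwf, 'u gmor, 'u gcell) two_cat" where
  "GCwF =
    \<lparr>Cell0 = {W. generalised_cwf W},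
     Cell1 = {M. gcwf_loose_morphism M},
     Cell2 = {\<alpha>. gcwf_cell2 \<alpha>},
     Src1 = GSrc, Tgt1 = GTgt, Src2 = GDom2, Tgt2 = GCod2,
     Id1 = gcwf_id1, Comp1 = gcwf_comp1,
     Id2 = (\<lambda>M. \<lparr>GDom2 = M, GCod2 = M, GPsi = id_nat (GC M), GPhi = id_nat (GH M),
       GPhid = id_nat (GHd M)\<rparr>),
     VComp = (\<lambda>\<beta> \<alpha>. \<lparr>GDom2 = GDom2 \<alpha>, GCod2 = GCod2 \<beta>,
       GPsi = GPsi \<beta> \<bullet> GPsi \<alpha>, GPhi = GPhi \<beta> \<bullet> GPhi \<alpha>, GPhid = GPhid \<beta> \<bullet> GPhid \<alpha>\<rparr>),
     HComp = (\<lambda>\<beta> \<alpha>. \<lparr>GDom2 = gcwf_comp1 (GDom2 \<beta>) (GDom2 \<alpha>),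
       GCod2 = gcwf_comp1 (GCod2 \<beta>) (GCod2 \<alpha>),
       GPsi = GPsi \<beta> \<star> GPsi \<alpha>, GPhi = GPhi \<beta> \<star> GPhi \<alpha>, GPhid = GPhid \<beta> \<star> GPhid \<alpha>\<rparr>)\<rparr>"

definition GCwF_ps :: "('u gcwf, 'u gmor, 'u gcell) two_cat" where
  "GCwF_ps = wide_2full_sub GCwF gcwf_pseudo"

end

theory Submission
  imports Defs
begin

text \<open>
  A generalised category with families \<open>W\<close> is sent by \<open>G\<close> to the comprehension \<open>A \<mapsto> u \<epsilon>\<^sub>A\<close>; the
  structure of a morphism becomes the image of its mate under the term fibration \<open>v\<close>.  Conversely, in a
  comprehension category the cartesian lift \<open>\<epsilon>\<^sub>A : K A \<rightarrow> A\<close> of \<open>\<chi> A\<close> is the counit of a comonad, and a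
  coalgebra on \<open>A\<close> is nothing but a section of \<open>\<chi> A\<close>: coassociativity is automatic, because \<open>\<epsilon>\<close> is
  cartesian and \<open>\<chi> \<epsilon>\<close> is a pullback.  So \<open>F\<close> takes the category of types with a section (terms), the
  forgetful functor \<open>\<Sigma>\<close> and the cofree functor \<open>A \<mapsto> (K A, diagonal)\<close>, and \<open>G F = Id\<close> on the nose.

  The unit \<open>\<eta>\<close> of \<open>\<Sigma> \<dashv> \<Delta>\<close> is cartesian.  Hence \<open>\<Sigma>\<close> is faithful and conservative, and an arrow
  \<open>\<Sigma> a \<rightarrow> \<Sigma> b\<close> lifts to \<open>a \<rightarrow> b\<close> as soon as it respects the sections \<open>v \<eta>\<^sub>a\<close> and \<open>v \<eta>\<^sub>b\<close>.  It follows that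
  \<open>G\<close> is bijective on the 2-cells between two given 1-cells.  Moreover there are 1-cells
  \<open>F G W \<rightarrow> W\<close>, sending \<open>(A, s)\<close> to the reindexing of \<open>\<Delta> A\<close> along \<open>s\<close>, and \<open>W \<rightarrow> F G W\<close>, sending \<open>a\<close> to
  \<open>(\<Sigma> a, v \<eta>\<^sub>a)\<close>, which \<open>G\<close> maps to identities.  The rest is formal: 2-cells are lifted along \<open>G\<close>, and
  equations between 2-cells hold because they hold after applying \<open>G\<close>.  Finally a loose morphism is
  pseudo if and only if its image under \<open>G\<close> is, since \<open>\<Sigma>\<close> maps mates to cartesian arrows.
\<close>

section \<open>Categories, functors and natural transformations\<close>

text \<open>Two features of the definitions shape the work. The right adjoint \<Delta> does not lie
  over the base and is not assumed to preserve cartesian arrows, so it is not immediate that the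
  comprehension of \<open>W\<close> sends cartesian arrows to pullbacks. Arrows of the base are
  therefore realised by cartesian lifts in the term fibration and transposed; that \<Delta>
  preserves cartesian arrows comes out afterwards, as a consequence of the pullback squares. Also,
  cleavages are arbitrary and 1-cells ignore them. The comparison
  \<open>F G W \<rightarrow> W\<close> reindexes along the cleavage, so its naturality squares
  commute only up to 2-cells. These are never computed: each is the unique 2-cell over an identity.
  \<open>F\<close> itself can be strict: a 1-cell sends a section \<open>s\<close> of \<chi> at
  \<open>A\<close> to the upper side of \<zeta> at \<open>A\<close> after \<open>B s\<close>, and
  \<Sigma> commutes strictly with this. Finally, all carriers live in one type, and pairs of a type
  and a section must be coded there; this is where the infinity of the universe enters.\<close>

lemma in_Hom: "f \<in> Hom C x y \<longleftrightarrow> f \<in> Arr C \<and> Dom C f = x \<and> Cod C f = y"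
  by (simp add: Hom_def)

lemma categoryI:
  assumes "\<And>f. f \<in> Arr C \<Longrightarrow> Dom C f \<in> Obj C" "\<And>f. f \<in> Arr C \<Longrightarrow> Cod C f \<in> Obj C"
    and "\<And>x. x \<in> Obj C \<Longrightarrow> Ide C x \<in> Arr C \<and> Dom C (Ide C x) = x \<and> Cod C (Ide C x) = x"
    and "\<And>f g. \<lbrakk>f \<in> Arr C; g \<in> Arr C; Cod C f = Dom C g\<rbrakk> \<Longrightarrow>
      Comp C g f \<in> Arr C \<and> Dom C (Comp C g f) = Dom C f \<and> Cod C (Comp C g f) = Cod C g"
    and "\<And>f. f \<in> Arr C \<Longrightarrow> Comp C (Ide C (Cod C f)) f = f"
    and "\<And>f. f \<in> Arr C \<Longrightarrow> Comp C f (Ide C (Dom C f)) = f"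
    and "\<And>f g h. \<lbrakk>f \<in> Arr C; g \<in> Arr C; h \<in> Arr C; Cod C f = Dom C g; Cod C g = Dom C h\<rbrakk> \<Longrightarrow>
      Comp C h (Comp C g f) = Comp C (Comp C h g) f"
    and "Dom C \<in> extensional (Arr C)" "Cod C \<in> extensional (Arr C)" "Ide C \<in> extensional (Obj C)"
    and "\<And>f g. \<not> (f \<in> Arr C \<and> g \<in> Arr C \<and> Cod C f = Dom C g) \<Longrightarrow> Comp C g f = undefined"
  shows "category C"
  using assms by unfold_locales (auto simp: in_Hom)

text \<open>A description, so that any exhibited inverse can be identified with it by
  \<open>inv_arr_eq\<close>; its value matters on isomorphisms only.\<close>

definition inv_arr :: "('o, 'a) cat \<Rightarrow> 'a \<Rightarrow> 'a" where
  "inv_arr C f = (THE g. g \<in> Arr C \<and> Dom C g = Cod C f \<and> Cod C g = Dom C f \<and>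
     Comp C g f = Ide C (Dom C f) \<and> Comp C f g = Ide C (Cod C f))"

section \<open>Composites and isomorphisms in a category\<close>

context category
begin

lemmas Dom_in [simp] Cod_in [simp]

lemma ide [simp]:
  assumes "x \<in> Obj C"
  shows "Ide C x \<in> Arr C" "Dom C (Ide C x) = x" "Cod C (Ide C x) = x"
  using Ide_in[OF assms] by (auto simp: in_Hom)

lemma comp [simp]:
  assumes "f \<in> Arr C" "g \<in> Arr C" "Cod C f = Dom C g"
  shows "Comp C g f \<in> Arr C" "Dom C (Comp C g f) = Dom C f" "Cod C (Comp C g f) = Cod C g"
  using Comp_in[of f "Dom C f" "Cod C f" g "Cod C g"] assms by (auto simp: in_Hom)

lemma comp_ide_left [simp]: "f \<in> Arr C \<Longrightarrow> Cod C f = y \<Longrightarrow> Comp C (Ide C y) f = f"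
  using Comp_Ide_left[of f "Dom C f" y] by (auto simp: in_Hom)

lemma comp_ide_right [simp]: "f \<in> Arr C \<Longrightarrow> Dom C f = x \<Longrightarrow> Comp C f (Ide C x) = f"
  using Comp_Ide_right[of f x] by (auto simp: in_Hom)

lemma assoc [simp]:
  "\<lbrakk>f \<in> Arr C; g \<in> Arr C; h \<in> Arr C; Cod C f = Dom C g; Cod C g = Dom C h\<rbrakk> \<Longrightarrow>
    Comp C (Comp C h g) f = Comp C h (Comp C g f)"
  using Comp_assoc[of f "Dom C f" "Cod C f" g "Cod C g" h "Cod C h"] by (auto simp: in_Hom)

text \<open>Composites are normalised to the right, so an equation for \<open>g f\<close> no longer
  matches inside \<open>g (f x)\<close>; this is its right-nested form.\<close>

lemma reassoc:
  assumes "Comp C g f = k" "f \<in> Arr C" "g \<in> Arr C" "Cod C f = Dom C g"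
    "x \<in> Arr C" "Cod C x = Dom C f"
  shows "Comp C g (Comp C f x) = Comp C k x"
  using assms by auto

text \<open>The form in which commuting squares are pasted throughout: a square is applied at the
  head of a right-nested composite.\<close>

lemma reassoc2:
  assumes "Comp C g f = Comp C k l" "f \<in> Arr C" "g \<in> Arr C" "Cod C f = Dom C g"
    "l \<in> Arr C" "k \<in> Arr C" "Cod C l = Dom C k"
    "x \<in> Arr C" "Cod C x = Dom C f"
  shows "Comp C g (Comp C f x) = Comp C k (Comp C l x)"
proof -
  \<comment> \<open>The domain of \<open>l\<close> is not among the assumptions; equality of the two
    composites forces it.\<close>
  have "Dom C (Comp C k l) = Dom C f" using assms(1-4) by (metis comp(2))
  then have "Dom C l = Dom C f" using assms by simp
  then show ?thesis using reassoc[OF assms(1-4) assms(8,9)] assms by simp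
qed

lemma is_isoI:
  "\<lbrakk>f \<in> Arr C; g \<in> Arr C; Dom C g = Cod C f; Cod C g = Dom C f;
    Comp C g f = Ide C (Dom C f); Comp C f g = Ide C (Cod C f)\<rbrakk> \<Longrightarrow> is_iso C f"
  by (auto simp: is_iso_def in_Hom)

lemma inverse_unique:
  assumes "f \<in> Arr C" "g \<in> Arr C" "Dom C g = Cod C f" "Cod C g = Dom C f"
    "Comp C g f = Ide C (Dom C f)"
    and "h \<in> Arr C" "Dom C h = Cod C f" "Cod C h = Dom C f" "Comp C f h = Ide C (Cod C f)"
  shows "g = h"
proof -
  have "g = Comp C g (Comp C f h)" using assms by simp
  also have "\<dots> = Comp C (Comp C g f) h" using assms(1-4,6-8) by simp
  also have "\<dots> = h" using assms by simp
  finally show ?thesis .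
qed

lemma inv_arr_eq:
  assumes "f \<in> Arr C" "g \<in> Arr C" "Dom C g = Cod C f" "Cod C g = Dom C f"
    "Comp C g f = Ide C (Dom C f)" "Comp C f g = Ide C (Cod C f)"
  shows "inv_arr C f = g"
  unfolding inv_arr_def
proof (rule the_equality)
  fix h assume "h \<in> Arr C \<and> Dom C h = Cod C f \<and> Cod C h = Dom C f \<and>
    Comp C h f = Ide C (Dom C f) \<and> Comp C f h = Ide C (Cod C f)"
  then show "h = g" using inverse_unique[of f h g] assms by auto
qed (use assms in auto)

lemma iso_arr: "is_iso C f \<Longrightarrow> f \<in> Arr C"
  by (simp add: is_iso_def)

lemma inv_arr [simp]:
  assumes "is_iso C f"
  shows "inv_arr C f \<in> Arr C" "Dom C (inv_arr C f) = Cod C f" "Cod C (inv_arr C f) = Dom C f"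
    "Comp C (inv_arr C f) f = Ide C (Dom C f)" "Comp C f (inv_arr C f) = Ide C (Cod C f)"
proof -
  from assms obtain g where "f \<in> Arr C" "g \<in> Arr C" "Dom C g = Cod C f" "Cod C g = Dom C f"
    "Comp C g f = Ide C (Dom C f)" "Comp C f g = Ide C (Cod C f)"
    by (auto simp: is_iso_def in_Hom)
  moreover from this have "inv_arr C f = g" by (rule inv_arr_eq)
  ultimately show "inv_arr C f \<in> Arr C" "Dom C (inv_arr C f) = Cod C f"
    "Cod C (inv_arr C f) = Dom C f" "Comp C (inv_arr C f) f = Ide C (Dom C f)"
    "Comp C f (inv_arr C f) = Ide C (Cod C f)" by auto
qed

lemma inv_comp [simp]:
  assumes "is_iso C f" "x \<in> Arr C"
  shows "Cod C x = Dom C f \<Longrightarrow> Comp C (inv_arr C f) (Comp C f x) = x"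
    and "Cod C x = Cod C f \<Longrightarrow> Comp C f (Comp C (inv_arr C f) x) = x"
  using assms reassoc[OF inv_arr(4)[OF assms(1)], of x] reassoc[OF inv_arr(5)[OF assms(1)], of x]
  by (auto simp: iso_arr)

lemma iso_cancel:
  assumes "Comp C f x = Comp C f y" "is_iso C f" "x \<in> Arr C" "y \<in> Arr C"
    "Cod C x = Dom C f" "Cod C y = Dom C f"
  shows "x = y"
  using assms inv_comp(1) by metis

lemma iso_ide [simp]: "x \<in> Obj C \<Longrightarrow> is_iso C (Ide C x)"
  by (rule is_isoI[of _ "Ide C x"]) auto

lemma iso_inv [simp]: "is_iso C f \<Longrightarrow> is_iso C (inv_arr C f)"
  by (rule is_isoI[of _ f]) (auto simp: iso_arr)

lemma iso_comp:
  assumes "is_iso C f" "is_iso C g" "Cod C f = Dom C g"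
  shows "is_iso C (Comp C g f)"
  by (rule is_isoI[of _ "Comp C (inv_arr C f) (inv_arr C g)"])
    (use assms in \<open>auto simp: iso_arr\<close>)

end

section \<open>Functors and their equality\<close>

locale pre_func = C: category C + D: category D for C :: "('o, 'a) cat" and D :: "('p, 'b) cat" +
  fixes F :: "('o, 'a, 'p, 'b) ftr"
  assumes is_functor: "cat_functor F" and FDom: "FDom F = C" and FCod: "FCod F = D"
begin

lemma obj [simp]: "x \<in> Obj C \<Longrightarrow> FObj F x \<in> Obj D"
  using cat_functor.FObj_in[OF is_functor, unfolded FDom FCod] by simp

lemma arr [simp]:
  assumes "f \<in> Arr C"
  shows "FArr F f \<in> Arr D" "Dom D (FArr F f) = FObj F (Dom C f)"
    "Cod D (FArr F f) = FObj F (Cod C f)"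
  using cat_functor.FArr_in[OF is_functor, unfolded FDom FCod, of f "Dom C f" "Cod C f"]
      assms by (auto simp: in_Hom)

lemma ide [simp]: "x \<in> Obj C \<Longrightarrow> FArr F (Ide C x) = Ide D (FObj F x)"
  using cat_functor.FArr_Ide[OF is_functor, unfolded FDom FCod] by simp

lemma comp [simp]:
  "\<lbrakk>f \<in> Arr C; g \<in> Arr C; Cod C f = Dom C g\<rbrakk> \<Longrightarrow>
    FArr F (Comp C g f) = Comp D (FArr F g) (FArr F f)"
  using cat_functor.FArr_Comp[OF is_functor, unfolded FDom FCod, of f "Dom C f" "Cod C f" g "Cod C g"]
  by (auto simp: in_Hom)

lemma comp_eq:
  assumes "Comp C g f = k" "f \<in> Arr C" "g \<in> Arr C" "Cod C f = Dom C g"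
  shows "Comp D (FArr F g) (FArr F f) = FArr F k"
  using comp[OF assms(2-4)] assms(1) by simp

lemma comp_eq2:
  assumes "Comp C g f = Comp C k l" "f \<in> Arr C" "g \<in> Arr C" "Cod C f = Dom C g"
    "l \<in> Arr C" "k \<in> Arr C" "Cod C l = Dom C k"
  shows "Comp D (FArr F g) (FArr F f) = Comp D (FArr F k) (FArr F l)"
  using comp[OF assms(2-4)] comp[OF assms(5-7)] assms(1) by simp

lemma iso [simp]:
  assumes "is_iso C f" shows "is_iso D (FArr F f)"
  by (rule D.is_isoI[of _ "FArr F (inv_arr C f)"])
    (use assms comp_eq[OF C.inv_arr(4)[OF assms]] comp_eq[OF C.inv_arr(5)[OF assms]]
      in \<open>auto simp: C.iso_arr\<close>)

lemma FObj_ext: "FObj F \<in> extensional (Obj C)"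
  using cat_functor.FObj_ext[OF is_functor, unfolded FDom FCod] by simp

lemma FArr_ext: "FArr F \<in> extensional (Arr C)"
  using cat_functor.FArr_ext[OF is_functor, unfolded FDom FCod] by simp

end

text \<open>A fibration \<open>p\<close> is a \<^locale>\<open>pre_func\<close> from \<^term>\<open>Tot p\<close> to \<^term>\<open>Base p\<close>, for which
  the equations below would be circular rewrite rules.\<close>

locale func = pre_func
begin

lemmas FDom [simp] FCod [simp]

end

lemma cat_functor_func: "cat_functor F \<Longrightarrow> FDom F = C \<Longrightarrow> FCod F = D \<Longrightarrow> func C D F"
  by (auto simp: func_def pre_func_def pre_func_axioms_def cat_functor.FDom_category
      cat_functor.FCod_category)

lemma funcI:
  assumes "category C" "category D" "FDom F = C" "FCod F = D"
    and "\<And>x. x \<in> Obj C \<Longrightarrow> FObj F x \<in> Obj D"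
    and "\<And>f. f \<in> Arr C \<Longrightarrow> FArr F f \<in> Arr D \<and> Dom D (FArr F f) = FObj F (Dom C f) \<and>
      Cod D (FArr F f) = FObj F (Cod C f)"
    and "\<And>x. x \<in> Obj C \<Longrightarrow> FArr F (Ide C x) = Ide D (FObj F x)"
    and "\<And>f g. \<lbrakk>f \<in> Arr C; g \<in> Arr C; Cod C f = Dom C g\<rbrakk> \<Longrightarrow>
      FArr F (Comp C g f) = Comp D (FArr F g) (FArr F f)"
    and "FObj F \<in> extensional (Obj C)" "FArr F \<in> extensional (Arr C)"
  shows "func C D F"
  by (rule cat_functor_func, rule cat_functor.intro) (use assms in \<open>auto simp: in_Hom\<close>)

text \<open>Agreement on arrows suffices: an object is recovered as the domain of its identity, and
  outside the carriers both functors are undefined.\<close>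

lemma ftr_eqI:
  assumes "func C D F" "func C D G" "\<And>f. f \<in> Arr C \<Longrightarrow> FArr F f = FArr G f"
  shows "F = G"
proof -
  interpret F: func C D F by fact
  interpret G: func C D G by fact
  have "FArr F = FArr G" using F.FArr_ext G.FArr_ext assms(3) by (rule extensionalityI)
  moreover have "FObj F = FObj G"
  proof (rule extensionalityI[OF F.FObj_ext G.FObj_ext])
    fix x assume x: "x \<in> Obj C"
    then have "Ide D (FObj F x) = Ide D (FObj G x)" using assms(3)[of "Ide C x"] by simp
    then have "Dom D (Ide D (FObj F x)) = Dom D (Ide D (FObj G x))" by simp
    then show "FObj F x = FObj G x" using x by simp
  qed
  moreover have "FDom F = FDom G" "FCod F = FCod G" by auto
  ultimately show ?thesis by (intro ftr.equality) auto
qed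

section \<open>Natural transformations and their compositions\<close>

locale ntrans = F: func C D F + G: func C D G
  for C :: "('o, 'a) cat" and D :: "('p, 'b) cat" and F G +
  fixes \<alpha> :: "('o, 'a, 'p, 'b) ntr"
  assumes nat: "nat_from_to \<alpha> F G"
begin

lemma NDom [simp]: "NDom \<alpha> = F" and NCod [simp]: "NCod \<alpha> = G"
  using nat by (auto simp: nat_from_to_def)

lemma nat_trans: "nat_trans \<alpha>"
  using nat by (simp add: nat_from_to_def)

lemma component [simp]:
  assumes "x \<in> Obj C"
  shows "NComp \<alpha> x \<in> Arr D" "Dom D (NComp \<alpha> x) = FObj F x" "Cod D (NComp \<alpha> x) = FObj G x"
  using nat_trans.NComp_in[OF nat_trans, of x] assms by (auto simp: in_Hom)

lemma natural:
  "f \<in> Arr C \<Longrightarrow> Dom C f = x \<Longrightarrow> Cod C f = y \<Longrightarrow>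
    Comp D (FArr G f) (NComp \<alpha> x) = Comp D (NComp \<alpha> y) (FArr F f)"
  using nat_trans.naturality[OF nat_trans, of f x y] by (auto simp: in_Hom)

lemma natural':
  assumes "f \<in> Arr C" "Dom C f = x" "Cod C f = y" "h \<in> Arr D" "Cod D h = FObj F x"
  shows "Comp D (FArr G f) (Comp D (NComp \<alpha> x) h) = Comp D (NComp \<alpha> y) (Comp D (FArr F f) h)"
  by (rule F.D.reassoc2[OF natural]) (use assms in auto)

lemma NComp_ext: "NComp \<alpha> \<in> extensional (Obj C)"
  using nat_trans.NComp_ext[OF nat_trans] by simp

end

lemma ntransI:
  assumes "func C D F" "func C D G" "NDom \<alpha> = F" "NCod \<alpha> = G"
    and "\<And>x. x \<in> Obj C \<Longrightarrow> NComp \<alpha> x \<in> Arr D \<and> Dom D (NComp \<alpha> x) = FObj F x \<and>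
      Cod D (NComp \<alpha> x) = FObj G x"
    and "\<And>f. f \<in> Arr C \<Longrightarrow> Comp D (FArr G f) (NComp \<alpha> (Dom C f)) =
      Comp D (NComp \<alpha> (Cod C f)) (FArr F f)"
    and "NComp \<alpha> \<in> extensional (Obj C)"
  shows "ntrans C D F G \<alpha>"
proof -
  interpret F: func C D F by fact
  interpret G: func C D G by fact
  have "nat_trans \<alpha>"
    by (rule nat_trans.intro) (use assms F.is_functor G.is_functor in \<open>auto simp: in_Hom\<close>)
  then show ?thesis using assms(3,4)
    by (intro ntrans.intro ntrans_axioms.intro F.func_axioms G.func_axioms)
      (auto simp: nat_from_to_def)
qed

lemma nat_from_to_ntrans:
  "nat_from_to \<alpha> F G \<Longrightarrow> FDom F = C \<Longrightarrow> FCod F = D \<Longrightarrow> ntrans C D F G \<alpha>"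
  by (intro ntrans.intro ntrans_axioms.intro)
    (auto simp: nat_from_to_def nat_trans_def intro!: cat_functor_func)

lemma ntr_eqI:
  assumes "ntrans C D F G \<alpha>" "ntrans C D F G \<beta>" "\<And>x. x \<in> Obj C \<Longrightarrow> NComp \<alpha> x = NComp \<beta> x"
  shows "\<alpha> = \<beta>"
proof -
  interpret a: ntrans C D F G \<alpha> by fact
  interpret b: ntrans C D F G \<beta> by fact
  have "NComp \<alpha> = NComp \<beta>" using a.NComp_ext b.NComp_ext assms(3) by (rule extensionalityI)
  then show ?thesis by (intro ntr.equality) auto
qed

lemma id_ftr_simps [simp]:
  "FDom (id_ftr C) = C" "FCod (id_ftr C) = C"
  "x \<in> Obj C \<Longrightarrow> FObj (id_ftr C) x = x" "f \<in> Arr C \<Longrightarrow> FArr (id_ftr C) f = f"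
  by (auto simp: id_ftr_def)

lemma comp_ftr_simps [simp]:
  "FDom (G \<circ>\<^sub>c F) = FDom F" "FCod (G \<circ>\<^sub>c F) = FCod G"
  "x \<in> Obj (FDom F) \<Longrightarrow> FObj (G \<circ>\<^sub>c F) x = FObj G (FObj F x)"
  "f \<in> Arr (FDom F) \<Longrightarrow> FArr (G \<circ>\<^sub>c F) f = FArr G (FArr F f)"
  by (auto simp: comp_ftr_def)

lemma id_nat_simps [simp]:
  "NDom (id_nat F) = F" "NCod (id_nat F) = F"
  "x \<in> Obj (FDom F) \<Longrightarrow> NComp (id_nat F) x = Ide (FCod F) (FObj F x)"
  by (auto simp: id_nat_def)

lemma vcomp_nat_simps [simp]:
  "NDom (\<beta> \<bullet> \<alpha>) = NDom \<alpha>" "NCod (\<beta> \<bullet> \<alpha>) = NCod \<beta>"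
  "x \<in> Obj (FDom (NDom \<alpha>)) \<Longrightarrow>
    NComp (\<beta> \<bullet> \<alpha>) x = Comp (FCod (NDom \<alpha>)) (NComp \<beta> x) (NComp \<alpha> x)"
  by (auto simp: vcomp_nat_def)

lemma lwhisker_simps [simp]:
  "NDom (F \<cdot>\<^sub>l \<alpha>) = F \<circ>\<^sub>c NDom \<alpha>" "NCod (F \<cdot>\<^sub>l \<alpha>) = F \<circ>\<^sub>c NCod \<alpha>"
  "x \<in> Obj (FDom (NDom \<alpha>)) \<Longrightarrow> NComp (F \<cdot>\<^sub>l \<alpha>) x = FArr F (NComp \<alpha> x)"
  by (auto simp: lwhisker_def)

lemma rwhisker_simps [simp]:
  "NDom (\<alpha> \<cdot>\<^sub>r F) = NDom \<alpha> \<circ>\<^sub>c F" "NCod (\<alpha> \<cdot>\<^sub>r F) = NCod \<alpha> \<circ>\<^sub>c F"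
  "x \<in> Obj (FDom F) \<Longrightarrow> NComp (\<alpha> \<cdot>\<^sub>r F) x = NComp \<alpha> (FObj F x)"
  by (auto simp: rwhisker_def)

lemma hcomp_nat_simps [simp]:
  "NDom (\<beta> \<star> \<alpha>) = NDom \<beta> \<circ>\<^sub>c NDom \<alpha>" "NCod (\<beta> \<star> \<alpha>) = NCod \<beta> \<circ>\<^sub>c NCod \<alpha>"
  "x \<in> Obj (FDom (NDom \<alpha>)) \<Longrightarrow> x \<in> Obj (FDom (NCod \<alpha>)) \<Longrightarrow> NComp (\<beta> \<star> \<alpha>) x =
    Comp (FCod (NDom \<beta>)) (NComp \<beta> (FObj (NCod \<alpha>) x)) (FArr (NDom \<beta>) (NComp \<alpha> x))"
  by (auto simp: hcomp_nat_def)

lemma id_nat_ext: "NComp (id_nat F) \<in> extensional (Obj (FDom F))"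
  by (simp add: id_nat_def)

lemma vcomp_nat_ext: "NComp (\<beta> \<bullet> \<alpha>) \<in> extensional (Obj (FDom (NDom \<alpha>)))"
  by (simp add: vcomp_nat_def)

lemma lwhisker_ext: "NComp (F \<cdot>\<^sub>l \<alpha>) \<in> extensional (Obj (FDom (NDom \<alpha>)))"
  by (simp add: lwhisker_def)

lemma rwhisker_ext: "NComp (\<alpha> \<cdot>\<^sub>r F) \<in> extensional (Obj (FDom F))"
  by (simp add: rwhisker_def)

lemma func_id: "category C \<Longrightarrow> func C C (id_ftr C)"
proof -
  assume "category C"
  then interpret category C .
  show ?thesis by (rule funcI) (use category_axioms in \<open>auto simp: id_ftr_def\<close>)
qed

lemma func_comp:
  assumes "func C D F" "func D E G" shows "func C E (G \<circ>\<^sub>c F)"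
proof -
  interpret F: func C D F by fact
  interpret G: func D E G by fact
  show ?thesis
  proof (rule funcI)
    show "FObj (G \<circ>\<^sub>c F) \<in> extensional (Obj C)" "FArr (G \<circ>\<^sub>c F) \<in> extensional (Arr C)"
      by (auto simp: comp_ftr_def)
  qed (auto intro: F.C.category_axioms G.D.category_axioms)
qed

lemma ntrans_id: "func C D F \<Longrightarrow> ntrans C D F F (id_nat F)"
proof -
  assume "func C D F"
  then interpret func C D F .
  show ?thesis
    by (rule ntransI) (use func_axioms id_nat_ext[of F] in auto)
qed

lemma ntrans_vcomp:
  assumes "ntrans C D F G \<alpha>" "ntrans C D G H \<beta>" shows "ntrans C D F H (\<beta> \<bullet> \<alpha>)"
proof -
  interpret a: ntrans C D F G \<alpha> by fact
  interpret b: ntrans C D G H \<beta> by fact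
  show ?thesis
  proof (rule ntransI)
    fix f assume f: "f \<in> Arr C"
    show "Comp D (FArr H f) (NComp (\<beta> \<bullet> \<alpha>) (Dom C f)) =
        Comp D (NComp (\<beta> \<bullet> \<alpha>) (Cod C f)) (FArr F f)"
      using f by (simp add: b.natural' a.natural)
  qed (use vcomp_nat_ext[of \<beta> \<alpha>] in \<open>auto intro: a.F.func_axioms b.G.func_axioms\<close>)
qed

lemma ntrans_lwhisker:
  assumes "ntrans C D F G \<alpha>" "func D E H" shows "ntrans C E (H \<circ>\<^sub>c F) (H \<circ>\<^sub>c G) (H \<cdot>\<^sub>l \<alpha>)"
proof -
  interpret a: ntrans C D F G \<alpha> by fact
  interpret H: func D E H by fact
  show ?thesis
  proof (rule ntransI)
    fix f assume f: "f \<in> Arr C"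
    show "Comp E (FArr (H \<circ>\<^sub>c G) f) (NComp (H \<cdot>\<^sub>l \<alpha>) (Dom C f)) =
        Comp E (NComp (H \<cdot>\<^sub>l \<alpha>) (Cod C f)) (FArr (H \<circ>\<^sub>c F) f)"
      using f H.comp_eq2[OF a.natural[OF f]] by simp
  qed (use lwhisker_ext[of H \<alpha>] in
      \<open>auto intro: func_comp a.F.func_axioms a.G.func_axioms H.func_axioms\<close>)
qed

lemma ntrans_rwhisker:
  assumes "ntrans D E F G \<alpha>" "func C D H" shows "ntrans C E (F \<circ>\<^sub>c H) (G \<circ>\<^sub>c H) (\<alpha> \<cdot>\<^sub>r H)"
proof -
  interpret a: ntrans D E F G \<alpha> by fact
  interpret H: func C D H by fact
  show ?thesis
    by (rule ntransI) (use rwhisker_ext[of \<alpha> H] in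
      \<open>auto intro: func_comp a.F.func_axioms a.G.func_axioms H.func_axioms simp: a.natural\<close>)
qed

lemma ntrans_hcomp:
  assumes "ntrans C D F F' \<alpha>" "ntrans D E G G' \<beta>"
  shows "ntrans C E (G \<circ>\<^sub>c F) (G' \<circ>\<^sub>c F') (\<beta> \<star> \<alpha>)"
proof -
  interpret a: ntrans C D F F' \<alpha> by fact
  interpret b: ntrans D E G G' \<beta> by fact
  show ?thesis unfolding hcomp_nat_def a.NCod b.NDom
    by (rule ntrans_vcomp[OF ntrans_lwhisker[OF assms(1) b.F.func_axioms]
          ntrans_rwhisker[OF assms(2) a.G.func_axioms]])
qed

lemma comp_ftr_id:
  assumes "func C D F" shows "id_ftr D \<circ>\<^sub>c F = F" "F \<circ>\<^sub>c id_ftr C = F"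
proof -
  interpret func C D F by fact
  show "id_ftr D \<circ>\<^sub>c F = F"
    by (rule ftr_eqI[OF func_comp[OF assms func_id[OF D.category_axioms]] assms]) simp
  show "F \<circ>\<^sub>c id_ftr C = F"
    by (rule ftr_eqI[OF func_comp[OF func_id[OF C.category_axioms] assms] assms]) simp
qed

lemma comp_ftr_assoc:
  assumes "func A B F" "func B C G" "func C D H"
  shows "H \<circ>\<^sub>c (G \<circ>\<^sub>c F) = (H \<circ>\<^sub>c G) \<circ>\<^sub>c F"
proof -
  interpret F: func A B F by fact
  interpret G: func B C G by fact
  interpret H: func C D H by fact
  show ?thesis by (rule ftr_eqI[of A D]) (auto intro: func_comp assms)
qed

lemma vcomp_nat_id:
  assumes "ntrans C D F G \<alpha>" shows "id_nat G \<bullet> \<alpha> = \<alpha>" "\<alpha> \<bullet> id_nat F = \<alpha>"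
proof -
  interpret ntrans C D F G \<alpha> by fact
  show "id_nat G \<bullet> \<alpha> = \<alpha>"
    by (rule ntr_eqI[OF ntrans_vcomp[OF assms ntrans_id[OF G.func_axioms]] assms]) simp
  show "\<alpha> \<bullet> id_nat F = \<alpha>"
    by (rule ntr_eqI[OF ntrans_vcomp[OF ntrans_id[OF F.func_axioms] assms] assms]) simp
qed

lemma vcomp_nat_assoc:
  assumes "ntrans C D F G \<alpha>" "ntrans C D G H \<beta>" "ntrans C D H K \<gamma>"
  shows "\<gamma> \<bullet> (\<beta> \<bullet> \<alpha>) = (\<gamma> \<bullet> \<beta>) \<bullet> \<alpha>"
proof -
  interpret a: ntrans C D F G \<alpha> by fact
  interpret b: ntrans C D G H \<beta> by fact
  interpret c: ntrans C D H K \<gamma> by fact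
  show ?thesis by (rule ntr_eqI[of C D F K]) (auto intro: ntrans_vcomp assms)
qed

lemma hcomp_nat_id:
  assumes "ntrans C D F G \<alpha>"
  shows "id_nat (id_ftr D) \<star> \<alpha> = \<alpha>" "\<alpha> \<star> id_nat (id_ftr C) = \<alpha>"
proof -
  interpret ntrans C D F G \<alpha> by fact
  note C = func_id[OF F.C.category_axioms] and D = func_id[OF F.D.category_axioms]
  show "id_nat (id_ftr D) \<star> \<alpha> = \<alpha>"
    using ntrans_hcomp[OF assms ntrans_id[OF D]]
    by (intro ntr_eqI[OF _ assms])
      (simp_all add: comp_ftr_id[OF F.func_axioms] comp_ftr_id[OF G.func_axioms])
  show "\<alpha> \<star> id_nat (id_ftr C) = \<alpha>"
    using ntrans_hcomp[OF ntrans_id[OF C] assms]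
    by (intro ntr_eqI[OF _ assms])
      (simp_all add: comp_ftr_id[OF F.func_axioms] comp_ftr_id[OF G.func_axioms])
qed

lemma hcomp_nat_id_id:
  assumes "func C D F" "func D E G"
  shows "id_nat G \<star> id_nat F = id_nat (G \<circ>\<^sub>c F)"
proof -
  interpret F: func C D F by fact
  interpret G: func D E G by fact
  show ?thesis
    by (rule ntr_eqI[of C E "G \<circ>\<^sub>c F" "G \<circ>\<^sub>c F"])
      (auto intro: ntrans_hcomp ntrans_id func_comp assms)
qed

lemma hcomp_nat_assoc:
  assumes "ntrans A B F F' \<alpha>" "ntrans B C G G' \<beta>" "ntrans C D H H' \<gamma>"
  shows "\<gamma> \<star> (\<beta> \<star> \<alpha>) = (\<gamma> \<star> \<beta>) \<star> \<alpha>"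
proof -
  interpret a: ntrans A B F F' \<alpha> by fact
  interpret b: ntrans B C G G' \<beta> by fact
  interpret c: ntrans C D H H' \<gamma> by fact
  have "ntrans A D ((H \<circ>\<^sub>c G) \<circ>\<^sub>c F) ((H' \<circ>\<^sub>c G') \<circ>\<^sub>c F') (\<gamma> \<star> (\<beta> \<star> \<alpha>))"
    using ntrans_hcomp[OF ntrans_hcomp[OF assms(1,2)] assms(3)]
    by (simp add: comp_ftr_assoc[OF a.F.func_axioms b.F.func_axioms c.F.func_axioms]
        comp_ftr_assoc[OF a.G.func_axioms b.G.func_axioms c.G.func_axioms])
  then show ?thesis
    by (rule ntr_eqI) (auto intro: ntrans_hcomp assms)
qed

text \<open>In components this is naturality of \<beta> at the components of
  \<open>\<alpha>'\<close>; the rest is functoriality and associativity.\<close>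

lemma hcomp_vcomp_interchange:
  assumes "ntrans C D F F' \<alpha>" "ntrans C D F' F'' \<alpha>'" "ntrans D E G G' \<beta>" "ntrans D E G' G'' \<beta>'"
  shows "(\<beta>' \<bullet> \<beta>) \<star> (\<alpha>' \<bullet> \<alpha>) = (\<beta>' \<star> \<alpha>') \<bullet> (\<beta> \<star> \<alpha>)"
proof -
  interpret a: ntrans C D F F' \<alpha> by fact
  interpret a': ntrans C D F' F'' \<alpha>' by fact
  interpret b: ntrans D E G G' \<beta> by fact
  interpret b': ntrans D E G' G'' \<beta>' by fact
  show ?thesis
    by (rule ntr_eqI[of C E "G \<circ>\<^sub>c F" "G'' \<circ>\<^sub>c F''"])
      (auto intro!: ntrans_hcomp ntrans_vcomp assms intro: assms simp: b.natural'[symmetric])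
qed

lemma ex1_eqD: "\<exists>!x. P x \<Longrightarrow> P a \<Longrightarrow> P b \<Longrightarrow> a = b"
  by blast

section \<open>Arrow categories and pullbacks\<close>

lemma arrow_cat_Obj [simp]: "Obj (arrow_cat B) = Arr B"
  by (simp add: arrow_cat_def Let_def)

lemma arrow_cat_Arr [simp]:
  "(f, g, h, k) \<in> Arr (arrow_cat B) \<longleftrightarrow> f \<in> Arr B \<and> g \<in> Arr B \<and>
    h \<in> Arr B \<and> Dom B h = Dom B f \<and> Cod B h = Dom B g \<and>
    k \<in> Arr B \<and> Dom B k = Cod B f \<and> Cod B k = Cod B g \<and> Comp B g h = Comp B k f"
  by (auto simp: arrow_cat_def Let_def in_Hom)

lemma arrow_cat_Dom: "s \<in> Arr (arrow_cat B) \<Longrightarrow> Dom (arrow_cat B) s = fst s"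
  and arrow_cat_Cod: "s \<in> Arr (arrow_cat B) \<Longrightarrow> Cod (arrow_cat B) s = fst (snd s)"
  and arrow_cat_Ide: "f \<in> Arr B \<Longrightarrow>
    Ide (arrow_cat B) f = (f, f, Ide B (Dom B f), Ide B (Cod B f))"
  by (auto simp: arrow_cat_def Let_def)

lemma arrow_cat_Comp:
  "(f, g, h, k) \<in> Arr (arrow_cat B) \<Longrightarrow> (g, g', h', k') \<in> Arr (arrow_cat B) \<Longrightarrow>
    Comp (arrow_cat B) (g, g', h', k') (f, g, h, k) = (f, g', Comp B h' h, Comp B k' k)"
  by (auto simp: arrow_cat_def Let_def)

lemma arrow_cat_Comp_undefined:
  "\<not> (s \<in> Arr (arrow_cat B) \<and> t \<in> Arr (arrow_cat B) \<and> fst (snd s) = fst t) \<Longrightarrow>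
    Comp (arrow_cat B) t s = undefined"
  by (cases s; cases t) (auto simp: arrow_cat_def Let_def)

lemma category_arrow_cat:
  assumes "category B" shows "category (arrow_cat B)"
proof -
  interpret category B by fact
  have R: "Comp B g' (Comp B h' h) = Comp B (Comp B k' k) f"
    if "(f, g, h, k) \<in> Arr (arrow_cat B)" "(g, g', h', k') \<in> Arr (arrow_cat B)"
    for f g h k g' h' k'
    using that by (auto simp: reassoc2[of g' h' k' g])
  show ?thesis
  proof (rule categoryI)
    fix f g
    assume fg: "f \<in> Arr (arrow_cat B)" "g \<in> Arr (arrow_cat B)"
      "Cod (arrow_cat B) f = Dom (arrow_cat B) g"
    obtain a b h k a' b' h' k' where e: "f = (a, b, h, k)" "g = (a', b', h', k')"
      by (cases f; cases g) auto
    have "a' = b" using fg by (simp add: arrow_cat_Dom arrow_cat_Cod e)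
    with fg e have fg': "(a, b, h, k) \<in> Arr (arrow_cat B)" "(b, b', h', k') \<in> Arr (arrow_cat B)"
      "f = (a, b, h, k)" "g = (b, b', h', k')" by auto
    have *: "(a, b', Comp B h' h, Comp B k' k) \<in> Arr (arrow_cat B)"
      using fg'(1,2) R[OF fg'(1,2)] by auto
    show "Comp (arrow_cat B) g f \<in> Arr (arrow_cat B) \<and>
      Dom (arrow_cat B) (Comp (arrow_cat B) g f) = Dom (arrow_cat B) f \<and>
      Cod (arrow_cat B) (Comp (arrow_cat B) g f) = Cod (arrow_cat B) g"
      unfolding fg'(3,4) arrow_cat_Comp[OF fg'(1,2)]
      using * by (simp add: arrow_cat_Dom[OF *] arrow_cat_Cod[OF *] arrow_cat_Dom[OF fg'(1)]
          arrow_cat_Cod[OF fg'(2)])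
  next
    fix f g h
    assume fgh: "f \<in> Arr (arrow_cat B)" "g \<in> Arr (arrow_cat B)" "h \<in> Arr (arrow_cat B)"
      "Cod (arrow_cat B) f = Dom (arrow_cat B) g" "Cod (arrow_cat B) g = Dom (arrow_cat B) h"
    obtain a1 b1 h1 k1 a2 b2 h2 k2 a3 b3 h3 k3 where
      e: "f = (a1, b1, h1, k1)" "g = (a2, b2, h2, k2)" "h = (a3, b3, h3, k3)"
      by (cases f; cases g; cases h) auto
    have e2: "a2 = b1" "a3 = b2" using fgh by (auto simp: arrow_cat_Dom arrow_cat_Cod e)
    have 1: "(a1, b1, h1, k1) \<in> Arr (arrow_cat B)" and 2: "(b1, b2, h2, k2) \<in> Arr (arrow_cat B)"
      and 3: "(b2, b3, h3, k3) \<in> Arr (arrow_cat B)"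
      using fgh e e2 by auto
    have 12: "(a1, b2, Comp B h2 h1, Comp B k2 k1) \<in> Arr (arrow_cat B)"
      and 23: "(b1, b3, Comp B h3 h2, Comp B k3 k2) \<in> Arr (arrow_cat B)"
      using 1 2 3 R[OF 1 2] R[OF 2 3] by auto
    show "Comp (arrow_cat B) h (Comp (arrow_cat B) g f) =
      Comp (arrow_cat B) (Comp (arrow_cat B) h g) f"
      unfolding e e2 arrow_cat_Comp[OF 1 2] arrow_cat_Comp[OF 2 3]
        arrow_cat_Comp[OF 12 3] arrow_cat_Comp[OF 1 23]
      using 1 2 3 by auto
  next
    fix f g
    assume "\<not> (f \<in> Arr (arrow_cat B) \<and> g \<in> Arr (arrow_cat B) \<and>
      Cod (arrow_cat B) f = Dom (arrow_cat B) g)"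
    then show "Comp (arrow_cat B) g f = undefined"
      by (intro arrow_cat_Comp_undefined) (auto simp: arrow_cat_Dom arrow_cat_Cod)
  next
    fix f assume f: "f \<in> Arr (arrow_cat B)"
    obtain a b h k where e: "f = (a, b, h, k)" by (cases f) auto
    have I: "(a, a, Ide B (Dom B a), Ide B (Cod B a)) \<in> Arr (arrow_cat B)"
      "(b, b, Ide B (Dom B b), Ide B (Cod B b)) \<in> Arr (arrow_cat B)"
      using f by (auto simp: e)
    show "Comp (arrow_cat B) (Ide (arrow_cat B) (Cod (arrow_cat B) f)) f = f"
      "Comp (arrow_cat B) f (Ide (arrow_cat B) (Dom (arrow_cat B) f)) = f"
      using f I arrow_cat_Comp[OF f[unfolded e] I(2)] arrow_cat_Comp[OF I(1) f[unfolded e]]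
      by (auto simp: e arrow_cat_Dom arrow_cat_Cod arrow_cat_Ide)
  qed (auto simp: arrow_cat_Ide arrow_cat_Dom arrow_cat_Cod, auto simp: arrow_cat_def Let_def)
qed

lemma arrow_ftr_simps [simp]:
  "FDom (arrow_ftr F) = arrow_cat (FDom F)" "FCod (arrow_ftr F) = arrow_cat (FCod F)"
  "f \<in> Arr (FDom F) \<Longrightarrow> FObj (arrow_ftr F) f = FArr F f"
  "(f, g, h, k) \<in> Arr (arrow_cat (FDom F)) \<Longrightarrow>
    FArr (arrow_ftr F) (f, g, h, k) = (FArr F f, FArr F g, FArr F h, FArr F k)"
  by (auto simp: arrow_ftr_def simp del: arrow_cat_Arr)

lemma func_arrow_ftr:
  assumes "func C D F" shows "func (arrow_cat C) (arrow_cat D) (arrow_ftr F)"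
proof -
  interpret func C D F by fact
  interpret aC: category "arrow_cat C" by (rule category_arrow_cat) (rule C.category_axioms)
  have A: "(FArr F f, FArr F g, FArr F h, FArr F k) \<in> Arr (arrow_cat D)"
    if "(f, g, h, k) \<in> Arr (arrow_cat C)" for f g h k
    using that comp_eq2[of g h k f] by auto
  show ?thesis
  proof (rule funcI)
    fix f assume f: "f \<in> Arr (arrow_cat C)"
    obtain a b h k where e: "f = (a, b, h, k)" by (cases f) auto
    show "FArr (arrow_ftr F) f \<in> Arr (arrow_cat D) \<and>
         Dom (arrow_cat D) (FArr (arrow_ftr F) f) = FObj (arrow_ftr F) (Dom (arrow_cat C) f) \<and>
         Cod (arrow_cat D) (FArr (arrow_ftr F) f) = FObj (arrow_ftr F) (Cod (arrow_cat C) f)"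
      using f A[OF f[unfolded e]] by (auto simp: e arrow_cat_Dom arrow_cat_Cod)
  next
    fix f g
    assume fg: "f \<in> Arr (arrow_cat C)" "g \<in> Arr (arrow_cat C)"
      "Cod (arrow_cat C) f = Dom (arrow_cat C) g"
    obtain a b h k a' b' h' k' where e: "f = (a, b, h, k)" "g = (a', b', h', k')"
      by (cases f; cases g) auto
    have "a' = b" using fg by (simp add: arrow_cat_Dom arrow_cat_Cod e)
    with fg e have fg': "(a, b, h, k) \<in> Arr (arrow_cat C)" "(b, b', h', k') \<in> Arr (arrow_cat C)"
      "f = (a, b, h, k)" "g = (b, b', h', k')" by auto
    have "(a, b', Comp C h' h, Comp C k' k) \<in> Arr (arrow_cat C)"
      using aC.comp[of f g] fg e \<open>a' = b\<close> arrow_cat_Comp[OF fg'(1,2)] by simp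
    then have "FArr (arrow_ftr F) (Comp (arrow_cat C) g f) =
      (FArr F a, FArr F b', FArr F (Comp C h' h), FArr F (Comp C k' k))"
      unfolding fg'(3,4) arrow_cat_Comp[OF fg'(1,2)] by (subst arrow_ftr_simps(4)) simp_all
    also have "\<dots> = Comp (arrow_cat D) (FArr (arrow_ftr F) g) (FArr (arrow_ftr F) f)"
      using fg'(1,2) arrow_cat_Comp[OF A[OF fg'(1)] A[OF fg'(2)]] unfolding fg'(3,4) by auto
    finally show "FArr (arrow_ftr F) (Comp (arrow_cat C) g f) =
      Comp (arrow_cat D) (FArr (arrow_ftr F) g) (FArr (arrow_ftr F) f)" .
  next
    show "category (arrow_cat C)" by (rule aC.category_axioms)
    show "category (arrow_cat D)" by (rule category_arrow_cat) (rule D.category_axioms)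
  qed (auto simp: arrow_cat_Ide, auto simp: arrow_ftr_def)
qed

section \<open>Pullback squares\<close>

lemma is_pullbackI:
  assumes "(f, g, h, k) \<in> Arr (arrow_cat B)"
    and "\<And>a b. \<lbrakk>a \<in> Arr B; b \<in> Arr B; Dom B a = Dom B b; Cod B a = Dom B g; Cod B b = Cod B f;
      Comp B g a = Comp B k b\<rbrakk> \<Longrightarrow>
      \<exists>m. m \<in> Arr B \<and> Dom B m = Dom B b \<and> Cod B m = Dom B f \<and> Comp B h m = a \<and> Comp B f m = b"
    and "\<And>m n. \<lbrakk>m \<in> Arr B; n \<in> Arr B; Dom B m = Dom B n; Cod B m = Dom B f; Cod B n = Dom B f;
      Comp B h m = Comp B h n; Comp B f m = Comp B f n\<rbrakk> \<Longrightarrow> m = n"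
  shows "is_pullback B (f, g, h, k)"
  unfolding is_pullback_def prod.case
proof (intro conjI ballI impI)
  fix z a b assume z: "z \<in> Obj B" and a: "a \<in> Hom B z (Dom B g)" and b: "b \<in> Hom B z (Cod B f)"
    and eq: "Comp B g a = Comp B k b"
  have "\<exists>m. m \<in> Arr B \<and> Dom B m = Dom B b \<and> Cod B m = Dom B f \<and>
      Comp B h m = a \<and> Comp B f m = b"
    by (rule assms(2)) (use a b eq in \<open>simp_all add: in_Hom\<close>)
  then obtain m where m: "m \<in> Arr B" "Dom B m = z" "Cod B m = Dom B f" "Comp B h m = a"
    "Comp B f m = b"
    using b by (auto simp: in_Hom)
  show "\<exists>!m. m \<in> Hom B z (Dom B f) \<and> Comp B h m = a \<and> Comp B f m = b"
  proof (rule ex1I[of _ m])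
    fix n assume "n \<in> Hom B z (Dom B f) \<and> Comp B h n = a \<and> Comp B f n = b"
    with m show "n = m" by - (rule assms(3), simp_all add: in_Hom)
  qed (use m in \<open>simp add: in_Hom\<close>)
qed (fact assms(1))

context category
begin

lemma pullback_ex:
  assumes "is_pullback C (f, g, h, k)" "a \<in> Arr C" "b \<in> Arr C" "Dom C a = Dom C b"
    "Cod C a = Dom C g" "Cod C b = Cod C f" "Comp C g a = Comp C k b"
  obtains m where "m \<in> Arr C" "Dom C m = Dom C b" "Cod C m = Dom C f" "Comp C h m = a"
    "Comp C f m = b"
proof -
  have "\<exists>!m. m \<in> Hom C (Dom C b) (Dom C f) \<and> Comp C h m = a \<and> Comp C f m = b"
    using assms unfolding is_pullback_def by (simp add: in_Hom)
  then obtain m where "m \<in> Hom C (Dom C b) (Dom C f) \<and> Comp C h m = a \<and> Comp C f m = b"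
    by blast
  then show ?thesis using that[of m] by (simp add: in_Hom)
qed

lemma pullback_unique:
  assumes "is_pullback C (f, g, h, k)" "m \<in> Arr C" "n \<in> Arr C" "Dom C m = Dom C n"
    "Cod C m = Dom C f" "Cod C n = Dom C f" "Comp C h m = Comp C h n" "Comp C f m = Comp C f n"
  shows "m = n"
proof -
  have sq: "(f, g, h, k) \<in> Arr (arrow_cat C)" using assms(1) by (simp add: is_pullback_def)
  have "Comp C g (Comp C h n) = Comp C k (Comp C f n)"
    using sq assms by (intro reassoc2) auto
  then have "\<exists>!l. l \<in> Hom C (Dom C n) (Dom C f) \<and> Comp C h l = Comp C h n \<and>
      Comp C f l = Comp C f n"
    using assms(1-6) sq by (simp add: in_Hom is_pullback_def)
  then show ?thesis by (rule ex1_eqD) (use assms in \<open>simp_all add: in_Hom\<close>)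
qed

end


section \<open>Fibrations\<close>

context pre_func
begin

lemma cart_arr: "cartesian F f \<Longrightarrow> f \<in> Arr C"
  by (simp add: cartesian_def FDom)

lemma cartesianI:
  assumes "f \<in> Arr C"
    and "\<And>g w. \<lbrakk>g \<in> Arr C; w \<in> Arr D; Dom D w = FObj F (Dom C g); Cod D w = FObj F (Dom C f);
      Cod C g = Cod C f; Comp D (FArr F f) w = FArr F g\<rbrakk> \<Longrightarrow>
      \<exists>h. h \<in> Arr C \<and> Dom C h = Dom C g \<and> Cod C h = Dom C f \<and> FArr F h = w \<and> Comp C f h = g"
    and "\<And>h k. \<lbrakk>h \<in> Arr C; k \<in> Arr C; Dom C h = Dom C k; Cod C h = Dom C f; Cod C k = Dom C f;
      FArr F h = FArr F k; Comp C f h = Comp C f k\<rbrakk> \<Longrightarrow> h = k"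
  shows "cartesian F f"
  unfolding cartesian_def FDom FCod
proof (intro conjI ballI impI)
  fix g w assume g: "g \<in> Arr C" and w: "w \<in> Hom D (FObj F (Dom C g)) (FObj F (Dom C f))"
    and eq: "Cod C g = Cod C f \<and> Comp D (FArr F f) w = FArr F g"
  have "\<exists>h. h \<in> Arr C \<and> Dom C h = Dom C g \<and> Cod C h = Dom C f \<and> FArr F h = w \<and>
      Comp C f h = g"
    by (rule assms(2)) (use g w eq in \<open>simp_all add: in_Hom\<close>)
  then obtain h where h: "h \<in> Arr C" "Dom C h = Dom C g" "Cod C h = Dom C f" "FArr F h = w"
    "Comp C f h = g"
    by auto
  show "\<exists>!h. h \<in> Hom C (Dom C g) (Dom C f) \<and> FArr F h = w \<and> Comp C f h = g"
  proof (rule ex1I[of _ h])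
    fix k assume "k \<in> Hom C (Dom C g) (Dom C f) \<and> FArr F k = w \<and> Comp C f k = g"
    with h show "k = h" by - (rule assms(3), simp_all add: in_Hom)
  qed (use h in \<open>simp add: in_Hom\<close>)
qed (fact assms(1))

lemma cartesianD:
  assumes "cartesian F f" "g \<in> Arr C" "w \<in> Arr D" "Dom D w = FObj F (Dom C g)"
    "Cod D w = FObj F (Dom C f)" "Cod C g = Cod C f" "Comp D (FArr F f) w = FArr F g"
  shows "\<exists>!h. h \<in> Hom C (Dom C g) (Dom C f) \<and> FArr F h = w \<and> Comp C f h = g"
  using assms unfolding cartesian_def FDom FCod by (simp add: in_Hom)

lemma cart_ex:
  assumes "cartesian F f" "g \<in> Arr C" "w \<in> Arr D" "Dom D w = FObj F (Dom C g)"
    "Cod D w = FObj F (Dom C f)" "Cod C g = Cod C f" "Comp D (FArr F f) w = FArr F g"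
  obtains h where "h \<in> Arr C" "Dom C h = Dom C g" "Cod C h = Dom C f" "FArr F h = w"
    "Comp C f h = g"
proof -
  obtain h where "h \<in> Hom C (Dom C g) (Dom C f) \<and> FArr F h = w \<and> Comp C f h = g"
    using cartesianD[OF assms] by blast
  then show ?thesis using that[of h] by (simp add: in_Hom)
qed

lemma cart_unique:
  assumes "cartesian F f" "h \<in> Arr C" "k \<in> Arr C" "Dom C h = Dom C k" "Cod C h = Dom C f"
    "Cod C k = Dom C f" "FArr F h = FArr F k" "Comp C f h = Comp C f k"
  shows "h = k"
proof -
  have f: "f \<in> Arr C" using assms(1) by (rule cart_arr)
  have "\<exists>!l. l \<in> Hom C (Dom C k) (Dom C f) \<and> FArr F l = FArr F k \<and>
      Comp C f l = Comp C f k"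
    using cartesianD[OF assms(1), of "Comp C f k" "FArr F k"] assms f by simp
  then show ?thesis by (rule ex1_eqD) (use assms f in \<open>simp_all add: in_Hom\<close>)
qed

lemma cart_comp:
  assumes f: "cartesian F f" and g: "cartesian F g" and fg: "Cod C f = Dom C g"
  shows "cartesian F (Comp C g f)"
proof -
  note [simp] = cart_arr[OF f] cart_arr[OF g] fg
  show ?thesis
  proof (rule cartesianI)
    fix k w assume k: "k \<in> Arr C" and w: "w \<in> Arr D" "Dom D w = FObj F (Dom C k)"
      "Cod D w = FObj F (Dom C (Comp C g f))" "Cod C k = Cod C (Comp C g f)"
      "Comp D (FArr F (Comp C g f)) w = FArr F k"
    obtain h where h: "h \<in> Arr C" "Dom C h = Dom C k" "Cod C h = Dom C g"
        "FArr F h = Comp D (FArr F f) w" "Comp C g h = k"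
      by (rule cart_ex[OF g k, of "Comp D (FArr F f) w"]) (use w in auto)
    obtain l where "l \<in> Arr C" "Dom C l = Dom C h" "Cod C l = Dom C f"
        "FArr F l = w" "Comp C f l = h"
      by (rule cart_ex[OF f h(1), of w]) (use w h fg in auto)
    with h show "\<exists>h. h \<in> Arr C \<and> Dom C h = Dom C k \<and> Cod C h = Dom C (Comp C g f) \<and>
        FArr F h = w \<and> Comp C (Comp C g f) h = k" by (intro exI[of _ l]) auto
  next
    fix h k assume hk: "h \<in> Arr C" "k \<in> Arr C" "Dom C h = Dom C k"
      "Cod C h = Dom C (Comp C g f)" "Cod C k = Dom C (Comp C g f)" "FArr F h = FArr F k"
      "Comp C (Comp C g f) h = Comp C (Comp C g f) k"
    then have "Comp C f h = Comp C f k" by - (rule cart_unique[OF g], auto)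
    then show "h = k" using hk by - (rule cart_unique[OF f], auto)
  qed simp
qed

text \<open>A factorisation is produced by \<open>g f\<close>, and that it is one through
  \<open>f\<close> is checked after \<open>g\<close>, where lifts are unique. This is the usual way
  below to recognise a cartesian arrow: naturality exhibits it as a factor in a composite of
  cartesian arrows.\<close>

lemma cart_cancel:
  assumes g: "cartesian F g" and gf: "cartesian F (Comp C g f)"
    and f [simp]: "f \<in> Arr C" "Cod C f = Dom C g"
  shows "cartesian F f"
proof -
  note [simp] = cart_arr[OF g]
  show ?thesis
  proof (rule cartesianI)
    fix k w assume k: "k \<in> Arr C" and w: "w \<in> Arr D" "Dom D w = FObj F (Dom C k)"
      "Cod D w = FObj F (Dom C f)" "Cod C k = Cod C f" "Comp D (FArr F f) w = FArr F k"
    obtain h where h: "h \<in> Arr C" "Dom C h = Dom C k" "Cod C h = Dom C f"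
        "FArr F h = w" "Comp C (Comp C g f) h = Comp C g k"
      by (rule cart_ex[OF gf, of "Comp C g k" w]) (use k w in auto)
    have "Comp C f h = k" by (rule cart_unique[OF g]) (use h k w in auto)
    with h show "\<exists>h. h \<in> Arr C \<and> Dom C h = Dom C k \<and> Cod C h = Dom C f \<and> FArr F h = w \<and>
        Comp C f h = k" by auto
  next
    fix h k assume hk: "h \<in> Arr C" "k \<in> Arr C" "Dom C h = Dom C k" "Cod C h = Dom C f"
      "Cod C k = Dom C f" "FArr F h = FArr F k" "Comp C f h = Comp C f k"
    then show "h = k" by - (rule cart_unique[OF gf], auto)
  qed simp
qed

lemma cart_iso:
  assumes "is_iso C f" shows "cartesian F f"
proof -
  note f [simp] = C.iso_arr[OF assms]
  show ?thesis
  proof (rule cartesianI)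
    fix g w assume g: "g \<in> Arr C" and w: "w \<in> Arr D" "Dom D w = FObj F (Dom C g)"
      "Cod D w = FObj F (Dom C f)" "Cod C g = Cod C f" "Comp D (FArr F f) w = FArr F g"
    have "FArr F (Comp C (inv_arr C f) g) = Comp D (FArr F (inv_arr C f)) (FArr F g)"
      using assms g w by simp
    also have "\<dots> = Comp D (FArr F (inv_arr C f)) (Comp D (FArr F f) w)" using w by simp
    also have "\<dots> = w"
      by (subst D.reassoc[OF comp_eq[OF C.inv_arr(4)[OF assms]]]) (use assms w in auto)
    finally show "\<exists>h. h \<in> Arr C \<and> Dom C h = Dom C g \<and> Cod C h = Dom C f \<and> FArr F h = w \<and>
        Comp C f h = g"
      using assms g w by (intro exI[of _ "Comp C (inv_arr C f) g"]) auto
  next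
    fix h k assume "h \<in> Arr C" "k \<in> Arr C" "Dom C h = Dom C k" "Cod C h = Dom C f"
      "Cod C k = Dom C f" "FArr F h = FArr F k" "Comp C f h = Comp C f k"
    then show "h = k" using C.iso_cancel[of f h k] assms by auto
  qed simp
qed

text \<open>The lift of the inverse of \<open>F f\<close> through \<open>f\<close> is a right
  inverse by construction and a left inverse by uniqueness of lifts.\<close>

lemma cart_over_iso:
  assumes f: "cartesian F f" and i: "is_iso D (FArr F f)"
  shows "is_iso C f"
proof -
  note [simp] = cart_arr[OF f]
  obtain h where h: "h \<in> Arr C" "Dom C h = Cod C f" "Cod C h = Dom C f"
      "FArr F h = inv_arr D (FArr F f)" "Comp C f h = Ide C (Cod C f)"
    by (rule cart_ex[OF f, of "Ide C (Cod C f)" "inv_arr D (FArr F f)"]) (use i in auto)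
  have "Comp C h f = Ide C (Dom C f)"
    by (rule cart_unique[OF f]) (use h i C.reassoc[OF h(5), of f] in auto)
  with h show ?thesis by (intro C.is_isoI[of f h]) auto
qed

end

section \<open>Fibrations, their 1-cells and 2-cells\<close>

sublocale fibration \<subseteq> pre_func "Tot p" "Base p" "Fun p"
  by (rule func.axioms, rule cat_functor_func[OF Fun_functor]) auto

context fibration
begin

lemma func_axioms: "func (Tot p) (Base p) (Fun p)"
  by (rule func.intro) unfold_locales

lemma lift [simp]:
  assumes "e \<in> Obj (Tot p)" "w \<in> Arr (Base p)" "Cod (Base p) w = FObj (Fun p) e"
  shows "cartesian (Fun p) (Lift p w e)" "Lift p w e \<in> Arr (Tot p)"
    "Cod (Tot p) (Lift p w e) = e" "FArr (Fun p) (Lift p w e) = w"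
    "FObj (Fun p) (Dom (Tot p) (Lift p w e)) = Dom (Base p) w"
proof -
  show *: "cartesian (Fun p) (Lift p w e)" "Lift p w e \<in> Arr (Tot p)"
    "Cod (Tot p) (Lift p w e) = e" "FArr (Fun p) (Lift p w e) = w"
    using Lift_cartesian[OF assms] by (simp_all add: cart_arr)
  show "FObj (Fun p) (Dom (Tot p) (Lift p w e)) = Dom (Base p) w"
    using arr(2)[OF *(2)] unfolding *(4) by (rule sym)
qed

end

text \<open>The commuting square of functors is required on arrows only: objects follow through
  identities, and \<open>over_eq\<close> regains the equality of functors.\<close>

locale fib1 = p: fibration p + p': fibration p' + B: func "Base p" "Base p'" B +
  E: func "Tot p" "Tot p'" E
  for p :: "('o, 'a, 'p, 'b) fib" and p' :: "('o', 'a', 'p', 'b') fib" and B E +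
  assumes over [simp]:
      "f \<in> Arr (Tot p) \<Longrightarrow> FArr (Fun p') (FArr E f) = FArr B (FArr (Fun p) f)"
    and cart: "cartesian (Fun p) f \<Longrightarrow> cartesian (Fun p') (FArr E f)"
begin

lemma over_obj [simp]:
  assumes x: "x \<in> Obj (Tot p)" shows "FObj (Fun p') (FObj E x) = FObj B (FObj (Fun p) x)"
proof -
  have "Dom (Base p') (FArr (Fun p') (FArr E (Ide (Tot p) x))) =
      Dom (Base p') (FArr B (FArr (Fun p) (Ide (Tot p) x)))"
    by (subst over) (use x in auto)
  then show ?thesis using x by simp
qed

lemma over_eq: "Fun p' \<circ>\<^sub>c E = B \<circ>\<^sub>c Fun p"
  by (rule ftr_eqI[of "Tot p" "Base p'"])
    (auto intro!: func_comp[OF E.func_axioms p'.func_axioms] func_comp[OF p.func_axioms B.func_axioms])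

end

lemma fib_cell1_iff: "fib_cell1 p p' B E \<longleftrightarrow> fib1 p p' B E"
proof
  assume *: "fib_cell1 p p' B E"
  then interpret p: fibration p by (simp add: fib_cell1_def)
  from * interpret p': fibration p' by (simp add: fib_cell1_def)
  from * interpret B: func "Base p" "Base p'" B by (simp add: fib_cell1_def cat_functor_func)
  from * interpret E: func "Tot p" "Tot p'" E by (simp add: fib_cell1_def cat_functor_func)
  have eq: "Fun p' \<circ>\<^sub>c E = B \<circ>\<^sub>c Fun p" using * by (simp add: fib_cell1_def)
  show "fib1 p p' B E"
  proof
    fix f assume "f \<in> Arr (Tot p)"
    then show "FArr (Fun p') (FArr E f) = FArr B (FArr (Fun p) f)"
      using arg_cong[OF eq, of "\<lambda>F. FArr F f"] by simp
  qed (use * in \<open>auto simp: fib_cell1_def\<close>)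
next
  assume "fib1 p p' B E"
  then interpret fib1 p p' B E .
  show "fib_cell1 p p' B E"
    using over_eq cart p.fibration_axioms p'.fibration_axioms B.is_functor E.is_functor
    by (auto simp: fib_cell1_def)
qed

lemma fib1_id:
  assumes "fibration p" shows "fib1 p p (id_ftr (Base p)) (id_ftr (Tot p))"
proof -
  interpret fibration p by fact
  interpret B: func "Base p" "Base p" "id_ftr (Base p)" by (rule func_id[OF D.category_axioms])
  interpret E: func "Tot p" "Tot p" "id_ftr (Tot p)" by (rule func_id[OF C.category_axioms])
  show ?thesis by unfold_locales (simp_all add: cart_arr)
qed

lemma fib1_comp:
  assumes "fib1 p p' B E" "fib1 p' p'' B' E'"
  shows "fib1 p p'' (B' \<circ>\<^sub>c B) (E' \<circ>\<^sub>c E)"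
proof -
  interpret M: fib1 p p' B E by fact
  interpret N: fib1 p' p'' B' E' by fact
  interpret B: func "Base p" "Base p''" "B' \<circ>\<^sub>c B"
    by (rule func_comp[OF M.B.func_axioms N.B.func_axioms])
  interpret E: func "Tot p" "Tot p''" "E' \<circ>\<^sub>c E"
    by (rule func_comp[OF M.E.func_axioms N.E.func_axioms])
  show ?thesis by unfold_locales (simp_all add: M.p.cart_arr M.cart N.cart)
qed

locale fib2 = M: fib1 p p' B1 E1 + N: fib1 p p' B2 E2 +
  psi: ntrans "Base p" "Base p'" B1 B2 \<psi> + phi: ntrans "Tot p" "Tot p'" E1 E2 \<phi>
  for p :: "('o, 'a, 'p, 'b) fib" and p' :: "('o', 'a', 'p', 'b') fib" and B1 E1 B2 E2 \<psi> \<phi> +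
  assumes over [simp]:
    "x \<in> Obj (Tot p) \<Longrightarrow> FArr (Fun p') (NComp \<phi> x) = NComp \<psi> (FObj (Fun p) x)"

lemma fib_cell2_iff: "fib_cell2 p p' B1 E1 B2 E2 \<psi> \<phi> \<longleftrightarrow> fib2 p p' B1 E1 B2 E2 \<psi> \<phi>"
proof
  assume *: "fib_cell2 p p' B1 E1 B2 E2 \<psi> \<phi>"
  then interpret M: fib1 p p' B1 E1 by (simp add: fib_cell2_def fib_cell1_iff)
  from * interpret N: fib1 p p' B2 E2 by (simp add: fib_cell2_def fib_cell1_iff)
  from * interpret psi: ntrans "Base p" "Base p'" B1 B2 \<psi>
    by (simp add: fib_cell2_def nat_from_to_ntrans)
  from * interpret phi: ntrans "Tot p" "Tot p'" E1 E2 \<phi>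
    by (simp add: fib_cell2_def nat_from_to_ntrans)
  have eq: "Fun p' \<cdot>\<^sub>l \<phi> = \<psi> \<cdot>\<^sub>r Fun p" using * by (simp add: fib_cell2_def)
  show "fib2 p p' B1 E1 B2 E2 \<psi> \<phi>"
    by unfold_locales (metis eq lwhisker_simps(3) rwhisker_simps(3) phi.NDom M.E.FDom)
next
  assume "fib2 p p' B1 E1 B2 E2 \<psi> \<phi>"
  then interpret fib2 p p' B1 E1 B2 E2 \<psi> \<phi> .
  have "Fun p' \<cdot>\<^sub>l \<phi> = \<psi> \<cdot>\<^sub>r Fun p"
    by (rule ntr_eqI[OF ntrans_lwhisker[OF phi.ntrans_axioms M.p'.func_axioms]])
      (use ntrans_rwhisker[OF psi.ntrans_axioms M.p.func_axioms] in
        \<open>auto simp: M.over_eq N.over_eq\<close>)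
  then show "fib_cell2 p p' B1 E1 B2 E2 \<psi> \<phi>"
    using M.fib1_axioms N.fib1_axioms psi.nat phi.nat by (simp add: fib_cell2_def fib_cell1_iff)
qed

lemma fib2_id:
  assumes "fib1 p p' B E" shows "fib2 p p' B E B E (id_nat B) (id_nat E)"
proof -
  interpret fib1 p p' B E by fact
  interpret psi: ntrans "Base p" "Base p'" B B "id_nat B" by (rule ntrans_id[OF B.func_axioms])
  interpret phi: ntrans "Tot p" "Tot p'" E E "id_nat E" by (rule ntrans_id[OF E.func_axioms])
  show ?thesis by unfold_locales auto
qed

lemma fib2_vcomp:
  assumes "fib2 p p' B1 E1 B2 E2 \<psi> \<phi>" "fib2 p p' B2 E2 B3 E3 \<psi>' \<phi>'"
  shows "fib2 p p' B1 E1 B3 E3 (\<psi>' \<bullet> \<psi>) (\<phi>' \<bullet> \<phi>)"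
proof -
  interpret a: fib2 p p' B1 E1 B2 E2 \<psi> \<phi> by fact
  interpret b: fib2 p p' B2 E2 B3 E3 \<psi>' \<phi>' by fact
  interpret psi: ntrans "Base p" "Base p'" B1 B3 "\<psi>' \<bullet> \<psi>"
    by (rule ntrans_vcomp[OF a.psi.ntrans_axioms b.psi.ntrans_axioms])
  interpret phi: ntrans "Tot p" "Tot p'" E1 E3 "\<phi>' \<bullet> \<phi>"
    by (rule ntrans_vcomp[OF a.phi.ntrans_axioms b.phi.ntrans_axioms])
  show ?thesis by unfold_locales auto
qed

lemma fib2_hcomp:
  assumes "fib2 p p' B1 E1 B2 E2 \<psi> \<phi>" "fib2 p' p'' B1' E1' B2' E2' \<psi>' \<phi>'"
  shows "fib2 p p'' (B1' \<circ>\<^sub>c B1) (E1' \<circ>\<^sub>c E1) (B2' \<circ>\<^sub>c B2) (E2' \<circ>\<^sub>c E2) (\<psi>' \<star> \<psi>) (\<phi>' \<star> \<phi>)"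
proof -
  interpret a: fib2 p p' B1 E1 B2 E2 \<psi> \<phi> by fact
  interpret b: fib2 p' p'' B1' E1' B2' E2' \<psi>' \<phi>' by fact
  interpret M: fib1 p p'' "B1' \<circ>\<^sub>c B1" "E1' \<circ>\<^sub>c E1"
    by (rule fib1_comp[OF a.M.fib1_axioms b.M.fib1_axioms])
  interpret N: fib1 p p'' "B2' \<circ>\<^sub>c B2" "E2' \<circ>\<^sub>c E2"
    by (rule fib1_comp[OF a.N.fib1_axioms b.N.fib1_axioms])
  interpret psi: ntrans "Base p" "Base p''" "B1' \<circ>\<^sub>c B1" "B2' \<circ>\<^sub>c B2" "\<psi>' \<star> \<psi>"
    by (rule ntrans_hcomp[OF a.psi.ntrans_axioms b.psi.ntrans_axioms])
  interpret phi: ntrans "Tot p" "Tot p''" "E1' \<circ>\<^sub>c E1" "E2' \<circ>\<^sub>c E2" "\<phi>' \<star> \<phi>"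
    by (rule ntrans_hcomp[OF a.phi.ntrans_axioms b.phi.ntrans_axioms])
  show ?thesis by unfold_locales auto
qed

section \<open>The codomain functor\<close>

lemma cod_ftr_simps [simp]:
  "FDom (cod_ftr B) = arrow_cat B" "FCod (cod_ftr B) = B"
  "f \<in> Arr B \<Longrightarrow> FObj (cod_ftr B) f = Cod B f"
  "(f, g, h, k) \<in> Arr (arrow_cat B) \<Longrightarrow> FArr (cod_ftr B) (f, g, h, k) = k"
  by (auto simp: cod_ftr_def simp del: arrow_cat_Arr)

lemma func_cod_ftr:
  assumes "category B" shows "func (arrow_cat B) B (cod_ftr B)"
proof -
  interpret category B by fact
  interpret aB: category "arrow_cat B" by (rule category_arrow_cat) (rule category_axioms)
  show ?thesis
  proof (rule funcI)
    fix f assume f: "f \<in> Arr (arrow_cat B)"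
    obtain a b h k where e: "f = (a, b, h, k)" by (cases f) auto
    show "FArr (cod_ftr B) f \<in> Arr B \<and>
       Dom B (FArr (cod_ftr B) f) = FObj (cod_ftr B) (Dom (arrow_cat B) f) \<and>
       Cod B (FArr (cod_ftr B) f) = FObj (cod_ftr B) (Cod (arrow_cat B) f)"
      using f by (simp add: e arrow_cat_Dom arrow_cat_Cod)
  next
    fix f g assume fg: "f \<in> Arr (arrow_cat B)" "g \<in> Arr (arrow_cat B)"
      "Cod (arrow_cat B) f = Dom (arrow_cat B) g"
    obtain a b h l a' b' h' l' where e: "f = (a, b, h, l)" "g = (a', b', h', l')"
      by (cases f; cases g) auto
    have e': "a' = b" using fg by (simp add: e arrow_cat_Dom arrow_cat_Cod)
    note fg' = fg(1,2)[unfolded e e']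
    have "(a, b', Comp B h' h, Comp B l' l) \<in> Arr (arrow_cat B)"
      using aB.comp(1)[OF fg] unfolding e e' arrow_cat_Comp[OF fg'] .
    then show "FArr (cod_ftr B) (Comp (arrow_cat B) g f) =
       Comp B (FArr (cod_ftr B) g) (FArr (cod_ftr B) f)"
      using fg' unfolding e e' by (simp add: arrow_cat_Comp del: arrow_cat_Arr)
  qed (simp_all add: arrow_cat_Ide category_axioms aB.category_axioms, simp_all add: cod_ftr_def)
qed

section \<open>Comprehension categories\<close>

abbreviation cE :: "'u compcat \<Rightarrow> 'u scat" where "cE X \<equiv> Tot (CFib X)"
abbreviation cB :: "'u compcat \<Rightarrow> 'u scat" where "cB X \<equiv> Base (CFib X)"
abbreviation cp :: "'u compcat \<Rightarrow> 'u sftr" where "cp X \<equiv> Fun (CFib X)"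

text \<open>\<open>dp X A\<close> is the display map \<open>\<chi> A : ext X A \<rightarrow> p A\<close>, and \<open>q X f\<close> the upper side of the
  square \<open>\<chi> f\<close>.\<close>

definition dp :: "'u compcat \<Rightarrow> 'u \<Rightarrow> 'u" where "dp X A = FObj (CChi X) A"
definition ext :: "'u compcat \<Rightarrow> 'u \<Rightarrow> 'u" where "ext X A = Dom (cB X) (dp X A)"
definition q :: "'u compcat \<Rightarrow> 'u \<Rightarrow> 'u" where "q X f = fst (snd (snd (FArr (CChi X) f)))"

text \<open>As cod after \<chi> is \<open>p\<close>, the lower side of each square is forced, and
  its vertical sides are display maps. So \<open>d\<close> and \<open>k\<close> are all the data
  that a comprehension carries.\<close>

definition mk_chi :: "'u sfib \<Rightarrow> ('u \<Rightarrow> 'u) \<Rightarrow> ('u \<Rightarrow> 'u) \<Rightarrow> 'u chi_ftr" where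
  "mk_chi p d k = \<lparr>FDom = Tot p, FCod = arrow_cat (Base p), FObj = restrict d (Obj (Tot p)),
     FArr = restrict (\<lambda>f. (d (Dom (Tot p) f), d (Cod (Tot p) f), k f, FArr (Fun p) f))
       (Arr (Tot p))\<rparr>"

sublocale comprehension_category \<subseteq> p: fibration "CFib X"
  by (rule CFib_fibration)

sublocale comprehension_category \<subseteq> chi: func "cE X" "arrow_cat (cB X)" "CChi X"
  by (rule cat_functor_func[OF CChi_functor CChi_FDom CChi_FCod])

context comprehension_category
begin

lemma dp [simp]:
  assumes "A \<in> Obj (cE X)"
  shows "dp X A \<in> Arr (cB X)" "Dom (cB X) (dp X A) = ext X A" "Cod (cB X) (dp X A) = FObj (cp X) A"
proof -
  show "dp X A \<in> Arr (cB X)" using chi.obj[OF assms] by (simp add: dp_def)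
  then show "Cod (cB X) (dp X A) = FObj (cp X) A"
    using arg_cong[OF cod_CChi, of "\<lambda>F. FObj F A"] assms by (simp add: dp_def)
qed (simp add: ext_def)

lemma FArr_CChi:
  assumes f: "f \<in> Arr (cE X)"
  shows "FArr (CChi X) f = (dp X (Dom (cE X) f), dp X (Cod (cE X) f), q X f, FArr (cp X) f)"
proof -
  obtain a b h k where e: "FArr (CChi X) f = (a, b, h, k)" by (cases "FArr (CChi X) f") auto
  have s: "(a, b, h, k) \<in> Arr (arrow_cat (cB X))" using chi.arr(1)[OF f] e by simp
  have "a = dp X (Dom (cE X) f)" "b = dp X (Cod (cE X) f)"
    using chi.arr(2,3)[OF f] unfolding e arrow_cat_Dom[OF s] arrow_cat_Cod[OF s]
    by (simp_all add: dp_def)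
  moreover have "k = FArr (cp X) f"
    using arg_cong[OF cod_CChi, of "\<lambda>F. FArr F f"] f s by (simp add: e del: arrow_cat_Arr)
  ultimately show ?thesis by (simp add: e q_def)
qed

lemma chi_arr:
  assumes "f \<in> Arr (cE X)"
  shows "(dp X (Dom (cE X) f), dp X (Cod (cE X) f), q X f, FArr (cp X) f) \<in> Arr (arrow_cat (cB X))"
  using chi.arr(1)[OF assms] by (simp only: FArr_CChi[OF assms])

lemma q [simp]:
  assumes f: "f \<in> Arr (cE X)"
  shows "q X f \<in> Arr (cB X)" "Dom (cB X) (q X f) = ext X (Dom (cE X) f)"
    "Cod (cB X) (q X f) = ext X (Cod (cE X) f)"
  using chi_arr[OF f] f by simp_all

lemma ext [simp]: "A \<in> Obj (cE X) \<Longrightarrow> ext X A \<in> Obj (cB X)"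
  using p.D.Dom_in[of "dp X A"] by simp

lemma square:
  "f \<in> Arr (cE X) \<Longrightarrow> Dom (cE X) f = x \<Longrightarrow> Cod (cE X) f = y \<Longrightarrow>
    Comp (cB X) (dp X y) (q X f) = Comp (cB X) (FArr (cp X) f) (dp X x)"
  using chi_arr[of f] by auto

lemma q_ide [simp]: "A \<in> Obj (cE X) \<Longrightarrow> q X (Ide (cE X) A) = Ide (cB X) (ext X A)"
  using chi.ide[of A] by (simp add: q_def arrow_cat_Ide flip: dp_def)

lemma q_comp [simp]:
  assumes "f \<in> Arr (cE X)" "g \<in> Arr (cE X)" "Cod (cE X) f = Dom (cE X) g"
  shows "q X (Comp (cE X) g f) = Comp (cB X) (q X g) (q X f)"
  using chi.comp[OF assms] assms chi_arr[OF assms(1)] chi_arr[OF assms(2)]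
  by (simp add: FArr_CChi arrow_cat_Comp del: arrow_cat_Arr)

lemma pullback:
  assumes "cartesian (cp X) f" "Dom (cE X) f = x" "Cod (cE X) f = y"
  shows "is_pullback (cB X) (dp X x, dp X y, q X f, FArr (cp X) f)"
  using CChi_pullback[OF assms(1)] assms by (simp add: FArr_CChi p.cart_arr)

text \<open>Reduces equality of comprehensions to display maps and upper sides; this is how
  \<open>G F X\<close> is recognised as \<open>X\<close>.\<close>

lemma CChi_eq: "CChi X = mk_chi (CFib X) (dp X) (q X)"
proof (rule ftr.equality)
  show "FObj (CChi X) = FObj (mk_chi (CFib X) (dp X) (q X))"
    using chi.FObj_ext by (auto simp: mk_chi_def dp_def intro: extensionalityI)
  show "FArr (CChi X) = FArr (mk_chi (CFib X) (dp X) (q X))"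
    using chi.FArr_ext by (auto simp: mk_chi_def FArr_CChi intro!: extensionalityI)
qed (simp_all add: mk_chi_def)

end

lemma comprehension_categoryI:
  assumes "fibration p"
    and d: "\<And>A. A \<in> Obj (Tot p) \<Longrightarrow> d A \<in> Arr (Base p) \<and> Cod (Base p) (d A) = FObj (Fun p) A"
    and k: "\<And>f. f \<in> Arr (Tot p) \<Longrightarrow> k f \<in> Arr (Base p) \<and>
      Dom (Base p) (k f) = Dom (Base p) (d (Dom (Tot p) f)) \<and>
      Cod (Base p) (k f) = Dom (Base p) (d (Cod (Tot p) f)) \<and>
      Comp (Base p) (d (Cod (Tot p) f)) (k f) = Comp (Base p) (FArr (Fun p) f) (d (Dom (Tot p) f))"
    and k_ide: "\<And>A. A \<in> Obj (Tot p) \<Longrightarrow> k (Ide (Tot p) A) = Ide (Base p) (Dom (Base p) (d A))"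
    and k_comp: "\<And>f g. \<lbrakk>f \<in> Arr (Tot p); g \<in> Arr (Tot p); Cod (Tot p) f = Dom (Tot p) g\<rbrakk> \<Longrightarrow>
      k (Comp (Tot p) g f) = Comp (Base p) (k g) (k f)"
    and pb: "\<And>f. cartesian (Fun p) f \<Longrightarrow>
      is_pullback (Base p) (d (Dom (Tot p) f), d (Cod (Tot p) f), k f, FArr (Fun p) f)"
  shows "comprehension_category \<lparr>CFib = p, CChi = mk_chi p d k\<rparr>"
proof -
  interpret fibration p by fact
  have sq: "(d (Dom (Tot p) f), d (Cod (Tot p) f), k f, FArr (Fun p) f) \<in> Arr (arrow_cat (Base p))"
    if "f \<in> Arr (Tot p)" for f
    using k[OF that] d[of "Dom (Tot p) f"] d[of "Cod (Tot p) f"] that by simp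
  interpret chi: func "Tot p" "arrow_cat (Base p)" "mk_chi p d k"
  proof (rule funcI)
    fix f g assume fg: "f \<in> Arr (Tot p)" "g \<in> Arr (Tot p)" "Cod (Tot p) f = Dom (Tot p) g"
    show "FArr (mk_chi p d k) (Comp (Tot p) g f) =
      Comp (arrow_cat (Base p)) (FArr (mk_chi p d k) g) (FArr (mk_chi p d k) f)"
      using fg sq[OF fg(1)] sq[OF fg(2)]
      by (simp add: mk_chi_def arrow_cat_Comp k_comp del: arrow_cat_Arr)
  next
    fix f assume f: "f \<in> Arr (Tot p)"
    show "FArr (mk_chi p d k) f \<in> Arr (arrow_cat (Base p)) \<and>
        Dom (arrow_cat (Base p)) (FArr (mk_chi p d k) f) = FObj (mk_chi p d k) (Dom (Tot p) f) \<and>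
        Cod (arrow_cat (Base p)) (FArr (mk_chi p d k) f) = FObj (mk_chi p d k) (Cod (Tot p) f)"
      using f sq[OF f] by (simp add: mk_chi_def arrow_cat_Dom arrow_cat_Cod del: arrow_cat_Arr)
  qed (simp_all add: mk_chi_def d k_ide arrow_cat_Ide category_arrow_cat C.category_axioms
      D.category_axioms)
  show ?thesis
  proof (rule comprehension_category.intro)
    note cod = func_cod_ftr[OF D.category_axioms]
    have "cod_ftr (Base p) \<circ>\<^sub>c mk_chi p d k = Fun p"
      by (rule ftr_eqI[OF func_comp[OF chi.func_axioms cod] func_axioms])
        (use sq in \<open>simp add: mk_chi_def del: arrow_cat_Arr\<close>)
    then show "cod_ftr (cB \<lparr>CFib = p, CChi = mk_chi p d k\<rparr>) \<circ>\<^sub>c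
        CChi \<lparr>CFib = p, CChi = mk_chi p d k\<rparr> = cp \<lparr>CFib = p, CChi = mk_chi p d k\<rparr>"
      by simp
    show "is_pullback (cB \<lparr>CFib = p, CChi = mk_chi p d k\<rparr>)
        (FArr (CChi \<lparr>CFib = p, CChi = mk_chi p d k\<rparr>) f)"
      if "cartesian (cp \<lparr>CFib = p, CChi = mk_chi p d k\<rparr>) f" for f
      using that pb[of f] cart_arr[of f] by (simp add: mk_chi_def)
  qed (use assms(1) chi.is_functor in simp_all)
qed

lemma mk_chi_simps:
  assumes "X = \<lparr>CFib = p, CChi = mk_chi p d k\<rparr>"
  shows "A \<in> Obj (Tot p) \<Longrightarrow> dp X A = d A" "A \<in> Obj (Tot p) \<Longrightarrow> ext X A = Dom (Base p) (d A)"
    "f \<in> Arr (Tot p) \<Longrightarrow> q X f = k f"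
  using assms by (simp_all add: dp_def ext_def q_def mk_chi_def)

text \<open>\<open>tt M A\<close> is the upper side of the square \<open>\<zeta>\<^sub>A\<close>, whose lower side is an identity.\<close>

definition tt :: "'u compmor \<Rightarrow> 'u \<Rightarrow> 'u" where
  "tt M A = fst (snd (snd (NComp (CZeta M) A)))"

definition mk_zeta :: "'u compcat \<Rightarrow> 'u compcat \<Rightarrow> 'u sftr \<Rightarrow> 'u sftr \<Rightarrow> ('u \<Rightarrow> 'u) \<Rightarrow> 'u chi_ntr"
  where "mk_zeta X Y B H t = \<lparr>NDom = arrow_ftr B \<circ>\<^sub>c CChi X, NCod = CChi Y \<circ>\<^sub>c H,
    NComp = restrict (\<lambda>A. (FArr B (dp X A), dp Y (FObj H A), t A,
      Ide (cB Y) (FObj B (FObj (cp X) A)))) (Obj (cE X))\<rparr>"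

text \<open>The unpacked form of a lax morphism: since cod \<zeta> is an identity, \<zeta> amounts
  to base arrows \<open>tt M A\<close> over the display maps, natural with respect to
  \<open>q\<close>. Source and target become parameters, which makes composable morphisms easy to
  speak of.\<close>

locale lax = X: comprehension_category X + Y: comprehension_category Y +
  F: fib1 "CFib X" "CFib Y" "CBase M" "CTot M" for X Y and M :: "'u compmor" +
  assumes CSrc: "CSrc M = X" and CTgt: "CTgt M = Y"
    and CZeta_eq: "CZeta M = mk_zeta X Y (CBase M) (CTot M) (tt M)"
    and tt [simp]: "A \<in> Obj (cE X) \<Longrightarrow> tt M A \<in> Arr (cB Y)"
      "A \<in> Obj (cE X) \<Longrightarrow> Dom (cB Y) (tt M A) = FObj (CBase M) (ext X A)"
      "A \<in> Obj (cE X) \<Longrightarrow> Cod (cB Y) (tt M A) = ext Y (FObj (CTot M) A)"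
    and dp_tt: "A \<in> Obj (cE X) \<Longrightarrow>
      Comp (cB Y) (dp Y (FObj (CTot M) A)) (tt M A) = FArr (CBase M) (dp X A)"
    and tt_natural: "f \<in> Arr (cE X) \<Longrightarrow> Dom (cE X) f = x \<Longrightarrow> Cod (cE X) f = y \<Longrightarrow>
      Comp (cB Y) (q Y (FArr (CTot M) f)) (tt M x) =
      Comp (cB Y) (tt M y) (FArr (CBase M) (q X f))"

lemma mk_zeta_cong:
  "(\<And>A. A \<in> Obj (cE X) \<Longrightarrow> t A = t' A) \<Longrightarrow> mk_zeta X Y B H t = mk_zeta X Y B H t'"
  by (auto simp: mk_zeta_def intro!: restrict_ext)

lemma tt_mk_zeta:
  "CZeta M = mk_zeta X Y B H t \<Longrightarrow> A \<in> Obj (cE X) \<Longrightarrow> tt M A = t A"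
  by (simp add: tt_def mk_zeta_def)

lemma lax_imp_comp_lax_morphism:
  assumes "lax X Y M" shows "comp_lax_morphism M"
proof -
  interpret lax X Y M by fact
  let ?B = "CBase M" and ?H = "CTot M"
  have sq: "(FArr ?B (dp X A), dp Y (FObj ?H A), tt M A, Ide (cB Y) (FObj ?B (FObj (cp X) A)))
      \<in> Arr (arrow_cat (cB Y))" if "A \<in> Obj (cE X)" for A
    using that dp_tt[OF that] by simp
  have NDom: "func (cE X) (arrow_cat (cB Y)) (arrow_ftr ?B \<circ>\<^sub>c CChi X)"
    by (rule func_comp[OF X.chi.func_axioms func_arrow_ftr[OF F.B.func_axioms]])
  have NCod: "func (cE X) (arrow_cat (cB Y)) (CChi Y \<circ>\<^sub>c ?H)"
    by (rule func_comp[OF F.E.func_axioms Y.chi.func_axioms])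
  interpret zeta: ntrans "cE X" "arrow_cat (cB Y)" "arrow_ftr ?B \<circ>\<^sub>c CChi X" "CChi Y \<circ>\<^sub>c ?H"
    "CZeta M"
    unfolding CZeta_eq
  proof (rule ntransI[OF NDom NCod])
    fix A assume A: "A \<in> Obj (cE X)"
    let ?s = "NComp (mk_zeta X Y ?B ?H (tt M)) A"
    show "?s \<in> Arr (arrow_cat (cB Y)) \<and>
        Dom (arrow_cat (cB Y)) ?s = FObj (arrow_ftr ?B \<circ>\<^sub>c CChi X) A \<and>
        Cod (arrow_cat (cB Y)) ?s = FObj (CChi Y \<circ>\<^sub>c ?H) A"
      using sq[OF A] A X.dp(1)[OF A]
      by (simp add: mk_zeta_def arrow_cat_Dom arrow_cat_Cod dp_def del: arrow_cat_Arr)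
  next
    fix f assume f: "f \<in> Arr (cE X)"
    let ?z = "NComp (mk_zeta X Y ?B ?H (tt M))"
    have 1: "(FArr ?B (dp X (Dom (cE X) f)), FArr ?B (dp X (Cod (cE X) f)),
        FArr ?B (q X f), FArr ?B (FArr (cp X) f)) \<in> Arr (arrow_cat (cB Y))"
      using pre_func.arr(1)[OF func.axioms[OF func_arrow_ftr[OF F.B.func_axioms]] X.chi_arr[OF f]]
        X.chi_arr[OF f] by (simp del: arrow_cat_Arr)
    have 2: "(dp Y (FObj ?H (Dom (cE X) f)), dp Y (FObj ?H (Cod (cE X) f)),
        q Y (FArr ?H f), FArr ?B (FArr (cp X) f)) \<in> Arr (arrow_cat (cB Y))"
      using Y.chi_arr[of "FArr ?H f"] f by (simp del: arrow_cat_Arr)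
    show "Comp (arrow_cat (cB Y)) (FArr (CChi Y \<circ>\<^sub>c ?H) f) (?z (Dom (cE X) f)) =
         Comp (arrow_cat (cB Y)) (?z (Cod (cE X) f)) (FArr (arrow_ftr ?B \<circ>\<^sub>c CChi X) f)"
      using sq[of "Dom (cE X) f"] sq[of "Cod (cE X) f"] 1 2 X.chi_arr[OF f] f
      by (simp add: mk_zeta_def X.FArr_CChi Y.FArr_CChi arrow_cat_Comp tt_natural
          del: arrow_cat_Arr)
  qed (simp_all add: mk_zeta_def)
  \<comment> \<open>Equality with \<open>id_nat\<close> is equality of records, so the source and
    target functors have to be matched before the components.\<close>
  have "cod_ftr (cB Y) \<circ>\<^sub>c (arrow_ftr ?B \<circ>\<^sub>c CChi X) = ?B \<circ>\<^sub>c cp X"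
    by (rule ftr_eqI[OF func_comp[OF NDom func_cod_ftr[OF Y.p.D.category_axioms]]
          func_comp[OF X.p.func_axioms F.B.func_axioms]])
      (use X.chi_arr pre_func.arr(1)[OF func.axioms[OF func_arrow_ftr[OF F.B.func_axioms]] X.chi_arr]
        in \<open>simp add: X.FArr_CChi del: arrow_cat_Arr\<close>)
  moreover have "cod_ftr (cB Y) \<circ>\<^sub>c (CChi Y \<circ>\<^sub>c ?H) = ?B \<circ>\<^sub>c cp X"
    unfolding comp_ftr_assoc[OF F.E.func_axioms Y.chi.func_axioms
        func_cod_ftr[OF Y.p.D.category_axioms]] Y.cod_CChi by (rule F.over_eq)
  ultimately have "cod_ftr (cB Y) \<cdot>\<^sub>l CZeta M = id_nat (?B \<circ>\<^sub>c cp X)"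
    by (intro ntr.equality)
      (use sq in \<open>auto simp: lwhisker_def id_nat_def CZeta_eq mk_zeta_def
        simp del: arrow_cat_Arr intro!: restrict_ext\<close>)
  then show ?thesis
    using zeta.nat F.fib1_axioms
    by (simp add: comp_lax_morphism_def CSrc CTgt X.comprehension_category_axioms
        Y.comprehension_category_axioms fib_cell1_iff)
qed

lemma comp_lax_morphism_imp_lax:
  assumes "comp_lax_morphism M" "CSrc M = X" "CTgt M = Y" shows "lax X Y M"
proof -
  let ?B = "CBase M" and ?H = "CTot M"
  interpret X: comprehension_category X using assms by (auto simp: comp_lax_morphism_def)
  interpret Y: comprehension_category Y using assms by (auto simp: comp_lax_morphism_def)
  interpret F: fib1 "CFib X" "CFib Y" ?B ?H
    using assms by (auto simp: comp_lax_morphism_def fib_cell1_iff)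
  interpret zeta: ntrans "cE X" "arrow_cat (cB Y)" "arrow_ftr ?B \<circ>\<^sub>c CChi X" "CChi Y \<circ>\<^sub>c ?H"
    "CZeta M"
    using assms by (intro nat_from_to_ntrans) (auto simp: comp_lax_morphism_def)
  have cod: "cod_ftr (cB Y) \<cdot>\<^sub>l CZeta M = id_nat (?B \<circ>\<^sub>c cp X)"
    using assms by (auto simp: comp_lax_morphism_def)
  have comp: "NComp (CZeta M) A = (FArr ?B (dp X A), dp Y (FObj ?H A), tt M A,
      Ide (cB Y) (FObj ?B (FObj (cp X) A)))"
    and sq: "(FArr ?B (dp X A), dp Y (FObj ?H A), tt M A, Ide (cB Y) (FObj ?B (FObj (cp X) A)))
      \<in> Arr (arrow_cat (cB Y))" if A: "A \<in> Obj (cE X)" for A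
  proof -
    obtain a b h k where e: "NComp (CZeta M) A = (a, b, h, k)"
      by (cases "NComp (CZeta M) A") auto
    have s: "(a, b, h, k) \<in> Arr (arrow_cat (cB Y))" using zeta.component(1)[OF A] e by simp
    have "a = FArr ?B (dp X A)" "b = dp Y (FObj ?H A)"
      using zeta.component(2,3)[OF A] A X.dp(1)[OF A]
      unfolding e arrow_cat_Dom[OF s] arrow_cat_Cod[OF s] by (simp_all add: dp_def)
    moreover have "k = Ide (cB Y) (FObj ?B (FObj (cp X) A))"
      using arg_cong[OF cod, of "\<lambda>a. NComp a A"] A s
      by (simp add: e del: arrow_cat_Arr)
    ultimately show "NComp (CZeta M) A = (FArr ?B (dp X A), dp Y (FObj ?H A), tt M A,
      Ide (cB Y) (FObj ?B (FObj (cp X) A)))" by (simp add: e tt_def)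
    with s e show "(FArr ?B (dp X A), dp Y (FObj ?H A), tt M A,
      Ide (cB Y) (FObj ?B (FObj (cp X) A))) \<in> Arr (arrow_cat (cB Y))" by simp
  qed
  show ?thesis
  proof unfold_locales
    show "CZeta M = mk_zeta X Y ?B ?H (tt M)"
      using zeta.NComp_ext
      by (intro ntr.equality) (auto simp: mk_zeta_def comp intro: extensionalityI)
  next
    fix f x y assume f: "f \<in> Arr (cE X)" "Dom (cE X) f = x" "Cod (cE X) f = y"
    have 1: "(FArr ?B (dp X (Dom (cE X) f)), FArr ?B (dp X (Cod (cE X) f)),
        FArr ?B (q X f), FArr ?B (FArr (cp X) f)) \<in> Arr (arrow_cat (cB Y))"
      using pre_func.arr(1)[OF func.axioms[OF func_arrow_ftr[OF F.B.func_axioms]] X.chi_arr[OF f(1)]]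
        X.chi_arr[OF f(1)] by (simp del: arrow_cat_Arr)
    have 2: "(dp Y (FObj ?H (Dom (cE X) f)), dp Y (FObj ?H (Cod (cE X) f)),
        q Y (FArr ?H f), FArr ?B (FArr (cp X) f)) \<in> Arr (arrow_cat (cB Y))"
      using Y.chi_arr[of "FArr ?H f"] f(1) by (simp del: arrow_cat_Arr)
    show "Comp (cB Y) (q Y (FArr ?H f)) (tt M x) = Comp (cB Y) (tt M y) (FArr ?B (q X f))"
      using zeta.natural[OF f] sq[of x] sq[of y] 1 2 X.chi_arr[OF f(1)] f
      by (auto simp add: comp X.FArr_CChi Y.FArr_CChi arrow_cat_Comp simp del: arrow_cat_Arr)
  qed (use sq assms(2,3) in simp_all)
qed

lemma lax_iff: "lax X Y M \<longleftrightarrow> comp_lax_morphism M \<and> CSrc M = X \<and> CTgt M = Y"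
  using lax_imp_comp_lax_morphism comp_lax_morphism_imp_lax lax.CSrc lax.CTgt by metis

text \<open>Neither record is assumed natural: the two pastings in the condition on a 2-cell can be
  compared without first proving that they are natural transformations.\<close>

lemma ntr_eq_iff:
  fixes \<alpha> \<beta> :: "('o, 'a, 'p, 'b) ntr"
  assumes "NComp \<alpha> \<in> extensional S" "NComp \<beta> \<in> extensional S" "NDom \<alpha> = NDom \<beta>" "NCod \<alpha> = NCod \<beta>"
  shows "\<alpha> = \<beta> \<longleftrightarrow> (\<forall>x \<in> S. NComp \<alpha> x = NComp \<beta> x)"
proof
  assume "\<forall>x \<in> S. NComp \<alpha> x = NComp \<beta> x"
  then have "NComp \<alpha> = NComp \<beta>" using assms(1,2) by (auto intro: extensionalityI)
  with assms(3,4) show "\<alpha> = \<beta>" by (intro ntr.equality) simp_all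
qed simp

locale ccell2 = M: lax X Y "CDom2 \<alpha>" + N: lax X Y "CCod2 \<alpha>" +
  a: fib2 "CFib X" "CFib Y" "CBase (CDom2 \<alpha>)" "CTot (CDom2 \<alpha>)" "CBase (CCod2 \<alpha>)" "CTot (CCod2 \<alpha>)"
    "CPsi \<alpha>" "CPhi \<alpha>" for X Y and \<alpha> :: "'u compcell" +
  assumes tt_cell: "A \<in> Obj (cE X) \<Longrightarrow> Comp (cB Y) (q Y (NComp (CPhi \<alpha>) A)) (tt (CDom2 \<alpha>) A) =
    Comp (cB Y) (tt (CCod2 \<alpha>) A) (NComp (CPsi \<alpha>) (ext X A))"

text \<open>The condition compares squares of the arrow category whose vertical and lower sides
  agree in any case, so only the upper sides carry information.\<close>

lemma ccell2_iff:
  "ccell2 X Y \<alpha> \<longleftrightarrow> comp_cell2 \<alpha> \<and> CSrc (CDom2 \<alpha>) = X \<and> CTgt (CDom2 \<alpha>) = Y"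
proof -
  define M where "M = CDom2 \<alpha>"
  define N where "N = CCod2 \<alpha>"
  have "(CChi Y \<cdot>\<^sub>l CPhi \<alpha>) \<bullet> CZeta M = CZeta N \<bullet> (arrow_nat (CPsi \<alpha>) \<cdot>\<^sub>r CChi X) \<longleftrightarrow>
     (\<forall>A \<in> Obj (cE X). Comp (cB Y) (q Y (NComp (CPhi \<alpha>) A)) (tt M A) =
        Comp (cB Y) (tt N A) (NComp (CPsi \<alpha>) (ext X A)))" (is "?l = ?r \<longleftrightarrow> _")
    if M: "lax X Y M" and N: "lax X Y N"
      and f: "fib2 (CFib X) (CFib Y) (CBase M) (CTot M) (CBase N) (CTot N) (CPsi \<alpha>) (CPhi \<alpha>)"
  proof -
    interpret M: lax X Y M by fact
    interpret N: lax X Y N by fact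
    interpret a: fib2 "CFib X" "CFib Y" "CBase M" "CTot M" "CBase N" "CTot N" "CPsi \<alpha>" "CPhi \<alpha>"
      by fact
    let ?d = "\<lambda>A. FArr (CBase M) (dp X A)" and ?c = "\<lambda>A. dp Y (FObj (CTot N) A)"
    let ?k = "\<lambda>A. NComp (CPsi \<alpha>) (FObj (cp X) A)"
    have l: "NComp ?l A = (?d A, ?c A, Comp (cB Y) (q Y (NComp (CPhi \<alpha>) A)) (tt M A), ?k A)"
      and r: "NComp ?r A = (?d A, ?c A, Comp (cB Y) (tt N A) (NComp (CPsi \<alpha>) (ext X A)), ?k A)"
      if A: "A \<in> Obj (cE X)" for A
    proof -
      have s1: "(?d A, dp Y (FObj (CTot M) A), tt M A,
          Ide (cB Y) (FObj (CBase M) (FObj (cp X) A))) \<in> Arr (arrow_cat (cB Y))"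
        using A M.dp_tt[of A] by simp
      have s2: "(FArr (CBase N) (dp X A), ?c A, tt N A,
          Ide (cB Y) (FObj (CBase N) (FObj (cp X) A))) \<in> Arr (arrow_cat (cB Y))"
        using A N.dp_tt[of A] by simp
      have s3: "(dp Y (FObj (CTot M) A), ?c A, q Y (NComp (CPhi \<alpha>) A), ?k A) \<in> Arr (arrow_cat (cB Y))"
        using M.Y.chi_arr[of "NComp (CPhi \<alpha>) A"] A by (simp del: arrow_cat_Arr)
      have s4: "(?d A, FArr (CBase N) (dp X A), NComp (CPsi \<alpha>) (ext X A), ?k A)
          \<in> Arr (arrow_cat (cB Y))"
        using A a.psi.natural[of "dp X A"] by simp
      show "NComp ?l A = (?d A, ?c A, Comp (cB Y) (q Y (NComp (CPhi \<alpha>) A)) (tt M A), ?k A)"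
        using A s1 s3 M.Y.FArr_CChi[of "NComp (CPhi \<alpha>) A"]
        by (simp add: M.CZeta_eq mk_zeta_def arrow_cat_Comp del: arrow_cat_Arr)
      show "NComp ?r A = (?d A, ?c A, Comp (cB Y) (tt N A) (NComp (CPsi \<alpha>) (ext X A)), ?k A)"
        using A s2 s4 M.X.dp[of A] 
        by (simp add: N.CZeta_eq mk_zeta_def arrow_nat_def arrow_cat_Comp del: arrow_cat_Arr
            flip: dp_def)
    qed
    have "NComp ?l \<in> extensional (Obj (cE X))" "NComp ?r \<in> extensional (Obj (cE X))"
      using vcomp_nat_ext[of "CChi Y \<cdot>\<^sub>l CPhi \<alpha>" "CZeta M"]
        vcomp_nat_ext[of "CZeta N" "arrow_nat (CPsi \<alpha>) \<cdot>\<^sub>r CChi X"]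
      by (simp_all add: M.CZeta_eq mk_zeta_def)
    moreover have "NDom ?l = NDom ?r" "NCod ?l = NCod ?r"
      by (simp_all add: M.CZeta_eq N.CZeta_eq mk_zeta_def arrow_nat_def)
    ultimately have "?l = ?r \<longleftrightarrow> (\<forall>A \<in> Obj (cE X). NComp ?l A = NComp ?r A)"
      by (intro ntr_eq_iff)
    also have "\<dots> \<longleftrightarrow> (\<forall>A \<in> Obj (cE X). Comp (cB Y) (q Y (NComp (CPhi \<alpha>) A)) (tt M A) =
        Comp (cB Y) (tt N A) (NComp (CPsi \<alpha>) (ext X A)))"
      by (intro ball_cong refl) (simp only: l r prod.inject simp_thms)
    finally show ?thesis .
  qed
  then show ?thesis
    unfolding comp_cell2_def Let_def fib_cell2_iff ccell2_def ccell2_axioms_def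
    by (auto simp: lax_iff M_def N_def)
qed

section \<open>The 2-category of comprehension categories\<close>

lemma arrow_ftr_id:
  assumes "category B" shows "arrow_ftr (id_ftr B) = id_ftr (arrow_cat B)"
proof (rule ftr_eqI)
  show "func (arrow_cat B) (arrow_cat B) (arrow_ftr (id_ftr B))"
    using func_arrow_ftr[OF func_id[OF assms]] by simp
  show "func (arrow_cat B) (arrow_cat B) (id_ftr (arrow_cat B))"
    by (rule func_id[OF category_arrow_cat[OF assms]])
  fix f assume "f \<in> Arr (arrow_cat B)"
  then show "FArr (arrow_ftr (id_ftr B)) f = FArr (id_ftr (arrow_cat B)) f"
    by (cases f) (simp add: arrow_ftr_def)
qed

lemma arrow_ftr_comp:
  assumes "func C D F" "func D E G"
  shows "arrow_ftr (G \<circ>\<^sub>c F) = arrow_ftr G \<circ>\<^sub>c arrow_ftr F"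
proof (rule ftr_eqI)
  interpret F: func C D F by fact
  interpret G: func D E G by fact
  interpret aF: func "arrow_cat C" "arrow_cat D" "arrow_ftr F" by (rule func_arrow_ftr[OF assms(1)])
  show "func (arrow_cat C) (arrow_cat E) (arrow_ftr (G \<circ>\<^sub>c F))"
    by (rule func_arrow_ftr[OF func_comp[OF assms]])
  show "func (arrow_cat C) (arrow_cat E) (arrow_ftr G \<circ>\<^sub>c arrow_ftr F)"
    by (rule func_comp[OF func_arrow_ftr[OF assms(1)] func_arrow_ftr[OF assms(2)]])
  fix f assume f: "f \<in> Arr (arrow_cat C)"
  obtain a b h k where e: "f = (a, b, h, k)" by (cases f) auto
  have "FArr (arrow_ftr F) f \<in> Arr (arrow_cat D)" using f by simp
  moreover have "FArr (arrow_ftr F) f = (FArr F a, FArr F b, FArr F h, FArr F k)"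
    using f unfolding e by (simp del: arrow_cat_Arr)
  ultimately show "FArr (arrow_ftr (G \<circ>\<^sub>c F)) f = FArr (arrow_ftr G \<circ>\<^sub>c arrow_ftr F) f"
    using f unfolding e by (simp del: arrow_cat_Arr, simp)
qed

text \<open>The family \<open>t\<close> is kept apart from \<open>tt M\<close>, which is read off
  from \<open>CZeta M\<close>; the conditions can thus be checked before \<zeta> is
  decomposed.\<close>

lemma laxI:
  assumes "comprehension_category X" "comprehension_category Y"
    "fib1 (CFib X) (CFib Y) (CBase M) (CTot M)"
    "CSrc M = X" "CTgt M = Y" "CZeta M = mk_zeta X Y (CBase M) (CTot M) t"
    and "\<And>A. A \<in> Obj (cE X) \<Longrightarrow> t A \<in> Arr (cB Y) \<and> Dom (cB Y) (t A) = FObj (CBase M) (ext X A) \<and>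
      Cod (cB Y) (t A) = ext Y (FObj (CTot M) A) \<and>
      Comp (cB Y) (dp Y (FObj (CTot M) A)) (t A) = FArr (CBase M) (dp X A)"
    and "\<And>f. f \<in> Arr (cE X) \<Longrightarrow>
      Comp (cB Y) (q Y (FArr (CTot M) f)) (t (Dom (cE X) f)) =
      Comp (cB Y) (t (Cod (cE X) f)) (FArr (CBase M) (q X f))"
  shows "lax X Y M"
proof -
  interpret X: comprehension_category X by fact
  interpret Y: comprehension_category Y by fact
  interpret F: fib1 "CFib X" "CFib Y" "CBase M" "CTot M" by fact
  note t = tt_mk_zeta[OF assms(6)]
  have "CZeta M = mk_zeta X Y (CBase M) (CTot M) (tt M)"
    unfolding assms(6) by (rule mk_zeta_cong) (simp add: t)
  then show ?thesis
  proof unfold_locales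
    fix f x y assume "f \<in> Arr (cE X)" "Dom (cE X) f = x" "Cod (cE X) f = y"
    then show "Comp (cB Y) (q Y (FArr (CTot M) f)) (tt M x) =
      Comp (cB Y) (tt M y) (FArr (CBase M) (q X f))"
      using assms(8)[of f] t[of x] t[of y] X.p.C.Dom_in[of f] X.p.C.Cod_in[of f] by simp
  qed (simp_all add: assms(4,5,7) t)
qed

text \<open>The test for equality of 1-cells: beyond the two functors, \<zeta> carries nothing but
  its upper sides.\<close>

lemma lax_eqI:
  assumes "lax X Y M" "lax X Y N" "CBase M = CBase N" "CTot M = CTot N"
    "\<And>A. A \<in> Obj (cE X) \<Longrightarrow> tt M A = tt N A"
  shows "M = N"
proof -
  interpret M: lax X Y M by fact
  interpret N: lax X Y N by fact
  have "CZeta M = CZeta N"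
    unfolding M.CZeta_eq N.CZeta_eq assms(3,4) by (rule mk_zeta_cong) (rule assms(5))
  then show ?thesis
    by (intro compmor.equality) (simp_all add: M.CSrc N.CSrc M.CTgt N.CTgt assms(3,4))
qed

lemma lax_comp_id1:
  assumes "comprehension_category X"
  shows "lax X X (comp_id1 X)"
    and "A \<in> Obj (cE X) \<Longrightarrow> tt (comp_id1 X) A = Ide (cB X) (ext X A)"
proof -
  interpret X: comprehension_category X by fact
  have z: "CZeta (comp_id1 X) =
    mk_zeta X X (CBase (comp_id1 X)) (CTot (comp_id1 X)) (\<lambda>A. Ide (cB X) (ext X A))"
    using X.dp by (intro ntr.equality)
      (auto simp: comp_id1_def mk_zeta_def id_nat_def arrow_ftr_id[OF X.p.D.category_axioms]
        comp_ftr_id[OF X.chi.func_axioms] arrow_cat_Ide simp flip: dp_def intro!: restrict_ext)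
  show "lax X X (comp_id1 X)"
    by (rule laxI[OF assms assms _ _ _ z])
      (simp_all add: comp_id1_def fib1_id X.p.fibration_axioms)
  show "A \<in> Obj (cE X) \<Longrightarrow> tt (comp_id1 X) A = Ide (cB X) (ext X A)"
    by (rule tt_mk_zeta[OF z])
qed

text \<open>The square of the composite is that of \<open>N\<close> at \<open>CTot M A\<close>
  pasted to the image under \<open>CBase N\<close> of the square of \<open>M\<close>. The lower
  sides compose to an identity, and the upper sides give the formula.\<close>

lemma lax_comp_comp1:
  assumes "lax X Y M" "lax Y Z N"
  shows "lax X Z (comp_comp1 N M)"
    and "A \<in> Obj (cE X) \<Longrightarrow>
      tt (comp_comp1 N M) A = Comp (cB Z) (tt N (FObj (CTot M) A)) (FArr (CBase N) (tt M A))"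
proof -
  interpret M: lax X Y M by fact
  interpret N: lax Y Z N by fact
  let ?t = "\<lambda>A. Comp (cB Z) (tt N (FObj (CTot M) A)) (FArr (CBase N) (tt M A))"
  have z: "CZeta (comp_comp1 N M) =
    mk_zeta X Z (CBase (comp_comp1 N M)) (CTot (comp_comp1 N M)) ?t"
  proof (rule ntr.equality)
    show "NDom (CZeta (comp_comp1 N M)) =
      NDom (mk_zeta X Z (CBase (comp_comp1 N M)) (CTot (comp_comp1 N M)) ?t)"
      by (simp add: comp_comp1_def mk_zeta_def M.CZeta_eq
          arrow_ftr_comp[OF M.F.B.func_axioms N.F.B.func_axioms]
          comp_ftr_assoc[OF M.X.chi.func_axioms func_arrow_ftr[OF M.F.B.func_axioms]
            func_arrow_ftr[OF N.F.B.func_axioms]])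
    show "NCod (CZeta (comp_comp1 N M)) =
      NCod (mk_zeta X Z (CBase (comp_comp1 N M)) (CTot (comp_comp1 N M)) ?t)"
      by (simp add: comp_comp1_def mk_zeta_def N.CZeta_eq
          comp_ftr_assoc[OF M.F.E.func_axioms N.F.E.func_axioms N.Y.chi.func_axioms])
    have "NComp (CZeta (comp_comp1 N M)) A =
      (FArr (CBase N) (FArr (CBase M) (dp X A)), dp Z (FObj (CTot N) (FObj (CTot M) A)), ?t A,
        Ide (cB Z) (FObj (CBase N) (FObj (CBase M) (FObj (cp X) A))))"
      if A: "A \<in> Obj (cE X)" for A
    proof -
      have s: "(FArr (CBase M) (dp X A), dp Y (FObj (CTot M) A), tt M A,
          Ide (cB Y) (FObj (CBase M) (FObj (cp X) A))) \<in> Arr (arrow_cat (cB Y))"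
        using A M.dp_tt[of A] by simp
      moreover have "(FArr (CBase N) (FArr (CBase M) (dp X A)), FArr (CBase N) (dp Y (FObj (CTot M) A)),
          FArr (CBase N) (tt M A), Ide (cB Z) (FObj (CBase N) (FObj (CBase M) (FObj (cp X) A))))
          \<in> Arr (arrow_cat (cB Z))"
        using A N.F.B.comp_eq[OF M.dp_tt[of A]] by simp
      moreover have "(FArr (CBase N) (dp Y (FObj (CTot M) A)),
          dp Z (FObj (CTot N) (FObj (CTot M) A)), tt N (FObj (CTot M) A),
          Ide (cB Z) (FObj (CBase N) (FObj (CBase M) (FObj (cp X) A)))) \<in> Arr (arrow_cat (cB Z))"
        using A N.dp_tt[of "FObj (CTot M) A"] by simp
      ultimately show ?thesis
        using A by (simp add: comp_comp1_def mk_zeta_def M.CZeta_eq N.CZeta_eq arrow_cat_Comp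
            del: arrow_cat_Arr)
    qed
    then show "NComp (CZeta (comp_comp1 N M)) =
      NComp (mk_zeta X Z (CBase (comp_comp1 N M)) (CTot (comp_comp1 N M)) ?t)"
      using vcomp_nat_ext[of "CZeta N \<cdot>\<^sub>r CTot M" "arrow_ftr (CBase N) \<cdot>\<^sub>l CZeta M"]
      by (intro extensionalityI[of _ "Obj (cE X)"])
        (simp_all add: comp_comp1_def mk_zeta_def M.CZeta_eq)
  qed simp
  show "lax X Z (comp_comp1 N M)"
  proof (rule laxI[OF M.X.comprehension_category_axioms N.Y.comprehension_category_axioms _ _ _ z])
    fix A assume A: "A \<in> Obj (cE X)"
    then have "Comp (cB Z) (dp Z (FObj (CTot N) (FObj (CTot M) A))) (?t A) =
      FArr (CBase N) (FArr (CBase M) (dp X A))"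
      using N.F.B.comp_eq[OF M.dp_tt[of A]]
      by (subst N.Y.p.D.reassoc[OF N.dp_tt]) simp_all
    then show "?t A \<in> Arr (cB Z) \<and>
         Dom (cB Z) (?t A) = FObj (CBase (comp_comp1 N M)) (ext X A) \<and>
         Cod (cB Z) (?t A) = ext Z (FObj (CTot (comp_comp1 N M)) A) \<and>
         Comp (cB Z) (dp Z (FObj (CTot (comp_comp1 N M)) A)) (?t A) =
         FArr (CBase (comp_comp1 N M)) (dp X A)"
      using A by (simp add: comp_comp1_def)
  next
    fix f assume f: "f \<in> Arr (cE X)"
    let ?x = "Dom (cE X) f" and ?y = "Cod (cE X) f"
    have "Comp (cB Z) (q Z (FArr (CTot N) (FArr (CTot M) f))) (?t ?x) =
      Comp (cB Z) (tt N (FObj (CTot M) ?y))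
        (Comp (cB Z) (FArr (CBase N) (q Y (FArr (CTot M) f))) (FArr (CBase N) (tt M ?x)))"
      using f by (subst N.Y.p.D.reassoc2[OF N.tt_natural]) simp_all
    also have "\<dots> = Comp (cB Z) (?t ?y) (FArr (CBase N) (FArr (CBase M) (q X f)))"
      using f by (subst N.F.B.comp_eq2[OF M.tt_natural]) simp_all
    finally show "Comp (cB Z) (q Z (FArr (CTot (comp_comp1 N M)) f)) (?t ?x) =
         Comp (cB Z) (?t ?y) (FArr (CBase (comp_comp1 N M)) (q X f))"
      using f by (simp add: comp_comp1_def)
  qed (simp_all add: comp_comp1_def M.CSrc N.CTgt fib1_comp[OF M.F.fib1_axioms N.F.fib1_axioms])
  show "A \<in> Obj (cE X) \<Longrightarrow> tt (comp_comp1 N M) A = ?t A"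
    by (rule tt_mk_zeta[OF z])
qed

lemma CompCat_simps [simp]:
  "Cell0 CompCat = {X. comprehension_category X}" "Cell1 CompCat = {M. comp_lax_morphism M}"
  "Cell2 CompCat = {\<alpha>. comp_cell2 \<alpha>}" "Src1 CompCat = CSrc" "Tgt1 CompCat = CTgt"
  "Src2 CompCat = CDom2" "Tgt2 CompCat = CCod2" "Id1 CompCat = comp_id1" "Comp1 CompCat = comp_comp1"
  "Id2 CompCat M = \<lparr>CDom2 = M, CCod2 = M, CPsi = id_nat (CBase M), CPhi = id_nat (CTot M)\<rparr>"
  "VComp CompCat \<beta> \<alpha> = \<lparr>CDom2 = CDom2 \<alpha>, CCod2 = CCod2 \<beta>,
    CPsi = CPsi \<beta> \<bullet> CPsi \<alpha>, CPhi = CPhi \<beta> \<bullet> CPhi \<alpha>\<rparr>"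
  "HComp CompCat \<beta> \<alpha> = \<lparr>CDom2 = comp_comp1 (CDom2 \<beta>) (CDom2 \<alpha>),
    CCod2 = comp_comp1 (CCod2 \<beta>) (CCod2 \<alpha>), CPsi = CPsi \<beta> \<star> CPsi \<alpha>, CPhi = CPhi \<beta> \<star> CPhi \<alpha>\<rparr>"
  by (simp_all add: CompCat_def)

lemma Hom1_CompCat [simp]: "M \<in> Hom1 CompCat X Y \<longleftrightarrow> lax X Y M"
  by (simp add: Hom1_def lax_iff)

lemma Hom2_CompCat:
  "lax X Y M \<Longrightarrow> \<alpha> \<in> Hom2 CompCat M N \<longleftrightarrow> ccell2 X Y \<alpha> \<and> CDom2 \<alpha> = M \<and> CCod2 \<alpha> = N"
  by (auto simp: Hom2_def ccell2_iff lax_iff)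

lemma ccell2I:
  assumes "lax X Y (CDom2 \<alpha>)" "lax X Y (CCod2 \<alpha>)"
    "fib2 (CFib X) (CFib Y) (CBase (CDom2 \<alpha>)) (CTot (CDom2 \<alpha>)) (CBase (CCod2 \<alpha>)) (CTot (CCod2 \<alpha>))
      (CPsi \<alpha>) (CPhi \<alpha>)"
    "\<And>A. A \<in> Obj (cE X) \<Longrightarrow> Comp (cB Y) (q Y (NComp (CPhi \<alpha>) A)) (tt (CDom2 \<alpha>) A) =
      Comp (cB Y) (tt (CCod2 \<alpha>) A) (NComp (CPsi \<alpha>) (ext X A))"
  shows "ccell2 X Y \<alpha>"
  using assms by (simp add: ccell2_def ccell2_axioms_def)

lemma ccell2_id:
  assumes "lax X Y M" shows "ccell2 X Y (Id2 CompCat M)"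
proof -
  interpret lax X Y M by fact
  show ?thesis by (rule ccell2I) (use assms fib2_id[OF F.fib1_axioms] in simp_all)
qed

lemma ccell2_vcomp:
  assumes "ccell2 X Y \<alpha>" "ccell2 X Y \<beta>" "CCod2 \<alpha> = CDom2 \<beta>"
  shows "ccell2 X Y (VComp CompCat \<beta> \<alpha>)"
proof -
  interpret a: ccell2 X Y \<alpha> by fact
  interpret b: ccell2 X Y \<beta> by fact
  note a = a.a.fib2_axioms[unfolded assms(3)]
  interpret a': fib2 "CFib X" "CFib Y" "CBase (CDom2 \<alpha>)" "CTot (CDom2 \<alpha>)" "CBase (CDom2 \<beta>)"
    "CTot (CDom2 \<beta>)" "CPsi \<alpha>" "CPhi \<alpha>" by (rule a)
  show ?thesis
  proof (rule ccell2I)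
    show "fib2 (CFib X) (CFib Y) (CBase (CDom2 (VComp CompCat \<beta> \<alpha>))) (CTot (CDom2 (VComp CompCat \<beta> \<alpha>)))
     (CBase (CCod2 (VComp CompCat \<beta> \<alpha>))) (CTot (CCod2 (VComp CompCat \<beta> \<alpha>)))
     (CPsi (VComp CompCat \<beta> \<alpha>)) (CPhi (VComp CompCat \<beta> \<alpha>))"
      using fib2_vcomp[OF a b.a.fib2_axioms] by simp
    fix A assume A: "A \<in> Obj (cE X)"
    have "Comp (cB Y) (q Y (NComp (CPhi \<beta>) A)) (Comp (cB Y) (q Y (NComp (CPhi \<alpha>) A)) (tt (CDom2 \<alpha>) A))
      = Comp (cB Y) (q Y (NComp (CPhi \<beta>) A))
        (Comp (cB Y) (tt (CDom2 \<beta>) A) (NComp (CPsi \<alpha>) (ext X A)))"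
      using a.tt_cell[OF A] by (simp add: assms(3))
    also have "\<dots> = Comp (cB Y) (tt (CCod2 \<beta>) A)
        (Comp (cB Y) (NComp (CPsi \<beta>) (ext X A)) (NComp (CPsi \<alpha>) (ext X A)))"
      using A by (intro a.M.Y.p.D.reassoc2[OF b.tt_cell]) (simp_all add: assms(3))
    finally show "Comp (cB Y) (q Y (NComp (CPhi (VComp CompCat \<beta> \<alpha>)) A))
          (tt (CDom2 (VComp CompCat \<beta> \<alpha>)) A) =
         Comp (cB Y) (tt (CCod2 (VComp CompCat \<beta> \<alpha>)) A) (NComp (CPsi (VComp CompCat \<beta> \<alpha>)) (ext X A))"
      using A by (simp add: assms(3))
  qed (simp_all add: a.M.lax_axioms b.N.lax_axioms)
qed

text \<open>A pasting in four moves: naturality of \<open>tt\<close> for the source of \<beta> at a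
  component of \<alpha>, the condition on \<alpha> under the base functor, the condition on \<beta>,
  and naturality of the base part of \<beta>.\<close>

lemma ccell2_hcomp:
  assumes "ccell2 X Y \<alpha>" "ccell2 Y Z \<beta>"
  shows "ccell2 X Z (HComp CompCat \<beta> \<alpha>)"
proof -
  interpret a: ccell2 X Y \<alpha> by fact
  interpret b: ccell2 Y Z \<beta> by fact
  show ?thesis
  proof (rule ccell2I)
    show "fib2 (CFib X) (CFib Z) (CBase (CDom2 (HComp CompCat \<beta> \<alpha>))) (CTot (CDom2 (HComp CompCat \<beta> \<alpha>)))
     (CBase (CCod2 (HComp CompCat \<beta> \<alpha>))) (CTot (CCod2 (HComp CompCat \<beta> \<alpha>)))
     (CPsi (HComp CompCat \<beta> \<alpha>)) (CPhi (HComp CompCat \<beta> \<alpha>))"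
      using fib2_hcomp[OF a.a.fib2_axioms b.a.fib2_axioms] by (simp add: comp_comp1_def)
    fix A assume A: "A \<in> Obj (cE X)"
    let ?H = "CTot (CDom2 \<alpha>)" and ?H' = "CTot (CCod2 \<alpha>)" and ?B = "CBase (CDom2 \<beta>)"
      and ?B' = "CBase (CCod2 \<beta>)"
    let ?p = "NComp (CPhi \<alpha>) A" and ?s = "NComp (CPsi \<alpha>) (ext X A)"
    have "Comp (cB Z) (q Z (FArr (CTot (CDom2 \<beta>)) ?p))
        (Comp (cB Z) (tt (CDom2 \<beta>) (FObj ?H A)) (FArr ?B (tt (CDom2 \<alpha>) A)))
      = Comp (cB Z) (tt (CDom2 \<beta>) (FObj ?H' A))
         (Comp (cB Z) (FArr ?B (q Y ?p)) (FArr ?B (tt (CDom2 \<alpha>) A)))"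
      using A by (intro b.M.Y.p.D.reassoc2[OF b.M.tt_natural]) simp_all
    also have "\<dots> = Comp (cB Z) (tt (CDom2 \<beta>) (FObj ?H' A))
         (Comp (cB Z) (FArr ?B (tt (CCod2 \<alpha>) A)) (FArr ?B ?s))"
      using A by (subst b.M.F.B.comp_eq2[OF a.tt_cell]) simp_all
    finally have 1: "Comp (cB Z) (q Z (FArr (CTot (CDom2 \<beta>)) ?p))
        (Comp (cB Z) (tt (CDom2 \<beta>) (FObj ?H A)) (FArr ?B (tt (CDom2 \<alpha>) A)))
      = Comp (cB Z) (tt (CDom2 \<beta>) (FObj ?H' A))
         (Comp (cB Z) (FArr ?B (tt (CCod2 \<alpha>) A)) (FArr ?B ?s))" .
    have "Comp (cB Z) (q Z (NComp (CPhi \<beta>) (FObj ?H' A)))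
         (Comp (cB Z) (tt (CDom2 \<beta>) (FObj ?H' A))
           (Comp (cB Z) (FArr ?B (tt (CCod2 \<alpha>) A)) (FArr ?B ?s)))
      = Comp (cB Z) (tt (CCod2 \<beta>) (FObj ?H' A)) (Comp (cB Z) (NComp (CPsi \<beta>) (ext Y (FObj ?H' A)))
           (Comp (cB Z) (FArr ?B (tt (CCod2 \<alpha>) A)) (FArr ?B ?s)))"
      using A by (intro b.M.Y.p.D.reassoc2[OF b.tt_cell]) simp_all
    also have "\<dots> = Comp (cB Z) (tt (CCod2 \<beta>) (FObj ?H' A)) (Comp (cB Z)
          (FArr ?B' (tt (CCod2 \<alpha>) A)) (Comp (cB Z) (NComp (CPsi \<beta>) (FObj (CBase (CCod2 \<alpha>)) (ext X A)))
           (FArr ?B ?s)))"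
      using A by (subst b.a.psi.natural'[of "tt (CCod2 \<alpha>) A"]) simp_all
    finally show "Comp (cB Z) (q Z (NComp (CPhi (HComp CompCat \<beta> \<alpha>)) A))
          (tt (CDom2 (HComp CompCat \<beta> \<alpha>)) A) =
         Comp (cB Z) (tt (CCod2 (HComp CompCat \<beta> \<alpha>)) A) (NComp (CPsi (HComp CompCat \<beta> \<alpha>)) (ext X A))"
      using A 1 by (simp add: lax_comp_comp1(2)[OF a.M.lax_axioms b.M.lax_axioms]
          lax_comp_comp1(2)[OF a.N.lax_axioms b.N.lax_axioms])
  qed (simp_all add: lax_comp_comp1(1)[OF a.M.lax_axioms b.M.lax_axioms]
      lax_comp_comp1(1)[OF a.N.lax_axioms b.N.lax_axioms])
qed

lemma comp_comp1_assoc: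
  assumes "lax W X M" "lax X Y N" "lax Y Z P"
  shows "comp_comp1 P (comp_comp1 N M) = comp_comp1 (comp_comp1 P N) M"
proof -
  interpret M: lax W X M by fact
  interpret N: lax X Y N by fact
  interpret P: lax Y Z P by fact
  note NM = lax_comp_comp1[OF assms(1,2)] and PN = lax_comp_comp1[OF assms(2,3)]
  note l = lax_comp_comp1[OF NM(1) assms(3)] and r = lax_comp_comp1[OF assms(1) PN(1)]
  show ?thesis
  proof (rule lax_eqI[OF l(1) r(1)])
    show "CBase (comp_comp1 P (comp_comp1 N M)) = CBase (comp_comp1 (comp_comp1 P N) M)"
      by (simp add: comp_comp1_def
          comp_ftr_assoc[OF M.F.B.func_axioms N.F.B.func_axioms P.F.B.func_axioms])
    show "CTot (comp_comp1 P (comp_comp1 N M)) = CTot (comp_comp1 (comp_comp1 P N) M)"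
      by (simp add: comp_comp1_def
          comp_ftr_assoc[OF M.F.E.func_axioms N.F.E.func_axioms P.F.E.func_axioms])
    have c: "CTot (comp_comp1 N M) = CTot N \<circ>\<^sub>c CTot M" "CBase (comp_comp1 P N) = CBase P \<circ>\<^sub>c CBase N"
      by (simp_all add: comp_comp1_def)
    fix A assume A: "A \<in> Obj (cE W)"
    then show "tt (comp_comp1 P (comp_comp1 N M)) A = tt (comp_comp1 (comp_comp1 P N) M) A"
      by (simp add: l(2) r(2) NM(2) PN(2) c)
  qed
qed

lemma comp_comp1_id:
  assumes "lax X Y M"
  shows "comp_comp1 (comp_id1 Y) M = M" "comp_comp1 M (comp_id1 X) = M"
proof -
  interpret lax X Y M by fact
  note iX = lax_comp_id1[OF X.comprehension_category_axioms]
  note iY = lax_comp_id1[OF Y.comprehension_category_axioms]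
  note l = lax_comp_comp1[OF assms iY(1)] and r = lax_comp_comp1[OF iX(1) assms]
  have c: "CTot (comp_id1 X) = id_ftr (cE X)" "CBase (comp_id1 Y) = id_ftr (cB Y)"
    by (simp_all add: comp_id1_def)
  show "comp_comp1 (comp_id1 Y) M = M"
  proof (rule lax_eqI[OF l(1) assms])
    fix A assume "A \<in> Obj (cE X)"
    then show "tt (comp_comp1 (comp_id1 Y) M) A = tt M A" by (simp add: l(2) iY(2) c)
  qed (simp_all add: comp_comp1_def comp_id1_def comp_ftr_id[OF F.B.func_axioms]
      comp_ftr_id[OF F.E.func_axioms])
  show "comp_comp1 M (comp_id1 X) = M"
  proof (rule lax_eqI[OF r(1) assms])
    fix A assume "A \<in> Obj (cE X)"
    then show "tt (comp_comp1 M (comp_id1 X)) A = tt M A" by (simp add: r(2) iX(2) c)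
  qed (simp_all add: comp_comp1_def comp_id1_def comp_ftr_id[OF F.B.func_axioms]
      comp_ftr_id[OF F.E.func_axioms])
qed

lemma ccell2D:
  assumes "ccell2 X Y \<alpha>"
  shows "lax X Y (CDom2 \<alpha>)" "lax X Y (CCod2 \<alpha>)"
    "ntrans (cB X) (cB Y) (CBase (CDom2 \<alpha>)) (CBase (CCod2 \<alpha>)) (CPsi \<alpha>)"
    "ntrans (cE X) (cE Y) (CTot (CDom2 \<alpha>)) (CTot (CCod2 \<alpha>)) (CPhi \<alpha>)"
proof -
  interpret ccell2 X Y \<alpha> by fact
  show "lax X Y (CDom2 \<alpha>)" "lax X Y (CCod2 \<alpha>)" by unfold_locales
  show "ntrans (cB X) (cB Y) (CBase (CDom2 \<alpha>)) (CBase (CCod2 \<alpha>)) (CPsi \<alpha>)"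
    "ntrans (cE X) (cE Y) (CTot (CDom2 \<alpha>)) (CTot (CCod2 \<alpha>)) (CPhi \<alpha>)" by unfold_locales
qed

lemma laxD:
  assumes "lax X Y M"
  shows "func (cB X) (cB Y) (CBase M)" "func (cE X) (cE Y) (CTot M)"
    "comprehension_category X" "comprehension_category Y"
proof -
  interpret lax X Y M by fact
  show "func (cB X) (cB Y) (CBase M)" "func (cE X) (cE Y) (CTot M)"
    "comprehension_category X" "comprehension_category Y" by unfold_locales
qed

lemma Hom2_CompCatD:
  assumes "\<alpha> \<in> Hom2 CompCat f g"
  shows "ccell2 (CSrc f) (CTgt f) \<alpha>" "CDom2 \<alpha> = f" "CCod2 \<alpha> = g"
  using assms by (auto simp: Hom2_def ccell2_iff)

lemma Hom2_CompCatD':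
  assumes "\<alpha> \<in> Hom2 CompCat f g" "lax X Y f"
  shows "ccell2 X Y \<alpha>" "CDom2 \<alpha> = f" "CCod2 \<alpha> = g"
  using assms by (auto simp: Hom2_CompCat)

lemma Hom2_CompCatI:
  "ccell2 X Y \<alpha> \<Longrightarrow> CDom2 \<alpha> = f \<Longrightarrow> CCod2 \<alpha> = g \<Longrightarrow> \<alpha> \<in> Hom2 CompCat f g"
  by (auto simp: Hom2_def ccell2_iff)

lemma ccell2_eqI:
  "CDom2 \<alpha> = CDom2 \<beta> \<Longrightarrow> CCod2 \<alpha> = CCod2 \<beta> \<Longrightarrow> CPsi \<alpha> = CPsi \<beta> \<Longrightarrow> CPhi \<alpha> = CPhi \<beta> \<Longrightarrow>
    (\<alpha> :: 'u compcell) = \<beta>"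
  by (rule compcell.equality) simp_all

text \<open>A 2-cell is determined by its boundary and its two natural transformations, and all
  compositions act separately on these, so the laws for 2-cells are those of natural
  transformations.\<close>

lemma two_category_CompCat: "two_category (CompCat :: ('u compcat, 'u compmor, 'u compcell) two_cat)"
proof (rule two_category.intro)
  fix f assume "f \<in> Cell1 (CompCat :: ('u compcat, 'u compmor, 'u compcell) two_cat)"
  then have f: "lax (CSrc f) (CTgt f) f" by (simp add: lax_iff)
  show "Src1 CompCat f \<in> Cell0 CompCat" "Tgt1 CompCat f \<in> Cell0 CompCat"
    using laxD[OF f] by simp_all
  show "Id2 CompCat f \<in> Hom2 CompCat f f"
    by (rule Hom2_CompCatI[OF ccell2_id[OF f]]) simp_all
next
  fix \<alpha> assume "\<alpha> \<in> Cell2 (CompCat :: ('u compcat, 'u compmor, 'u compcell) two_cat)"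
  then have a: "ccell2 (CSrc (CDom2 \<alpha>)) (CTgt (CDom2 \<alpha>)) \<alpha>" by (simp add: ccell2_iff)
  show "Src2 CompCat \<alpha> \<in> Cell1 CompCat" "Tgt2 CompCat \<alpha> \<in> Cell1 CompCat"
    "Src1 CompCat (Tgt2 CompCat \<alpha>) = Src1 CompCat (Src2 CompCat \<alpha>)"
    "Tgt1 CompCat (Tgt2 CompCat \<alpha>) = Tgt1 CompCat (Src2 CompCat \<alpha>)"
    using ccell2D(1,2)[OF a] by (simp_all add: lax_iff)
next
  fix X assume "X \<in> Cell0 (CompCat :: ('u compcat, 'u compmor, 'u compcell) two_cat)"
  then show "Id1 CompCat X \<in> Hom1 CompCat X X" by (simp add: lax_comp_id1)
next
  fix f g X Y Z
  assume "f \<in> Hom1 (CompCat :: ('u compcat, 'u compmor, 'u compcell) two_cat) X Y"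
    "g \<in> Hom1 CompCat Y Z"
  then have f: "lax X Y f" and g: "lax Y Z g" by simp_all
  show "Comp1 CompCat g f \<in> Hom1 CompCat X Z" using f g by (simp add: lax_comp_comp1)
  show "HComp CompCat (Id2 CompCat g) (Id2 CompCat f) = Id2 CompCat (Comp1 CompCat g f)"
    using hcomp_nat_id_id[OF laxD(1)[OF f] laxD(1)[OF g]]
      hcomp_nat_id_id[OF laxD(2)[OF f] laxD(2)[OF g]] by (simp add: comp_comp1_def)
next
  fix f X Y assume "f \<in> Hom1 (CompCat :: ('u compcat, 'u compmor, 'u compcell) two_cat) X Y"
  then have f: "lax X Y f" by simp
  show "Comp1 CompCat (Id1 CompCat Y) f = f" "Comp1 CompCat f (Id1 CompCat X) = f"
    using comp_comp1_id[OF f] by simp_all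
next
  fix f g h W X Y Z assume "f \<in> Hom1 (CompCat :: ('u compcat, 'u compmor, 'u compcell) two_cat) W X"
    "g \<in> Hom1 CompCat X Y" "h \<in> Hom1 CompCat Y Z"
  then show "Comp1 CompCat h (Comp1 CompCat g f) = Comp1 CompCat (Comp1 CompCat h g) f"
    by (simp add: comp_comp1_assoc)
next
  fix \<alpha> \<beta> f g h assume *: "\<alpha> \<in> Hom2 (CompCat :: ('u compcat, 'u compmor, 'u compcell) two_cat) f g"
    "\<beta> \<in> Hom2 CompCat g h"
  note a = Hom2_CompCatD[OF *(1)]
  note b = Hom2_CompCatD'[OF *(2) ccell2D(2)[OF a(1), unfolded a(3)]]
  show "VComp CompCat \<beta> \<alpha> \<in> Hom2 CompCat f h"
    by (rule Hom2_CompCatI[OF ccell2_vcomp[OF a(1) b(1)]]) (simp_all add: a b)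
next
  fix \<alpha> f g assume *: "\<alpha> \<in> Hom2 (CompCat :: ('u compcat, 'u compmor, 'u compcell) two_cat) f g"
  note a = Hom2_CompCatD[OF *] and n = ccell2D(3,4)[OF Hom2_CompCatD(1)[OF *]]
  show "VComp CompCat (Id2 CompCat g) \<alpha> = \<alpha>" "VComp CompCat \<alpha> (Id2 CompCat f) = \<alpha>"
    using vcomp_nat_id[OF n(1)] vcomp_nat_id[OF n(2)] a(2,3) by (auto intro: ccell2_eqI)
next
  fix \<alpha> \<beta> \<gamma> e f g h
  assume *: "\<alpha> \<in> Hom2 (CompCat :: ('u compcat, 'u compmor, 'u compcell) two_cat) e f"
    "\<beta> \<in> Hom2 CompCat f g" "\<gamma> \<in> Hom2 CompCat g h"
  note a = Hom2_CompCatD[OF *(1)]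
  note b = Hom2_CompCatD'[OF *(2) ccell2D(2)[OF a(1), unfolded a(3)]]
  note c = Hom2_CompCatD'[OF *(3) ccell2D(2)[OF b(1), unfolded b(3)]]
  note n = ccell2D(3,4)[OF a(1), unfolded a] ccell2D(3,4)[OF b(1), unfolded b]
    ccell2D(3,4)[OF c(1), unfolded c]
  show "VComp CompCat \<gamma> (VComp CompCat \<beta> \<alpha>) = VComp CompCat (VComp CompCat \<gamma> \<beta>) \<alpha>"
    using vcomp_nat_assoc[OF n(1,3,5)] vcomp_nat_assoc[OF n(2,4,6)] by simp
next
  fix f f' g g' \<alpha> \<beta> X Y Z
  assume *: "f \<in> Hom1 (CompCat :: ('u compcat, 'u compmor, 'u compcell) two_cat) X Y"
    "g \<in> Hom1 CompCat Y Z" "\<alpha> \<in> Hom2 CompCat f f'" "\<beta> \<in> Hom2 CompCat g g'"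
  note a = Hom2_CompCatD'[OF *(3) *(1)[unfolded Hom1_CompCat]]
    and b = Hom2_CompCatD'[OF *(4) *(2)[unfolded Hom1_CompCat]]
  show "HComp CompCat \<beta> \<alpha> \<in> Hom2 CompCat (Comp1 CompCat g f) (Comp1 CompCat g' f')"
    by (rule Hom2_CompCatI[OF ccell2_hcomp[OF a(1) b(1)]]) (simp_all add: a b)
next
  fix f f' \<alpha> X Y
  assume *: "f \<in> Hom1 (CompCat :: ('u compcat, 'u compmor, 'u compcell) two_cat) X Y"
    "\<alpha> \<in> Hom2 CompCat f f'"
  note a = Hom2_CompCatD'[OF *(2) *(1)[unfolded Hom1_CompCat]]
  note n = ccell2D[OF a(1)]
  show "HComp CompCat (Id2 CompCat (Id1 CompCat Y)) \<alpha> = \<alpha>"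
    using hcomp_nat_id[OF n(3)] hcomp_nat_id[OF n(4)] comp_comp1_id[OF n(1)] comp_comp1_id[OF n(2)]
    by (intro ccell2_eqI) (simp_all, simp_all add: comp_id1_def)
  show "HComp CompCat \<alpha> (Id2 CompCat (Id1 CompCat X)) = \<alpha>"
    using hcomp_nat_id[OF n(3)] hcomp_nat_id[OF n(4)] comp_comp1_id[OF n(1)] comp_comp1_id[OF n(2)]
    by (intro ccell2_eqI) (simp_all, simp_all add: comp_id1_def)
next
  fix f f' g g' h h' \<alpha> \<beta> \<gamma> W X Y Z
  assume *: "f \<in> Hom1 (CompCat :: ('u compcat, 'u compmor, 'u compcell) two_cat) W X"
    "g \<in> Hom1 CompCat X Y" "h \<in> Hom1 CompCat Y Z" "\<alpha> \<in> Hom2 CompCat f f'"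
    "\<beta> \<in> Hom2 CompCat g g'" "\<gamma> \<in> Hom2 CompCat h h'"
  note a = ccell2D[OF Hom2_CompCatD'(1)[OF *(4) *(1)[unfolded Hom1_CompCat]]]
    and b = ccell2D[OF Hom2_CompCatD'(1)[OF *(5) *(2)[unfolded Hom1_CompCat]]]
    and c = ccell2D[OF Hom2_CompCatD'(1)[OF *(6) *(3)[unfolded Hom1_CompCat]]]
  show "HComp CompCat \<gamma> (HComp CompCat \<beta> \<alpha>) = HComp CompCat (HComp CompCat \<gamma> \<beta>) \<alpha>"
    using hcomp_nat_assoc[OF a(3) b(3) c(3)] hcomp_nat_assoc[OF a(4) b(4) c(4)]
      comp_comp1_assoc[OF a(1) b(1) c(1)] comp_comp1_assoc[OF a(2) b(2) c(2)] by simp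
next
  fix f f' f'' g g' g'' \<alpha> \<alpha>' \<beta> \<beta>' X Y Z
  assume *: "f \<in> Hom1 (CompCat :: ('u compcat, 'u compmor, 'u compcell) two_cat) X Y"
    "g \<in> Hom1 CompCat Y Z" "\<alpha> \<in> Hom2 CompCat f f'" "\<alpha>' \<in> Hom2 CompCat f' f''"
    "\<beta> \<in> Hom2 CompCat g g'" "\<beta>' \<in> Hom2 CompCat g' g''"
  note a = Hom2_CompCatD'[OF *(3) *(1)[unfolded Hom1_CompCat]]
    and b = Hom2_CompCatD'[OF *(5) *(2)[unfolded Hom1_CompCat]]
  note a' = Hom2_CompCatD'[OF *(4) ccell2D(2)[OF a(1), unfolded a]]
    and b' = Hom2_CompCatD'[OF *(6) ccell2D(2)[OF b(1), unfolded b]]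
  note n = ccell2D(3,4)[OF a(1), unfolded a] ccell2D(3,4)[OF a'(1), unfolded a']
    ccell2D(3,4)[OF b(1), unfolded b] ccell2D(3,4)[OF b'(1), unfolded b']
  show "HComp CompCat (VComp CompCat \<beta>' \<beta>) (VComp CompCat \<alpha>' \<alpha>) =
    VComp CompCat (HComp CompCat \<beta>' \<alpha>') (HComp CompCat \<beta> \<alpha>)"
    using hcomp_vcomp_interchange[OF n(1,3,5,7)] hcomp_vcomp_interchange[OF n(2,4,6,8)] by simp
qed

section \<open>The 2-category of generalised categories with families\<close>

abbreviation gU :: "'u gcwf \<Rightarrow> 'u scat" where "gU W \<equiv> Tot (GU W)"
abbreviation gV :: "'u gcwf \<Rightarrow> 'u scat" where "gV W \<equiv> Tot (GUd W)"
abbreviation gB :: "'u gcwf \<Rightarrow> 'u scat" where "gB W \<equiv> Base (GU W)"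
abbreviation gu :: "'u gcwf \<Rightarrow> 'u sftr" where "gu W \<equiv> Fun (GU W)"
abbreviation gv :: "'u gcwf \<Rightarrow> 'u sftr" where "gv W \<equiv> Fun (GUd W)"

sublocale generalised_cwf \<subseteq> u: fibration "GU W" by (rule GU_fibration)
sublocale generalised_cwf \<subseteq> v: fibration "GUd W" by (rule GUd_fibration)
text \<open>The two fibrations share their base only by the axiom \<open>GBase_eq\<close>. This
  second interpretation restates the facts on \<open>gv W\<close> over \<open>gB W\<close>, the form
  to which the simplifier rewrites.\<close>

sublocale generalised_cwf \<subseteq> v: pre_func "gV W" "gB W" "gv W"
  using v.pre_func_axioms unfolding GBase_eq .
sublocale generalised_cwf \<subseteq> Sig: func "gV W" "gU W" "GSig W"
  by (rule cat_functor_func) (use GAdj GSig_FDom GSig_FCod in \<open>simp_all add: adjunction_def\<close>)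
sublocale generalised_cwf \<subseteq> Del: func "gU W" "gV W" "GDel W"
  by (rule cat_functor_func) (use GAdj GSig_FDom GSig_FCod in \<open>simp_all add: adjunction_def\<close>)
sublocale generalised_cwf \<subseteq> eta: ntrans "gV W" "gV W" "id_ftr (gV W)" "GDel W \<circ>\<^sub>c GSig W" "GEta W"
  by (rule nat_from_to_ntrans) (use GAdj GSig_FDom GSig_FCod in \<open>auto simp: adjunction_def\<close>)
sublocale generalised_cwf \<subseteq> eps: ntrans "gU W" "gU W" "GSig W \<circ>\<^sub>c GDel W" "id_ftr (gU W)" "GEps W"
  by (rule nat_from_to_ntrans) (use GAdj GSig_FDom GSig_FCod in \<open>auto simp: adjunction_def\<close>)

context generalised_cwf
begin

lemmas GBase_eq [simp]

lemma Sig_over [simp]: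
  "f \<in> Arr (gV W) \<Longrightarrow> FArr (gu W) (FArr (GSig W) f) = FArr (gv W) f"
  "a \<in> Obj (gV W) \<Longrightarrow> FObj (gu W) (FObj (GSig W) a) = FObj (gv W) a"
  using arg_cong[OF GSig_over, of "\<lambda>F. FArr F f"] arg_cong[OF GSig_over, of "\<lambda>F. FObj F a"] by auto

end

locale gmorphism = W: generalised_cwf W + W': generalised_cwf W' +
  H: fib1 "GU W" "GU W'" "GC M" "GH M" + Hd: fib1 "GUd W" "GUd W'" "GC M" "GHd M" +
  zeta: ntrans "gV W" "gU W'" "GSig W' \<circ>\<^sub>c GHd M" "GH M \<circ>\<^sub>c GSig W" "GZeta M"
  for W W' and M :: "'u gmor" +
  assumes GSrc: "GSrc M = W" and GTgt: "GTgt M = W'"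
    and zeta_iso [simp]: "a \<in> Obj (gV W) \<Longrightarrow> is_iso (gU W') (NComp (GZeta M) a)"
    and zeta_vert [simp]: "a \<in> Obj (gV W) \<Longrightarrow>
      FArr (gu W') (NComp (GZeta M) a) = Ide (gB W') (FObj (GC M) (FObj (gv W) a))"

lemma gmorphism_iff:
  "gmorphism W W' M \<longleftrightarrow> gcwf_loose_morphism M \<and> GSrc M = W \<and> GTgt M = W'"
proof
  assume "gmorphism W W' M"
  then interpret gmorphism W W' M .
  show "gcwf_loose_morphism M \<and> GSrc M = W \<and> GTgt M = W'"
    using zeta.nat zeta.nat_trans H.fib1_axioms Hd.fib1_axioms W.generalised_cwf_axioms
      W'.generalised_cwf_axioms
    by (simp add: gcwf_loose_morphism_def GSrc GTgt fib_cell1_iff nat_iso_def)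
next
  assume *: "gcwf_loose_morphism M \<and> GSrc M = W \<and> GTgt M = W'"
  then interpret W: generalised_cwf W by (auto simp: gcwf_loose_morphism_def)
  from * interpret W': generalised_cwf W' by (auto simp: gcwf_loose_morphism_def)
  from * interpret H: fib1 "GU W" "GU W'" "GC M" "GH M"
    by (auto simp: gcwf_loose_morphism_def fib_cell1_iff)
  from * interpret Hd: fib1 "GUd W" "GUd W'" "GC M" "GHd M"
    by (auto simp: gcwf_loose_morphism_def fib_cell1_iff)
  interpret zeta: ntrans "gV W" "gU W'" "GSig W' \<circ>\<^sub>c GHd M" "GH M \<circ>\<^sub>c GSig W" "GZeta M"
    by (rule nat_from_to_ntrans) (use * in \<open>auto simp: gcwf_loose_morphism_def\<close>)
  show "gmorphism W W' M"
    by unfold_locales (use * in \<open>auto simp: gcwf_loose_morphism_def nat_iso_def\<close>)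
qed

locale gcell2 = M: gmorphism W W' "GDom2 \<alpha>" + N: gmorphism W W' "GCod2 \<alpha>" +
  a: fib2 "GU W" "GU W'" "GC (GDom2 \<alpha>)" "GH (GDom2 \<alpha>)" "GC (GCod2 \<alpha>)" "GH (GCod2 \<alpha>)"
    "GPsi \<alpha>" "GPhi \<alpha>" +
  d: fib2 "GUd W" "GUd W'" "GC (GDom2 \<alpha>)" "GHd (GDom2 \<alpha>)" "GC (GCod2 \<alpha>)" "GHd (GCod2 \<alpha>)"
    "GPsi \<alpha>" "GPhid \<alpha>" for W W' and \<alpha> :: "'u gcell" +
  assumes zeta_cell: "a \<in> Obj (gV W) \<Longrightarrow>
    Comp (gU W') (NComp (GPhi \<alpha>) (FObj (GSig W) a)) (NComp (GZeta (GDom2 \<alpha>)) a) =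
    Comp (gU W') (NComp (GZeta (GCod2 \<alpha>)) a) (FArr (GSig W') (NComp (GPhid \<alpha>) a))"

lemma gcell2_iff:
  "gcell2 W W' \<alpha> \<longleftrightarrow> gcwf_cell2 \<alpha> \<and> GSrc (GDom2 \<alpha>) = W \<and> GTgt (GDom2 \<alpha>) = W'"
proof -
  define M where "M = GDom2 \<alpha>"
  define N where "N = GCod2 \<alpha>"
  have "(GPhi \<alpha> \<cdot>\<^sub>r GSig W) \<bullet> GZeta M = GZeta N \<bullet> (GSig W' \<cdot>\<^sub>l GPhid \<alpha>) \<longleftrightarrow>
     (\<forall>a \<in> Obj (gV W). Comp (gU W') (NComp (GPhi \<alpha>) (FObj (GSig W) a)) (NComp (GZeta M) a) =
        Comp (gU W') (NComp (GZeta N) a) (FArr (GSig W') (NComp (GPhid \<alpha>) a)))" (is "?l = ?r \<longleftrightarrow> _")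
    if "gmorphism W W' M" "gmorphism W W' N"
      "fib2 (GU W) (GU W') (GC M) (GH M) (GC N) (GH N) (GPsi \<alpha>) (GPhi \<alpha>)"
      "fib2 (GUd W) (GUd W') (GC M) (GHd M) (GC N) (GHd N) (GPsi \<alpha>) (GPhid \<alpha>)"
  proof -
    interpret M: gmorphism W W' M by fact
    interpret N: gmorphism W W' N by fact
    interpret a: fib2 "GU W" "GU W'" "GC M" "GH M" "GC N" "GH N" "GPsi \<alpha>" "GPhi \<alpha>" by fact
    interpret d: fib2 "GUd W" "GUd W'" "GC M" "GHd M" "GC N" "GHd N" "GPsi \<alpha>" "GPhid \<alpha>" by fact
    have "NComp ?l \<in> extensional (Obj (gV W))" "NComp ?r \<in> extensional (Obj (gV W))"
      using vcomp_nat_ext[of "GPhi \<alpha> \<cdot>\<^sub>r GSig W" "GZeta M"]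
        vcomp_nat_ext[of "GZeta N" "GSig W' \<cdot>\<^sub>l GPhid \<alpha>"] by simp_all
    then have "?l = ?r \<longleftrightarrow> (\<forall>a \<in> Obj (gV W). NComp ?l a = NComp ?r a)"
      by (rule ntr_eq_iff) simp_all
    also have "\<dots> \<longleftrightarrow> (\<forall>a \<in> Obj (gV W). Comp (gU W') (NComp (GPhi \<alpha>) (FObj (GSig W) a)) (NComp (GZeta
        M) a) =
        Comp (gU W') (NComp (GZeta N) a) (FArr (GSig W') (NComp (GPhid \<alpha>) a)))"
      by (intro ball_cong refl) simp
    finally show ?thesis .
  qed
  then show ?thesis
    unfolding gcwf_cell2_def Let_def fib_cell2_iff gcell2_def gcell2_axioms_def
    by (auto simp: gmorphism_iff M_def N_def)
qed

lemma gmorphism_id1: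
  assumes "generalised_cwf W" shows "gmorphism W W (gcwf_id1 W)"
proof -
  interpret W: generalised_cwf W by fact
  have 1: "id_ftr (gU W) \<circ>\<^sub>c GSig W = GSig W" "GSig W \<circ>\<^sub>c id_ftr (gV W) = GSig W"
    by (rule comp_ftr_id[OF W.Sig.func_axioms])+
  show ?thesis
    using fib1_id[OF W.u.fibration_axioms] fib1_id[OF W.v.fibration_axioms] assms
      ntrans_id[OF W.Sig.func_axioms]
    by (intro gmorphism.intro gmorphism_axioms.intro) (simp_all add: gcwf_id1_def 1)
qed

lemma gmorphism_comp1:
  assumes "gmorphism W W' M" "gmorphism W' W'' N" shows "gmorphism W W'' (gcwf_comp1 N M)"
proof -
  interpret M: gmorphism W W' M by fact
  interpret N: gmorphism W' W'' N by fact
  have "ntrans (gV W) (gU W'') (GSig W'' \<circ>\<^sub>c GHd (gcwf_comp1 N M)) (GH (gcwf_comp1 N M) \<circ>\<^sub>c GSig W)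
      (GZeta (gcwf_comp1 N M))"
    using ntrans_vcomp[OF ntrans_rwhisker[OF N.zeta.ntrans_axioms M.Hd.E.func_axioms,
            folded comp_ftr_assoc[OF M.Hd.E.func_axioms M.W'.Sig.func_axioms N.H.E.func_axioms]]
        ntrans_lwhisker[OF M.zeta.ntrans_axioms N.H.E.func_axioms]]
    by (simp add: gcwf_comp1_def
        comp_ftr_assoc[OF M.Hd.E.func_axioms N.Hd.E.func_axioms N.W'.Sig.func_axioms]
        comp_ftr_assoc[OF M.W.Sig.func_axioms M.H.E.func_axioms N.H.E.func_axioms])
  then interpret z: ntrans "gV W" "gU W''" "GSig W'' \<circ>\<^sub>c GHd (gcwf_comp1 N M)"
    "GH (gcwf_comp1 N M) \<circ>\<^sub>c GSig W" "GZeta (gcwf_comp1 N M)" .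
  interpret H: fib1 "GU W" "GU W''" "GC (gcwf_comp1 N M)" "GH (gcwf_comp1 N M)"
    using fib1_comp[OF M.H.fib1_axioms N.H.fib1_axioms] by (simp add: gcwf_comp1_def)
  interpret Hd: fib1 "GUd W" "GUd W''" "GC (gcwf_comp1 N M)" "GHd (gcwf_comp1 N M)"
    using fib1_comp[OF M.Hd.fib1_axioms N.Hd.fib1_axioms] by (simp add: gcwf_comp1_def)
  show ?thesis
  proof unfold_locales
    fix a assume a: "a \<in> Obj (gV W)"
    then show "is_iso (gU W'') (NComp (GZeta (gcwf_comp1 N M)) a)"
      by (simp add: gcwf_comp1_def N.W'.u.C.iso_comp)
    show "FArr (gu W'') (NComp (GZeta (gcwf_comp1 N M)) a) =
         Ide (gB W'') (FObj (GC (gcwf_comp1 N M)) (FObj (gv W) a))"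
      using a by (simp add: gcwf_comp1_def)
  qed (simp_all add: gcwf_comp1_def M.GSrc N.GTgt)
qed

lemma gcwf_comp1_assoc:
  assumes "gmorphism W X M" "gmorphism X Y N" "gmorphism Y Z P"
  shows "gcwf_comp1 P (gcwf_comp1 N M) = gcwf_comp1 (gcwf_comp1 P N) M"
proof -
  interpret M: gmorphism W X M by fact
  interpret N: gmorphism X Y N by fact
  interpret P: gmorphism Y Z P by fact
  interpret l: gmorphism W Z "gcwf_comp1 P (gcwf_comp1 N M)"
    by (intro gmorphism_comp1[OF _ assms(3)] gmorphism_comp1[OF assms(1,2)])
  interpret r: gmorphism W Z "gcwf_comp1 (gcwf_comp1 P N) M"
    by (intro gmorphism_comp1[OF assms(1)] gmorphism_comp1[OF assms(2,3)])
  have 1: "GC (gcwf_comp1 P (gcwf_comp1 N M)) = GC (gcwf_comp1 (gcwf_comp1 P N) M)"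
    "GH (gcwf_comp1 P (gcwf_comp1 N M)) = GH (gcwf_comp1 (gcwf_comp1 P N) M)"
    "GHd (gcwf_comp1 P (gcwf_comp1 N M)) = GHd (gcwf_comp1 (gcwf_comp1 P N) M)"
    by (simp_all add: gcwf_comp1_def
        comp_ftr_assoc[OF M.H.B.func_axioms N.H.B.func_axioms P.H.B.func_axioms]
        comp_ftr_assoc[OF M.H.E.func_axioms N.H.E.func_axioms P.H.E.func_axioms]
        comp_ftr_assoc[OF M.Hd.E.func_axioms N.Hd.E.func_axioms P.Hd.E.func_axioms])
  have "GZeta (gcwf_comp1 P (gcwf_comp1 N M)) = GZeta (gcwf_comp1 (gcwf_comp1 P N) M)"
    by (rule ntr_eqI[OF l.zeta.ntrans_axioms r.zeta.ntrans_axioms[folded 1]])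
      (simp add: gcwf_comp1_def)
  with 1 show ?thesis by (intro gmor.equality) (simp_all, simp_all add: gcwf_comp1_def)
qed

lemma gcwf_comp1_id:
  assumes "gmorphism X Y M"
  shows "gcwf_comp1 (gcwf_id1 Y) M = M" "gcwf_comp1 M (gcwf_id1 X) = M"
proof -
  interpret M: gmorphism X Y M by fact
  interpret l: gmorphism X Y "gcwf_comp1 (gcwf_id1 Y) M"
    by (rule gmorphism_comp1[OF assms gmorphism_id1[OF M.W'.generalised_cwf_axioms]])
  interpret r: gmorphism X Y "gcwf_comp1 M (gcwf_id1 X)"
    by (rule gmorphism_comp1[OF gmorphism_id1[OF M.W.generalised_cwf_axioms] assms])
  have 1: "GC (gcwf_comp1 (gcwf_id1 Y) M) = GC M" "GH (gcwf_comp1 (gcwf_id1 Y) M) = GH M"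
    "GHd (gcwf_comp1 (gcwf_id1 Y) M) = GHd M"
    and 2: "GC (gcwf_comp1 M (gcwf_id1 X)) = GC M" "GH (gcwf_comp1 M (gcwf_id1 X)) = GH M"
    "GHd (gcwf_comp1 M (gcwf_id1 X)) = GHd M"
    by (simp_all add: gcwf_comp1_def gcwf_id1_def comp_ftr_id[OF M.H.B.func_axioms]
        comp_ftr_id[OF M.H.E.func_axioms] comp_ftr_id[OF M.Hd.E.func_axioms])
  have "GZeta (gcwf_comp1 (gcwf_id1 Y) M) = GZeta M"
    by (rule ntr_eqI[OF l.zeta.ntrans_axioms[unfolded 1] M.zeta.ntrans_axioms])
      (simp add: gcwf_comp1_def gcwf_id1_def)
  with 1 show "gcwf_comp1 (gcwf_id1 Y) M = M"
    by (intro gmor.equality) (simp_all, simp_all add: gcwf_comp1_def gcwf_id1_def M.GTgt)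
  have "GZeta (gcwf_comp1 M (gcwf_id1 X)) = GZeta M"
    by (rule ntr_eqI[OF r.zeta.ntrans_axioms[unfolded 2] M.zeta.ntrans_axioms])
      (simp add: gcwf_comp1_def gcwf_id1_def)
  with 2 show "gcwf_comp1 M (gcwf_id1 X) = M"
    by (intro gmor.equality) (simp_all, simp_all add: gcwf_comp1_def gcwf_id1_def M.GSrc)
qed

lemma GCwF_simps [simp]:
  "Cell0 GCwF = {W. generalised_cwf W}" "Cell1 GCwF = {M. gcwf_loose_morphism M}"
  "Cell2 GCwF = {\<alpha>. gcwf_cell2 \<alpha>}" "Src1 GCwF = GSrc" "Tgt1 GCwF = GTgt"
  "Src2 GCwF = GDom2" "Tgt2 GCwF = GCod2" "Id1 GCwF = gcwf_id1" "Comp1 GCwF = gcwf_comp1"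
  "Id2 GCwF M = \<lparr>GDom2 = M, GCod2 = M, GPsi = id_nat (GC M), GPhi = id_nat (GH M),
    GPhid = id_nat (GHd M)\<rparr>"
  "VComp GCwF \<beta> \<alpha> = \<lparr>GDom2 = GDom2 \<alpha>, GCod2 = GCod2 \<beta>,
    GPsi = GPsi \<beta> \<bullet> GPsi \<alpha>, GPhi = GPhi \<beta> \<bullet> GPhi \<alpha>, GPhid = GPhid \<beta> \<bullet> GPhid \<alpha>\<rparr>"
  "HComp GCwF \<beta> \<alpha> = \<lparr>GDom2 = gcwf_comp1 (GDom2 \<beta>) (GDom2 \<alpha>),
    GCod2 = gcwf_comp1 (GCod2 \<beta>) (GCod2 \<alpha>), GPsi = GPsi \<beta> \<star> GPsi \<alpha>, GPhi = GPhi \<beta> \<star> GPhi \<alpha>,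
    GPhid = GPhid \<beta> \<star> GPhid \<alpha>\<rparr>"
  by (simp_all add: GCwF_def)

lemma Hom1_GCwF [simp]: "M \<in> Hom1 GCwF X Y \<longleftrightarrow> gmorphism X Y M"
  by (simp add: Hom1_def gmorphism_iff)

lemma Hom2_GCwFD:
  assumes "\<alpha> \<in> Hom2 GCwF f g"
  shows "gcell2 (GSrc f) (GTgt f) \<alpha>" "GDom2 \<alpha> = f" "GCod2 \<alpha> = g"
  using assms by (auto simp: Hom2_def gcell2_iff)

lemma Hom2_GCwFD':
  assumes "\<alpha> \<in> Hom2 GCwF f g" "gmorphism X Y f"
  shows "gcell2 X Y \<alpha>" "GDom2 \<alpha> = f" "GCod2 \<alpha> = g"
  using assms by (auto simp: Hom2_def gcell2_iff gmorphism_iff)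

lemma Hom2_GCwFI:
  "gcell2 X Y \<alpha> \<Longrightarrow> GDom2 \<alpha> = f \<Longrightarrow> GCod2 \<alpha> = g \<Longrightarrow> \<alpha> \<in> Hom2 GCwF f g"
  by (auto simp: Hom2_def gcell2_iff)

lemma gcell2_eqI:
  "GDom2 \<alpha> = GDom2 \<beta> \<Longrightarrow> GCod2 \<alpha> = GCod2 \<beta> \<Longrightarrow> GPsi \<alpha> = GPsi \<beta> \<Longrightarrow> GPhi \<alpha> = GPhi \<beta> \<Longrightarrow>
    GPhid \<alpha> = GPhid \<beta> \<Longrightarrow> (\<alpha> :: 'u gcell) = \<beta>"
  by (rule gcell.equality) simp_all

lemma gcell2I:
  assumes "gmorphism W W' (GDom2 \<alpha>)" "gmorphism W W' (GCod2 \<alpha>)"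
    "fib2 (GU W) (GU W') (GC (GDom2 \<alpha>)) (GH (GDom2 \<alpha>)) (GC (GCod2 \<alpha>)) (GH (GCod2 \<alpha>))
      (GPsi \<alpha>) (GPhi \<alpha>)"
    "fib2 (GUd W) (GUd W') (GC (GDom2 \<alpha>)) (GHd (GDom2 \<alpha>)) (GC (GCod2 \<alpha>)) (GHd (GCod2 \<alpha>))
      (GPsi \<alpha>) (GPhid \<alpha>)"
    "\<And>a. a \<in> Obj (gV W) \<Longrightarrow>
      Comp (gU W') (NComp (GPhi \<alpha>) (FObj (GSig W) a)) (NComp (GZeta (GDom2 \<alpha>)) a) =
      Comp (gU W') (NComp (GZeta (GCod2 \<alpha>)) a) (FArr (GSig W') (NComp (GPhid \<alpha>) a))"
  shows "gcell2 W W' \<alpha>"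
  using assms by (simp add: gcell2_def gcell2_axioms_def)

lemma gmorphismD:
  assumes "gmorphism X Y M"
  shows "func (gB X) (gB Y) (GC M)" "func (gU X) (gU Y) (GH M)" "func (gV X) (gV Y) (GHd M)"
    "generalised_cwf X" "generalised_cwf Y"
proof -
  interpret gmorphism X Y M by fact
  show "func (gB X) (gB Y) (GC M)" "func (gU X) (gU Y) (GH M)" "func (gV X) (gV Y) (GHd M)"
    "generalised_cwf X" "generalised_cwf Y" by unfold_locales
qed

lemma gcell2D:
  assumes "gcell2 X Y \<alpha>"
  shows "gmorphism X Y (GDom2 \<alpha>)" "gmorphism X Y (GCod2 \<alpha>)"
    "ntrans (gB X) (gB Y) (GC (GDom2 \<alpha>)) (GC (GCod2 \<alpha>)) (GPsi \<alpha>)"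
    "ntrans (gU X) (gU Y) (GH (GDom2 \<alpha>)) (GH (GCod2 \<alpha>)) (GPhi \<alpha>)"
    "ntrans (gV X) (gV Y) (GHd (GDom2 \<alpha>)) (GHd (GCod2 \<alpha>)) (GPhid \<alpha>)"
proof -
  interpret gcell2 X Y \<alpha> by fact
  show "gmorphism X Y (GDom2 \<alpha>)" "gmorphism X Y (GCod2 \<alpha>)" by unfold_locales
  show "ntrans (gB X) (gB Y) (GC (GDom2 \<alpha>)) (GC (GCod2 \<alpha>)) (GPsi \<alpha>)"
    "ntrans (gU X) (gU Y) (GH (GDom2 \<alpha>)) (GH (GCod2 \<alpha>)) (GPhi \<alpha>)"
    "ntrans (gV X) (gV Y) (GHd (GDom2 \<alpha>)) (GHd (GCod2 \<alpha>)) (GPhid \<alpha>)" by unfold_locales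
qed

lemma gcell2_id:
  assumes "gmorphism W W' M" shows "gcell2 W W' (Id2 GCwF M)"
proof -
  interpret gmorphism W W' M by fact
  show ?thesis
    by (rule gcell2I) (use assms fib2_id[OF H.fib1_axioms] fib2_id[OF Hd.fib1_axioms] in simp_all)
qed

lemma gcell2_vcomp:
  assumes "gcell2 W W' \<alpha>" "gcell2 W W' \<beta>" "GCod2 \<alpha> = GDom2 \<beta>"
  shows "gcell2 W W' (VComp GCwF \<beta> \<alpha>)"
proof -
  interpret a: gcell2 W W' \<alpha> by fact
  interpret b: gcell2 W W' \<beta> by fact
  show ?thesis
  proof (rule gcell2I)
    fix a assume a: "a \<in> Obj (gV W)"
    have "Comp (gU W') (NComp (GPhi \<beta>) (FObj (GSig W) a))
        (Comp (gU W') (NComp (GPhi \<alpha>) (FObj (GSig W) a)) (NComp (GZeta (GDom2 \<alpha>)) a))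
      = Comp (gU W') (NComp (GPhi \<beta>) (FObj (GSig W) a))
        (Comp (gU W') (NComp (GZeta (GDom2 \<beta>)) a) (FArr (GSig W') (NComp (GPhid \<alpha>) a)))"
      using a.zeta_cell[OF a] by (simp add: assms(3))
    also have "\<dots> = Comp (gU W') (NComp (GZeta (GCod2 \<beta>)) a)
        (Comp (gU W') (FArr (GSig W') (NComp (GPhid \<beta>) a)) (FArr (GSig W') (NComp (GPhid \<alpha>) a)))"
      using a by (intro a.M.W'.u.C.reassoc2[OF b.zeta_cell]) (simp_all add: assms(3))
    finally show "Comp (gU W') (NComp (GPhi (VComp GCwF \<beta> \<alpha>)) (FObj (GSig W) a))
          (NComp (GZeta (GDom2 (VComp GCwF \<beta> \<alpha>))) a) =
         Comp (gU W') (NComp (GZeta (GCod2 (VComp GCwF \<beta> \<alpha>))) a)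
          (FArr (GSig W') (NComp (GPhid (VComp GCwF \<beta> \<alpha>)) a))"
      using a by (simp add: assms(3))
  qed (simp_all add: a.M.gmorphism_axioms b.N.gmorphism_axioms
      fib2_vcomp[OF a.a.fib2_axioms[unfolded assms(3)] b.a.fib2_axioms]
      fib2_vcomp[OF a.d.fib2_axioms[unfolded assms(3)] b.d.fib2_axioms])
qed

text \<open>The moves of the pasting are: the condition on \<alpha> under the type functor of the
  source of \<beta>, naturality of \<zeta> of that source, naturality of the type part of \<beta> at
  \<zeta> of the target of \<alpha>, and the condition on \<beta>.\<close>

lemma gcell2_hcomp:
  assumes "gcell2 W W' \<alpha>" "gcell2 W' W'' \<beta>"
  shows "gcell2 W W'' (HComp GCwF \<beta> \<alpha>)"
proof -
  interpret a: gcell2 W W' \<alpha> by fact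
  interpret b: gcell2 W' W'' \<beta> by fact
  show ?thesis
  proof (rule gcell2I)
    fix a assume a: "a \<in> Obj (gV W)"
    let ?D = "gU W''" and ?H = "GH (GDom2 \<beta>)" and ?H' = "GH (GCod2 \<beta>)"
      and ?x = "FObj (GHd (GDom2 \<alpha>)) a" and ?x' = "FObj (GHd (GCod2 \<alpha>)) a"
    let ?z = "NComp (GZeta (GDom2 \<alpha>)) a" and ?z' = "NComp (GZeta (GCod2 \<alpha>)) a"
      and ?n = "NComp (GZeta (GDom2 \<beta>))" and ?n' = "NComp (GZeta (GCod2 \<beta>))"
      and ?p = "NComp (GPhi \<alpha>) (FObj (GSig W) a)" and ?d = "NComp (GPhid \<alpha>) a"
      and ?r = "NComp (GPhi \<beta>)"
    have "Comp ?D (FArr ?H ?p) (Comp ?D (FArr ?H ?z) (?n ?x)) =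
      Comp ?D (FArr ?H ?z') (Comp ?D (FArr ?H (FArr (GSig W') ?d)) (?n ?x))"
      using a by (intro b.M.W'.u.C.reassoc2[OF b.M.H.E.comp_eq2[OF a.zeta_cell]]) simp_all
    also have "\<dots> = Comp ?D (FArr ?H ?z') (Comp ?D (?n ?x') (FArr (GSig W'') (FArr (GHd (GDom2 \<beta>)) ?d)))"
      using b.M.zeta.natural[of ?d ?x ?x'] a by simp
    finally have "Comp ?D (?r (FObj (GH (GCod2 \<alpha>)) (FObj (GSig W) a)))
        (Comp ?D (FArr ?H ?p) (Comp ?D (FArr ?H ?z) (?n ?x))) =
      Comp ?D (?r (FObj (GH (GCod2 \<alpha>)) (FObj (GSig W) a)))
        (Comp ?D (FArr ?H ?z') (Comp ?D (?n ?x') (FArr (GSig W'') (FArr (GHd (GDom2 \<beta>)) ?d))))"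
      by simp
    also have "\<dots> = Comp ?D (FArr ?H' ?z') (Comp ?D (?r (FObj (GSig W') ?x'))
        (Comp ?D (?n ?x') (FArr (GSig W'') (FArr (GHd (GDom2 \<beta>)) ?d))))"
      using a by (subst b.a.phi.natural'[of ?z']) simp_all
    also have "\<dots> = Comp ?D (FArr ?H' ?z') (Comp ?D (?n' ?x')
        (Comp ?D (FArr (GSig W'') (NComp (GPhid \<beta>) ?x')) (FArr (GSig W'') (FArr (GHd (GDom2 \<beta>)) ?d))))"
      using a by (subst b.M.W'.u.C.reassoc2[OF b.zeta_cell]) simp_all
    finally show "Comp (gU W'') (NComp (GPhi (HComp GCwF \<beta> \<alpha>)) (FObj (GSig W) a))
          (NComp (GZeta (GDom2 (HComp GCwF \<beta> \<alpha>))) a) =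
         Comp (gU W'') (NComp (GZeta (GCod2 (HComp GCwF \<beta> \<alpha>))) a)
          (FArr (GSig W'') (NComp (GPhid (HComp GCwF \<beta> \<alpha>)) a))"
      using a by (simp add: gcwf_comp1_def)
  qed (use gmorphism_comp1[OF a.M.gmorphism_axioms b.M.gmorphism_axioms]
      gmorphism_comp1[OF a.N.gmorphism_axioms b.N.gmorphism_axioms]
      fib2_hcomp[OF a.a.fib2_axioms b.a.fib2_axioms]
      fib2_hcomp[OF a.d.fib2_axioms b.d.fib2_axioms] in \<open>simp_all, simp_all add: gcwf_comp1_def\<close>)
qed

lemma two_category_GCwF: "two_category (GCwF :: ('u gcwf, 'u gmor, 'u gcell) two_cat)"
proof (rule two_category.intro)
  fix f assume "f \<in> Cell1 (GCwF :: ('u gcwf, 'u gmor, 'u gcell) two_cat)"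
  then have f: "gmorphism (GSrc f) (GTgt f) f" by (simp add: gmorphism_iff)
  show "Src1 GCwF f \<in> Cell0 GCwF" "Tgt1 GCwF f \<in> Cell0 GCwF"
    using gmorphismD[OF f] by simp_all
  show "Id2 GCwF f \<in> Hom2 GCwF f f"
    by (rule Hom2_GCwFI[OF gcell2_id[OF f]]) simp_all
next
  fix \<alpha> assume "\<alpha> \<in> Cell2 (GCwF :: ('u gcwf, 'u gmor, 'u gcell) two_cat)"
  then have a: "gcell2 (GSrc (GDom2 \<alpha>)) (GTgt (GDom2 \<alpha>)) \<alpha>" by (simp add: gcell2_iff)
  show "Src2 GCwF \<alpha> \<in> Cell1 GCwF" "Tgt2 GCwF \<alpha> \<in> Cell1 GCwF"
    "Src1 GCwF (Tgt2 GCwF \<alpha>) = Src1 GCwF (Src2 GCwF \<alpha>)"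
    "Tgt1 GCwF (Tgt2 GCwF \<alpha>) = Tgt1 GCwF (Src2 GCwF \<alpha>)"
    using gcell2D(1,2)[OF a] by (simp_all add: gmorphism_iff)
next
  fix X assume "X \<in> Cell0 (GCwF :: ('u gcwf, 'u gmor, 'u gcell) two_cat)"
  then show "Id1 GCwF X \<in> Hom1 GCwF X X" by (simp add: gmorphism_id1)
next
  fix f g X Y Z
  assume "f \<in> Hom1 (GCwF :: ('u gcwf, 'u gmor, 'u gcell) two_cat) X Y"
    "g \<in> Hom1 GCwF Y Z"
  then have f: "gmorphism X Y f" and g: "gmorphism Y Z g" by simp_all
  show "Comp1 GCwF g f \<in> Hom1 GCwF X Z" using f g by (simp add: gmorphism_comp1)
  show "HComp GCwF (Id2 GCwF g) (Id2 GCwF f) = Id2 GCwF (Comp1 GCwF g f)"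
    using hcomp_nat_id_id[OF gmorphismD(1)[OF f] gmorphismD(1)[OF g]]
      hcomp_nat_id_id[OF gmorphismD(2)[OF f] gmorphismD(2)[OF g]]
      hcomp_nat_id_id[OF gmorphismD(3)[OF f] gmorphismD(3)[OF g]] by (simp add: gcwf_comp1_def)
next
  fix f X Y assume "f \<in> Hom1 (GCwF :: ('u gcwf, 'u gmor, 'u gcell) two_cat) X Y"
  then have f: "gmorphism X Y f" by simp
  show "Comp1 GCwF (Id1 GCwF Y) f = f" "Comp1 GCwF f (Id1 GCwF X) = f"
    using gcwf_comp1_id[OF f] by simp_all
next
  fix f g h W X Y Z assume "f \<in> Hom1 (GCwF :: ('u gcwf, 'u gmor, 'u gcell) two_cat) W X"
    "g \<in> Hom1 GCwF X Y" "h \<in> Hom1 GCwF Y Z"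
  then show "Comp1 GCwF h (Comp1 GCwF g f) = Comp1 GCwF (Comp1 GCwF h g) f"
    by (simp add: gcwf_comp1_assoc)
next
  fix \<alpha> \<beta> f g h assume *: "\<alpha> \<in> Hom2 (GCwF :: ('u gcwf, 'u gmor, 'u gcell) two_cat) f g"
    "\<beta> \<in> Hom2 GCwF g h"
  note a = Hom2_GCwFD[OF *(1)]
  note b = Hom2_GCwFD'[OF *(2) gcell2D(2)[OF a(1), unfolded a(3)]]
  show "VComp GCwF \<beta> \<alpha> \<in> Hom2 GCwF f h"
    by (rule Hom2_GCwFI[OF gcell2_vcomp[OF a(1) b(1)]]) (simp_all add: a b)
next
  fix \<alpha> f g assume *: "\<alpha> \<in> Hom2 (GCwF :: ('u gcwf, 'u gmor, 'u gcell) two_cat) f g"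
  note a = Hom2_GCwFD[OF *] and n = gcell2D(3,4,5)[OF Hom2_GCwFD(1)[OF *]]
  show "VComp GCwF (Id2 GCwF g) \<alpha> = \<alpha>" "VComp GCwF \<alpha> (Id2 GCwF f) = \<alpha>"
    using vcomp_nat_id[OF n(1)] vcomp_nat_id[OF n(2)] vcomp_nat_id[OF n(3)]
        a(2,3) by (auto intro: gcell2_eqI)
next
  fix \<alpha> \<beta> \<gamma> e f g h
  assume *: "\<alpha> \<in> Hom2 (GCwF :: ('u gcwf, 'u gmor, 'u gcell) two_cat) e f"
    "\<beta> \<in> Hom2 GCwF f g" "\<gamma> \<in> Hom2 GCwF g h"
  note a = Hom2_GCwFD[OF *(1)]
  note b = Hom2_GCwFD'[OF *(2) gcell2D(2)[OF a(1), unfolded a(3)]]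
  note c = Hom2_GCwFD'[OF *(3) gcell2D(2)[OF b(1), unfolded b(3)]]
  note n = gcell2D(3,4,5)[OF a(1), unfolded a] gcell2D(3,4,5)[OF b(1), unfolded b]
    gcell2D(3,4,5)[OF c(1), unfolded c]
  show "VComp GCwF \<gamma> (VComp GCwF \<beta> \<alpha>) = VComp GCwF (VComp GCwF \<gamma> \<beta>) \<alpha>"
    using vcomp_nat_assoc[OF n(1,4,7)] vcomp_nat_assoc[OF n(2,5,8)]
      vcomp_nat_assoc[OF n(3,6,9)] by simp
next
  fix f f' g g' \<alpha> \<beta> X Y Z
  assume *: "f \<in> Hom1 (GCwF :: ('u gcwf, 'u gmor, 'u gcell) two_cat) X Y"
    "g \<in> Hom1 GCwF Y Z" "\<alpha> \<in> Hom2 GCwF f f'" "\<beta> \<in> Hom2 GCwF g g'"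
  note a = Hom2_GCwFD'[OF *(3) *(1)[unfolded Hom1_GCwF]]
    and b = Hom2_GCwFD'[OF *(4) *(2)[unfolded Hom1_GCwF]]
  show "HComp GCwF \<beta> \<alpha> \<in> Hom2 GCwF (Comp1 GCwF g f) (Comp1 GCwF g' f')"
    by (rule Hom2_GCwFI[OF gcell2_hcomp[OF a(1) b(1)]]) (simp_all add: a b)
next
  fix f f' \<alpha> X Y
  assume *: "f \<in> Hom1 (GCwF :: ('u gcwf, 'u gmor, 'u gcell) two_cat) X Y"
    "\<alpha> \<in> Hom2 GCwF f f'"
  note a = Hom2_GCwFD'[OF *(2) *(1)[unfolded Hom1_GCwF]]
  note n = gcell2D[OF a(1)]
  show "HComp GCwF (Id2 GCwF (Id1 GCwF Y)) \<alpha> = \<alpha>"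
    using hcomp_nat_id[OF n(3)] hcomp_nat_id[OF n(4)] hcomp_nat_id[OF n(5)] gcwf_comp1_id[OF n(1)]
        gcwf_comp1_id[OF n(2)]
    by (intro gcell2_eqI) (simp_all, simp_all add: gcwf_id1_def)
  show "HComp GCwF \<alpha> (Id2 GCwF (Id1 GCwF X)) = \<alpha>"
    using hcomp_nat_id[OF n(3)] hcomp_nat_id[OF n(4)] hcomp_nat_id[OF n(5)] gcwf_comp1_id[OF n(1)]
        gcwf_comp1_id[OF n(2)]
    by (intro gcell2_eqI) (simp_all, simp_all add: gcwf_id1_def)
next
  fix f f' g g' h h' \<alpha> \<beta> \<gamma> W X Y Z
  assume *: "f \<in> Hom1 (GCwF :: ('u gcwf, 'u gmor, 'u gcell) two_cat) W X"
    "g \<in> Hom1 GCwF X Y" "h \<in> Hom1 GCwF Y Z" "\<alpha> \<in> Hom2 GCwF f f'"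
    "\<beta> \<in> Hom2 GCwF g g'" "\<gamma> \<in> Hom2 GCwF h h'"
  note a = gcell2D[OF Hom2_GCwFD'(1)[OF *(4) *(1)[unfolded Hom1_GCwF]]]
    and b = gcell2D[OF Hom2_GCwFD'(1)[OF *(5) *(2)[unfolded Hom1_GCwF]]]
    and c = gcell2D[OF Hom2_GCwFD'(1)[OF *(6) *(3)[unfolded Hom1_GCwF]]]
  show "HComp GCwF \<gamma> (HComp GCwF \<beta> \<alpha>) = HComp GCwF (HComp GCwF \<gamma> \<beta>) \<alpha>"
    using hcomp_nat_assoc[OF a(3) b(3) c(3)] hcomp_nat_assoc[OF a(4) b(4) c(4)]
      hcomp_nat_assoc[OF a(5) b(5) c(5)]
      gcwf_comp1_assoc[OF a(1) b(1) c(1)] gcwf_comp1_assoc[OF a(2) b(2) c(2)] by simp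
next
  fix f f' f'' g g' g'' \<alpha> \<alpha>' \<beta> \<beta>' X Y Z
  assume *: "f \<in> Hom1 (GCwF :: ('u gcwf, 'u gmor, 'u gcell) two_cat) X Y"
    "g \<in> Hom1 GCwF Y Z" "\<alpha> \<in> Hom2 GCwF f f'" "\<alpha>' \<in> Hom2 GCwF f' f''"
    "\<beta> \<in> Hom2 GCwF g g'" "\<beta>' \<in> Hom2 GCwF g' g''"
  note a = Hom2_GCwFD'[OF *(3) *(1)[unfolded Hom1_GCwF]]
    and b = Hom2_GCwFD'[OF *(5) *(2)[unfolded Hom1_GCwF]]
  note a' = Hom2_GCwFD'[OF *(4) gcell2D(2)[OF a(1), unfolded a]]
    and b' = Hom2_GCwFD'[OF *(6) gcell2D(2)[OF b(1), unfolded b]]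
  note n = gcell2D(3,4,5)[OF a(1), unfolded a] gcell2D(3,4,5)[OF a'(1), unfolded a']
    gcell2D(3,4,5)[OF b(1), unfolded b] gcell2D(3,4,5)[OF b'(1), unfolded b']
  show "HComp GCwF (VComp GCwF \<beta>' \<beta>) (VComp GCwF \<alpha>' \<alpha>) =
    VComp GCwF (HComp GCwF \<beta>' \<alpha>') (HComp GCwF \<beta> \<alpha>)"
    using hcomp_vcomp_interchange[OF n(1,4,7,10)] hcomp_vcomp_interchange[OF n(2,5,8,11)]
      hcomp_vcomp_interchange[OF n(3,6,9,12)] by simp
qed

section \<open>The comprehension category of a generalised category with families\<close>

context generalised_cwf
begin

lemma triangle1:
  assumes a: "a \<in> Obj (gV W)"
  shows "Comp (gU W) (NComp (GEps W) (FObj (GSig W) a)) (FArr (GSig W) (NComp (GEta W) a)) =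
    Ide (gU W) (FObj (GSig W) a)"
proof -
  have "(GEps W \<cdot>\<^sub>r GSig W) \<bullet> (GSig W \<cdot>\<^sub>l GEta W) = id_nat (GSig W)"
    using GAdj by (simp add: adjunction_def)
  from arg_cong[OF this, of "\<lambda>\<alpha>. NComp \<alpha> a"] a show ?thesis by simp
qed

lemma triangle2:
  assumes A: "A \<in> Obj (gU W)"
  shows "Comp (gV W) (FArr (GDel W) (NComp (GEps W) A)) (NComp (GEta W) (FObj (GDel W) A)) =
    Ide (gV W) (FObj (GDel W) A)"
proof -
  have "(GDel W \<cdot>\<^sub>l GEps W) \<bullet> (GEta W \<cdot>\<^sub>r GDel W) = id_nat (GDel W)"
    using GAdj by (simp add: adjunction_def)
  from arg_cong[OF this, of "\<lambda>\<alpha>. NComp \<alpha> A"] A show ?thesis by simp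
qed

lemma eps_natural:
  "f \<in> Arr (gU W) \<Longrightarrow> Dom (gU W) f = x \<Longrightarrow> Cod (gU W) f = y \<Longrightarrow>
    Comp (gU W) (NComp (GEps W) y) (FArr (GSig W) (FArr (GDel W) f)) = Comp (gU W) f (NComp (GEps W) x)"
  using eps.natural[of f x y] by simp

lemma eta_natural:
  "f \<in> Arr (gV W) \<Longrightarrow> Dom (gV W) f = x \<Longrightarrow> Cod (gV W) f = y \<Longrightarrow>
    Comp (gV W) (FArr (GDel W) (FArr (GSig W) f)) (NComp (GEta W) x) = Comp (gV W) (NComp (GEta W) y) f"
  using eta.natural[of f x y] by simp

text \<open>An arrow \<open>h\<close> into \<open>b\<close> is determined by its image under
  \<open>v\<close> and its composite with the cartesian \<eta> at \<open>b\<close>. The first is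
  \<open>u \<Sigma> h\<close>, and the second is \<open>\<Delta> \<Sigma> h\<close> after \<eta> by
  naturality.\<close>

lemma Sig_faithful:
  assumes "h \<in> Arr (gV W)" "k \<in> Arr (gV W)" "Dom (gV W) h = Dom (gV W) k" "Cod (gV W) h = Cod (gV W) k"
    "FArr (GSig W) h = FArr (GSig W) k"
  shows "h = k"
proof (rule v.cart_unique[OF GEta_cartesian[of "Cod (gV W) k"]])
  show "FArr (gv W) h = FArr (gv W) k" using assms Sig_over(1)[of h] Sig_over(1)[of k] by simp
  show "Comp (gV W) (NComp (GEta W) (Cod (gV W) k)) h = Comp (gV W) (NComp (GEta W) (Cod (gV W) k)) k"
    using eta_natural[of h] eta_natural[of k] assms by simp
qed (use assms in simp_all)

text \<open>An arrow into \<open>\<Delta> A\<close> is recovered from its transpose by a triangle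
  identity. Equations between such arrows are regularly verified after \<Sigma> and \<epsilon> in
  this way.\<close>

lemma transpose_unique:
  assumes "k \<in> Arr (gV W)" "k' \<in> Arr (gV W)" "Dom (gV W) k = Dom (gV W) k'" "A \<in> Obj (gU W)"
    "Cod (gV W) k = FObj (GDel W) A" "Cod (gV W) k' = FObj (GDel W) A"
    "Comp (gU W) (NComp (GEps W) A) (FArr (GSig W) k) = Comp (gU W) (NComp (GEps W) A) (FArr (GSig
        W) k')"
  shows "k = k'"
proof -
  have *: "Comp (gV W) (FArr (GDel W) (Comp (gU W) (NComp (GEps W) A) (FArr (GSig W) l)))
    (NComp (GEta W) (Dom (gV W) l)) = l"
    if "l \<in> Arr (gV W)" "Cod (gV W) l = FObj (GDel W) A" for l
    using that assms(4) eta_natural[OF that(1) refl that(2)]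
      v.C.reassoc[OF triangle2[OF assms(4)], of l] by simp
  show ?thesis using *[of k] *[of k'] assms by simp
qed

text \<open>Naturality writes \<open>\<eta> k\<close> as the isomorphism
  \<open>\<Delta> \<Sigma> k\<close> after the cartesian \<eta>, so \<open>k\<close> is cartesian by
  cancellation; over the base it is \<open>u \<Sigma> k\<close>, which is invertible.\<close>

lemma Sig_conservative:
  assumes k: "k \<in> Arr (gV W)" and i: "is_iso (gU W) (FArr (GSig W) k)"
  shows "is_iso (gV W) k"
proof (rule v.cart_over_iso)
  have "cartesian (gv W) (Comp (gV W) (FArr (GDel W) (FArr (GSig W) k)) (NComp (GEta W) (Dom (gV W)
      k)))"
    using k by (intro v.cart_comp[OF GEta_cartesian v.cart_iso[OF Del.iso[OF i]]]) simp_all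
  then show "cartesian (gv W) k"
    using k by - (rule v.cart_cancel[OF GEta_cartesian[of "Cod (gV W) k"]], simp_all add: eta_natural)
  show "is_iso (gB W) (FArr (gv W) k)" using u.iso[OF i] k by simp
qed

lemma v_lift [simp]:
  assumes "e \<in> Obj (gV W)" "w \<in> Arr (gB W)" "Cod (gB W) w = FObj (gv W) e"
  shows "cartesian (gv W) (Lift (GUd W) w e)" "Lift (GUd W) w e \<in> Arr (gV W)"
    "Cod (gV W) (Lift (GUd W) w e) = e" "FArr (gv W) (Lift (GUd W) w e) = w"
    "FObj (gv W) (Dom (gV W) (Lift (GUd W) w e)) = Dom (gB W) w"
  using v.lift[of e w] assms by simp_all

text \<open>By naturality of \<epsilon> it is the factor of the cartesian
  \<open>f \<epsilon>\<close> through the cartesian \<epsilon>. Unlike the statement on \<Delta>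
  alone, this needs no pullbacks.\<close>

lemma Sig_Del_cartesian:
  assumes "cartesian (gu W) f" shows "cartesian (gu W) (FArr (GSig W) (FArr (GDel W) f))"
proof (rule u.cart_cancel[OF GEps_cartesian[of "Cod (gU W) f"]])
  have f: "f \<in> Arr (gU W)" using assms by (rule u.cart_arr)
  then show "cartesian (gu W) (Comp (gU W) (NComp (GEps W) (Cod (gU W) f)) (FArr (GSig W) (FArr
      (GDel W) f)))"
    using assms by (simp add: eps_natural u.cart_comp GEps_cartesian)
qed (use u.cart_arr[OF assms] in simp_all)

text \<open>Given a cone \<open>x\<close>, \<open>y\<close> in the base, let \<open>l\<close> be the
  cartesian lift of \<open>x\<close> into \<open>\<Delta> A'\<close>. Its transpose factors through
  \<open>f\<close> over \<open>y\<close>, and the transpose of that factor lies over the mediating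
  arrow. Uniqueness cannot appeal to cartesianness of \<open>\<Delta> f\<close>, which is derived
  from this lemma; instead, all mediating arrows are realised by arrows out of one source, with the
  same composite \<open>l\<close> with \<open>\<Delta> f\<close>.\<close>

lemma is_pullback_eps:
  assumes f: "cartesian (gu W) f" "Dom (gU W) f = A" "Cod (gU W) f = A'"
  shows "is_pullback (gB W) (FArr (gu W) (NComp (GEps W) A), FArr (gu W) (NComp (GEps W) A'),
    FArr (gv W) (FArr (GDel W) f), FArr (gu W) f)"
proof (rule is_pullbackI)
  have fU [simp]: "f \<in> Arr (gU W)" using f(1) by (rule u.cart_arr)
  have [simp]: "A \<in> Obj (gU W)" "A' \<in> Obj (gU W)" using fU f u.C.Dom_in u.C.Cod_in by metis+
  note [simp] = f(2,3)
  have sq: "Comp (gB W) (FArr (gu W) (NComp (GEps W) A')) (FArr (gv W) (FArr (GDel W) f)) =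
      Comp (gB W) (FArr (gu W) f) (FArr (gu W) (NComp (GEps W) A))"
    using u.comp_eq2[OF eps_natural[OF fU f(2,3)]] by simp
  then show "(FArr (gu W) (NComp (GEps W) A), FArr (gu W) (NComp (GEps W) A'),
    FArr (gv W) (FArr (GDel W) f), FArr (gu W) f) \<in> Arr (arrow_cat (gB W))" by simp
  {
    fix x y assume xy: "x \<in> Arr (gB W)" "y \<in> Arr (gB W)" "Dom (gB W) x = Dom (gB W) y"
      "Cod (gB W) x = Dom (gB W) (FArr (gu W) (NComp (GEps W) A'))"
      "Cod (gB W) y = Cod (gB W) (FArr (gu W) (NComp (GEps W) A))"
      "Comp (gB W) (FArr (gu W) (NComp (GEps W) A')) x = Comp (gB W) (FArr (gu W) f) y"
    define l where "l = Lift (GUd W) x (FObj (GDel W) A')"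
    have l: "l \<in> Arr (gV W)" "Cod (gV W) l = FObj (GDel W) A'" "FArr (gv W) l = x"
      "FObj (gv W) (Dom (gV W) l) = Dom (gB W) x"
      using xy by (simp_all add: l_def)
    obtain m where m: "m \<in> Arr (gU W)" "Dom (gU W) m = FObj (GSig W) (Dom (gV W) l)" "Cod (gU W) m = A"
      "FArr (gu W) m = y" "Comp (gU W) f m = Comp (gU W) (NComp (GEps W) A') (FArr (GSig W) l)"
      by (rule u.cart_ex[OF f(1), of "Comp (gU W) (NComp (GEps W) A') (FArr (GSig W) l)" y])
        (use l xy in simp_all)
    \<comment> \<open>The transpose of \<open>m\<close> under the adjunction; \<open>ek\<close>
      transposes it back.\<close>
    define k where "k = Comp (gV W) (FArr (GDel W) m) (NComp (GEta W) (Dom (gV W) l))"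
    have k: "k \<in> Arr (gV W)" "Dom (gV W) k = Dom (gV W) l" "Cod (gV W) k = FObj (GDel W) A"
      using m l by (simp_all add: k_def)
    have ek: "Comp (gU W) (NComp (GEps W) A) (FArr (GSig W) k) = m"
      using m l u.C.reassoc2[OF eps_natural[OF m(1,2,3)], of "FArr (GSig W) (NComp (GEta W) (Dom (gV
          W) l))"]
        triangle1[of "Dom (gV W) l"]
      by (simp add: k_def)
    have "Comp (gV W) (FArr (GDel W) f) k = l"
    proof (rule transpose_unique[of _ _ A'])
      have "Comp (gU W) (NComp (GEps W) A') (Comp (gU W) (FArr (GSig W) (FArr (GDel W) f)) (FArr
          (GSig W) k))
        = Comp (gU W) f (Comp (gU W) (NComp (GEps W) A) (FArr (GSig W) k))"
        using k by (intro u.C.reassoc2[OF eps_natural]) simp_all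
      then show "Comp (gU W) (NComp (GEps W) A') (FArr (GSig W) (Comp (gV W) (FArr (GDel W) f) k)) =
        Comp (gU W) (NComp (GEps W) A') (FArr (GSig W) l)"
        using k m(5) ek by simp
    qed (use k l in simp_all)
    then have "Comp (gB W) (FArr (gv W) (FArr (GDel W) f)) (FArr (gv W) k) = x"
      using v.comp_eq[of "FArr (GDel W) f" k l] k l by simp
    moreover have "Comp (gB W) (FArr (gu W) (NComp (GEps W) A)) (FArr (gv W) k) = y"
      using u.comp_eq[OF ek] k m(4) by simp
    ultimately show "\<exists>m. m \<in> Arr (gB W) \<and> Dom (gB W) m = Dom (gB W) y \<and>
      Cod (gB W) m = Dom (gB W) (FArr (gu W) (NComp (GEps W) A)) \<and>
      Comp (gB W) (FArr (gv W) (FArr (GDel W) f)) m = x \<and>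
      Comp (gB W) (FArr (gu W) (NComp (GEps W) A)) m = y"
      using k l xy by (intro exI[of _ "FArr (gv W) k"]) simp
  next
    fix n n' assume n: "n \<in> Arr (gB W)" and n': "n' \<in> Arr (gB W)" and d: "Dom (gB W) n = Dom (gB W) n'"
      and c: "Cod (gB W) n = Dom (gB W) (FArr (gu W) (NComp (GEps W) A))"
        "Cod (gB W) n' = Dom (gB W) (FArr (gu W) (NComp (GEps W) A))"
      and x: "Comp (gB W) (FArr (gv W) (FArr (GDel W) f)) n =
          Comp (gB W) (FArr (gv W) (FArr (GDel W) f)) n'"
      and y: "Comp (gB W) (FArr (gu W) (NComp (GEps W) A)) n =
          Comp (gB W) (FArr (gu W) (NComp (GEps W) A)) n'"
    define x where "x = Comp (gB W) (FArr (gv W) (FArr (GDel W) f)) n'"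
    define l where "l = Lift (GUd W) x (FObj (GDel W) A')"
    have X: "x \<in> Arr (gB W)" "Dom (gB W) x = Dom (gB W) n'" "Cod (gB W) x =
        FObj (gv W) (FObj (GDel W) A')"
      using n' c by (simp_all add: x_def)
    have l: "cartesian (gv W) l" "l \<in> Arr (gV W)" "Cod (gV W) l = FObj (GDel W) A'" "FArr (gv W) l = x"
      "FObj (gv W) (Dom (gV W) l) = Dom (gB W) n'"
      using X by (simp_all add: l_def)
    text \<open>The cartesian lifts of \<open>n\<close> and \<open>l\<close> differ by a vertical arrow that \<open>\<Sigma>\<close> inverts.\<close>
    have *: "\<exists>k. k \<in> Arr (gV W) \<and> Dom (gV W) k = Dom (gV W) l \<and> Cod (gV W) k = FObj (GDel W) A \<and>
        FArr (gv W) k = n \<and> Comp (gV W) (FArr (GDel W) f) k = l"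
      if n: "n \<in> Arr (gB W)" "Dom (gB W) n = Dom (gB W) n'" "Cod (gB W) n =
          FObj (gv W) (FObj (GDel W) A)"
        and x: "Comp (gB W) (FArr (gv W) (FArr (GDel W) f)) n = x" for n
    proof -
      define r where "r = Lift (GUd W) n (FObj (GDel W) A)"
      have r: "cartesian (gv W) r" "r \<in> Arr (gV W)" "Cod (gV W) r = FObj (GDel W) A" "FArr (gv W) r = n"
        "FObj (gv W) (Dom (gV W) r) = Dom (gB W) n'"
        using n by (simp_all add: r_def)
      obtain s where s: "s \<in> Arr (gV W)" "Dom (gV W) s = Dom (gV W) r" "Cod (gV W) s = Dom (gV W) l"
        "FArr (gv W) s = Ide (gB W) (Dom (gB W) n')" "Comp (gV W) l s = Comp (gV W) (FArr (GDel W) f) r"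
        by (rule v.cart_ex[OF l(1), of "Comp (gV W) (FArr (GDel W) f) r" "Ide (gB W) (Dom (gB W) n')"])
          (use l r X x n' in simp_all)
      \<comment> \<open>Both \<open>\<Sigma> l\<close> and \<open>\<Sigma> (l s)\<close> are
        cartesian; the latter is \<open>\<Sigma> \<Delta> f\<close> after \<open>\<Sigma> r\<close>,
        and \<open>\<Sigma> \<Delta>\<close> is known to preserve cartesian arrows even though
        \<Delta> is not yet.\<close>
      have "cartesian (gu W) (FArr (GSig W) s)"
      proof (rule u.cart_cancel[OF GSig_cartesian[OF l(1)]])
        have "cartesian (gu W) (Comp (gU W) (FArr (GSig W) (FArr (GDel W) f)) (FArr (GSig W) r))"
          using r by (intro u.cart_comp[OF GSig_cartesian[OF r(1)] Sig_Del_cartesian[OF f(1)]]) simp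
        then show "cartesian (gu W) (Comp (gU W) (FArr (GSig W) l) (FArr (GSig W) s))"
          using Sig.comp_eq2[OF s(5)] s l r by simp
      qed (use s l in simp_all)
      then have "is_iso (gU W) (FArr (GSig W) s)"
        by (rule u.cart_over_iso) (use s n' in simp)
      then have si: "is_iso (gV W) s" by (rule Sig_conservative[OF s(1)])
      define k where "k = Comp (gV W) r (inv_arr (gV W) s)"
      have i: "inv_arr (gV W) s \<in> Arr (gV W)" "Dom (gV W) (inv_arr (gV W) s) = Dom (gV W) l"
        "Cod (gV W) (inv_arr (gV W) s) = Dom (gV W) r"
        using si s by simp_all
      have "FArr (gv W) (inv_arr (gV W) s) =
          Comp (gB W) (Ide (gB W) (Dom (gB W) n')) (FArr (gv W) (inv_arr (gV W) s))"
        by (rule u.D.comp_ide_left[symmetric]) (simp_all add: i r(5))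
      also have "\<dots> = FArr (gv W) (Ide (gV W) (Cod (gV W) s))"
        unfolding s(4)[symmetric] by (rule v.comp_eq[OF v.C.inv_arr(5)[OF si]]) (simp_all add: i s(1-3))
      also have "\<dots> = Ide (gB W) (Dom (gB W) n')"
        by (simp add: s(3) l(2,5))
      finally have "FArr (gv W) (inv_arr (gV W) s) = Ide (gB W) (Dom (gB W) n')" .
      then have "FArr (gv W) k = n" using r s n si by (simp add: k_def)
      moreover have "Comp (gV W) (FArr (GDel W) f) k = l"
        using v.C.reassoc2[OF s(5)[symmetric], of "inv_arr (gV W) s"] s r l si by (simp add: k_def)
      ultimately show ?thesis using r s si by (intro exI[of _ k]) (simp add: k_def)
    qed
    obtain k where k: "k \<in> Arr (gV W)" "Dom (gV W) k = Dom (gV W) l" "Cod (gV W) k = FObj (GDel W) A"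
        "FArr (gv W) k = n" "Comp (gV W) (FArr (GDel W) f) k = l"
      using *[of n] n d c x by (auto simp: x_def)
    obtain k' where k': "k' \<in> Arr (gV W)" "Dom (gV W) k' = Dom (gV W) l" "Cod (gV W) k' =
        FObj (GDel W) A"
        "FArr (gv W) k' = n'" "Comp (gV W) (FArr (GDel W) f) k' = l"
      using *[of n'] n' d c x by (auto simp: x_def)
    have fe: "Comp (gU W) f (Comp (gU W) (NComp (GEps W) A) (FArr (GSig W) h)) =
        Comp (gU W) (NComp (GEps W) A') (FArr (GSig W) l)"
      if "h \<in> Arr (gV W)" "Cod (gV W) h = FObj (GDel W) A" "Comp (gV W) (FArr (GDel W) f) h = l" for h
      using u.C.reassoc2[OF eps_natural[OF fU f(2,3)], of "FArr (GSig W) h"] that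
        Sig.comp_eq[OF that(3)] by simp
    \<comment> \<open>The transposes of \<open>k\<close> and \<open>k'\<close> lie over the same
      base arrow by \<open>y\<close> and become equal after the cartesian \<open>f\<close> by
      \<open>fe\<close>.\<close>
    have "k = k'"
    proof (rule transpose_unique[of _ _ A], goal_cases)
      case 7
      show ?case
        by (rule u.cart_unique[OF f(1)]) (use k k' fe[of k] fe[of k'] y in simp_all)
    qed (use k k' in simp_all)
    then show "n = n'" using k(4) k'(4) by simp
  }
qed

text \<open>The factorisation is again a transpose, but nothing in the axioms says what lies under
  it; the pullback square supplies that it lies over \<open>w\<close>. Uniqueness is cartesianness
  of \<open>f\<close>, applied to transposes.\<close>

lemma Del_cartesian:
  assumes f: "cartesian (gu W) f" shows "cartesian (gv W) (FArr (GDel W) f)"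
proof (rule v.cartesianI)
  define A where "A = Dom (gU W) f"
  define A' where "A' = Cod (gU W) f"
  have fU [simp]: "f \<in> Arr (gU W)" using f by (rule u.cart_arr)
  have [simp]: "A \<in> Obj (gU W)" "A' \<in> Obj (gU W)" using A_def A'_def u.C.Dom_in u.C.Cod_in by simp_all
  have DC [simp]: "Dom (gU W) f = A" "Cod (gU W) f = A'" by (simp_all add: A_def A'_def)
  note pb = is_pullback_eps[OF f DC]
  have fe: "Comp (gU W) (NComp (GEps W) A') (FArr (GSig W) (Comp (gV W) (FArr (GDel W) f) h)) =
      Comp (gU W) f (Comp (gU W) (NComp (GEps W) A) (FArr (GSig W) h))"
    if "h \<in> Arr (gV W)" "Cod (gV W) h = FObj (GDel W) A" for h
    using u.C.reassoc2[OF eps_natural[OF fU DC], of "FArr (GSig W) h"] that by simp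
  show "FArr (GDel W) f \<in> Arr (gV W)" by simp
  {
    fix g w assume g: "g \<in> Arr (gV W)" and w: "w \<in> Arr (gB W)" "Dom (gB W) w =
        FObj (gv W) (Dom (gV W) g)"
      "Cod (gB W) w = FObj (gv W) (Dom (gV W) (FArr (GDel W) f))" "Cod (gV W) g =
          Cod (gV W) (FArr (GDel W) f)"
      "Comp (gB W) (FArr (gv W) (FArr (GDel W) f)) w = FArr (gv W) g"
    have sq: "Comp (gB W) (FArr (gu W) (NComp (GEps W) A')) (FArr (gv W) g) =
        Comp (gB W) (FArr (gu W) f) (Comp (gB W) (FArr (gu W) (NComp (GEps W) A)) w)"
      using u.D.reassoc2[OF u.comp_eq2[OF eps_natural[OF fU DC]], of w] w by simp
    obtain m where m: "m \<in> Arr (gU W)" "Dom (gU W) m = FObj (GSig W) (Dom (gV W) g)" "Cod (gU W) m = A"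
      "FArr (gu W) m = Comp (gB W) (FArr (gu W) (NComp (GEps W) A)) w"
      "Comp (gU W) f m = Comp (gU W) (NComp (GEps W) A') (FArr (GSig W) g)"
      by (rule u.cart_ex[OF f, of "Comp (gU W) (NComp (GEps W) A') (FArr (GSig W) g)"
            "Comp (gB W) (FArr (gu W) (NComp (GEps W) A)) w"])
        (use g w sq in simp_all)
    define k where "k = Comp (gV W) (FArr (GDel W) m) (NComp (GEta W) (Dom (gV W) g))"
    have k: "k \<in> Arr (gV W)" "Dom (gV W) k = Dom (gV W) g" "Cod (gV W) k = FObj (GDel W) A"
      using m g by (simp_all add: k_def)
    have ek: "Comp (gU W) (NComp (GEps W) A) (FArr (GSig W) k) = m"
      using m g u.C.reassoc2[OF eps_natural[OF m(1,2,3)], of "FArr (GSig W) (NComp (GEta W) (Dom (gV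
          W) g))"]
        triangle1[of "Dom (gV W) g"]
      by (simp add: k_def)
    have fk: "Comp (gV W) (FArr (GDel W) f) k = g"
      by (rule transpose_unique[of _ _ A']) (use k g w m(5) fe[of k] ek in simp_all)
    \<comment> \<open>Both arrows mediate for the same cone.\<close>
    have "FArr (gv W) k = w"
    proof (rule u.D.pullback_unique[OF pb])
      show "Comp (gB W) (FArr (gv W) (FArr (GDel W) f)) (FArr (gv W) k) =
        Comp (gB W) (FArr (gv W) (FArr (GDel W) f)) w"
        using v.comp_eq[OF fk] k w by simp
      show "Comp (gB W) (FArr (gu W) (NComp (GEps W) A)) (FArr (gv W) k) =
        Comp (gB W) (FArr (gu W) (NComp (GEps W) A)) w"
        using u.comp_eq[OF ek] k m(4) by simp
    qed (use k w g in simp_all)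
    with k fk show "\<exists>h. h \<in> Arr (gV W) \<and> Dom (gV W) h = Dom (gV W) g \<and>
      Cod (gV W) h = Dom (gV W) (FArr (GDel W) f) \<and> FArr (gv W) h = w \<and>
      Comp (gV W) (FArr (GDel W) f) h = g" by (intro exI[of _ k]) simp
  next
    fix h k assume hk: "h \<in> Arr (gV W)" "k \<in> Arr (gV W)" "Dom (gV W) h = Dom (gV W) k"
      "Cod (gV W) h = Dom (gV W) (FArr (GDel W) f)" "Cod (gV W) k = Dom (gV W) (FArr (GDel W) f)"
      "FArr (gv W) h = FArr (gv W) k"
      "Comp (gV W) (FArr (GDel W) f) h = Comp (gV W) (FArr (GDel W) f) k"
    show "h = k"
    proof (rule transpose_unique[of _ _ A], goal_cases)
      case 7
      show ?case
        by (rule u.cart_unique[OF f]) (use hk fe[of h] fe[of k] in simp_all)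
    qed (use hk in simp_all)
  }
qed

text \<open>By naturality \<open>\<eta> f\<close> is \<open>\<Delta> \<Sigma> f\<close> after
  \<eta>, a composite of cartesian arrows now that \<Delta> preserves them; the outer \<eta> is
  cancelled.\<close>

lemma Sig_reflects_cartesian:
  assumes f: "f \<in> Arr (gV W)" and c: "cartesian (gu W) (FArr (GSig W) f)"
  shows "cartesian (gv W) f"
proof (rule v.cart_cancel[OF GEta_cartesian[of "Cod (gV W) f"]])
  show "cartesian (gv W) (Comp (gV W) (NComp (GEta W) (Cod (gV W) f)) f)"
    using f v.cart_comp[OF GEta_cartesian[of "Dom (gV W) f"] Del_cartesian[OF c]]
    by (simp add: eta_natural)
qed (use f in simp_all)

end

text \<open>The section of the display map of \<open>\<Sigma> a\<close> that the term
  \<open>a\<close> names; \<open>eps_gsig\<close> is the section property.\<close>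

definition gsig :: "'u gcwf \<Rightarrow> 'u \<Rightarrow> 'u" where "gsig W a = FArr (gv W) (NComp (GEta W) a)"

context generalised_cwf
begin

lemma eps_transpose:
  assumes c: "c \<in> Obj (gV W)" and m: "m \<in> Arr (gU W)" "Dom (gU W) m = FObj (GSig W) c"
      "Cod (gU W) m = A"
  shows "Comp (gU W) (NComp (GEps W) A)
    (FArr (GSig W) (Comp (gV W) (FArr (GDel W) m) (NComp (GEta W) c))) = m"
proof -
  have "A \<in> Obj (gU W)" using m by auto
  then show ?thesis
    using u.C.reassoc2[OF eps_natural[OF m], of "FArr (GSig W) (NComp (GEta W) c)"] triangle1[OF c] c m
    by simp
qed

lemma gsig [simp]:
  assumes "a \<in> Obj (gV W)"
  shows "gsig W a \<in> Arr (gB W)" "Dom (gB W) (gsig W a) = FObj (gv W) a"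
    "Cod (gB W) (gsig W a) = FObj (gv W) (FObj (GDel W) (FObj (GSig W) a))"
  using assms by (simp_all add: gsig_def)

lemma eps_gsig:
  assumes "a \<in> Obj (gV W)"
  shows "Comp (gB W) (FArr (gu W) (NComp (GEps W) (FObj (GSig W) a))) (gsig W a) =
    Ide (gB W) (FObj (gv W) a)"
  using u.comp_eq[OF triangle1[OF assms]] assms by (simp add: gsig_def)

lemma gsig_natural:
  assumes "f \<in> Arr (gV W)" "Dom (gV W) f = x" "Cod (gV W) f = y"
  shows "Comp (gB W) (FArr (gv W) (FArr (GDel W) (FArr (GSig W) f))) (gsig W x) =
    Comp (gB W) (gsig W y) (FArr (gv W) f)"
  using v.comp_eq2[OF eta_natural[OF assms]] assms by (auto simp: gsig_def)

text \<open>\<open>\<Sigma>\<close> identifies \<open>gV W\<close> with a full subcategory of the category of pairs of an object \<open>A\<close> and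
  a section of \<open>u \<epsilon>\<^sub>A\<close>.\<close>

lemma Sig_lift:
  assumes a: "a \<in> Obj (gV W)" and b: "b \<in> Obj (gV W)" and m: "m \<in> Arr (gU W)"
    "Dom (gU W) m = FObj (GSig W) a" "Cod (gU W) m = FObj (GSig W) b"
    and s: "Comp (gB W) (FArr (gv W) (FArr (GDel W) m)) (gsig W a) =
        Comp (gB W) (gsig W b) (FArr (gu W) m)"
  obtains k where "k \<in> Arr (gV W)" "Dom (gV W) k = a" "Cod (gV W) k = b" "FArr (GSig W) k = m"
proof -
  \<comment> \<open>A lift through the cartesian unit at \<open>b\<close>: the hypothesis on the
    sections is exactly the equation required over the base. That \<Sigma> returns \<open>m\<close>
    is then seen by inserting a triangle identity.\<close>
  obtain k where k: "k \<in> Arr (gV W)" "Dom (gV W) k = a" "Cod (gV W) k = b"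
    "FArr (gv W) k = FArr (gu W) m"
    "Comp (gV W) (NComp (GEta W) b) k = Comp (gV W) (FArr (GDel W) m) (NComp (GEta W) a)"
    by (rule v.cart_ex[OF GEta_cartesian[OF b], of "Comp (gV W) (FArr (GDel W) m) (NComp (GEta W) a)"
          "FArr (gu W) m"]) (use a b m s in \<open>simp_all add: gsig_def\<close>)
  have "FArr (GSig W) k = Comp (gU W) (NComp (GEps W) (FObj (GSig W) b))
      (Comp (gU W) (FArr (GSig W) (NComp (GEta W) b)) (FArr (GSig W) k))"
    using u.C.reassoc[OF triangle1[OF b], of "FArr (GSig W) k"] k b by simp
  also have "\<dots> = Comp (gU W) (NComp (GEps W) (FObj (GSig W) b))
      (Comp (gU W) (FArr (GSig W) (FArr (GDel W) m)) (FArr (GSig W) (NComp (GEta W) a)))"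
    using Sig.comp_eq2[OF k(5)] a b k m by simp
  also have "\<dots> = Comp (gU W) m
      (Comp (gU W) (NComp (GEps W) (FObj (GSig W) a)) (FArr (GSig W) (NComp (GEta W) a)))"
    by (rule u.C.reassoc2[OF eps_natural[OF m]]) (use a b m in simp_all)
  also have "\<dots> = m" using triangle1[OF a] m by simp
  finally show ?thesis using that k by blast
qed

end

section \<open>The comprehension category of a generalised category with families\<close>

definition GO :: "'u gcwf \<Rightarrow> 'u compcat" where
  "GO W = \<lparr>CFib = GU W, CChi = mk_chi (GU W) (\<lambda>A. FArr (gu W) (NComp (GEps W) A))
     (\<lambda>f. FArr (gv W) (FArr (GDel W) f))\<rparr>"

lemma CFib_GO [simp]: "CFib (GO W) = GU W"
  by (simp add: GO_def)

context generalised_cwf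
begin

lemma comprehension_category_GO: "comprehension_category (GO W)"
  unfolding GO_def
proof (rule comprehension_categoryI)
  fix f assume "f \<in> Arr (gU W)"
  then show "FArr (gv W) (FArr (GDel W) f) \<in> Arr (gB W) \<and>
      Dom (gB W) (FArr (gv W) (FArr (GDel W) f)) = Dom (gB W) (FArr (gu W) (NComp (GEps W) (Dom (gU
          W) f))) \<and>
      Cod (gB W) (FArr (gv W) (FArr (GDel W) f)) = Dom (gB W) (FArr (gu W) (NComp (GEps W) (Cod (gU
          W) f))) \<and>
      Comp (gB W) (FArr (gu W) (NComp (GEps W) (Cod (gU W) f))) (FArr (gv W) (FArr (GDel W) f)) =
      Comp (gB W) (FArr (gu W) f) (FArr (gu W) (NComp (GEps W) (Dom (gU W) f)))"
    using u.comp_eq2[OF eps_natural[of f]] by simp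
next
  fix f assume "cartesian (gu W) f"
  then show "is_pullback (gB W) (FArr (gu W) (NComp (GEps W) (Dom (gU W) f)),
     FArr (gu W) (NComp (GEps W) (Cod (gU W) f)), FArr (gv W) (FArr (GDel W) f), FArr (gu W) f)"
    by (intro is_pullback_eps) simp_all
qed (simp_all add: GU_fibration)

lemma GO_simps [simp]:
  "A \<in> Obj (gU W) \<Longrightarrow> dp (GO W) A = FArr (gu W) (NComp (GEps W) A)"
  "A \<in> Obj (gU W) \<Longrightarrow> ext (GO W) A = FObj (gv W) (FObj (GDel W) A)"
  "f \<in> Arr (gU W) \<Longrightarrow> q (GO W) f = FArr (gv W) (FArr (GDel W) f)"
  using mk_chi_simps[OF GO_def[of W]] by simp_all

end

section \<open>Mates and the action of \<open>G\<close> on 1-cells\<close>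

context gmorphism
begin

abbreviation mate :: "'u \<Rightarrow> 'u" where "mate \<equiv> NComp (gcwf_mate M)"

lemma mate_eq:
  "A \<in> Obj (gU W) \<Longrightarrow> mate A =
    Comp (gV W') (FArr (GDel W') (Comp (gU W') (FArr (GH M) (NComp (GEps W) A))
      (NComp (GZeta M) (FObj (GDel W) A)))) (NComp (GEta W') (FObj (GHd M) (FObj (GDel W) A)))"
  by (simp add: gcwf_mate_def GSrc GTgt)

lemma mate [simp]:
  assumes "A \<in> Obj (gU W)"
  shows "mate A \<in> Arr (gV W')" "Dom (gV W') (mate A) = FObj (GHd M) (FObj (GDel W) A)"
    "Cod (gV W') (mate A) = FObj (GDel W') (FObj (GH M) A)"
  using assms by (simp_all add: mate_eq)

text \<open>Identifies the mate as the transpose of \<open>H \<epsilon>\<close> after \<zeta>.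
  Together with \<open>transpose_unique\<close> it replaces the explicit formula.\<close>

lemma eps_mate:
  assumes A: "A \<in> Obj (gU W)"
  shows "Comp (gU W') (NComp (GEps W') (FObj (GH M) A)) (FArr (GSig W') (mate A)) =
    Comp (gU W') (FArr (GH M) (NComp (GEps W) A)) (NComp (GZeta M) (FObj (GDel W) A))"
proof -
  show ?thesis unfolding mate_eq[OF A] by (rule W'.eps_transpose) (use A in simp_all)
qed

lemma mate_natural:
  assumes f: "f \<in> Arr (gU W)" "Dom (gU W) f = x" "Cod (gU W) f = y"
  shows "Comp (gV W') (FArr (GDel W') (FArr (GH M) f)) (mate x) =
    Comp (gV W') (mate y) (FArr (GHd M) (FArr (GDel W) f))"
proof (rule W'.transpose_unique[of _ _ "FObj (GH M) y"], goal_cases)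
  have [simp]: "x \<in> Obj (gU W)" "y \<in> Obj (gU W)" using f by auto
  case 7
  have "Comp (gU W') (NComp (GEps W') (FObj (GH M) y))
      (FArr (GSig W') (Comp (gV W') (FArr (GDel W') (FArr (GH M) f)) (mate x))) =
    Comp (gU W') (FArr (GH M) f) (Comp (gU W') (NComp (GEps W') (FObj (GH M) x)) (FArr (GSig W')
        (mate x)))"
    using W'.u.C.reassoc2[OF W'.eps_natural[of "FArr (GH M) f" "FObj (GH M) x" "FObj (GH M) y"],
        of "FArr (GSig W') (mate x)"] f by simp
  also have "\<dots> = Comp (gU W') (FArr (GH M) f) (Comp (gU W') (FArr (GH M) (NComp (GEps W) x))
      (NComp (GZeta M) (FObj (GDel W) x)))" by (simp add: eps_mate)
  also have "\<dots> = Comp (gU W') (FArr (GH M) (NComp (GEps W) y))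
      (Comp (gU W') (FArr (GH M) (FArr (GSig W) (FArr (GDel W) f))) (NComp (GZeta M) (FObj (GDel W)
          x)))"
    by (rule W'.u.C.reassoc2[OF H.E.comp_eq2[OF W.eps_natural[OF f, symmetric]]]) (use f in simp_all)
  also have "\<dots> = Comp (gU W') (FArr (GH M) (NComp (GEps W) y))
      (Comp (gU W') (NComp (GZeta M) (FObj (GDel W) y)) (FArr (GSig W') (FArr (GHd M) (FArr (GDel W)
          f))))"
    using zeta.natural[of "FArr (GDel W) f"] f by simp
  also have "\<dots> = Comp (gU W') (NComp (GEps W') (FObj (GH M) y)) (Comp (gU W') (FArr (GSig W') (mate y))
      (FArr (GSig W') (FArr (GHd M) (FArr (GDel W) f))))"
    by (rule W'.u.C.reassoc2[OF eps_mate[symmetric]]) (use f in simp_all)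
  finally show ?case using f by simp
qed (use f in auto)

text \<open>The companion of \<open>eps_mate\<close> for the unit: both sides transpose to \<zeta>
  at \<open>a\<close>, by a triangle identity of the source and one of the target.\<close>

lemma mate_eta:
  assumes a: "a \<in> Obj (gV W)"
  shows "Comp (gV W') (mate (FObj (GSig W) a)) (FArr (GHd M) (NComp (GEta W) a)) =
    Comp (gV W') (FArr (GDel W') (NComp (GZeta M) a)) (NComp (GEta W') (FObj (GHd M) a))"
proof (rule W'.transpose_unique[of _ _ "FObj (GH M) (FObj (GSig W) a)"], goal_cases)
  case 7
  let ?S = "FObj (GSig W) a" and ?D = "FObj (GDel W) (FObj (GSig W) a)"
  have "Comp (gU W') (NComp (GEps W') (FObj (GH M) ?S)) (FArr (GSig W')
      (Comp (gV W') (mate ?S) (FArr (GHd M) (NComp (GEta W) a)))) =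
    Comp (gU W') (FArr (GH M) (NComp (GEps W) ?S)) (Comp (gU W') (NComp (GZeta M) ?D)
      (FArr (GSig W') (FArr (GHd M) (NComp (GEta W) a))))"
    using W'.u.C.reassoc2[OF eps_mate[of ?S], of "FArr (GSig W') (FArr (GHd M) (NComp (GEta W) a))"]
        a by simp
  also have "\<dots> = Comp (gU W') (FArr (GH M) (NComp (GEps W) ?S))
      (Comp (gU W') (FArr (GH M) (FArr (GSig W) (NComp (GEta W) a))) (NComp (GZeta M) a))"
    using zeta.natural[of "NComp (GEta W) a" a ?D] a by simp
  also have "\<dots> = NComp (GZeta M) a"
    using W'.u.C.reassoc[OF H.E.comp_eq[OF W.triangle1[OF a]], of "NComp (GZeta M) a"] a by simp
  also have "\<dots> = Comp (gU W') (NComp (GZeta M) a) (Comp (gU W')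
      (NComp (GEps W') (FObj (GSig W') (FObj (GHd M) a))) (FArr (GSig W') (NComp (GEta W') (FObj
          (GHd M) a))))"
    using a by (simp add: W'.triangle1)
  also have "\<dots> = Comp (gU W') (NComp (GEps W') (FObj (GH M) ?S))
      (Comp (gU W') (FArr (GSig W') (FArr (GDel W') (NComp (GZeta M) a)))
        (FArr (GSig W') (NComp (GEta W') (FObj (GHd M) a))))"
    by (rule W'.u.C.reassoc2[OF W'.eps_natural[symmetric]]) (use a in simp_all)
  finally show ?case using a by simp
qed (use a in simp_all)

text \<open>Read in the base: the morphism carries the section named by \<open>a\<close> to the
  section named by its image, up to the mate and \<zeta>. This is what allows 2-cells to be lifted
  along \<open>G\<close>.\<close>

lemma mate_gsig:
  assumes a: "a \<in> Obj (gV W)"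
  shows "Comp (gB W') (FArr (gv W') (mate (FObj (GSig W) a))) (FArr (GC M) (gsig W a)) =
    Comp (gB W') (FArr (gv W') (FArr (GDel W') (NComp (GZeta M) a))) (gsig W' (FObj (GHd M) a))"
  using W'.v.comp_eq2[OF mate_eta[OF a]] a by (simp add: gsig_def)

lemma mate_ntrans: "ntrans (gU W) (gV W') (GHd M \<circ>\<^sub>c GDel W) (GDel W' \<circ>\<^sub>c GH M) (gcwf_mate M)"
proof (rule ntransI)
  show "NComp (gcwf_mate M) \<in> extensional (Obj (gU W))"
    using rwhisker_ext[of "GEta W'" "GHd M \<circ>\<^sub>c GDel W"]
    by (simp add: gcwf_mate_def vcomp_nat_def GSrc GTgt)
  show "NDom (gcwf_mate M) = GHd M \<circ>\<^sub>c GDel W"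
    using comp_ftr_id[OF func_comp[OF W.Del.func_axioms Hd.E.func_axioms]]
    by (simp add: gcwf_mate_def GSrc GTgt)
  show "NCod (gcwf_mate M) = GDel W' \<circ>\<^sub>c GH M"
    using comp_ftr_id[OF H.E.func_axioms] by (simp add: gcwf_mate_def GSrc GTgt)
qed (use mate_natural in \<open>auto intro: func_comp W.Del.func_axioms Hd.E.func_axioms
    H.E.func_axioms W'.Del.func_axioms\<close>)

lemma gcwf_pseudo_iff: "gcwf_pseudo M \<longleftrightarrow> (\<forall>A \<in> Obj (gU W). is_iso (gV W') (mate A))"
proof -
  interpret m: ntrans "gU W" "gV W'" "GHd M \<circ>\<^sub>c GDel W" "GDel W' \<circ>\<^sub>c GH M" "gcwf_mate M"
    by (rule mate_ntrans)
  show ?thesis by (simp add: gcwf_pseudo_def nat_iso_def m.nat_trans)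
qed

end

definition GM :: "'u gmor \<Rightarrow> 'u compmor" where
  "GM M = \<lparr>CSrc = GO (GSrc M), CTgt = GO (GTgt M), CBase = GC M, CTot = GH M,
     CZeta = mk_zeta (GO (GSrc M)) (GO (GTgt M)) (GC M) (GH M)
       (\<lambda>A. FArr (gv (GTgt M)) (NComp (gcwf_mate M) A))\<rparr>"

lemma GM_simps [simp]: "CBase (GM M) = GC M" "CTot (GM M) = GH M"
  "CSrc (GM M) = GO (GSrc M)" "CTgt (GM M) = GO (GTgt M)"
  by (simp_all add: GM_def)

context gmorphism
begin

lemma tt_GM [simp]: "A \<in> Obj (gU W) \<Longrightarrow> tt (GM M) A = FArr (gv W') (mate A)"
  using tt_mk_zeta[of "GM M" "GO W" "GO W'" "GC M" "GH M" "\<lambda>A. FArr (gv W') (mate A)" A]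
  by (simp add: GM_def GSrc GTgt)

lemma lax_GM: "lax (GO W) (GO W') (GM M)"
proof (rule laxI)
  show "CZeta (GM M) = mk_zeta (GO W) (GO W') (CBase (GM M)) (CTot (GM M)) (\<lambda>A. FArr (gv W') (mate A))"
    by (simp add: GM_def GSrc GTgt)
  fix A assume "A \<in> Obj (cE (GO W))"
  then have A: "A \<in> Obj (gU W)" by simp
  show "FArr (gv W') (mate A) \<in> Arr (cB (GO W')) \<and>
     Dom (cB (GO W')) (FArr (gv W') (mate A)) = FObj (CBase (GM M)) (ext (GO W) A) \<and>
     Cod (cB (GO W')) (FArr (gv W') (mate A)) = ext (GO W') (FObj (CTot (GM M)) A) \<and>
     Comp (cB (GO W')) (dp (GO W') (FObj (CTot (GM M)) A)) (FArr (gv W') (mate A)) =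
       FArr (CBase (GM M)) (dp (GO W) A)"
    using W'.u.comp_eq2[OF eps_mate[OF A]] A by simp
next
  fix f assume "f \<in> Arr (cE (GO W))"
  then have f: "f \<in> Arr (gU W)" by simp
  show "Comp (cB (GO W')) (q (GO W') (FArr (CTot (GM M)) f)) (FArr (gv W') (mate (Dom (cE (GO W)) f))) =
     Comp (cB (GO W')) (FArr (gv W') (mate (Cod (cE (GO W)) f))) (FArr (CBase (GM M)) (q (GO W) f))"
    using W'.v.comp_eq2[OF mate_natural[OF f refl refl]] f by simp
qed (simp_all add: W.comprehension_category_GO W'.comprehension_category_GO H.fib1_axioms GSrc GTgt)

text \<open>By \<open>eps_mate\<close>, the image of the mate under \<Sigma> followed by \<epsilon>
  is a composite of cartesian arrows, so this image is cartesian by cancellation. It is then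
  invertible as soon as it is so over the base, and \<Sigma> is conservative.\<close>

lemma gcwf_pseudo_iff_tt: "gcwf_pseudo M \<longleftrightarrow> (\<forall>A \<in> Obj (gU W). is_iso (gB W') (FArr (gv W') (mate A)))"
proof -
  have "is_iso (gV W') (mate A)" if A: "A \<in> Obj (gU W)" and i:
      "is_iso (gB W') (FArr (gv W') (mate A))" for A
  proof (rule W'.Sig_conservative)
    have "cartesian (gu W') (Comp (gU W') (FArr (GH M) (NComp (GEps W) A)) (NComp (GZeta M) (FObj
        (GDel W) A)))"
      using A by (intro W'.u.cart_comp[OF W'.u.cart_iso[OF zeta_iso]
          H.cart[OF W.GEps_cartesian]]) simp_all
    then have "cartesian (gu W') (FArr (GSig W') (mate A))"
      using A by - (rule W'.u.cart_cancel[OF W'.GEps_cartesian[of "FObj (GH M) A"]],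
          simp_all add: eps_mate)
    then show "is_iso (gU W') (FArr (GSig W') (mate A))"
      by (rule W'.u.cart_over_iso) (use A i in simp)
  qed (use A in simp)
  then show ?thesis by (auto simp: gcwf_pseudo_iff)
qed

end

section \<open>Pseudo morphisms of comprehension categories\<close>

context category
begin

lemma is_iso_arrow_cat:
  assumes s: "(f, g, h, k) \<in> Arr (arrow_cat C)"
  shows "is_iso (arrow_cat C) (f, g, h, k) \<longleftrightarrow> is_iso C h \<and> is_iso C k"
proof
  interpret A: category "arrow_cat C" by (rule category_arrow_cat) (rule category_axioms)
  {
    assume i: "is_iso (arrow_cat C) (f, g, h, k)"
    obtain a b h' k' where e: "inv_arr (arrow_cat C) (f, g, h, k) = (a, b, h', k')"
      by (cases "inv_arr (arrow_cat C) (f, g, h, k)") auto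
    have t: "(a, b, h', k') \<in> Arr (arrow_cat C)" using A.inv_arr(1)[OF i] e by simp
    have ab: "a = g" "b = f"
      using A.inv_arr(2,3)[OF i] unfolding e arrow_cat_Dom[OF t] arrow_cat_Cod[OF t]
        arrow_cat_Dom[OF s] arrow_cat_Cod[OF s] by simp_all
    note t' = t[unfolded ab]
    have "Comp C h' h = Ide C (Dom C f)" "Comp C k' k = Ide C (Cod C f)"
      "Comp C h h' = Ide C (Dom C g)" "Comp C k k' = Ide C (Cod C g)"
      using A.inv_arr(4,5)[OF i] s t'
      unfolding e ab arrow_cat_Comp[OF s t'] arrow_cat_Comp[OF t' s] arrow_cat_Dom[OF s]
          arrow_cat_Cod[OF s]
      by (simp_all add: arrow_cat_Ide)
    then show "is_iso C h \<and> is_iso C k"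
      using s t' by (intro conjI is_isoI[of h h'] is_isoI[of k k']) simp_all
  next
    assume i: "is_iso C h \<and> is_iso C k"
    then have ih: "is_iso C h" and ik: "is_iso C k" by simp_all
    have sq: "Comp C g h = Comp C k f" using s by simp
    have s': "f \<in> Arr C" "g \<in> Arr C" "h \<in> Arr C" "k \<in> Arr C" "Dom C h = Dom C f" "Cod C h = Dom C g"
      "Dom C k = Cod C f" "Cod C k = Cod C g" using s by simp_all
    have "Comp C f (inv_arr C h) = Comp C (inv_arr C k) (Comp C (Comp C k f) (inv_arr C h))"
      using s' ih ik by simp
    also have "\<dots> = Comp C (inv_arr C k) g"
      unfolding sq[symmetric] using s' ih ik by simp
    finally have t: "(g, f, inv_arr C h, inv_arr C k) \<in> Arr (arrow_cat C)"
      using s ih ik by simp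
    show "is_iso (arrow_cat C) (f, g, h, k)"
    proof (rule A.is_isoI[OF s t])
      show "Comp (arrow_cat C) (g, f, inv_arr C h, inv_arr C k) (f, g, h, k) =
          Ide (arrow_cat C) (Dom (arrow_cat C) (f, g, h, k))"
        unfolding arrow_cat_Comp[OF s t] arrow_cat_Dom[OF s] using s ih ik by (simp add: arrow_cat_Ide)
      show "Comp (arrow_cat C) (f, g, h, k) (g, f, inv_arr C h, inv_arr C k) =
          Ide (arrow_cat C) (Cod (arrow_cat C) (f, g, h, k))"
        unfolding arrow_cat_Comp[OF t s] arrow_cat_Cod[OF s] using s ih ik by (simp add: arrow_cat_Ide)
    qed (simp_all add: arrow_cat_Dom[OF s] arrow_cat_Dom[OF t] arrow_cat_Cod[OF s] arrow_cat_Cod[OF t])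
  }
qed

end

text \<open>The lower side of each square of \<zeta> is an identity, so the square is invertible
  exactly when its upper side is.\<close>

lemma (in lax) comp_pseudo_iff: "comp_pseudo M \<longleftrightarrow> (\<forall>A \<in> Obj (cE X). is_iso (cB Y) (tt M A))"
proof -
  have "nat_trans (CZeta M)"
    using lax_imp_comp_lax_morphism[OF lax_axioms] by (simp add: comp_lax_morphism_def nat_from_to_def)
  moreover have "is_iso (arrow_cat (cB Y)) (FArr (CBase M) (dp X A), dp Y (FObj (CTot M) A), tt M A,
      Ide (cB Y) (FObj (CBase M) (FObj (cp X) A))) \<longleftrightarrow> is_iso (cB Y) (tt M A)"
    if "A \<in> Obj (cE X)" for A
    by (subst Y.p.D.is_iso_arrow_cat) (use that dp_tt[OF that] in simp_all)
  ultimately show ?thesis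
    unfolding comp_pseudo_def nat_iso_def CZeta_eq by (simp add: mk_zeta_def)
qed

section \<open>Functoriality of \<open>G\<close> and its action on 2-cells\<close>

lemma GM_id1:
  assumes "generalised_cwf W" shows "GM (gcwf_id1 W) = comp_id1 (GO W)"
proof -
  interpret W: generalised_cwf W by fact
  interpret I: gmorphism W W "gcwf_id1 W" by (rule gmorphism_id1[OF assms])
  note i = lax_comp_id1[OF W.comprehension_category_GO]
  show ?thesis
  proof (rule lax_eqI[OF I.lax_GM i(1)])
    fix A assume "A \<in> Obj (cE (GO W))"
    then have A: "A \<in> Obj (gU W)" by simp
    have "I.mate A = Ide (gV W) (FObj (GDel W) A)"
      using A W.triangle2[OF A] by (subst I.mate_eq[OF A]) (simp add: gcwf_id1_def)
    then show "tt (GM (gcwf_id1 W)) A = tt (comp_id1 (GO W)) A" using A by (simp add: i(2))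
  qed (simp_all add: gcwf_id1_def comp_id1_def)
qed

text \<open>Mates paste: transposed, both sides become the image of \<epsilon> under both type
  functors, after the two \<zeta>. \<open>eps_mate\<close> is used for \<open>N\<close> and for
  \<open>M\<close>, with naturality of \<zeta> of \<open>N\<close> in between.\<close>

lemma mate_comp1:
  assumes "gmorphism W W' M" "gmorphism W' W'' N" and A: "A \<in> Obj (gU W)"
  shows "NComp (gcwf_mate (gcwf_comp1 N M)) A =
    Comp (gV W'') (NComp (gcwf_mate N) (FObj (GH M) A)) (FArr (GHd N) (NComp (gcwf_mate M) A))"
proof -
  interpret M: gmorphism W W' M by fact
  interpret N: gmorphism W' W'' N by fact
  interpret NM: gmorphism W W'' "gcwf_comp1 N M" by (rule gmorphism_comp1[OF assms(1,2)])
  have c: "GH (gcwf_comp1 N M) = GH N \<circ>\<^sub>c GH M" "GHd (gcwf_comp1 N M) = GHd N \<circ>\<^sub>c GHd M"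
    "a \<in> Obj (gV W) \<Longrightarrow> NComp (GZeta (gcwf_comp1 N M)) a =
      Comp (gU W'') (FArr (GH N) (NComp (GZeta M) a)) (NComp (GZeta N) (FObj (GHd M) a))" for a
    by (simp_all add: gcwf_comp1_def)
  show ?thesis
  proof (rule N.W'.transpose_unique[of _ _ "FObj (GH N) (FObj (GH M) A)"], goal_cases)
    case 7
    let ?D = "FObj (GDel W) A" and ?m = "M.mate A"
    have "Comp (gU W'') (NComp (GEps W'') (FObj (GH N) (FObj (GH M) A))) (Comp (gU W'')
        (FArr (GSig W'') (N.mate (FObj (GH M) A))) (FArr (GSig W'') (FArr (GHd N) ?m)))
      = Comp (gU W'') (FArr (GH N) (NComp (GEps W') (FObj (GH M) A)))
        (Comp (gU W'') (NComp (GZeta N) (FObj (GDel W') (FObj (GH M) A))) (FArr (GSig W'') (FArr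
            (GHd N) ?m)))"
      by (rule N.W'.u.C.reassoc2[OF N.eps_mate]) (use A in simp_all)
    also have "\<dots> = Comp (gU W'') (FArr (GH N) (NComp (GEps W') (FObj (GH M) A)))
        (Comp (gU W'') (FArr (GH N) (FArr (GSig W') ?m)) (NComp (GZeta N) (FObj (GHd M) ?D)))"
      using N.zeta.natural[of ?m] A by simp
    also have "\<dots> = Comp (gU W'') (FArr (GH N) (FArr (GH M) (NComp (GEps W) A)))
        (Comp (gU W'') (FArr (GH N) (NComp (GZeta M) ?D)) (NComp (GZeta N) (FObj (GHd M) ?D)))"
      by (rule N.W'.u.C.reassoc2[OF N.H.E.comp_eq2[OF M.eps_mate]]) (use A in simp_all)
    finally show ?case using NM.eps_mate[OF A] A by (simp add: c)
  qed (use A NM.mate[OF A] in \<open>simp_all add: c\<close>)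
qed

lemma GM_comp1:
  assumes "gmorphism W W' M" "gmorphism W' W'' N"
  shows "GM (gcwf_comp1 N M) = comp_comp1 (GM N) (GM M)"
proof -
  interpret M: gmorphism W W' M by fact
  interpret N: gmorphism W' W'' N by fact
  interpret NM: gmorphism W W'' "gcwf_comp1 N M" by (rule gmorphism_comp1[OF assms])
  note c = lax_comp_comp1[OF M.lax_GM N.lax_GM]
  show ?thesis
  proof (rule lax_eqI[OF NM.lax_GM c(1)])
    fix A assume "A \<in> Obj (cE (GO W))"
    then have A: "A \<in> Obj (gU W)" by simp
    show "tt (GM (gcwf_comp1 N M)) A = tt (comp_comp1 (GM N) (GM M)) A"
      using A by (simp add: c(2) mate_comp1[OF assms])
  qed (simp_all add: gcwf_comp1_def comp_comp1_def)
qed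

definition GC2 :: "'u gcell \<Rightarrow> 'u compcell" where
  "GC2 \<alpha> = \<lparr>CDom2 = GM (GDom2 \<alpha>), CCod2 = GM (GCod2 \<alpha>), CPsi = GPsi \<alpha>, CPhi = GPhi \<alpha>\<rparr>"

lemma GC2_simps [simp]: "CDom2 (GC2 \<alpha>) = GM (GDom2 \<alpha>)" "CCod2 (GC2 \<alpha>) = GM (GCod2 \<alpha>)"
  "CPsi (GC2 \<alpha>) = GPsi \<alpha>" "CPhi (GC2 \<alpha>) = GPhi \<alpha>"
  by (simp_all add: GC2_def)

text \<open>The condition is the shadow of an equation of mates in the term category. That equation
  holds after transposition by naturality of the type part at \<epsilon> and the condition on
  \<alpha> at \<open>\<Delta> A\<close>.\<close>

lemma ccell2_GC2:
  assumes "gcell2 W W' \<alpha>" shows "ccell2 (GO W) (GO W') (GC2 \<alpha>)"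
proof -
  interpret gcell2 W W' \<alpha> by fact
  show ?thesis
  proof (rule ccell2I)
    fix A assume "A \<in> Obj (cE (GO W))"
    then have A: "A \<in> Obj (gU W)" by simp
    let ?D = "FObj (GDel W) A" and ?p = "NComp (GPhi \<alpha>)" and ?d = "NComp (GPhid \<alpha>)"
    let ?z = "NComp (GZeta (GDom2 \<alpha>))" and ?z' = "NComp (GZeta (GCod2 \<alpha>))"
    have "Comp (gV W') (FArr (GDel W') (?p A)) (M.mate A) = Comp (gV W') (N.mate A) (?d ?D)"
    proof (rule M.W'.transpose_unique[of _ _ "FObj (GH (GCod2 \<alpha>)) A"], goal_cases)
      case 7
      have "Comp (gU W') (NComp (GEps W') (FObj (GH (GCod2 \<alpha>)) A))
          (Comp (gU W') (FArr (GSig W') (FArr (GDel W') (?p A))) (FArr (GSig W') (M.mate A)))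
        = Comp (gU W') (?p A)
            (Comp (gU W') (NComp (GEps W') (FObj (GH (GDom2 \<alpha>)) A)) (FArr (GSig W') (M.mate A)))"
        by (rule M.W'.u.C.reassoc2[OF M.W'.eps_natural]) (use A in simp_all)
      also have "\<dots> = Comp (gU W') (?p A) (Comp (gU W') (FArr (GH (GDom2 \<alpha>)) (NComp (GEps W) A)) (?z
          ?D))"
        using A by (simp add: M.eps_mate)
      also have "\<dots> = Comp (gU W') (FArr (GH (GCod2 \<alpha>)) (NComp (GEps W) A))
          (Comp (gU W') (?p (FObj (GSig W) ?D)) (?z ?D))"
        using A by (subst a.phi.natural'[symmetric]) simp_all
      also have "\<dots> = Comp (gU W') (FArr (GH (GCod2 \<alpha>)) (NComp (GEps W) A))
          (Comp (gU W') (?z' ?D) (FArr (GSig W') (?d ?D)))"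
        using A zeta_cell[of ?D] by simp
      also have "\<dots> = Comp (gU W') (NComp (GEps W') (FObj (GH (GCod2 \<alpha>)) A))
          (Comp (gU W') (FArr (GSig W') (N.mate A)) (FArr (GSig W') (?d ?D)))"
        by (rule M.W'.u.C.reassoc2[OF N.eps_mate[symmetric]]) (use A in simp_all)
      finally show ?case using A by simp
    qed (use A in simp_all)
    from M.W'.v.comp_eq2[OF this] A
    show "Comp (cB (GO W')) (q (GO W') (NComp (CPhi (GC2 \<alpha>)) A)) (tt (CDom2 (GC2 \<alpha>)) A) =
         Comp (cB (GO W')) (tt (CCod2 (GC2 \<alpha>)) A) (NComp (CPsi (GC2 \<alpha>)) (ext (GO W) A))"
      by simp
  qed (simp_all add: M.lax_GM N.lax_GM a.fib2_axioms)
qed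

section \<open>Biequivalences from retractions that are locally isomorphisms\<close>

lemma Hom1D: "f \<in> Hom1 K X Y \<Longrightarrow> f \<in> Cell1 K \<and> Src1 K f = X \<and> Tgt1 K f = Y"
  by (simp add: Hom1_def)

lemma Hom2D: "\<alpha> \<in> Hom2 K f g \<Longrightarrow> \<alpha> \<in> Cell2 K \<and> Src2 K \<alpha> = f \<and> Tgt2 K \<alpha> = g"
  by (simp add: Hom2_def)

context two_category
begin

lemma Hom1_self: "f \<in> Cell1 K \<Longrightarrow> f \<in> Hom1 K (Src1 K f) (Tgt1 K f)"
  by (simp add: Hom1_def)

lemma Hom1_Cell0: "f \<in> Hom1 K X Y \<Longrightarrow> X \<in> Cell0 K \<and> Y \<in> Cell0 K"
  using Src1_in Tgt1_in by (auto simp: Hom1_def)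

lemma Hom2_Cell1: "\<alpha> \<in> Hom2 K f g \<Longrightarrow> f \<in> Hom1 K (Src1 K f) (Tgt1 K f) \<and> g \<in> Hom1 K (Src1 K f) (Tgt1 K f)"
  using Src2_in Tgt2_in Src1_Tgt2 Tgt1_Tgt2 by (auto simp: Hom1_def Hom2_def)

lemma Hom2_Hom1: "\<alpha> \<in> Hom2 K f g \<Longrightarrow> f \<in> Hom1 K X Y \<Longrightarrow> g \<in> Hom1 K X Y"
  using Hom2_Cell1[of \<alpha> f g] by (auto simp: Hom1_def)

lemma Id2_Hom2: "f \<in> Hom1 K X Y \<Longrightarrow> Id2 K f \<in> Hom2 K f f"
  using Id2_in by (simp add: Hom1_def)

lemma VComp_Id2: "f \<in> Hom1 K X Y \<Longrightarrow> VComp K (Id2 K f) (Id2 K f) = Id2 K f"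
  using VComp_Id_left[OF Id2_Hom2] .

lemma invertible2_Id2: "f \<in> Hom1 K X Y \<Longrightarrow> invertible2 K (Id2 K f)"
  using Id2_Hom2[of f X Y] VComp_Id2[of f X Y] unfolding invertible2_def
  by (auto simp: Hom2_def intro!: bexI[of _ "Id2 K f"])

end

context two_functor
begin

lemma Map1_Cell1: "f \<in> Cell1 K \<Longrightarrow> Map1 F f \<in> Cell1 L"
  using Map1_in[OF K.Hom1_self] by (simp add: Hom1_def)

end

lemma two_functor_id: "two_category K \<Longrightarrow> two_functor K K id_two_ftr"
  by (simp add: two_functor_def two_functor_axioms_def id_two_ftr_def)

lemma two_functor_comp:
  assumes "two_functor K L F" "two_functor L N G"
  shows "two_functor K N (comp_two_ftr G F)"
proof -
  interpret F: two_functor K L F by fact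
  interpret G: two_functor L N G by fact
  show ?thesis
  proof unfold_locales
    fix f f' g g' \<alpha> \<beta> X Y Z assume *: "f \<in> Hom1 K X Y" "g \<in> Hom1 K Y Z" "\<alpha> \<in> Hom2 K f f'"
        "\<beta> \<in> Hom2 K g g'"
    show "Map2 (comp_two_ftr G F) (HComp K \<beta> \<alpha>) =
      HComp N (Map2 (comp_two_ftr G F) \<beta>) (Map2 (comp_two_ftr G F) \<alpha>)"
      using F.Map2_HComp[OF *] G.Map2_HComp[OF F.Map1_in[OF *(1)] F.Map1_in[OF *(2)] F.Map2_in[OF *(3)]
          F.Map2_in[OF *(4)]] by (simp add: comp_two_ftr_def)
  next
    fix f g h \<alpha> \<beta> assume *: "\<alpha> \<in> Hom2 K f g" "\<beta> \<in> Hom2 K g h"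
    show "Map2 (comp_two_ftr G F) (VComp K \<beta> \<alpha>) =
      VComp N (Map2 (comp_two_ftr G F) \<beta>) (Map2 (comp_two_ftr G F) \<alpha>)"
      using F.Map2_VComp[OF *] G.Map2_VComp[OF F.Map2_in[OF *(1)] F.Map2_in[OF *(2)]]
      by (simp add: comp_two_ftr_def)
  next
    fix f g X Y Z assume *: "f \<in> Hom1 K X Y" "g \<in> Hom1 K Y Z"
    show "Map1 (comp_two_ftr G F) (Comp1 K g f) =
      Comp1 N (Map1 (comp_two_ftr G F) g) (Map1 (comp_two_ftr G F) f)"
      using F.Map1_Comp1[OF *] G.Map1_Comp1[OF F.Map1_in[OF *(1)] F.Map1_in[OF *(2)]]
      by (simp add: comp_two_ftr_def)
  qed (simp_all add: comp_two_ftr_def F.Map0_in G.Map0_in F.Map1_Id1 G.Map1_Id1 F.Map2_Id2 G.Map2_Id2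
      F.Map1_Cell1 F.Map1_in G.Map1_in F.Map2_in G.Map2_in)
qed

lemma pseudo_natural_id:
  assumes "two_functor K L F" shows "pseudo_natural K L F F (id_pseudo L F)"
proof -
  interpret F: two_functor K L F by fact
  note m = F.Map1_in and l = F.L.Comp1_Id_left[OF F.Map1_in] and r = F.L.Comp1_Id_right[OF F.Map1_in]
  show ?thesis
  proof unfold_locales
    fix f X Y assume f: "f \<in> Hom1 K X Y"
    show "PArr (id_pseudo L F) f \<in> Hom2 L (Comp1 L (Map1 F f) (PObj (id_pseudo L F) X))
      (Comp1 L (PObj (id_pseudo L F) Y) (Map1 F f))"
      using l[OF f] r[OF f] F.L.Id2_Hom2[OF m[OF f]] by (simp add: id_pseudo_def)
  next
    fix f g X Y Z assume f: "f \<in> Hom1 K X Y" and g: "g \<in> Hom1 K Y Z"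
    show "PArr (id_pseudo L F) (Comp1 K g f) =
      VComp L (HComp L (PArr (id_pseudo L F) g) (Id2 L (Map1 F f)))
        (HComp L (Id2 L (Map1 F g)) (PArr (id_pseudo L F) f))"
      using F.Map1_Comp1[OF f g] F.L.HComp_Id2[OF m[OF f] m[OF g]]
        F.L.VComp_Id2[OF F.L.Comp1_in[OF m[OF f] m[OF g]]] by (simp add: id_pseudo_def)
  next
    fix f X Y \<alpha> g assume f: "f \<in> Hom1 K X Y" and a: "\<alpha> \<in> Hom2 K f g"
    show "VComp L (HComp L (Id2 L (PObj (id_pseudo L F) Y)) (Map2 F \<alpha>)) (PArr (id_pseudo L F) f) =
      VComp L (PArr (id_pseudo L F) g) (HComp L (Map2 F \<alpha>) (Id2 L (PObj (id_pseudo L F) X)))"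
      using F.L.HComp_Id_left[OF m[OF f] F.Map2_in[OF a]] F.L.HComp_Id_right[OF m[OF f] F.Map2_in[OF a]]
        F.L.VComp_Id_left[OF F.Map2_in[OF a]] F.L.VComp_Id_right[OF F.Map2_in[OF a]]
      by (simp add: id_pseudo_def)
  next
    fix f assume f: "f \<in> Cell1 K"
    show "invertible2 L (PArr (id_pseudo L F) f)"
      using F.L.invertible2_Id2[OF m[OF F.K.Hom1_self[OF f]]] by (simp add: id_pseudo_def)
  qed (simp_all add: id_pseudo_def F.Map0_in F.L.Id1_in F.Map1_Id1)
qed

text \<open>2-functors are compared on cells only, so the identity transformation of Id is not
  literally one from Id to \<open>G F\<close>; this lemma transfers it.\<close>

lemma pseudo_natural_cong:
  assumes "pseudo_natural K L F G \<sigma>" "two_functor K L F'" "two_functor K L G'"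
    and "\<And>X. X \<in> Cell0 K \<Longrightarrow> PObj \<tau> X = PObj \<sigma> X \<and> Map0 F' X = Map0 F X \<and> Map0 G' X = Map0 G X"
    and "\<And>f. f \<in> Cell1 K \<Longrightarrow> PArr \<tau> f = PArr \<sigma> f \<and> Map1 F' f = Map1 F f \<and> Map1 G' f = Map1 G f"
    and "\<And>\<alpha>. \<alpha> \<in> Cell2 K \<Longrightarrow> Map2 F' \<alpha> = Map2 F \<alpha> \<and> Map2 G' \<alpha> = Map2 G \<alpha>"
  shows "pseudo_natural K L F' G' \<tau>"
proof -
  interpret s: pseudo_natural K L F G \<sigma> by fact
  interpret F': two_functor K L F' by fact
  interpret G': two_functor K L G' by fact
  have h1: "PArr \<tau> f = PArr \<sigma> f" "Map1 F' f = Map1 F f" "Map1 G' f = Map1 G f"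
    "PObj \<tau> X = PObj \<sigma> X" "PObj \<tau> Y = PObj \<sigma> Y" if "f \<in> Hom1 K X Y" for f X Y
    using that assms(4,5) s.F.K.Hom1_Cell0[of f X Y] by (auto dest: Hom1D)
  show ?thesis
  proof unfold_locales
    fix X assume X: "X \<in> Cell0 K"
    show "PObj \<tau> X \<in> Hom1 L (Map0 F' X) (Map0 G' X)" using s.PObj_in[OF X] assms(4)[OF X] by simp
    show "PArr \<tau> (Id1 K X) = Id2 L (PObj \<tau> X)"
      using s.PArr_Id1[OF X] assms(4)[OF X] h1(1)[OF s.F.K.Id1_in[OF X]] by simp
  next
    fix f X Y assume f: "f \<in> Hom1 K X Y"
    show "PArr \<tau> f \<in> Hom2 L (Comp1 L (Map1 G' f) (PObj \<tau> X)) (Comp1 L (PObj \<tau> Y) (Map1 F' f))"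
      using s.PArr_in[OF f] h1[OF f] by simp
  next
    fix f assume f: "f \<in> Cell1 K"
    then show "invertible2 L (PArr \<tau> f)" using s.PArr_invertible[OF f] assms(5)[OF f] by simp
  next
    fix f g X Y Z assume f: "f \<in> Hom1 K X Y" and g: "g \<in> Hom1 K Y Z"
    show "PArr \<tau> (Comp1 K g f) =
      VComp L (HComp L (PArr \<tau> g) (Id2 L (Map1 F' f))) (HComp L (Id2 L (Map1 G' g)) (PArr \<tau> f))"
      using s.PArr_Comp1[OF f g] h1[OF f] h1[OF g] h1[OF s.F.K.Comp1_in[OF f g]] by simp
  next
    fix f X Y \<alpha> g assume f: "f \<in> Hom1 K X Y" and a: "\<alpha> \<in> Hom2 K f g"
    show "VComp L (HComp L (Id2 L (PObj \<tau> Y)) (Map2 F' \<alpha>)) (PArr \<tau> f) =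
      VComp L (PArr \<tau> g) (HComp L (Map2 G' \<alpha>) (Id2 L (PObj \<tau> X)))"
      using s.PArr_natural[OF f a] h1[OF f] h1[OF s.F.K.Hom2_Hom1[OF a f]] assms(6)[of \<alpha>]
          Hom2D[OF a] by simp
  qed
qed

text \<open>A 2-functor \<open>G\<close> that is bijective on the 2-cells between given 1-cells; a section \<open>F\<close> of \<open>G\<close> and
  1-cells \<open>F G W \<rightarrow> W\<close>, \<open>W \<rightarrow> F G W\<close> over identities make \<open>G\<close> a biequivalence.  Since \<open>G\<close> is faithful on
  2-cells, every equation of 2-cells holds because its image under \<open>G\<close> is trivial.\<close>

locale local_iso = K: two_category K + G: two_functor L K G
  for K :: "('o, 'm, 'c) two_cat" and L :: "('p, 'n, 'd) two_cat"
    and G :: "('p, 'n, 'd, 'o, 'm, 'c) two_ftr" +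
  assumes faithful2: "M \<in> Hom1 L W W' \<Longrightarrow> \<alpha> \<in> Hom2 L M N \<Longrightarrow> \<beta> \<in> Hom2 L M N \<Longrightarrow>
      Map2 G \<alpha> = Map2 G \<beta> \<Longrightarrow> \<alpha> = \<beta>"
    and full2: "M \<in> Hom1 L W W' \<Longrightarrow> N \<in> Hom1 L W W' \<Longrightarrow> \<gamma> \<in> Hom2 K (Map1 G M) (Map1 G N) \<Longrightarrow>
      \<exists>\<alpha> \<in> Hom2 L M N. Map2 G \<alpha> = \<gamma>"
begin

text \<open>On 2-cells functoriality is a conclusion: both sides of each law lie over the same cell
  of \<open>K\<close>, and \<open>faithful2\<close> identifies them.\<close>

lemma section_two_functor:
  fixes F :: "('o, 'm, 'c, 'p, 'n, 'd) two_ftr"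
  assumes F0: "\<And>X. X \<in> Cell0 K \<Longrightarrow> Map0 F X \<in> Cell0 L \<and> Map0 G (Map0 F X) = X"
    and F1: "\<And>f X Y. f \<in> Hom1 K X Y \<Longrightarrow> Map1 F f \<in> Hom1 L (Map0 F X) (Map0 F Y) \<and> Map1 G (Map1 F f) = f"
    and F_id: "\<And>X. X \<in> Cell0 K \<Longrightarrow> Map1 F (Id1 K X) = Id1 L (Map0 F X)"
    and F_comp: "\<And>f g X Y Z. f \<in> Hom1 K X Y \<Longrightarrow> g \<in> Hom1 K Y Z \<Longrightarrow>
      Map1 F (Comp1 K g f) = Comp1 L (Map1 F g) (Map1 F f)"
    and F2: "\<And>\<alpha> f g. \<alpha> \<in> Hom2 K f g \<Longrightarrow> Map2 F \<alpha> \<in> Hom2 L (Map1 F f) (Map1 F g) \<and> Map2 G (Map2 F \<alpha>) = \<alpha>"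
  shows "two_functor K L F"
proof unfold_locales
  fix f assume f: "f \<in> Cell1 K"
  note f' = K.Hom1_self[OF f]
  note I = G.K.Id2_Hom2[OF F1[OF f', THEN conjunct1]]
  show "Map2 F (Id2 K f) = Id2 L (Map1 F f)"
    by (rule faithful2[OF F1[OF f', THEN conjunct1] _ I])
      (use F2[OF K.Id2_in[OF f]] G.Map2_Id2 F1[OF f'] in \<open>simp_all add: Hom1_def\<close>)
next
  fix f g h \<alpha> \<beta> assume a: "\<alpha> \<in> Hom2 K f g" and b: "\<beta> \<in> Hom2 K g h"
  note f = K.Hom2_Cell1[OF a, THEN conjunct1]
  show "Map2 F (VComp K \<beta> \<alpha>) = VComp L (Map2 F \<beta>) (Map2 F \<alpha>)"
    by (rule faithful2[OF F1[OF f, THEN conjunct1] F2[OF K.VComp_in[OF a b], THEN conjunct1]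
          G.K.VComp_in[OF F2[OF a, THEN conjunct1] F2[OF b, THEN conjunct1]]])
      (use G.Map2_VComp[OF F2[OF a, THEN conjunct1] F2[OF b, THEN conjunct1]] F2[OF a] F2[OF b]
        F2[OF K.VComp_in[OF a b]] in simp)
next
  fix f f' g g' \<alpha> \<beta> X Y Z assume *: "f \<in> Hom1 K X Y" "g \<in> Hom1 K Y Z" "\<alpha> \<in> Hom2 K f f'"
      "\<beta> \<in> Hom2 K g g'"
  note f = F1[OF *(1), THEN conjunct1] and g = F1[OF *(2), THEN conjunct1]
    and a = F2[OF *(3), THEN conjunct1] and b = F2[OF *(4), THEN conjunct1]
  have f': "f' \<in> Hom1 K X Y" and g': "g' \<in> Hom1 K Y Z" using K.Hom2_Hom1 * by blast+
  show "Map2 F (HComp K \<beta> \<alpha>) = HComp L (Map2 F \<beta>) (Map2 F \<alpha>)"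
  proof (rule faithful2[OF G.K.Comp1_in[OF f g] _ G.K.HComp_in[OF f g a b]])
    show "Map2 F (HComp K \<beta> \<alpha>) \<in> Hom2 L (Comp1 L (Map1 F g) (Map1 F f)) (Comp1 L (Map1 F g') (Map1 F
        f'))"
      using F2[OF K.HComp_in[OF *]] F_comp[OF *(1,2)] F_comp[OF f' g'] by simp
    show "Map2 G (Map2 F (HComp K \<beta> \<alpha>)) = Map2 G (HComp L (Map2 F \<beta>) (Map2 F \<alpha>))"
      using F2[OF K.HComp_in[OF *]] G.Map2_HComp[OF f g a b] F2[OF *(3)] F2[OF *(4)] by simp
  qed
qed (use assms in auto)

text \<open>The inverse is the lift of the same identity 2-cell in the opposite direction; both
  composites lie over identities.\<close>

lemma reflects_invertible2:
  assumes M: "M \<in> Hom1 L W W'" and N: "N \<in> Hom1 L W W'" and \<alpha>: "\<alpha> \<in> Hom2 L M N"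
    and e: "Map1 G N = Map1 G M" "Map2 G \<alpha> = Id2 K (Map1 G M)"
  shows "invertible2 L \<alpha>"
proof -
  have I: "Id2 K (Map1 G M) \<in> Hom2 K (Map1 G N) (Map1 G M)"
    using K.Id2_Hom2[OF G.Map1_in[OF M]] e by simp
  obtain \<beta> where \<beta>: "\<beta> \<in> Hom2 L N M" "Map2 G \<beta> = Id2 K (Map1 G M)"
    using full2[OF N M I] by blast
  have "VComp L \<beta> \<alpha> = Id2 L M"
    by (rule faithful2[OF M G.K.VComp_in[OF \<alpha> \<beta>(1)] G.K.Id2_Hom2[OF M]])
      (use G.Map2_VComp[OF \<alpha> \<beta>(1)] G.Map2_Id2[of M] Hom1D[OF M] e \<beta>
        K.VComp_Id2[OF G.Map1_in[OF M]] in simp)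
  moreover have "VComp L \<alpha> \<beta> = Id2 L N"
    by (rule faithful2[OF N G.K.VComp_in[OF \<beta>(1) \<alpha>] G.K.Id2_Hom2[OF N]])
      (use G.Map2_VComp[OF \<beta>(1) \<alpha>] G.Map2_Id2[of N] Hom1D[OF N] e \<beta>
        K.VComp_Id2[OF G.Map1_in[OF M]] in simp)
  ultimately show ?thesis using Hom2D[OF \<alpha>] \<beta>(1) by (auto simp: invertible2_def)
qed

lemma isomorphic1_if_Map1_eq:
  assumes M: "M \<in> Hom1 L W W'" and N: "N \<in> Hom1 L W W'" and e: "Map1 G N = Map1 G M"
  shows "isomorphic1 L M N"
proof -
  have "Id2 K (Map1 G M) \<in> Hom2 K (Map1 G M) (Map1 G N)"
    using K.Id2_Hom2[OF G.Map1_in[OF M]] e by simp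
  then obtain \<alpha> where "\<alpha> \<in> Hom2 L M N" "Map2 G \<alpha> = Id2 K (Map1 G M)"
    using full2[OF M N] by blast
  then show ?thesis using reflects_invertible2[OF M N] e by (auto simp: isomorphic1_def)
qed

end

text \<open>The counit has components and 2-cells over identities. \<open>\<kappa> W\<close> is a
  weak inverse of its component at \<open>W\<close>, so it is given pointwise and carries no
  2-cells.\<close>

locale local_iso_section = local_iso K L G + F: two_functor K L F
  for K :: "('o, 'm, 'c) two_cat" and L :: "('p, 'n, 'd) two_cat"
    and F :: "('o, 'm, 'c, 'p, 'n, 'd) two_ftr" and G :: "('p, 'n, 'd, 'o, 'm, 'c) two_ftr" +
  fixes \<epsilon> :: "('p, 'n, 'n, 'd) pseudo_nat" and \<kappa> :: "'p \<Rightarrow> 'n"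
  assumes GF: "two_ftr_eq K (comp_two_ftr G F) id_two_ftr"
    and eps: "W \<in> Cell0 L \<Longrightarrow> PObj \<epsilon> W \<in> Hom1 L (Map0 F (Map0 G W)) W"
    and G_eps: "W \<in> Cell0 L \<Longrightarrow> Map1 G (PObj \<epsilon> W) = Id1 K (Map0 G W)"
    and kappa: "W \<in> Cell0 L \<Longrightarrow> \<kappa> W \<in> Hom1 L W (Map0 F (Map0 G W))"
    and G_kappa: "W \<in> Cell0 L \<Longrightarrow> Map1 G (\<kappa> W) = Id1 K (Map0 G W)"
    and eps2: "M \<in> Hom1 L W W' \<Longrightarrow> PArr \<epsilon> M \<in>
      Hom2 L (Comp1 L M (PObj \<epsilon> W)) (Comp1 L (PObj \<epsilon> W') (Map1 F (Map1 G M)))"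
    and G_eps2: "M \<in> Hom1 L W W' \<Longrightarrow> Map2 G (PArr \<epsilon> M) = Id2 K (Map1 G M)"
begin

lemma GF0: "X \<in> Cell0 K \<Longrightarrow> Map0 G (Map0 F X) = X"
  and GF1: "f \<in> Cell1 K \<Longrightarrow> Map1 G (Map1 F f) = f"
  and GF2: "\<alpha> \<in> Cell2 K \<Longrightarrow> Map2 G (Map2 F \<alpha>) = \<alpha>"
  using GF by (auto simp: two_ftr_eq_def comp_two_ftr_def id_two_ftr_def)

lemma GF1': "f \<in> Hom1 K X Y \<Longrightarrow> Map1 G (Map1 F f) = f"
  by (simp add: GF1 Hom1_def)

lemma GF2': "\<alpha> \<in> Hom2 K f g \<Longrightarrow> Map2 G (Map2 F \<alpha>) = \<alpha>"
  by (simp add: GF2 Hom2_def)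

lemma counit: "pseudo_natural L L (comp_two_ftr F G) id_two_ftr \<epsilon>"
proof -
  interpret FG: two_functor L L "comp_two_ftr F G"
    by (rule two_functor_comp[OF G.two_functor_axioms F.two_functor_axioms])
  interpret I: two_functor L L id_two_ftr by (rule two_functor_id[OF G.K.two_category_axioms])
  have m: "Map0 (comp_two_ftr F G) W = Map0 F (Map0 G W)" "Map1 (comp_two_ftr F G) M =
      Map1 F (Map1 G M)"
    "Map2 (comp_two_ftr F G) \<alpha> = Map2 F (Map2 G \<alpha>)" "Map0 id_two_ftr W = W" "Map1 id_two_ftr M = M"
    "Map2 id_two_ftr \<alpha> = \<alpha>" for W M \<alpha>
    by (simp_all add: comp_two_ftr_def id_two_ftr_def)
  note FG1 = F.Map1_in[OF G.Map1_in]
  have e: "PObj \<epsilon> W \<in> Hom1 L (Map0 F (Map0 G W)) W" "Map1 G (PObj \<epsilon> W) = Id1 K (Map0 G W)"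
    "PObj \<epsilon> W' \<in> Hom1 L (Map0 F (Map0 G W')) W'" "Map1 G (PObj \<epsilon> W') = Id1 K (Map0 G W')"
    if "M \<in> Hom1 L W W'" for M W W'
    using eps G_eps G.K.Hom1_Cell0[OF that] by blast+
  \<comment> \<open>Both legs of the naturality square at \<open>M\<close> become \<open>G M\<close>
    under \<open>G\<close>, because the components of \<epsilon> lie over identities and
    \<open>G F\<close> is the identity on cells.\<close>
  have lr: "Comp1 L M (PObj \<epsilon> W) \<in> Hom1 L (Map0 F (Map0 G W)) W'"
    "Comp1 L (PObj \<epsilon> W') (Map1 F (Map1 G M)) \<in> Hom1 L (Map0 F (Map0 G W)) W'"
    "Map1 G (Comp1 L M (PObj \<epsilon> W)) = Map1 G M"
    "Map1 G (Comp1 L (PObj \<epsilon> W') (Map1 F (Map1 G M))) = Map1 G M"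
    if M: "M \<in> Hom1 L W W'" for M W W'
  proof -
    show "Comp1 L M (PObj \<epsilon> W) \<in> Hom1 L (Map0 F (Map0 G W)) W'"
      "Comp1 L (PObj \<epsilon> W') (Map1 F (Map1 G M)) \<in> Hom1 L (Map0 F (Map0 G W)) W'"
      using G.K.Comp1_in[OF e(1)[OF M] M] G.K.Comp1_in[OF FG1[OF M] e(3)[OF M]] by simp_all
    show "Map1 G (Comp1 L M (PObj \<epsilon> W)) = Map1 G M"
      "Map1 G (Comp1 L (PObj \<epsilon> W') (Map1 F (Map1 G M))) = Map1 G M"
      using G.Map1_Comp1[OF e(1)[OF M] M] G.Map1_Comp1[OF FG1[OF M] e(3)[OF M]] e[OF M]
        K.Comp1_Id_left[OF G.Map1_in[OF M]] K.Comp1_Id_right[OF G.Map1_in[OF M]]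
        GF1'[OF G.Map1_in[OF M]] by simp_all
  qed
  show ?thesis
  proof unfold_locales
    fix W assume W: "W \<in> Cell0 L"
    show "PObj \<epsilon> W \<in> Hom1 L (Map0 (comp_two_ftr F G) W) (Map0 id_two_ftr W)"
      using eps[OF W] by (simp add: m)
    note I = G.K.Id1_in[OF W] and i = G.Map1_Id1[OF W] F.Map1_Id1[OF G.Map0_in[OF W]]
    have c: "Comp1 L (Id1 L W) (PObj \<epsilon> W) = PObj \<epsilon> W"
      "Comp1 L (PObj \<epsilon> W) (Id1 L (Map0 F (Map0 G W))) = PObj \<epsilon> W"
      using G.K.Comp1_Id_left[OF eps[OF W]] G.K.Comp1_Id_right[OF eps[OF W]] by simp_all
    show "PArr \<epsilon> (Id1 L W) = Id2 L (PObj \<epsilon> W)"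
      by (rule faithful2[OF eps[OF W] _ G.K.Id2_Hom2[OF eps[OF W]]])
        (use eps2[OF I] G_eps2[OF I] G.Map2_Id2 Hom1D[OF eps[OF W]] in \<open>simp_all add: i c G_eps[OF W]\<close>)
  next
    fix M W W' assume M: "M \<in> Hom1 L W W'"
    show "PArr \<epsilon> M \<in> Hom2 L (Comp1 L (Map1 id_two_ftr M) (PObj \<epsilon> W))
        (Comp1 L (PObj \<epsilon> W') (Map1 (comp_two_ftr F G) M))"
      using eps2[OF M] by (simp add: m)
  next
    fix M assume "M \<in> Cell1 L"
    note M = G.K.Hom1_self[OF this]
    show "invertible2 L (PArr \<epsilon> M)"
      by (rule reflects_invertible2[OF lr(1,2)[OF M] eps2[OF M]])
        (simp_all add: lr(3,4)[OF M] G_eps2[OF M])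
  next
    fix M N W W' W'' assume M: "M \<in> Hom1 L W W'" and N: "N \<in> Hom1 L W' W''"
    note NM = G.K.Comp1_in[OF M N]
    note W = e(1)[OF M] and W' = e(3)[OF M] and W'' = e(3)[OF N]
    note FM = FG1[OF M] and FN = FG1[OF N]
    note GM = G.Map1_in[OF M] and GN = G.Map1_in[OF N]
    have FNM: "Map1 F (Map1 G (Comp1 L N M)) = Comp1 L (Map1 F (Map1 G N)) (Map1 F (Map1 G M))"
      by (simp add: G.Map1_Comp1[OF M N] F.Map1_Comp1[OF GM GN])
    note h1 = G.K.HComp_in[OF FM lr(1)[OF N] G.K.Id2_Hom2[OF FM] eps2[OF N]]
    note h2 = G.K.HComp_in[OF lr(1)[OF M] N eps2[OF M] G.K.Id2_Hom2[OF N]]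
    \<comment> \<open>Strict associativity of 1-cells is used to rewrite the two whiskered cells so
      that they meet in the same middle 1-cell.\<close>
    have h1': "HComp L (PArr \<epsilon> N) (Id2 L (Map1 F (Map1 G M))) \<in>
      Hom2 L (Comp1 L N (Comp1 L (PObj \<epsilon> W') (Map1 F (Map1 G M))))
        (Comp1 L (PObj \<epsilon> W'') (Map1 F (Map1 G (Comp1 L N M))))"
      using h1 by (simp add: FNM G.K.Comp1_assoc[OF FM W' N] G.K.Comp1_assoc[OF FM FN W''])
    have h2': "HComp L (Id2 L N) (PArr \<epsilon> M) \<in> Hom2 L (Comp1 L (Comp1 L N M) (PObj \<epsilon> W))
        (Comp1 L N (Comp1 L (PObj \<epsilon> W') (Map1 F (Map1 G M))))"
      using h2 by (simp add: G.K.Comp1_assoc[OF W M N])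
    have "PArr \<epsilon> (Comp1 L N M) =
      VComp L (HComp L (PArr \<epsilon> N) (Id2 L (Map1 F (Map1 G M)))) (HComp L (Id2 L N) (PArr \<epsilon> M))"
    proof (rule faithful2[OF lr(1)[OF NM] eps2[OF NM] G.K.VComp_in[OF h2' h1']])
      have "Map2 G (HComp L (PArr \<epsilon> N) (Id2 L (Map1 F (Map1 G M)))) = Id2 K (Map1 G (Comp1 L N M))"
        using G.Map2_HComp[OF FM lr(1)[OF N] G.K.Id2_Hom2[OF FM] eps2[OF N]] G.Map2_Id2 Hom1D[OF FM]
          K.HComp_Id2[OF GM GN] G.Map1_Comp1[OF M N] by (simp add: G_eps2[OF N] GF1'[OF GM])
      moreover have "Map2 G (HComp L (Id2 L N) (PArr \<epsilon> M)) = Id2 K (Map1 G (Comp1 L N M))"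
        using G.Map2_HComp[OF lr(1)[OF M] N eps2[OF M] G.K.Id2_Hom2[OF N]] G.Map2_Id2 Hom1D[OF N]
          K.HComp_Id2[OF GM GN] G.Map1_Comp1[OF M N] by (simp add: G_eps2[OF M])
      ultimately show "Map2 G (PArr \<epsilon> (Comp1 L N M)) = Map2 G (VComp L
          (HComp L (PArr \<epsilon> N) (Id2 L (Map1 F (Map1 G M)))) (HComp L (Id2 L N) (PArr \<epsilon> M)))"
        using G.Map2_VComp[OF h2' h1'] K.VComp_Id2[OF G.Map1_in[OF NM]] G_eps2[OF NM] by simp
    qed
    then show "PArr \<epsilon> (Comp1 L N M) =
      VComp L (HComp L (PArr \<epsilon> N) (Id2 L (Map1 (comp_two_ftr F G) M)))
        (HComp L (Id2 L (Map1 id_two_ftr N)) (PArr \<epsilon> M))" by (simp add: m)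
  next
    fix M W W' \<alpha> N assume M: "M \<in> Hom1 L W W'" and \<alpha>: "\<alpha> \<in> Hom2 L M N"
    note N = G.K.Hom2_Hom1[OF \<alpha> M]
    note W = e(1)[OF M] and W' = e(3)[OF M]
    note FG\<alpha> = F.Map2_in[OF G.Map2_in[OF \<alpha>]]
    note h1 = G.K.HComp_in[OF FG1[OF M] W' FG\<alpha> G.K.Id2_Hom2[OF W']]
    note h2 = G.K.HComp_in[OF W M G.K.Id2_Hom2[OF W] \<alpha>]
    have "VComp L (HComp L (Id2 L (PObj \<epsilon> W')) (Map2 F (Map2 G \<alpha>))) (PArr \<epsilon> M) =
      VComp L (PArr \<epsilon> N) (HComp L \<alpha> (Id2 L (PObj \<epsilon> W)))"
    proof (rule faithful2[OF lr(1)[OF M] G.K.VComp_in[OF eps2[OF M] h1] G.K.VComp_in[OF h2 eps2[OF N]]])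
      have 1: "Map2 G (HComp L (Id2 L (PObj \<epsilon> W')) (Map2 F (Map2 G \<alpha>))) = Map2 G \<alpha>"
        using G.Map2_HComp[OF FG1[OF M] W' FG\<alpha> G.K.Id2_Hom2[OF W']] G.Map2_Id2 Hom1D[OF W']
          K.HComp_Id_left[OF G.Map1_in[OF M] G.Map2_in[OF \<alpha>]]
        by (simp add: e(4)[OF M] GF2'[OF G.Map2_in[OF \<alpha>]])
      have 2: "Map2 G (HComp L \<alpha> (Id2 L (PObj \<epsilon> W))) = Map2 G \<alpha>"
        using G.Map2_HComp[OF W M G.K.Id2_Hom2[OF W] \<alpha>] G.Map2_Id2 Hom1D[OF W]
          K.HComp_Id_right[OF G.Map1_in[OF M] G.Map2_in[OF \<alpha>]]
        by (simp add: e(2)[OF M])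
      show "Map2 G (VComp L (HComp L (Id2 L (PObj \<epsilon> W')) (Map2 F (Map2 G \<alpha>))) (PArr \<epsilon> M)) =
        Map2 G (VComp L (PArr \<epsilon> N) (HComp L \<alpha> (Id2 L (PObj \<epsilon> W))))"
        using G.Map2_VComp[OF eps2[OF M] h1] G.Map2_VComp[OF h2 eps2[OF N]]
          K.VComp_Id_left[OF G.Map2_in[OF \<alpha>]] K.VComp_Id_right[OF G.Map2_in[OF \<alpha>]]
        by (simp add: 1 2 G_eps2[OF M] G_eps2[OF N])
    qed
    then show "VComp L (HComp L (Id2 L (PObj \<epsilon> W')) (Map2 (comp_two_ftr F G) \<alpha>)) (PArr \<epsilon> M) =
      VComp L (PArr \<epsilon> N) (HComp L (Map2 id_two_ftr \<alpha>) (Id2 L (PObj \<epsilon> W)))" by (simp add: m)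
  qed
qed

text \<open>Both composites with \<open>\<kappa> W\<close> lie over an identity, hence are
  isomorphic to identities.\<close>

lemma counit_equivalence1:
  assumes W: "W \<in> Cell0 L" shows "equivalence1 L (PObj \<epsilon> W)"
proof -
  note e = eps[OF W] and k = kappa[OF W] and I = G.K.Id1_in[OF F.Map0_in[OF G.Map0_in[OF W]]]
  note ke = G.K.Comp1_in[OF e k] and ek = G.K.Comp1_in[OF k e]
  have Id: "Comp1 K (Id1 K (Map0 G W)) (Id1 K (Map0 G W)) = Id1 K (Map0 G W)"
    using K.Comp1_Id_left[OF K.Id1_in[OF G.Map0_in[OF W]]] .
  have "isomorphic1 L (Id1 L (Map0 F (Map0 G W))) (Comp1 L (\<kappa> W) (PObj \<epsilon> W))"
    by (rule isomorphic1_if_Map1_eq[OF I ke])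
      (simp add: G.Map1_Comp1[OF e k] G_eps[OF W] G_kappa[OF W] Id
        G.Map1_Id1[OF F.Map0_in[OF G.Map0_in[OF W]]] GF0[OF G.Map0_in[OF W]])
  moreover have "isomorphic1 L (Comp1 L (PObj \<epsilon> W) (\<kappa> W)) (Id1 L W)"
    by (rule isomorphic1_if_Map1_eq[OF ek G.K.Id1_in[OF W]])
      (simp add: G.Map1_Comp1[OF k e] G_eps[OF W] G_kappa[OF W] Id G.Map1_Id1[OF W])
  ultimately show ?thesis using Hom1D[OF e] k by (auto simp: equivalence1_def)
qed

lemma unit_equivalence1:
  assumes X: "X \<in> Cell0 K" shows "equivalence1 K (Id1 K X)"
proof -
  note I = K.Id1_in[OF X]
  have "isomorphic1 K (Id1 K X) (Id1 K X)"
    using K.Id2_Hom2[OF I] K.invertible2_Id2[OF I] by (auto simp: isomorphic1_def)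
  then show ?thesis
    using Hom1D[OF I] I K.Comp1_Id_left[OF I]
    by (auto simp: equivalence1_def intro!: bexI[of _ "Id1 K X"])
qed

text \<open>The unit is the identity transformation. The triangle at \<open>G\<close> is then an
  identity on cells, because \<epsilon> lies over identities; the triangle at \<open>F\<close> is
  the counit at \<open>F X\<close>, which is not an identity but lies over one.\<close>

lemma adjoint_biequivalence:
  "adjoint_biequivalence K L F G (id_pseudo K id_two_ftr) \<epsilon>"
proof -
  interpret c: pseudo_natural L L "comp_two_ftr F G" id_two_ftr \<epsilon> by (rule counit)
  have I: "two_functor K K id_two_ftr" by (rule two_functor_id[OF K.two_category_axioms])
  have gf: "two_functor K K (comp_two_ftr G F)"
    by (rule two_functor_comp[OF F.two_functor_axioms G.two_functor_axioms])
  have "pseudo_natural K K id_two_ftr (comp_two_ftr G F) (id_pseudo K id_two_ftr)"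
    by (rule pseudo_natural_cong[OF pseudo_natural_id[OF I] I gf])
      (use GF in \<open>auto simp: two_ftr_eq_def\<close>)
  then interpret u: pseudo_natural K K id_two_ftr "comp_two_ftr G F" "id_pseudo K id_two_ftr" .
  have m: "Map0 (comp_two_ftr F G) W = Map0 F (Map0 G W)" "Map1 (comp_two_ftr F G) M =
      Map1 F (Map1 G M)"
    "Map2 (comp_two_ftr F G) \<alpha> = Map2 F (Map2 G \<alpha>)" for W M \<alpha>
    by (simp_all add: comp_two_ftr_def)
  have i: "Map0 id_two_ftr x = x" "Map1 id_two_ftr y = y" "Map2 id_two_ftr z = z" for x y z
    by (simp_all add: id_two_ftr_def)

  let ?s = "vcomp_pseudo K L (rwhisker_pseudo \<epsilon> F) (lwhisker_pseudo F (id_pseudo K id_two_ftr))"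
  have eF: "PObj \<epsilon> (Map0 F X) \<in> Hom1 L (Map0 F X) (Map0 F X)"
    "Map1 G (PObj \<epsilon> (Map0 F X)) = Id1 K X" if X: "X \<in> Cell0 K" for X
    using eps[OF F.Map0_in[OF X]] G_eps[OF F.Map0_in[OF X]] GF0[OF X] by simp_all
  have eF2: "PArr \<epsilon> (Map1 F f) \<in> Hom2 L (Comp1 L (Map1 F f) (PObj \<epsilon> (Map0 F X)))
      (Comp1 L (PObj \<epsilon> (Map0 F Y)) (Map1 F f))" "Map2 G (PArr \<epsilon> (Map1 F f)) = Id2 K f"
    if f: "f \<in> Hom1 K X Y" for f X Y
    using eps2[OF F.Map1_in[OF f]] G_eps2[OF F.Map1_in[OF f]] GF1'[OF f] by simp_all
  have s0: "PObj ?s X = PObj \<epsilon> (Map0 F X)" if X: "X \<in> Cell0 K" for X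
    using G.K.Comp1_Id_right[OF eF(1)[OF X]] F.Map1_Id1[OF X]
    by (simp add: vcomp_pseudo_def rwhisker_pseudo_def lwhisker_pseudo_def id_pseudo_def i)
  have s1: "PArr ?s f = PArr \<epsilon> (Map1 F f)" if f: "f \<in> Hom1 K X Y" for f X Y
  proof -
    have XY: "X \<in> Cell0 K" "Y \<in> Cell0 K" using K.Hom1_Cell0[OF f] by simp_all
    have fX: "Comp1 L (Map1 F f) (PObj \<epsilon> (Map0 F X)) \<in> Hom1 L (Map0 F X) (Map0 F Y)"
      by (rule G.K.Comp1_in[OF eF(1)[OF XY(1)] F.Map1_in[OF f]])
    have "Map2 F (Id2 K (Id1 K X)) = Id2 L (Id1 L (Map0 F X))"
      using F.Map2_Id2[of "Id1 K X"] Hom1D[OF K.Id1_in[OF XY(1)]] F.Map1_Id1[OF XY(1)] by simp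
    then show ?thesis
      using Hom1D[OF f] F.Map2_Id2[of f] F.Map1_Id1[OF XY(1)]
        G.K.HComp_Id2[OF F.Map1_in[OF f] eF(1)[OF XY(2)]]
        G.K.HComp_Id_right[OF fX eF2(1)[OF f]] G.K.VComp_Id_left[OF eF2(1)[OF f]]
      by (simp add: vcomp_pseudo_def rwhisker_pseudo_def lwhisker_pseudo_def id_pseudo_def i)
  qed
  \<comment> \<open>The counit whiskered with \<open>F\<close> runs from \<open>F G F\<close> to
    \<open>F\<close>; as \<open>G F\<close> is the identity on cells, the same data run from
    \<open>F\<close> to \<open>F\<close>.\<close>
  have "pseudo_natural K L F F \<lparr>PObj = \<lambda>X. PObj \<epsilon> (Map0 F X), PArr = \<lambda>f. PArr \<epsilon> (Map1 F f)\<rparr>"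
  proof unfold_locales
    fix X assume X: "X \<in> Cell0 K"
    show "PArr \<lparr>PObj = \<lambda>X. PObj \<epsilon> (Map0 F X), PArr = \<lambda>f. PArr \<epsilon> (Map1 F f)\<rparr> (Id1 K X) =
      Id2 L (PObj \<lparr>PObj = \<lambda>X. PObj \<epsilon> (Map0 F X), PArr = \<lambda>f. PArr \<epsilon> (Map1 F f)\<rparr> X)"
      using c.PArr_Id1[OF F.Map0_in[OF X]] F.Map1_Id1[OF X] by simp
  next
    fix f assume f: "f \<in> Cell1 K"
    show "invertible2 L (PArr \<lparr>PObj = \<lambda>X. PObj \<epsilon> (Map0 F X), PArr = \<lambda>f. PArr \<epsilon> (Map1 F f)\<rparr> f)"
      using c.PArr_invertible[OF F.Map1_Cell1[OF f]] by simp
  next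
    fix f g X Y Z assume f: "f \<in> Hom1 K X Y" and g: "g \<in> Hom1 K Y Z"
    show "PArr \<lparr>PObj = \<lambda>X. PObj \<epsilon> (Map0 F X), PArr = \<lambda>f. PArr \<epsilon> (Map1 F f)\<rparr> (Comp1 K g f) =
      VComp L (HComp L (PArr \<lparr>PObj = \<lambda>X. PObj \<epsilon> (Map0 F X), PArr = \<lambda>f. PArr \<epsilon> (Map1 F f)\<rparr> g)
        (Id2 L (Map1 F f))) (HComp L (Id2 L (Map1 F g))
          (PArr \<lparr>PObj = \<lambda>X. PObj \<epsilon> (Map0 F X), PArr = \<lambda>f. PArr \<epsilon> (Map1 F f)\<rparr> f))"
      using c.PArr_Comp1[OF F.Map1_in[OF f] F.Map1_in[OF g]] F.Map1_Comp1[OF f g]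
      by (simp add: m i GF1'[OF f])
  next
    fix f X Y \<alpha> g assume f: "f \<in> Hom1 K X Y" and a: "\<alpha> \<in> Hom2 K f g"
    show "VComp L (HComp L (Id2 L (PObj \<lparr>PObj = \<lambda>X. PObj \<epsilon> (Map0 F X), PArr = \<lambda>f. PArr \<epsilon> (Map1 F f)\<rparr> Y))
        (Map2 F \<alpha>)) (PArr \<lparr>PObj = \<lambda>X. PObj \<epsilon> (Map0 F X), PArr = \<lambda>f. PArr \<epsilon> (Map1 F f)\<rparr> f) =
      VComp L (PArr \<lparr>PObj = \<lambda>X. PObj \<epsilon> (Map0 F X), PArr = \<lambda>f. PArr \<epsilon> (Map1 F f)\<rparr> g)
        (HComp L (Map2 F \<alpha>) (Id2 L (PObj \<lparr>PObj = \<lambda>X. PObj \<epsilon> (Map0 F X), PArr =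
            \<lambda>f. PArr \<epsilon> (Map1 F f)\<rparr> X)))"
      using c.PArr_natural[OF F.Map1_in[OF f] F.Map2_in[OF a]] by (simp add: m i GF2'[OF a])
  qed (simp_all add: eF eF2)
  then have sp: "pseudo_natural K L F F ?s"
    by (rule pseudo_natural_cong[OF _ F.two_functor_axioms F.two_functor_axioms])
      (use s0 s1 in \<open>auto dest: K.Hom1_self\<close>)
  \<comment> \<open>The component of the modification at \<open>X\<close> is the 2-cell over the
    identity of \<open>Id1 K X\<close>. The modification law then holds because both sides lie over
    \<open>Id2 K f\<close>.\<close>
  have "\<exists>a. a \<in> Hom2 L (PObj ?s X) (Id1 L (Map0 F X)) \<and> invertible2 L a \<and> Map2 G a = Id2 K (Id1 K X)"
    if X: "X \<in> Cell0 K" for X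
  proof -
    note I = G.K.Id1_in[OF F.Map0_in[OF X]]
    have GI: "Map1 G (Id1 L (Map0 F X)) = Id1 K X"
      using G.Map1_Id1[OF F.Map0_in[OF X]] GF0[OF X] by simp
    have "Id2 K (Id1 K X) \<in> Hom2 K (Map1 G (PObj \<epsilon> (Map0 F X))) (Map1 G (Id1 L (Map0 F X)))"
      using K.Id2_Hom2[OF K.Id1_in[OF X]] by (simp add: GI eF(2)[OF X])
    then obtain a where a: "a \<in> Hom2 L (PObj \<epsilon> (Map0 F X)) (Id1 L (Map0 F X))" "Map2 G a =
        Id2 K (Id1 K X)"
      using full2[OF eF(1)[OF X] I] by blast
    moreover have "invertible2 L a"
      by (rule reflects_invertible2[OF eF(1)[OF X] I a(1)]) (simp_all add: GI eF(2)[OF X] a(2))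
    ultimately show ?thesis by (auto simp: s0[OF X])
  qed
  then obtain a where a: "\<And>X. X \<in> Cell0 K \<Longrightarrow> a X \<in> Hom2 L (PObj ?s X) (Id1 L (Map0 F X)) \<and>
      invertible2 L (a X) \<and> Map2 G (a X) = Id2 K (Id1 K X)"
    by metis
  have tF: "invertible_modification K L F F ?s (id_pseudo L F) a"
    unfolding invertible_modification_def
  proof (intro conjI ballI allI)
    fix X Y f assume f: "f \<in> Hom1 K X Y"
    have XY: "X \<in> Cell0 K" "Y \<in> Cell0 K" using K.Hom1_Cell0[OF f] by simp_all
    note Ff = F.Map1_in[OF f] and eX = eF(1)[OF XY(1)] and eY = eF(1)[OF XY(2)]
    have aX: "a X \<in> Hom2 L (PObj \<epsilon> (Map0 F X)) (Id1 L (Map0 F X))"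
      and aY: "a Y \<in> Hom2 L (PObj \<epsilon> (Map0 F Y)) (Id1 L (Map0 F Y))"
      using a[OF XY(1)] a[OF XY(2)] by (simp_all add: s0 XY)
    have c: "Comp1 L (Id1 L (Map0 F Y)) (Map1 F f) = Map1 F f"
        "Comp1 L (Map1 F f) (Id1 L (Map0 F X)) = Map1 F f"
      using G.K.Comp1_Id_left[OF Ff] G.K.Comp1_Id_right[OF Ff] by simp_all
    note h1 = G.K.HComp_in[OF Ff eY G.K.Id2_Hom2[OF Ff] aY, unfolded c]
    note h2 = G.K.HComp_in[OF eX Ff aX G.K.Id2_Hom2[OF Ff], unfolded c]
    have G1: "Map2 G (HComp L (a Y) (Id2 L (Map1 F f))) = Id2 K f"
      using G.Map2_HComp[OF Ff eY G.K.Id2_Hom2[OF Ff] aY] G.Map2_Id2 Hom1D[OF Ff] a[OF XY(2)]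
        K.HComp_Id_left[OF f K.Id2_Hom2[OF f]] by (simp add: GF1'[OF f])
    have G2: "Map2 G (HComp L (Id2 L (Map1 F f)) (a X)) = Id2 K f"
      using G.Map2_HComp[OF eX Ff aX G.K.Id2_Hom2[OF Ff]] G.Map2_Id2 Hom1D[OF Ff] a[OF XY(1)]
        K.HComp_Id_right[OF f K.Id2_Hom2[OF f]] by (simp add: GF1'[OF f])
    have "VComp L (HComp L (a Y) (Id2 L (Map1 F f))) (PArr \<epsilon> (Map1 F f)) =
      VComp L (Id2 L (Map1 F f)) (HComp L (Id2 L (Map1 F f)) (a X))"
      by (rule faithful2[OF G.K.Comp1_in[OF eX Ff] G.K.VComp_in[OF eF2(1)[OF f] h1]
            G.K.VComp_in[OF h2 G.K.Id2_Hom2[OF Ff]]])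
        (use G.Map2_VComp[OF eF2(1)[OF f] h1] G.Map2_VComp[OF h2 G.K.Id2_Hom2[OF Ff]] G.Map2_Id2
          Hom1D[OF Ff] in \<open>simp add: G1 G2 eF2(2)[OF f] GF1'[OF f]\<close>)
    then show "VComp L (HComp L (a Y) (Id2 L (Map1 F f))) (PArr ?s f) =
      VComp L (PArr (id_pseudo L F) f) (HComp L (Id2 L (Map1 F f)) (a X))"
      unfolding s1[OF f] by (simp add: id_pseudo_def)
  qed (use a sp pseudo_natural_id[OF F.two_functor_axioms] in \<open>simp_all add: id_pseudo_def\<close>)

  let ?t = "vcomp_pseudo L K (lwhisker_pseudo G \<epsilon>) (rwhisker_pseudo (id_pseudo K id_two_ftr) G)"
  have t0: "PObj ?t W = Id1 K (Map0 G W)" if W: "W \<in> Cell0 L" for W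
    using G_eps[OF W] K.Comp1_Id_left[OF K.Id1_in[OF G.Map0_in[OF W]]]
    by (simp add: vcomp_pseudo_def rwhisker_pseudo_def lwhisker_pseudo_def id_pseudo_def i)
  have t1: "PArr ?t f = Id2 K (Map1 G f)" if f: "f \<in> Hom1 L W W'" for f W W'
  proof -
    have W: "W \<in> Cell0 L" "W' \<in> Cell0 L" using G.K.Hom1_Cell0[OF f] by simp_all
    note Gf = G.Map1_in[OF f]
    show ?thesis
      using Hom1D[OF f] G_eps[OF W(2)] G_eps2[OF f] K.HComp_Id_left[OF Gf K.Id2_Hom2[OF Gf]]
        K.HComp_Id_right[OF Gf K.Id2_Hom2[OF Gf]] K.VComp_Id2[OF Gf]
      by (simp add: vcomp_pseudo_def rwhisker_pseudo_def lwhisker_pseudo_def id_pseudo_def i)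
  qed
  note Gid = pseudo_natural_id[OF G.two_functor_axioms]
  have tp: "pseudo_natural L K G G ?t"
    by (rule pseudo_natural_cong[OF Gid G.two_functor_axioms G.two_functor_axioms])
      (use t0 t1 in \<open>auto simp: id_pseudo_def dest: G.K.Hom1_self\<close>)
  \<comment> \<open>By \<open>t0\<close> and \<open>t1\<close> the composite agrees with the
    identity transformation on all cells, so identity 2-cells form the modification.\<close>
  have tG: "invertible_modification L K G G ?t (id_pseudo K G) (\<lambda>W. Id2 K (Id1 K (Map0 G W)))"
    unfolding invertible_modification_def
  proof (intro conjI ballI allI)
    fix W W' f assume f: "f \<in> Hom1 L W W'"
    note Gf = G.Map1_in[OF f]
    show "VComp K (HComp K (Id2 K (Id1 K (Map0 G W'))) (Id2 K (Map1 G f))) (PArr ?t f) =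
      VComp K (PArr (id_pseudo K G) f) (HComp K (Id2 K (Map1 G f)) (Id2 K (Id1 K (Map0 G W))))"
      using K.HComp_Id_left[OF Gf K.Id2_Hom2[OF Gf]] K.HComp_Id_right[OF Gf K.Id2_Hom2[OF Gf]]
      unfolding t1[OF f] by (simp add: id_pseudo_def)
  qed (use tp Gid K.Id2_Hom2[OF K.Id1_in[OF G.Map0_in]] K.invertible2_Id2[OF K.Id1_in[OF G.Map0_in]]
      t0 in \<open>simp_all add: id_pseudo_def\<close>)
  show ?thesis
    by unfold_locales
      (use unit_equivalence1 counit_equivalence1 tF tG in \<open>auto simp: id_pseudo_def i\<close>)
qed

end

section \<open>Wide 2-full sub-2-categories\<close>

lemma wide_2full_sub_simps [simp]:
  "Cell0 (wide_2full_sub K P) = Cell0 K" "Cell1 (wide_2full_sub K P) = {f \<in> Cell1 K. P f}"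
  "Cell2 (wide_2full_sub K P) = {\<alpha> \<in> Cell2 K. P (Src2 K \<alpha>) \<and> P (Tgt2 K \<alpha>)}"
  "Src1 (wide_2full_sub K P) = Src1 K" "Tgt1 (wide_2full_sub K P) = Tgt1 K"
  "Src2 (wide_2full_sub K P) = Src2 K" "Tgt2 (wide_2full_sub K P) = Tgt2 K"
  "Id1 (wide_2full_sub K P) = Id1 K" "Comp1 (wide_2full_sub K P) = Comp1 K"
  "Id2 (wide_2full_sub K P) = Id2 K" "VComp (wide_2full_sub K P) = VComp K"
  "HComp (wide_2full_sub K P) = HComp K"
  by (simp_all add: wide_2full_sub_def)

lemma Hom1_wide_2full_sub [simp]: "f \<in> Hom1 (wide_2full_sub K P) X Y \<longleftrightarrow> f \<in> Hom1 K X Y \<and> P f"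
  and Hom2_wide_2full_sub [simp]:
    "\<alpha> \<in> Hom2 (wide_2full_sub K P) f g \<longleftrightarrow> \<alpha> \<in> Hom2 K f g \<and> P f \<and> P g"
  by (auto simp: Hom1_def Hom2_def)

lemma two_category_wide_2full_sub:
  assumes "two_category K" and Id: "\<And>X. X \<in> Cell0 K \<Longrightarrow> P (Id1 K X)"
    and Comp: "\<And>f g X Y Z. f \<in> Hom1 K X Y \<Longrightarrow> g \<in> Hom1 K Y Z \<Longrightarrow> P f \<Longrightarrow> P g \<Longrightarrow> P (Comp1 K g f)"
  shows "two_category (wide_2full_sub K P)"
proof -
  interpret K: two_category K by fact
  show ?thesis
  proof (rule two_category.intro)
    fix f f' g g' \<alpha> \<beta> X Y Z assume "f \<in> Hom1 (wide_2full_sub K P) X Y"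
        "g \<in> Hom1 (wide_2full_sub K P) Y Z"
      "\<alpha> \<in> Hom2 (wide_2full_sub K P) f f'" "\<beta> \<in> Hom2 (wide_2full_sub K P) g g'"
    then show "HComp (wide_2full_sub K P) \<beta> \<alpha> \<in> Hom2 (wide_2full_sub K P)
        (Comp1 (wide_2full_sub K P) g f) (Comp1 (wide_2full_sub K P) g' f')"
      using K.HComp_in[of f X Y g Z \<alpha> f' \<beta> g'] K.Hom2_Hom1[of \<alpha> f f' X Y] K.Hom2_Hom1[of \<beta> g g' Y Z]
        Comp[of f X Y g Z] Comp[of f' X Y g' Z] by simp
  qed (auto simp: K.Src1_in K.Tgt1_in K.Src2_in K.Tgt2_in K.Src1_Tgt2 K.Tgt1_Tgt2 K.Id1_in Id
      intro: K.Comp1_in Comp K.Comp1_Id_left K.Comp1_Id_right K.Comp1_assoc K.Id2_in K.VComp_in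
        K.VComp_Id_left K.VComp_Id_right K.VComp_assoc K.HComp_Id_left K.HComp_Id_right K.HComp_assoc
        K.HComp_Id2 K.interchange)
qed

text \<open>\<open>Q\<close> is the preimage of \<open>P\<close> under \<open>G\<close>. The
  components of \<epsilon> and \<kappa> lie over identities and so belong to the smaller 2-category;
  since all 2-cells between retained 1-cells are kept, local bijectivity restricts.\<close>

lemma (in local_iso_section) wide_2full_sub:
  assumes Id: "\<And>X. X \<in> Cell0 K \<Longrightarrow> P (Id1 K X)"
    and Comp: "\<And>f g X Y Z. f \<in> Hom1 K X Y \<Longrightarrow> g \<in> Hom1 K Y Z \<Longrightarrow> P f \<Longrightarrow> P g \<Longrightarrow> P (Comp1 K g f)"
    and Q: "\<And>f. f \<in> Cell1 L \<Longrightarrow> Q f \<longleftrightarrow> P (Map1 G f)"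
  shows "local_iso_section (wide_2full_sub K P) (wide_2full_sub L Q) F G \<epsilon> \<kappa>"
proof -
  have Q1: "f \<in> Hom1 L W W' \<Longrightarrow> Q f \<longleftrightarrow> P (Map1 G f)" for f W W' using Q by (simp add: Hom1_def)
  have QI: "Q (Id1 L W)" if "W \<in> Cell0 L" for W
    using Q1[OF G.K.Id1_in[OF that]] G.Map1_Id1[OF that] Id[OF G.Map0_in[OF that]] by simp
  have QC: "Q (Comp1 L g f)" if f: "f \<in> Hom1 L X Y" and g: "g \<in> Hom1 L Y Z" and q: "Q f"
      "Q g" for f g X Y Z
    using Q1[OF G.K.Comp1_in[OF f g]] G.Map1_Comp1[OF f g] Comp[OF G.Map1_in[OF f] G.Map1_in[OF g]]
      Q1[OF f] Q1[OF g] q by simp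
  have QF: "Q (Map1 F f) \<longleftrightarrow> P f" if f: "f \<in> Hom1 K X Y" for f X Y
    using Q1[OF F.Map1_in[OF f]] GF1'[OF f] by simp
  have Qe: "Q (PObj \<epsilon> W)" "Q (\<kappa> W)" if W: "W \<in> Cell0 L" for W
    using Q1[OF eps[OF W]] Q1[OF kappa[OF W]] G_eps[OF W] G_kappa[OF W] Id[OF G.Map0_in[OF W]]
        by simp_all
  interpret K': two_category "wide_2full_sub K P"
    by (rule two_category_wide_2full_sub[OF K.two_category_axioms Id Comp])
  interpret L': two_category "wide_2full_sub L Q"
    by (rule two_category_wide_2full_sub[OF G.K.two_category_axioms QI QC])
  have F2: "Q (Map1 F f) = P f" "Q (Map1 F g) = P g" if "\<alpha> \<in> Hom2 K f g" for \<alpha> f g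
    using K.Hom2_Cell1[OF that] QF by blast+
  have G2: "Q f = P (Map1 G f)" "Q g = P (Map1 G g)" if "\<alpha> \<in> Hom2 L f g" for \<alpha> f g
    using G.K.Hom2_Cell1[OF that] Q1 by blast+
  interpret F': two_functor "wide_2full_sub K P" "wide_2full_sub L Q" F
    by unfold_locales (auto simp: F.Map0_in F.Map1_in F.Map2_in F.Map1_Id1 F.Map1_Comp1 F.Map2_Id2
        F.Map2_VComp F.Map2_HComp QF F2)
  interpret G': two_functor "wide_2full_sub L Q" "wide_2full_sub K P" G
    by unfold_locales (auto simp: G.Map0_in G.Map1_in G.Map2_in G.Map1_Id1 G.Map1_Comp1 G.Map2_Id2
        G.Map2_VComp G.Map2_HComp Q1 G2)
  show ?thesis
  proof unfold_locales
    fix M W W' \<alpha> N \<beta> assume "M \<in> Hom1 (wide_2full_sub L Q) W W'" "\<alpha> \<in> Hom2 (wide_2full_sub L Q) M N"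
      "\<beta> \<in> Hom2 (wide_2full_sub L Q) M N" "Map2 G \<alpha> = Map2 G \<beta>"
    then show "\<alpha> = \<beta>" using faithful2[of M W W' \<alpha> N \<beta>] by simp
  next
    fix M W W' N \<gamma> assume "M \<in> Hom1 (wide_2full_sub L Q) W W'" "N \<in> Hom1 (wide_2full_sub L Q) W W'"
      "\<gamma> \<in> Hom2 (wide_2full_sub K P) (Map1 G M) (Map1 G N)"
    then show "\<exists>\<alpha> \<in> Hom2 (wide_2full_sub L Q) M N. Map2 G \<alpha> = \<gamma>"
      using full2[of M W W' N \<gamma>] by auto
  next
    fix M W W' assume "M \<in> Hom1 (wide_2full_sub L Q) W W'"
    then have M: "M \<in> Hom1 L W W'" "Q M" by simp_all
    then have W: "W \<in> Cell0 L" "W' \<in> Cell0 L" using G.K.Hom1_Cell0 by blast+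
    have "Q (Map1 F (Map1 G M))" using QF[OF G.Map1_in[OF M(1)]] Q1[OF M(1)] M(2) by simp
    then show "PArr \<epsilon> M \<in> Hom2 (wide_2full_sub L Q) (Comp1 (wide_2full_sub L Q) M (PObj \<epsilon> W))
        (Comp1 (wide_2full_sub L Q) (PObj \<epsilon> W') (Map1 F (Map1 G M)))"
      using eps2[OF M(1)] QC[OF eps[OF W(1)] M(1)] QC[OF F.Map1_in[OF G.Map1_in[OF M(1)]] eps[OF W(2)]]
        Qe(1)[OF W(1)] Qe(1)[OF W(2)] M(2) by simp
    show "Map2 G (PArr \<epsilon> M) = Id2 (wide_2full_sub K P) (Map1 G M)" using G_eps2[OF M(1)] by simp
  next
    show "two_ftr_eq (wide_2full_sub K P) (comp_two_ftr G F) id_two_ftr"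
      using GF by (simp add: two_ftr_eq_def)
  qed (simp_all add: eps kappa G_eps G_kappa Qe)
qed

section \<open>Local full faithfulness\<close>

lemma (in category) inv_arr_ide [simp]: "x \<in> Obj C \<Longrightarrow> inv_arr C (Ide C x) = Ide C x"
  by (rule inv_arr_eq) simp_all

lemma (in pre_func) inv_arr [simp]:
  assumes "is_iso C f" shows "FArr F (inv_arr C f) = inv_arr D (FArr F f)"
proof (rule sym, rule D.inv_arr_eq)
  show "Comp D (FArr F (inv_arr C f)) (FArr F f) = Ide D (Dom D (FArr F f))"
    "Comp D (FArr F f) (FArr F (inv_arr C f)) = Ide D (Cod D (FArr F f))"
    using comp_eq[OF C.inv_arr(4)[OF assms]] comp_eq[OF C.inv_arr(5)[OF assms]]
        assms C.iso_arr[OF assms]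
    by simp_all
qed (use assms C.iso_arr[OF assms] in simp_all)

text \<open>As \<zeta> is invertible, the condition on a 2-cell determines \<Sigma> of each
  component of the term part, and \<Sigma> is faithful.\<close>

lemma GC2_faithful:
  assumes "gcell2 W W' \<alpha>" "gcell2 W W' \<beta>" "GDom2 \<alpha> = GDom2 \<beta>" "GCod2 \<alpha> = GCod2 \<beta>" "GC2 \<alpha> = GC2 \<beta>"
  shows "\<alpha> = \<beta>"
proof -
  interpret a: gcell2 W W' \<alpha> by fact
  interpret b: gcell2 W W' \<beta> by fact
  have e: "GPsi \<alpha> = GPsi \<beta>" "GPhi \<alpha> = GPhi \<beta>" using assms(5) by (simp_all add: GC2_def)
  have "GPhid \<alpha> = GPhid \<beta>"
  proof (rule ntr_eqI[OF a.d.phi.ntrans_axioms b.d.phi.ntrans_axioms[folded assms(3,4)]])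
    fix x assume x: "x \<in> Obj (gV W)"
    have "FArr (GSig W') (NComp (GPhid \<alpha>) x) = FArr (GSig W') (NComp (GPhid \<beta>) x)"
    proof (rule a.M.W'.u.C.iso_cancel)
      show "Comp (gU W') (NComp (GZeta (GCod2 \<beta>)) x) (FArr (GSig W') (NComp (GPhid \<alpha>) x)) =
        Comp (gU W') (NComp (GZeta (GCod2 \<beta>)) x) (FArr (GSig W') (NComp (GPhid \<beta>) x))"
        using a.zeta_cell[OF x] b.zeta_cell[OF x] by (simp add: e assms(3,4))
    qed (use x in \<open>simp_all add: assms(4)\<close>)
    then show "NComp (GPhid \<alpha>) x = NComp (GPhid \<beta>) x"
      using x by - (rule a.M.W'.Sig_faithful, simp_all add: assms(3,4))
  qed
  then show ?thesis using e assms(3,4) by (intro gcell2_eqI)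
qed

text \<open>Only the term part is missing. Its image under \<Sigma> is prescribed, and
  \<open>Sig_lift\<close> provides the components once they are seen to respect sections; naturality
  and the projection to the base follow because \<Sigma> is faithful and lies over the base.\<close>

lemma GC2_full:
  assumes M: "gmorphism W W' M" and N: "gmorphism W W' N" and \<beta>: "ccell2 (GO W) (GO W') \<beta>"
    and d: "CDom2 \<beta> = GM M" "CCod2 \<beta> = GM N"
  obtains \<alpha> where "gcell2 W W' \<alpha>" "GDom2 \<alpha> = M" "GCod2 \<alpha> = N" "GC2 \<alpha> = \<beta>"
proof -
  interpret M: gmorphism W W' M by fact
  interpret N: gmorphism W W' N by fact
  interpret b: ccell2 "GO W" "GO W'" \<beta> by fact
  define \<psi> where "\<psi> = CPsi \<beta>"
  define \<phi> where "\<phi> = CPhi \<beta>"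
  interpret a: fib2 "GU W" "GU W'" "GC M" "GH M" "GC N" "GH N" \<psi> \<phi>
    using b.a.fib2_axioms by (simp add: d \<psi>_def \<phi>_def)
  have cell: "Comp (gB W') (FArr (gv W') (FArr (GDel W') (NComp \<phi> A))) (FArr (gv W') (M.mate A)) =
      Comp (gB W') (FArr (gv W') (N.mate A)) (NComp \<psi> (FObj (gv W) (FObj (GDel W) A)))"
    if "A \<in> Obj (gU W)" for A
    using b.tt_cell[of A] that by (simp add: d flip: \<psi>_def \<phi>_def)
  \<comment> \<open>Forced by the condition on a 2-cell: this is what \<Sigma> has to send the
    component at \<open>x\<close> to.\<close>
  define m where "m = (\<lambda>x. Comp (gU W') (inv_arr (gU W') (NComp (GZeta N) x))
    (Comp (gU W') (NComp \<phi> (FObj (GSig W) x)) (NComp (GZeta M) x)))"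
  have m: "m x \<in> Arr (gU W')" "Dom (gU W') (m x) = FObj (GSig W') (FObj (GHd M) x)"
    "Cod (gU W') (m x) = FObj (GSig W') (FObj (GHd N) x)"
    "FArr (gu W') (m x) = NComp \<psi> (FObj (gv W) x)"
    "Comp (gU W') (NComp (GZeta N) x) (m x) =
      Comp (gU W') (NComp \<phi> (FObj (GSig W) x)) (NComp (GZeta M) x)"
    if x: "x \<in> Obj (gV W)" for x
    using x by (simp_all add: m_def)
  have "\<exists>k. k \<in> Arr (gV W') \<and> Dom (gV W') k = FObj (GHd M) x \<and> Cod (gV W') k = FObj (GHd N) x \<and>
      FArr (GSig W') k = m x" if x: "x \<in> Obj (gV W)" for x
  proof -
    let ?S = "FObj (GSig W) x" and ?g = "\<lambda>f. FArr (gv W') (FArr (GDel W') f)"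
    note mx = m[OF x]
    \<comment> \<open>The section condition of \<open>Sig_lift\<close>, proved first after an
      isomorphism, the image of \<zeta> of \<open>N\<close>: it uses \<open>mate_gsig\<close> for
      \<open>M\<close>, the condition on \<beta>, naturality of \<psi> at the section, and
      \<open>mate_gsig\<close> for \<open>N\<close>.\<close>
    have "Comp (gB W') (?g (NComp (GZeta N) x)) (Comp (gB W') (?g (m x)) (gsig W' (FObj (GHd M) x))) =
      Comp (gB W') (?g (NComp \<phi> ?S)) (Comp (gB W') (?g (NComp (GZeta M) x)) (gsig W' (FObj (GHd M) x)))"
      by (rule M.W'.u.D.reassoc2[OF M.W'.v.comp_eq2[OF M.W'.Del.comp_eq2[OF mx(5)]]]) (use x mx in
          simp_all)
    also have "\<dots> = Comp (gB W') (?g (NComp \<phi> ?S)) (Comp (gB W') (FArr (gv W') (M.mate ?S)) (FArr (GC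
        M) (gsig W x)))"
      using M.mate_gsig[OF x] by simp
    also have "\<dots> = Comp (gB W') (FArr (gv W') (N.mate ?S))
        (Comp (gB W') (NComp \<psi> (FObj (gv W) (FObj (GDel W) ?S))) (FArr (GC M) (gsig W x)))"
      by (rule M.W'.u.D.reassoc2[OF cell]) (use x in simp_all)
    also have "\<dots> = Comp (gB W') (FArr (gv W') (N.mate ?S))
        (Comp (gB W') (FArr (GC N) (gsig W x)) (NComp \<psi> (FObj (gv W) x)))"
      using a.psi.natural[of "gsig W x"] x by simp
    also have "\<dots> = Comp (gB W') (?g (NComp (GZeta N) x))
        (Comp (gB W') (gsig W' (FObj (GHd N) x)) (NComp \<psi> (FObj (gv W) x)))"
      by (rule M.W'.u.D.reassoc2[OF N.mate_gsig[OF x]]) (use x in simp_all)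
    finally have s: "Comp (gB W') (?g (m x)) (gsig W' (FObj (GHd M) x)) =
        Comp (gB W') (gsig W' (FObj (GHd N) x)) (NComp \<psi> (FObj (gv W) x))"
      by (rule M.W'.u.D.iso_cancel) (use x mx in simp_all)
    show ?thesis
      by (rule M.W'.Sig_lift[of "FObj (GHd M) x" "FObj (GHd N) x" "m x"]) (use x mx s in \<open>simp_all,
          blast\<close>)
  qed
  then obtain k where k: "\<And>x. x \<in> Obj (gV W) \<Longrightarrow> k x \<in> Arr (gV W') \<and> Dom (gV W') (k x) = FObj (GHd M) x \<and>
      Cod (gV W') (k x) = FObj (GHd N) x \<and> FArr (GSig W') (k x) = m x"
    by metis
  define \<delta> where "\<delta> = \<lparr>NDom = GHd M, NCod = GHd N, NComp = restrict k (Obj (gV W))\<rparr>"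
  have \<delta>: "NComp \<delta> x = k x" if "x \<in> Obj (gV W)" for x using that by (simp add: \<delta>_def)
  have nat: "ntrans (gV W) (gV W') (GHd M) (GHd N) \<delta>"
  proof (rule ntransI[OF M.Hd.E.func_axioms N.Hd.E.func_axioms])
    fix f assume f: "f \<in> Arr (gV W)"
    let ?x = "Dom (gV W) f" and ?y = "Cod (gV W) f"
    have x: "?x \<in> Obj (gV W)" and y: "?y \<in> Obj (gV W)" using f by simp_all
    note kx = k[OF x] and ky = k[OF y] and mx = m[OF x] and my = m[OF y]
    \<comment> \<open>Naturality of the new components is verified after \<Sigma>, which is
      faithful, and after \<zeta> of \<open>N\<close>, which is invertible.\<close>
    have "Comp (gU W') (NComp (GZeta N) ?y) (Comp (gU W') (FArr (GSig W') (FArr (GHd N) f)) (m ?x)) =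
      Comp (gU W') (FArr (GH N) (FArr (GSig W) f)) (Comp (gU W') (NComp (GZeta N) ?x) (m ?x))"
      using N.zeta.natural'[of f ?x ?y "m ?x"] f mx by simp
    also have "\<dots> = Comp (gU W') (NComp \<phi> (FObj (GSig W) ?y))
        (Comp (gU W') (FArr (GH M) (FArr (GSig W) f)) (NComp (GZeta M) ?x))"
      using a.phi.natural'[of "FArr (GSig W) f" _ _ "NComp (GZeta M) ?x"] f mx by simp
    also have "\<dots> = Comp (gU W') (NComp \<phi> (FObj (GSig W) ?y))
        (Comp (gU W') (NComp (GZeta M) ?y) (FArr (GSig W') (FArr (GHd M) f)))"
      using M.zeta.natural[of f ?x ?y] f by simp
    also have "\<dots> = Comp (gU W') (NComp (GZeta N) ?y) (Comp (gU W') (m ?y) (FArr (GSig W') (FArr (GHd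
        M) f)))"
      by (rule M.W'.u.C.reassoc2[OF my(5)[symmetric]]) (use f my in simp_all)
    finally have "Comp (gU W') (FArr (GSig W') (FArr (GHd N) f)) (m ?x) =
        Comp (gU W') (m ?y) (FArr (GSig W') (FArr (GHd M) f))"
      by (rule M.W'.u.C.iso_cancel) (use f mx my in simp_all)
    then have "Comp (gV W') (FArr (GHd N) f) (k ?x) = Comp (gV W') (k ?y) (FArr (GHd M) f)"
      using f kx ky by - (rule M.W'.Sig_faithful, simp_all)
    then show "Comp (gV W') (FArr (GHd N) f) (NComp \<delta> ?x) = Comp (gV W') (NComp \<delta> ?y) (FArr (GHd M) f)"
      by (simp add: \<delta>[OF x] \<delta>[OF y])
  qed (use k in \<open>simp_all add: \<delta>_def\<close>)
  interpret d: ntrans "gV W" "gV W'" "GHd M" "GHd N" \<delta> by (rule nat)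
  define \<alpha> where "\<alpha> = \<lparr>GDom2 = M, GCod2 = N, GPsi = \<psi>, GPhi = \<phi>, GPhid = \<delta>\<rparr>"
  have over: "FArr (gv W') (NComp \<delta> x) = NComp \<psi> (FObj (gv W) x)" if x: "x \<in> Obj (gV W)" for x
    using M.W'.Sig_over(1)[of "k x"] k[OF x] m(4)[OF x] by (simp add: \<delta>[OF x])
  have "gcell2 W W' \<alpha>"
  proof (rule gcell2I)
    have "ntrans (Base (GUd W)) (Base (GUd W')) (GC M) (GC N) \<psi>" using a.psi.ntrans_axioms by simp
    then show "fib2 (GUd W) (GUd W') (GC (GDom2 \<alpha>)) (GHd (GDom2 \<alpha>)) (GC (GCod2 \<alpha>)) (GHd (GCod2 \<alpha>))
        (GPsi \<alpha>) (GPhid \<alpha>)"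
      using M.Hd.fib1_axioms N.Hd.fib1_axioms nat over
      by (simp add: \<alpha>_def fib2_def fib2_axioms_def)
  qed (use k m a.fib2_axioms M N in \<open>simp_all add: \<alpha>_def \<delta>\<close>)
  moreover have "GC2 \<alpha> = \<beta>"
    by (rule ccell2_eqI) (simp_all add: \<alpha>_def d \<psi>_def \<phi>_def)
  ultimately show ?thesis using that[of \<alpha>] by (simp add: \<alpha>_def)
qed

section \<open>Local bijectivity of \<open>G\<close>\<close>

definition GFun :: "('u gcwf, 'u gmor, 'u gcell, 'u compcat, 'u compmor, 'u compcell) two_ftr" where
  "GFun = \<lparr>Map0 = GO, Map1 = GM, Map2 = GC2\<rparr>"

lemma GFun_simps [simp]: "Map0 GFun = GO" "Map1 GFun = GM" "Map2 GFun = GC2"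
  by (simp_all add: GFun_def)

lemma local_iso_GFun:
  "local_iso (CompCat :: ('u compcat, 'u compmor, 'u compcell) two_cat) GCwF GFun"
proof -
  interpret K: two_category "CompCat :: ('u compcat, 'u compmor, 'u compcell) two_cat"
    by (rule two_category_CompCat)
  interpret L: two_category "GCwF :: ('u gcwf, 'u gmor, 'u gcell) two_cat"
    by (rule two_category_GCwF)
  show ?thesis
  proof unfold_locales
    fix \<alpha> f g assume "\<alpha> \<in> Hom2 (GCwF :: ('u gcwf, 'u gmor, 'u gcell) two_cat) f g"
    note a = Hom2_GCwFD[OF this]
    show "Map2 GFun \<alpha> \<in> Hom2 CompCat (Map1 GFun f) (Map1 GFun g)"
      unfolding GFun_simps by (rule Hom2_CompCatI[OF ccell2_GC2[OF a(1)]]) (simp_all add: a)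
  next
    fix f f' g g' \<alpha> \<beta> X Y Z assume *: "f \<in> Hom1 (GCwF :: ('u gcwf, 'u gmor, 'u gcell) two_cat) X Y"
      "g \<in> Hom1 GCwF Y Z" "\<alpha> \<in> Hom2 GCwF f f'" "\<beta> \<in> Hom2 GCwF g g'"
    note a = Hom2_GCwFD'[OF *(3) *(1)[unfolded Hom1_GCwF]]
      and b = Hom2_GCwFD'[OF *(4) *(2)[unfolded Hom1_GCwF]]
    show "Map2 GFun (HComp GCwF \<beta> \<alpha>) = HComp CompCat (Map2 GFun \<beta>) (Map2 GFun \<alpha>)"
      by (rule ccell2_eqI)
        (simp_all add: GM_comp1[OF gcell2D(1)[OF a(1)] gcell2D(1)[OF b(1)]]
          GM_comp1[OF gcell2D(2)[OF a(1)] gcell2D(2)[OF b(1)]])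
  next
    fix M N W W' \<gamma> assume M: "M \<in> Hom1 (GCwF :: ('u gcwf, 'u gmor, 'u gcell) two_cat) W W'"
      and N: "N \<in> Hom1 GCwF W W'" and c: "\<gamma> \<in> Hom2 CompCat (Map1 GFun M) (Map1 GFun N)"
    note M' = M[unfolded Hom1_GCwF] and N' = N[unfolded Hom1_GCwF]
    have "lax (GO W) (GO W') (GM M)" using gmorphism.lax_GM[OF M'] .
    note c' = Hom2_CompCatD'[OF c[unfolded GFun_simps] this]
    obtain \<alpha> where "gcell2 W W' \<alpha>" "GDom2 \<alpha> = M" "GCod2 \<alpha> = N" "GC2 \<alpha> = \<gamma>"
      using GC2_full[OF M' N' c'] by blast
    then show "\<exists>\<alpha> \<in> Hom2 GCwF M N. Map2 GFun \<alpha> = \<gamma>"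
      using Hom2_GCwFI by (metis GFun_simps(3))
  next
    fix M N W W' \<alpha> \<beta> assume M: "M \<in> Hom1 (GCwF :: ('u gcwf, 'u gmor, 'u gcell) two_cat) W W'"
      and a: "\<alpha> \<in> Hom2 GCwF M N" and b: "\<beta> \<in> Hom2 GCwF M N" and e: "Map2 GFun \<alpha> = Map2 GFun \<beta>"
    note a' = Hom2_GCwFD'[OF a M[unfolded Hom1_GCwF]] and b' = Hom2_GCwFD'[OF b M[unfolded Hom1_GCwF]]
    show "\<alpha> = \<beta>"
      by (rule GC2_faithful[OF a'(1) b'(1)]) (use e in \<open>simp_all add: a' b'\<close>)
  next
    fix f X Y assume "f \<in> Hom1 (GCwF :: ('u gcwf, 'u gmor, 'u gcell) two_cat) X Y"
    then show "Map1 GFun f \<in> Hom1 CompCat (Map0 GFun X) (Map0 GFun Y)"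
      using gmorphism.lax_GM by simp
  next
    fix \<alpha> \<beta> f g h assume *: "\<alpha> \<in> Hom2 (GCwF :: ('u gcwf, 'u gmor, 'u gcell) two_cat) f g"
      "\<beta> \<in> Hom2 GCwF g h"
    show "Map2 GFun (VComp GCwF \<beta> \<alpha>) = VComp CompCat (Map2 GFun \<beta>) (Map2 GFun \<alpha>)"
      by (rule ccell2_eqI) simp_all
  next
    fix f assume "f \<in> Cell1 (GCwF :: ('u gcwf, 'u gmor, 'u gcell) two_cat)"
    show "Map2 GFun (Id2 GCwF f) = Id2 CompCat (Map1 GFun f)"
      by (rule ccell2_eqI) simp_all
  qed (simp_all add: generalised_cwf.comprehension_category_GO GM_id1 GM_comp1)
qed

section \<open>The category of terms of a comprehension category\<close>

text \<open>The factorisation over an identity is cartesian by cancellation, and a cartesian arrow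
  over an isomorphism is one.\<close>

lemma (in pre_func) cart_iso_between:
  assumes f: "cartesian F f" and g: "cartesian F g" and c: "Cod C f = Cod C g" and e: "FArr F f =
      FArr F g"
  obtains i where "is_iso C i" "Dom C i = Dom C f" "Cod C i = Dom C g" "Comp C g i = f"
proof -
  note [simp] = cart_arr[OF f] cart_arr[OF g]
  have d: "FObj F (Dom C f) = FObj F (Dom C g)" using arg_cong[OF e, of "Dom D"] by simp
  obtain i where i: "i \<in> Arr C" "Dom C i = Dom C f" "Cod C i = Dom C g"
    "FArr F i = Ide D (FObj F (Dom C g))" "Comp C g i = f"
    by (rule cart_ex[OF g, of f "Ide D (FObj F (Dom C g))"]) (use c d e in simp_all)
  have "cartesian F i" by (rule cart_cancel[OF g]) (use i f in simp_all)
  then have "is_iso C i" by (rule cart_over_iso) (use i in simp)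
  then show ?thesis using that i by blast
qed

section \<open>Sections of display maps and the weakening comonad\<close>

definition sect :: "'u compcat \<Rightarrow> 'u \<Rightarrow> 'u \<Rightarrow> bool" where
  "sect X A s \<longleftrightarrow> A \<in> Obj (cE X) \<and> s \<in> Arr (cB X) \<and> Dom (cB X) s = FObj (cp X) A \<and>
     Cod (cB X) s = ext X A \<and> Comp (cB X) (dp X A) s = Ide (cB X) (FObj (cp X) A)"

text \<open>The homomorphism condition between coalgebras, stated in the base;
  \<open>section_arr_natural\<close> recovers it in the total category.\<close>

definition tm :: "'u compcat \<Rightarrow> 'u \<Rightarrow> 'u \<Rightarrow> 'u \<Rightarrow> bool" where
  "tm X f s s' \<longleftrightarrow> f \<in> Arr (cE X) \<and> sect X (Dom (cE X) f) s \<and> sect X (Cod (cE X) f) s' \<and>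
     Comp (cB X) (q X f) s = Comp (cB X) s' (FArr (cp X) f)"

context comprehension_category
begin

lemma sectD:
  assumes "sect X A s"
  shows "A \<in> Obj (cE X)" "s \<in> Arr (cB X)" "Dom (cB X) s = FObj (cp X) A" "Cod (cB X) s = ext X A"
    "Comp (cB X) (dp X A) s = Ide (cB X) (FObj (cp X) A)"
  using assms by (simp_all add: sect_def)

lemma tmD:
  assumes "tm X f s s'"
  shows "f \<in> Arr (cE X)" "sect X (Dom (cE X) f) s" "sect X (Cod (cE X) f) s'"
    "Comp (cB X) (q X f) s = Comp (cB X) s' (FArr (cp X) f)"
  using assms by (simp_all add: tm_def)

lemma tm_ide: "sect X A s \<Longrightarrow> tm X (Ide (cE X) A) s s"
  by (simp add: tm_def sect_def)

lemma tm_comp: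
  assumes f: "tm X f s s'" and g: "tm X g s' s''" and c: "Cod (cE X) f = Dom (cE X) g"
  shows "tm X (Comp (cE X) g f) s s''"
proof -
  note f' = tmD[OF f] and g' = tmD[OF g]
  note s = sectD[OF f'(2)] and s' = sectD[OF f'(3)] and s'' = sectD[OF g'(3)]
  have "Comp (cB X) (q X g) (Comp (cB X) (q X f) s) = Comp (cB X) (Comp (cB X) (q X g) s') (FArr (cp
      X) f)"
    using f'(1,4) g'(1) s s' c by simp
  also have "\<dots> = Comp (cB X) s'' (Comp (cB X) (FArr (cp X) g) (FArr (cp X) f))"
    unfolding g'(4) using f'(1) g'(1) s'' c by simp
  finally show ?thesis using f' g' c s by (simp add: tm_def)
qed

text \<open>Reindexing of sections: \<open>s'\<close> after \<open>p f\<close> and an identity form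
  a cone over the pullback square of \<open>f\<close>, and the mediating arrow is the
  section.\<close>

lemma sect_pullback:
  assumes f: "cartesian (cp X) f" and s': "sect X (Cod (cE X) f) s'"
  obtains s where "tm X f s s'"
proof -
  note [simp] = p.cart_arr[OF f] and t = sectD[OF s']
  have e: "Comp (cB X) (dp X (Cod (cE X) f)) (Comp (cB X) s' (FArr (cp X) f)) = FArr (cp X) f"
    using p.D.reassoc[OF t(5), of "FArr (cp X) f"] t by simp
  obtain s where "s \<in> Arr (cB X)" "Dom (cB X) s = FObj (cp X) (Dom (cE X) f)"
    "Cod (cB X) s = ext X (Dom (cE X) f)" "Comp (cB X) (q X f) s = Comp (cB X) s' (FArr (cp X) f)"
    "Comp (cB X) (dp X (Dom (cE X) f)) s = Ide (cB X) (FObj (cp X) (Dom (cE X) f))"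
    by (rule p.D.pullback_ex[OF pullback[OF f refl refl],
          of "Comp (cB X) s' (FArr (cp X) f)" "Ide (cB X) (FObj (cp X) (Dom (cE X) f))"])
      (use t e in simp_all)
  then show ?thesis using that[of s] s' by (simp add: tm_def sect_def)
qed

text \<open>\<open>K A\<close> is \<open>A\<close> weakened along its own display map by the given
  cleavage, and \<open>diag A\<close> is its generic term, the comultiplication read in the base.
  \<open>diag\<close>, \<open>K_arr\<close> and \<open>section_arr\<close> are unique by the
  pullback property or cartesianness, so the choice operator only turns existence into
  functions.\<close>

definition "wk A = Lift (CFib X) (dp X A) A"
definition "K A = Dom (cE X) (wk A)"
definition "diag A = (SOME d. sect X (K A) d \<and> Comp (cB X) (q X (wk A)) d = Ide (cB X) (ext X A))"
definition "K_arr f = (SOME k. k \<in> Arr (cE X) \<and> Dom (cE X) k = K (Dom (cE X) f) \<and>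
  Cod (cE X) k = K (Cod (cE X) f) \<and> FArr (cp X) k = q X f \<and>
  Comp (cE X) (wk (Cod (cE X) f)) k = Comp (cE X) f (wk (Dom (cE X) f)))"
definition "section_arr A s = (SOME h. h \<in> Arr (cE X) \<and> Dom (cE X) h = A \<and> Cod (cE X) h = K A \<and>
  FArr (cp X) h = s \<and> Comp (cE X) (wk A) h = Ide (cE X) A)"

lemma wk [simp]:
  assumes "A \<in> Obj (cE X)"
  shows "cartesian (cp X) (wk A)" "wk A \<in> Arr (cE X)" "Dom (cE X) (wk A) = K A" "Cod (cE X) (wk A) = A"
    "FArr (cp X) (wk A) = dp X A" "K A \<in> Obj (cE X)" "FObj (cp X) (K A) = ext X A"
  using p.lift[of A "dp X A"] assms by (simp_all add: wk_def K_def)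

lemma wk_pullback:
  "A \<in> Obj (cE X) \<Longrightarrow> is_pullback (cB X) (dp X (K A), dp X A, q X (wk A), dp X A)"
  using pullback[OF wk(1), of A "K A" A] by simp

lemma diag:
  assumes A: "A \<in> Obj (cE X)"
  shows "sect X (K A) (diag A)" "Comp (cB X) (q X (wk A)) (diag A) = Ide (cB X) (ext X A)"
proof -
  obtain d where "d \<in> Arr (cB X)" "Dom (cB X) d = ext X A" "Cod (cB X) d = ext X (K A)"
    "Comp (cB X) (q X (wk A)) d = Ide (cB X) (ext X A)" "Comp (cB X) (dp X (K A)) d =
        Ide (cB X) (ext X A)"
    by (rule p.D.pullback_ex[OF wk_pullback[OF A], of "Ide (cB X) (ext X A)" "Ide (cB X) (ext X A)"])
      (use A in simp_all)
  then have "\<exists>d. sect X (K A) d \<and> Comp (cB X) (q X (wk A)) d = Ide (cB X) (ext X A)"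
    using A by (auto simp: sect_def)
  from someI_ex[OF this]
  show "sect X (K A) (diag A)" "Comp (cB X) (q X (wk A)) (diag A) = Ide (cB X) (ext X A)"
    by (simp_all add: diag_def)
qed

lemma diag_arr [simp]:
  assumes "A \<in> Obj (cE X)"
  shows "diag A \<in> Arr (cB X)" "Dom (cB X) (diag A) = ext X A" "Cod (cB X) (diag A) = ext X (K A)"
    "Comp (cB X) (dp X (K A)) (diag A) = Ide (cB X) (ext X A)"
  using sectD[OF diag(1)[OF assms]] assms by simp_all

lemma K_arr:
  assumes f: "f \<in> Arr (cE X)" "Dom (cE X) f = x" "Cod (cE X) f = y"
  shows "K_arr f \<in> Arr (cE X)" "Dom (cE X) (K_arr f) = K x" "Cod (cE X) (K_arr f) = K y"
    "FArr (cp X) (K_arr f) = q X f" "Comp (cE X) (wk y) (K_arr f) = Comp (cE X) f (wk x)"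
proof -
  have [simp]: "x \<in> Obj (cE X)" "y \<in> Obj (cE X)" using f by auto
  obtain k where "k \<in> Arr (cE X)" "Dom (cE X) k = K x" "Cod (cE X) k = K y" "FArr (cp X) k = q X f"
    "Comp (cE X) (wk y) k = Comp (cE X) f (wk x)"
    by (rule p.cart_ex[OF wk(1)[of y], of "Comp (cE X) f (wk x)" "q X f"])
      (use f square[OF f] in simp_all)
  then have "\<exists>k. k \<in> Arr (cE X) \<and> Dom (cE X) k = K x \<and> Cod (cE X) k = K y \<and> FArr (cp X) k = q X f \<and>
    Comp (cE X) (wk y) k = Comp (cE X) f (wk x)" by blast
  from someI_ex[OF this]
  show "K_arr f \<in> Arr (cE X)" "Dom (cE X) (K_arr f) = K x" "Cod (cE X) (K_arr f) = K y"
    "FArr (cp X) (K_arr f) = q X f" "Comp (cE X) (wk y) (K_arr f) = Comp (cE X) f (wk x)"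
    by (simp_all add: K_arr_def f)
qed

lemma wk_unique:
  assumes "A \<in> Obj (cE X)" "h \<in> Arr (cE X)" "k \<in> Arr (cE X)" "Dom (cE X) h = Dom (cE X) k"
    "Cod (cE X) h = K A" "Cod (cE X) k = K A" "FArr (cp X) h = FArr (cp X) k"
    "Comp (cE X) (wk A) h = Comp (cE X) (wk A) k"
  shows "h = k"
  by (rule p.cart_unique[OF wk(1)[OF assms(1)]]) (use assms in simp_all)

text \<open>Both composites are arrows into the pullback of the display map of \<open>y\<close>
  along itself, and both become \<open>q X f\<close> after either projection.\<close>

lemma tm_K_arr:
  assumes f: "f \<in> Arr (cE X)" "Dom (cE X) f = x" "Cod (cE X) f = y"
  shows "tm X (K_arr f) (diag x) (diag y)"
proof -
  have xy [simp]: "x \<in> Obj (cE X)" "y \<in> Obj (cE X)" using f by auto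
  note k = K_arr[OF f]
  have "Comp (cB X) (q X (K_arr f)) (diag x) = Comp (cB X) (diag y) (q X f)"
  proof (rule p.D.pullback_unique[OF wk_pullback[OF xy(2)]])
    have "q X (Comp (cE X) (wk y) (K_arr f)) = q X (Comp (cE X) f (wk x))" using k(5) by simp
    then have 1: "Comp (cB X) (q X (wk y)) (q X (K_arr f)) = Comp (cB X) (q X f) (q X (wk x))"
      using k(1-3) f by simp
    have "Comp (cB X) (q X (wk y)) (Comp (cB X) (q X (K_arr f)) (diag x)) = q X f"
      using p.D.reassoc2[OF 1, of "diag x"] diag(2)[OF xy(1)] k(1-3) f by simp
    moreover have "Comp (cB X) (q X (wk y)) (Comp (cB X) (diag y) (q X f)) = q X f"
      using p.D.reassoc[OF diag(2)[OF xy(2)], of "q X f"] f by simp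
    ultimately show "Comp (cB X) (q X (wk y)) (Comp (cB X) (q X (K_arr f)) (diag x)) =
      Comp (cB X) (q X (wk y)) (Comp (cB X) (diag y) (q X f))" by simp
    have "Comp (cB X) (dp X (K y)) (Comp (cB X) (q X (K_arr f)) (diag x)) = q X f"
      using p.D.reassoc2[OF square[OF k(1-3)], of "diag x"] k(1-4) f by simp
    moreover have "Comp (cB X) (dp X (K y)) (Comp (cB X) (diag y) (q X f)) = q X f"
      using p.D.reassoc[OF diag_arr(4)[OF xy(2)], of "q X f"] f by simp
    ultimately show "Comp (cB X) (dp X (K y)) (Comp (cB X) (q X (K_arr f)) (diag x)) =
      Comp (cB X) (dp X (K y)) (Comp (cB X) (diag y) (q X f))" by simp
  qed (use k(1-4) f in simp_all)
  then show ?thesis using k(1-4) diag(1)[OF xy(1)] diag(1)[OF xy(2)] by (simp add: tm_def)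
qed

lemma K_arr_ide: "A \<in> Obj (cE X) \<Longrightarrow> K_arr (Ide (cE X) A) = Ide (cE X) (K A)"
  using K_arr[of "Ide (cE X) A" A A] by - (rule wk_unique[of A], simp_all)

lemma K_arr_comp:
  assumes "f \<in> Arr (cE X)" "g \<in> Arr (cE X)" "Cod (cE X) f = Dom (cE X) g"
  shows "K_arr (Comp (cE X) g f) = Comp (cE X) (K_arr g) (K_arr f)"
proof -
  note f = K_arr[OF assms(1) refl assms(3)] and g = K_arr[OF assms(2) refl refl]
    and gf = K_arr[of "Comp (cE X) g f" "Dom (cE X) f" "Cod (cE X) g"]
  have "Comp (cE X) (wk (Cod (cE X) g)) (Comp (cE X) (K_arr g) (K_arr f)) =
    Comp (cE X) g (Comp (cE X) (wk (Dom (cE X) g)) (K_arr f))"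
    by (rule p.C.reassoc2[OF g(5)]) (use f g assms in simp_all)
  then have "Comp (cE X) (wk (Cod (cE X) g)) (Comp (cE X) (K_arr g) (K_arr f)) =
    Comp (cE X) g (Comp (cE X) f (wk (Dom (cE X) f)))" by (simp add: f(5))
  then show ?thesis
    using f(1-4) g(1-4) gf assms by - (rule wk_unique[of "Cod (cE X) g"], simp_all)
qed

lemma section_arr:
  assumes "sect X A s"
  shows "section_arr A s \<in> Arr (cE X)" "Dom (cE X) (section_arr A s) = A"
      "Cod (cE X) (section_arr A s) = K A"
    "FArr (cp X) (section_arr A s) = s" "Comp (cE X) (wk A) (section_arr A s) = Ide (cE X) A"
proof -
  note s = sectD[OF assms]
  obtain h where "h \<in> Arr (cE X)" "Dom (cE X) h = A" "Cod (cE X) h = K A" "FArr (cp X) h = s"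
    "Comp (cE X) (wk A) h = Ide (cE X) A"
    by (rule p.cart_ex[OF wk(1)[OF s(1)], of "Ide (cE X) A" s]) (use s in simp_all)
  then have "\<exists>h. h \<in> Arr (cE X) \<and> Dom (cE X) h = A \<and> Cod (cE X) h = K A \<and> FArr (cp X) h = s \<and>
    Comp (cE X) (wk A) h = Ide (cE X) A" by blast
  from someI_ex[OF this]
  show "section_arr A s \<in> Arr (cE X)" "Dom (cE X) (section_arr A s) = A"
      "Cod (cE X) (section_arr A s) = K A"
    "FArr (cp X) (section_arr A s) = s" "Comp (cE X) (wk A) (section_arr A s) = Ide (cE X) A"
    by (simp_all add: section_arr_def)
qed

text \<open>This is coassociativity of the coalgebra that \<open>s\<close> stands for: after either
  projection of the pullback square of \<open>wk A\<close>, both composites equal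
  \<open>s\<close>.\<close>

lemma tm_section_arr:
  assumes "sect X A s" shows "tm X (section_arr A s) s (diag A)"
proof -
  note s = sectD[OF assms] and h = section_arr[OF assms]
  have "Comp (cB X) (q X (section_arr A s)) s = Comp (cB X) (diag A) s"
  proof (rule p.D.pullback_unique[OF wk_pullback[OF s(1)]])
    have "q X (Comp (cE X) (wk A) (section_arr A s)) = Ide (cB X) (ext X A)" using h(5) s(1) by simp
    then have 1: "Comp (cB X) (q X (wk A)) (q X (section_arr A s)) =
        Ide (cB X) (ext X A)" using h(1-3) s(1) by simp
    have "Comp (cB X) (q X (wk A)) (Comp (cB X) (q X (section_arr A s)) s) = s"
      using p.D.reassoc[OF 1, of s] h(1-3) s by simp
    moreover have "Comp (cB X) (q X (wk A)) (Comp (cB X) (diag A) s) = s"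
      using p.D.reassoc[OF diag(2)[OF s(1)], of s] s by simp
    ultimately show "Comp (cB X) (q X (wk A)) (Comp (cB X) (q X (section_arr A s)) s) =
      Comp (cB X) (q X (wk A)) (Comp (cB X) (diag A) s)" by simp
    have "Comp (cB X) (dp X (K A)) (Comp (cB X) (q X (section_arr A s)) s) = s"
      using p.D.reassoc2[OF square[OF h(1-3)], of s] h(1-4) s by simp
    moreover have "Comp (cB X) (dp X (K A)) (Comp (cB X) (diag A) s) = s"
      using p.D.reassoc[OF diag_arr(4)[OF s(1)], of s] s by simp
    ultimately show "Comp (cB X) (dp X (K A)) (Comp (cB X) (q X (section_arr A s)) s) =
      Comp (cB X) (dp X (K A)) (Comp (cB X) (diag A) s)" by simp
  qed (use h(1-3) s in simp_all)
  then show ?thesis using h(1-4) assms diag(1)[OF s(1)] by (simp add: tm_def)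
qed

lemma section_arr_natural:
  assumes "tm X f s s'"
  shows "Comp (cE X) (K_arr f) (section_arr (Dom (cE X) f) s) =
      Comp (cE X) (section_arr (Cod (cE X) f) s') f"
proof -
  note f = tmD[OF assms]
  note k = K_arr[OF f(1) refl refl] and h = section_arr[OF f(2)] and h' = section_arr[OF f(3)]
  have "Comp (cE X) (wk (Cod (cE X) f)) (Comp (cE X) (K_arr f) (section_arr (Dom (cE X) f) s)) = f"
    using p.C.reassoc2[OF k(5), of "section_arr (Dom (cE X) f) s"] k(1-3) h f(1) by simp
  moreover have "Comp (cE X) (wk (Cod (cE X) f)) (Comp (cE X) (section_arr (Cod (cE X) f) s') f) = f"
    using p.C.reassoc[OF h'(5), of f] h'(1-3) f(1) by simp
  ultimately show ?thesis
    using k(1-4) h(1-4) h'(1-4) f by - (rule wk_unique[of "Cod (cE X) f"], simp_all)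
qed

text \<open>A counit law of the comonad, with \<open>section_arr (K A) (diag A)\<close> as its
  comultiplication; it becomes a triangle identity of the adjunction.\<close>

lemma K_arr_wk_section_arr:
  assumes A: "A \<in> Obj (cE X)"
  shows "Comp (cE X) (K_arr (wk A)) (section_arr (K A) (diag A)) = Ide (cE X) (K A)"
proof -
  note h = section_arr[OF diag(1)[OF A]] and k = K_arr[OF wk(2-4)[OF A]]
  have "Comp (cE X) (wk A) (Comp (cE X) (K_arr (wk A)) (section_arr (K A) (diag A))) = wk A"
    using p.C.reassoc2[OF k(5), of "section_arr (K A) (diag A)"] k(1-3) h A by simp
  then show ?thesis
    using k(1-4) h(1-4) diag(2)[OF A] A by - (rule wk_unique[of A], simp_all)
qed

end

text \<open>Objects and arrows have to be elements of \<open>'u\<close>, so terms and their arrows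
  are coded by an injective pairing; \<open>fs\<close> and \<open>sn\<close> decode, with arbitrary
  values outside its range.\<close>

locale encoding =
  fixes enc :: "'u \<times> 'u \<Rightarrow> 'u"
  assumes inj_enc: "inj enc"
begin

definition "fs x = fst (inv enc x)"
definition "sn x = snd (inv enc x)"

lemma fs_enc [simp]: "fs (enc (a, b)) = a" and sn_enc [simp]: "sn (enc (a, b)) = b"
  by (simp_all add: fs_def sn_def inv_f_f[OF inj_enc])

lemma enc_eq [simp]: "enc (a, b) = enc (c, d) \<longleftrightarrow> a = c \<and> b = d"
  using inj_eq[OF inj_enc] by simp

text \<open>A term is a pair of a type \<open>A\<close> and a section \<open>s\<close> of \<open>dp X A\<close>; an arrow \<open>f\<close> between terms carries
  its two sections.\<close>

definition tcat :: "'u compcat \<Rightarrow> 'u scat" where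
  "tcat X = (let Ob = {enc (A, s) |A s. sect X A s};
      Ar = {enc (f, enc (s, s')) |f s s'. tm X f s s'} in
    \<lparr>Obj = Ob, Arr = Ar,
     Dom = restrict (\<lambda>x. enc (Dom (cE X) (fs x), fs (sn x))) Ar,
     Cod = restrict (\<lambda>x. enc (Cod (cE X) (fs x), sn (sn x))) Ar,
     Ide = restrict (\<lambda>x. enc (Ide (cE X) (fs x), enc (sn x, sn x))) Ob,
     Comp = (\<lambda>g f. if f \<in> Ar \<and> g \<in> Ar \<and> Cod (cE X) (fs f) = Dom (cE X) (fs g) \<and> sn (sn f) = fs (sn g)
       then enc (Comp (cE X) (fs g) (fs f), enc (fs (sn f), sn (sn g))) else undefined)\<rparr>)"

lemma tcat_Obj [simp]: "enc (A, s) \<in> Obj (tcat X) \<longleftrightarrow> sect X A s"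
  and tcat_Arr [simp]: "enc (f, enc (s, s')) \<in> Arr (tcat X) \<longleftrightarrow> tm X f s s'"
  and tcat_Dom [simp]: "tm X f s s' \<Longrightarrow> Dom (tcat X) (enc (f, enc (s, s'))) = enc (Dom (cE X) f, s)"
  and tcat_Cod [simp]: "tm X f s s' \<Longrightarrow> Cod (tcat X) (enc (f, enc (s, s'))) = enc (Cod (cE X) f, s')"
  and tcat_Ide [simp]: "sect X A s \<Longrightarrow> Ide (tcat X) (enc (A, s)) = enc (Ide (cE X) A, enc (s, s))"
  and tcat_Comp [simp]: "tm X f s s' \<Longrightarrow> tm X g s' s'' \<Longrightarrow> Cod (cE X) f = Dom (cE X) g \<Longrightarrow>
    Comp (tcat X) (enc (g, enc (s', s''))) (enc (f, enc (s, s'))) = enc (Comp (cE X) g f, enc (s, s''))"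
  by (auto simp: tcat_def Let_def)

lemma tcat_ObjE:
  assumes "x \<in> Obj (tcat X)" obtains A s where "x = enc (A, s)" "sect X A s"
  using assms by (auto simp: tcat_def Let_def)

lemma tcat_ArrE:
  assumes "x \<in> Arr (tcat X)" obtains f s s' where "x = enc (f, enc (s, s'))" "tm X f s s'"
  using assms by (auto simp: tcat_def Let_def)

lemma category_tcat:
  assumes "comprehension_category X" shows "category (tcat X)"
proof -
  interpret comprehension_category X by fact
  show ?thesis
  proof (rule categoryI)
    fix f assume "f \<in> Arr (tcat X)"
    then obtain h s s' where [simp]: "f = enc (h, enc (s, s'))" and h: "tm X h s s'" by (rule tcat_ArrE)
    note hD = tmD[OF h]
    show "Dom (tcat X) f \<in> Obj (tcat X)" "Cod (tcat X) f \<in> Obj (tcat X)" using h hD by simp_all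
    show "Comp (tcat X) (Ide (tcat X) (Cod (tcat X) f)) f = f"
      "Comp (tcat X) f (Ide (tcat X) (Dom (tcat X) f)) = f"
      using h hD tm_ide[OF hD(2)] tm_ide[OF hD(3)] by simp_all
  next
    fix x assume "x \<in> Obj (tcat X)"
    then obtain A s where [simp]: "x = enc (A, s)" and s: "sect X A s" by (rule tcat_ObjE)
    show "Ide (tcat X) x \<in> Arr (tcat X) \<and> Dom (tcat X) (Ide (tcat X) x) = x \<and>
        Cod (tcat X) (Ide (tcat X) x) = x"
      using s tm_ide[OF s] sectD(1)[OF s] by simp
  next
    fix f g assume fg: "f \<in> Arr (tcat X)" "g \<in> Arr (tcat X)" "Cod (tcat X) f = Dom (tcat X) g"
    obtain h s s' where [simp]: "f = enc (h, enc (s, s'))" and h: "tm X h s s'"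
      using fg(1) by (rule tcat_ArrE)
    obtain k r s'' where [simp]: "g = enc (k, enc (r, s''))" and k: "tm X k r s''"
      using fg(2) by (rule tcat_ArrE)
    have c: "Cod (cE X) h = Dom (cE X) k" "r = s'" using fg(3) h k by simp_all
    show "Comp (tcat X) g f \<in> Arr (tcat X) \<and> Dom (tcat X) (Comp (tcat X) g f) = Dom (tcat X) f \<and>
       Cod (tcat X) (Comp (tcat X) g f) = Cod (tcat X) g"
      using h k tm_comp[OF h k[unfolded c(2)] c(1)] tmD(1)[OF h] tmD(1)[OF k] by (simp add: c)
  next
    fix f g j assume fg: "f \<in> Arr (tcat X)" "g \<in> Arr (tcat X)" "j \<in> Arr (tcat X)"
      "Cod (tcat X) f = Dom (tcat X) g" "Cod (tcat X) g = Dom (tcat X) j"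
    obtain h s s' where [simp]: "f = enc (h, enc (s, s'))" and h: "tm X h s s'"
      using fg(1) by (rule tcat_ArrE)
    obtain k r s'' where [simp]: "g = enc (k, enc (r, s''))" and k: "tm X k r s''"
      using fg(2) by (rule tcat_ArrE)
    obtain l r' t where [simp]: "j = enc (l, enc (r', t))" and l: "tm X l r' t"
      using fg(3) by (rule tcat_ArrE)
    have c: "Cod (cE X) h = Dom (cE X) k" "r = s'" "Cod (cE X) k = Dom (cE X) l" "r' = s''"
      using fg(4,5) h k l by simp_all
    show "Comp (tcat X) j (Comp (tcat X) g f) = Comp (tcat X) (Comp (tcat X) j g) f"
      using h k l tm_comp[OF h k[unfolded c(2)] c(1)] tm_comp[OF k l[unfolded c(4)] c(3)]
        tmD(1)[OF h] tmD(1)[OF k] tmD(1)[OF l] by (simp add: c)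
  next
    fix f g assume *: "\<not> (f \<in> Arr (tcat X) \<and> g \<in> Arr (tcat X) \<and> Cod (tcat X) f = Dom (tcat X) g)"
    show "Comp (tcat X) g f = undefined"
    proof (cases "f \<in> Arr (tcat X) \<and> g \<in> Arr (tcat X)")
      case True
      obtain h s s' where f: "f = enc (h, enc (s, s'))" and h: "tm X h s s'"
        using True by (blast elim: tcat_ArrE)
      obtain k r s'' where g: "g = enc (k, enc (r, s''))" and k: "tm X k r s''"
        using True by (blast elim: tcat_ArrE)
      have "\<not> (Cod (cE X) h = Dom (cE X) k \<and> s' = r)" using * True h k by (auto simp: f g)
      then show ?thesis unfolding f g by (auto simp: tcat_def Let_def)
    qed (auto simp: tcat_def Let_def)
  qed (auto simp: tcat_def Let_def)
qed

end

lemma mk_chi_cong: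
  assumes "\<And>A. A \<in> Obj (Tot p) \<Longrightarrow> d A = d' A" "\<And>f. f \<in> Arr (Tot p) \<Longrightarrow> k f = k' f"
    and "category (Tot p)"
  shows "mk_chi p d k = mk_chi p d' k'"
proof -
  interpret category "Tot p" by fact
  show ?thesis using assms(1,2) by (auto simp: mk_chi_def intro!: restrict_ext)
qed

section \<open>The data of \<open>F\<close> on objects\<close>

context encoding
begin

definition tSig :: "'u compcat \<Rightarrow> 'u sftr" where
  "tSig X = \<lparr>FDom = tcat X, FCod = cE X, FObj = restrict fs (Obj (tcat X)),
     FArr = restrict fs (Arr (tcat X))\<rparr>"

text \<open>In a comprehension category the source section is determined by the pullback square of
  the lift, so the choice only names it.\<close>

definition tLift :: "'u compcat \<Rightarrow> 'u \<Rightarrow> 'u \<Rightarrow> 'u" where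
  "tLift X w x = (if x \<in> Obj (tcat X) \<and> w \<in> Arr (cB X) \<and> Cod (cB X) w = FObj (cp X) (fs x)
     then enc (Lift (CFib X) w (fs x), enc (SOME s. tm X (Lift (CFib X) w (fs x)) s (sn x), sn x))
     else undefined)"

definition tfib :: "'u compcat \<Rightarrow> 'u sfib" where
  "tfib X = \<lparr>Fun = cp X \<circ>\<^sub>c tSig X, Lift = tLift X\<rparr>"

text \<open>The constants of the locale take \<open>X\<close> as an explicit argument, since
  \<open>F\<close> has to be a function on all records.\<close>

definition tDel :: "'u compcat \<Rightarrow> 'u sftr" where
  "tDel X = \<lparr>FDom = cE X, FCod = tcat X,
     FObj = restrict (\<lambda>A. enc (comprehension_category.K X A, comprehension_category.diag X A)) (Obj
         (cE X)),
     FArr = restrict (\<lambda>f. enc (comprehension_category.K_arr X f,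
       enc (comprehension_category.diag X (Dom (cE X) f), comprehension_category.diag X (Cod (cE X)
           f))))
       (Arr (cE X))\<rparr>"

definition tEta :: "'u compcat \<Rightarrow> 'u sntr" where
  "tEta X = \<lparr>NDom = id_ftr (tcat X), NCod = tDel X \<circ>\<^sub>c tSig X,
     NComp = restrict (\<lambda>x. enc (comprehension_category.section_arr X (fs x) (sn x),
       enc (sn x, comprehension_category.diag X (fs x)))) (Obj (tcat X))\<rparr>"

definition tEps :: "'u compcat \<Rightarrow> 'u sntr" where
  "tEps X = \<lparr>NDom = tSig X \<circ>\<^sub>c tDel X, NCod = id_ftr (cE X),
     NComp = restrict (comprehension_category.wk X) (Obj (cE X))\<rparr>"

definition FO :: "'u compcat \<Rightarrow> 'u gcwf" where
  "FO X = \<lparr>GU = CFib X, GUd = tfib X, GSig = tSig X, GDel = tDel X, GEta = tEta X, GEps = tEps X\<rparr>"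

lemma FO_simps [simp]: "GU (FO X) = CFib X" "GUd (FO X) = tfib X" "GSig (FO X) = tSig X"
  "GDel (FO X) = tDel X" "GEta (FO X) = tEta X" "GEps (FO X) = tEps X"
  by (simp_all add: FO_def)

lemma tfib_simps [simp]: "Fun (tfib X) = cp X \<circ>\<^sub>c tSig X" "Lift (tfib X) = tLift X"
  by (simp_all add: tfib_def)

lemma tSig_simps [simp]: "FDom (tSig X) = tcat X" "FCod (tSig X) = cE X"
  "sect X A s \<Longrightarrow> FObj (tSig X) (enc (A, s)) = A"
  "tm X f s s' \<Longrightarrow> FArr (tSig X) (enc (f, enc (s, s'))) = f"
  by (simp_all add: tSig_def)

end

section \<open>Verification of the axioms for the terms of \<open>X\<close>\<close>

locale terms = comprehension_category X + encoding enc for X :: "'u compcat" and enc :: "'u \<times> 'u \<Rightarrow> 'u"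
begin

lemma tDel_simps [simp]: "FDom (tDel X) = cE X" "FCod (tDel X) = tcat X"
  "A \<in> Obj (cE X) \<Longrightarrow> FObj (tDel X) A = enc (K A, diag A)"
  "f \<in> Arr (cE X) \<Longrightarrow> FArr (tDel X) f = enc (K_arr f, enc (diag (Dom (cE X) f), diag (Cod (cE X) f)))"
  by (simp_all add: tDel_def)

lemma tEta_simps [simp]: "NDom (tEta X) = id_ftr (tcat X)" "NCod (tEta X) = tDel X \<circ>\<^sub>c tSig X"
  "sect X A s \<Longrightarrow> NComp (tEta X) (enc (A, s)) = enc (section_arr A s, enc (s, diag A))"
  by (simp_all add: tEta_def)

lemma tEps_simps [simp]: "NDom (tEps X) = tSig X \<circ>\<^sub>c tDel X" "NCod (tEps X) = id_ftr (cE X)"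
  "A \<in> Obj (cE X) \<Longrightarrow> NComp (tEps X) A = wk A"
  by (simp_all add: tEps_def)

lemma tcat: "category (tcat X)"
  by (rule category_tcat) (rule comprehension_category_axioms)

lemma func_tSig: "func (tcat X) (cE X) (tSig X)"
proof (rule funcI)
  fix f assume "f \<in> Arr (tcat X)"
  then obtain h s s' where [simp]: "f = enc (h, enc (s, s'))" and h: "tm X h s s'" by (rule tcat_ArrE)
  show "FArr (tSig X) f \<in> Arr (cE X) \<and> Dom (cE X) (FArr (tSig X) f) = FObj (tSig X) (Dom (tcat X) f) \<and>
      Cod (cE X) (FArr (tSig X) f) = FObj (tSig X) (Cod (tcat X) f)"
    using h tmD[OF h] by simp
next
  fix f g assume fg: "f \<in> Arr (tcat X)" "g \<in> Arr (tcat X)" "Cod (tcat X) f = Dom (tcat X) g"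
  obtain h s s' where [simp]: "f = enc (h, enc (s, s'))" and h: "tm X h s s'"
    using fg(1) by (rule tcat_ArrE)
  obtain k r s'' where [simp]: "g = enc (k, enc (r, s''))" and k: "tm X k r s''"
    using fg(2) by (rule tcat_ArrE)
  have c: "Cod (cE X) h = Dom (cE X) k" "r = s'" using fg(3) h k by simp_all
  show "FArr (tSig X) (Comp (tcat X) g f) = Comp (cE X) (FArr (tSig X) g) (FArr (tSig X) f)"
    using h k tm_comp[OF h k[unfolded c(2)] c(1)] by (simp add: c)
next
  fix x assume "x \<in> Obj (tcat X)"
  then obtain A s where [simp]: "x = enc (A, s)" and s: "sect X A s" by (rule tcat_ObjE)
  show "FObj (tSig X) x \<in> Obj (cE X)" "FArr (tSig X) (Ide (tcat X) x) = Ide (cE X) (FObj (tSig X) x)"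
    using s tm_ide[OF s] sectD(1)[OF s] by simp_all
qed (simp_all add: tcat p.C.category_axioms, simp_all add: tSig_def)

lemma func_tDel: "func (cE X) (tcat X) (tDel X)"
proof (rule funcI)
  fix f assume f: "f \<in> Arr (cE X)"
  show "FArr (tDel X) f \<in> Arr (tcat X) \<and> Dom (tcat X) (FArr (tDel X) f) = FObj (tDel X) (Dom (cE X) f) \<and>
      Cod (tcat X) (FArr (tDel X) f) = FObj (tDel X) (Cod (cE X) f)"
    using f tm_K_arr[OF f refl refl] K_arr[OF f refl refl] by simp
next
  fix f g assume fg: "f \<in> Arr (cE X)" "g \<in> Arr (cE X)" "Cod (cE X) f = Dom (cE X) g"
  show "FArr (tDel X) (Comp (cE X) g f) = Comp (tcat X) (FArr (tDel X) g) (FArr (tDel X) f)"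
    using fg tm_K_arr[OF fg(1) refl fg(3)] tm_K_arr[OF fg(2) refl refl] K_arr[OF fg(1) refl fg(3)]
      K_arr[OF fg(2) refl refl] K_arr_comp[OF fg] by simp
next
  fix A assume A: "A \<in> Obj (cE X)"
  show "FObj (tDel X) A \<in> Obj (tcat X)" "FArr (tDel X) (Ide (cE X) A) = Ide (tcat X) (FObj (tDel X) A)"
    using A diag(1)[OF A] K_arr_ide[OF A] by simp_all
qed (simp_all add: tcat p.C.category_axioms, simp_all add: tDel_def)

interpretation Sig: func "tcat X" "cE X" "tSig X" by (rule func_tSig)
interpretation Del: func "cE X" "tcat X" "tDel X" by (rule func_tDel)
interpretation T: func "tcat X" "cB X" "cp X \<circ>\<^sub>c tSig X"
  by (rule func_comp[OF func_tSig p.func_axioms])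

text \<open>A factorisation exists below, in the types; what has to be shown is that it respects
  sections, and this is uniqueness for the pullback square of \<open>h\<close>.\<close>

lemma cartesian_tcat:
  assumes h: "tm X h s s'" and c: "cartesian (cp X) h"
  shows "cartesian (cp X \<circ>\<^sub>c tSig X) (enc (h, enc (s, s')))"
proof (rule T.cartesianI)
  note hD = tmD[OF h] and s = sectD[OF tmD(2)[OF h]] and s' = sectD[OF tmD(3)[OF h]]
  show "enc (h, enc (s, s')) \<in> Arr (tcat X)" using h by simp
  {
    fix g w assume g: "g \<in> Arr (tcat X)" and w: "w \<in> Arr (cB X)"
      "Dom (cB X) w = FObj (cp X \<circ>\<^sub>c tSig X) (Dom (tcat X) g)"
      "Cod (cB X) w = FObj (cp X \<circ>\<^sub>c tSig X) (Dom (tcat X) (enc (h, enc (s, s'))))"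
      "Cod (tcat X) g = Cod (tcat X) (enc (h, enc (s, s')))"
      "Comp (cB X) (FArr (cp X \<circ>\<^sub>c tSig X) (enc (h, enc (s, s')))) w = FArr (cp X \<circ>\<^sub>c tSig X) g"
    obtain k r r' where g': "g = enc (k, enc (r, r'))" and k: "tm X k r r'"
      using g by (rule tcat_ArrE)
    note kD = tmD[OF k] and r = sectD[OF tmD(2)[OF k]]
    have w': "Dom (cB X) w = FObj (cp X) (Dom (cE X) k)" "Cod (cB X) w = FObj (cp X) (Dom (cE X) h)"
      "Cod (cE X) k = Cod (cE X) h" "r' = s'" "Comp (cB X) (FArr (cp X) h) w = FArr (cp X) k"
      using w(2-) h k hD kD by (simp_all add: g')
    obtain l where l: "l \<in> Arr (cE X)" "Dom (cE X) l = Dom (cE X) k" "Cod (cE X) l = Dom (cE X) h"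
      "FArr (cp X) l = w" "Comp (cE X) h l = k"
      by (rule p.cart_ex[OF c kD(1) w(1) w'(1,2,3,5)]) (use that in blast)
    \<comment> \<open>After the two projections both sides become \<open>s'\<close> after
      \<open>p k\<close>, respectively \<open>w\<close>.\<close>
    have "Comp (cB X) (q X l) r = Comp (cB X) s w"
    proof (rule p.D.pullback_unique[OF pullback[OF c refl refl]])
      have "q X (Comp (cE X) h l) = q X k" using l(5) by simp
      then have 1: "Comp (cB X) (q X h) (q X l) = q X k" using l(1-3) hD(1) by simp
      have "Comp (cB X) (q X h) (Comp (cB X) (q X l) r) = Comp (cB X) (q X k) r"
        using p.D.reassoc[OF 1, of r] l(1-3) hD(1) r kD(1) by simp
      also have "\<dots> = Comp (cB X) s' (Comp (cB X) (FArr (cp X) h) w)"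
        using kD(4) w' by simp
      also have "\<dots> = Comp (cB X) (q X h) (Comp (cB X) s w)"
        using p.D.reassoc2[OF hD(4), of w] hD(1) s s' w w' by simp
      finally show "Comp (cB X) (q X h) (Comp (cB X) (q X l) r) =
          Comp (cB X) (q X h) (Comp (cB X) s w)" .
      have "Comp (cB X) (dp X (Dom (cE X) h)) (Comp (cB X) (q X l) r) = w"
        using p.D.reassoc2[OF square[OF l(1-3)], of r] l r kD(1) hD(1) w(1) w'(1,2) by simp
      moreover have "Comp (cB X) (dp X (Dom (cE X) h)) (Comp (cB X) s w) = w"
        using p.D.reassoc[OF s(5), of w] s w(1) w' by simp
      ultimately show "Comp (cB X) (dp X (Dom (cE X) h)) (Comp (cB X) (q X l) r) =
        Comp (cB X) (dp X (Dom (cE X) h)) (Comp (cB X) s w)" by simp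
    qed (use l(1-3) r s w(1) w' kD(1) hD(1) in simp_all)
    then have tl: "tm X l r s" using l kD(2) hD(2) by (simp add: tm_def)
    show "\<exists>h'. h' \<in> Arr (tcat X) \<and> Dom (tcat X) h' = Dom (tcat X) g \<and>
        Cod (tcat X) h' = Dom (tcat X) (enc (h, enc (s, s'))) \<and> FArr (cp X \<circ>\<^sub>c tSig X) h' = w \<and>
        Comp (tcat X) (enc (h, enc (s, s'))) h' = g"
      by (rule exI[of _ "enc (l, enc (r, s))"]) (use tl l h k w' in \<open>simp add: g'\<close>)
  next
    fix x y assume xy: "x \<in> Arr (tcat X)" "y \<in> Arr (tcat X)" "Dom (tcat X) x = Dom (tcat X) y"
      "Cod (tcat X) x = Dom (tcat X) (enc (h, enc (s, s')))" "Cod (tcat X) y = Dom (tcat X) (enc (h,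
          enc (s, s')))"
      "FArr (cp X \<circ>\<^sub>c tSig X) x = FArr (cp X \<circ>\<^sub>c tSig X) y"
      "Comp (tcat X) (enc (h, enc (s, s'))) x = Comp (tcat X) (enc (h, enc (s, s'))) y"
    obtain k r r' where x': "x = enc (k, enc (r, r'))" and k: "tm X k r r'"
      using xy(1) by (rule tcat_ArrE)
    obtain l t t' where y': "y = enc (l, enc (t, t'))" and l: "tm X l t t'"
      using xy(2) by (rule tcat_ArrE)
    have e: "Dom (cE X) k = Dom (cE X) l" "r = t" "Cod (cE X) k = Dom (cE X) h" "r' = s"
      "Cod (cE X) l = Dom (cE X) h" "t' = s"
      using xy(3-5) h k l by (simp_all add: x' y')
    have "k = l"
      by (rule p.cart_unique[OF c]) (use xy(6,7) h k l tmD(1)[OF k] tmD(1)[OF l]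
          e in \<open>simp_all add: x' y'\<close>)
    then show "x = y" by (simp add: x' y' e)
  }
qed

lemma fibration_tfib: "fibration (tfib X)"
proof (rule fibration.intro)
  show "cat_functor (Fun (tfib X))" using T.is_functor by simp
  fix x w
  show "\<not> (x \<in> Obj (Tot (tfib X)) \<and> w \<in> Arr (Base (tfib X)) \<and> Cod (Base (tfib X)) w =
      FObj (Fun (tfib X)) x) \<Longrightarrow>
      Lift (tfib X) w x = undefined"
    by (auto simp: tLift_def elim!: tcat_ObjE)
  assume *: "x \<in> Obj (Tot (tfib X))" "w \<in> Arr (Base (tfib X))" "Cod (Base (tfib X)) w =
      FObj (Fun (tfib X)) x"
  then have "x \<in> Obj (tcat X)" by simp
  then obtain A s where x: "x = enc (A, s)" and s: "sect X A s" by (rule tcat_ObjE)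
  have w: "A \<in> Obj (cE X)" "w \<in> Arr (cB X)" "Cod (cB X) w = FObj (cp X) A"
    using * s sectD(1)[OF s] by (simp_all add: x)
  have "\<exists>r. tm X (Lift (CFib X) w A) r s"
    by (rule sect_pullback[OF p.lift(1)[OF w]]) (use s w in \<open>simp_all, blast\<close>)
  then have t: "tm X (Lift (CFib X) w A) (SOME r. tm X (Lift (CFib X) w A) r s) s" by (rule someI_ex)
  then show "cartesian (Fun (tfib X)) (Lift (tfib X) w x) \<and> Cod (Tot (tfib X)) (Lift (tfib X) w x) = x \<and>
        FArr (Fun (tfib X)) (Lift (tfib X) w x) = w"
    using cartesian_tcat[OF t] w s by (simp add: x tLift_def)
qed

text \<open>The chosen lift of the underlying base arrow, with the reindexed section, is cartesian
  among terms by \<open>cartesian_tcat\<close>. It differs from \<open>f\<close> by an isomorphism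
  of terms, which \<open>tSig\<close> preserves.\<close>

lemma tSig_cartesian:
  assumes f: "cartesian (cp X \<circ>\<^sub>c tSig X) f" shows "cartesian (cp X) (FArr (tSig X) f)"
proof -
  have "f \<in> Arr (tcat X)" using f by (rule T.cart_arr)
  then obtain h s s' where f': "f = enc (h, enc (s, s'))" and h: "tm X h s s'" by (rule tcat_ArrE)
  note hD = tmD[OF h]
  define l where "l = Lift (CFib X) (FArr (cp X) h) (Cod (cE X) h)"
  have l: "cartesian (cp X) l" "l \<in> Arr (cE X)" "Cod (cE X) l = Cod (cE X) h" "FArr (cp X) l =
      FArr (cp X) h"
    using hD(1) by (simp_all add: l_def)
  obtain r where r: "tm X l r s'" using sect_pullback[OF l(1)] hD(3) l(3) by auto
  obtain i where i: "is_iso (tcat X) i" "Cod (tcat X) i = Dom (tcat X) (enc (l, enc (r, s')))"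
    "Comp (tcat X) (enc (l, enc (r, s'))) i = f"
    by (rule T.cart_iso_between[OF f cartesian_tcat[OF r l(1)]]) (use h r l in \<open>simp_all add: f'\<close>)
  have "FArr (tSig X) f = Comp (cE X) l (FArr (tSig X) i)"
    using Sig.comp[of i "enc (l, enc (r, s'))"] Sig.C.iso_arr[OF i(1)] i(2,3) r by simp
  moreover have "cartesian (cp X) (Comp (cE X) l (FArr (tSig X) i))"
    by (rule p.cart_comp[OF p.cart_iso[OF Sig.iso[OF i(1)]] l(1)])
      (use Sig.C.iso_arr[OF i(1)] i(2) r tmD(2)[OF r] in simp)
  ultimately show ?thesis by simp
qed

lemma ntrans_tEta: "ntrans (tcat X) (tcat X) (id_ftr (tcat X)) (tDel X \<circ>\<^sub>c tSig X) (tEta X)"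
proof (rule ntransI[OF func_id[OF tcat] func_comp[OF func_tSig func_tDel]])
  fix x assume "x \<in> Obj (tcat X)"
  then obtain A s where [simp]: "x = enc (A, s)" and s: "sect X A s" by (rule tcat_ObjE)
  show "NComp (tEta X) x \<in> Arr (tcat X) \<and> Dom (tcat X) (NComp (tEta X) x) = FObj (id_ftr (tcat X)) x \<and>
      Cod (tcat X) (NComp (tEta X) x) = FObj (tDel X \<circ>\<^sub>c tSig X) x"
    using s section_arr[OF s] tm_section_arr[OF s] sectD(1)[OF s] by simp
next
  fix f assume "f \<in> Arr (tcat X)"
  then obtain h s s' where [simp]: "f = enc (h, enc (s, s'))" and h: "tm X h s s'" by (rule tcat_ArrE)
  note hD = tmD[OF h]
  show "Comp (tcat X) (FArr (tDel X \<circ>\<^sub>c tSig X) f) (NComp (tEta X) (Dom (tcat X) f)) =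
      Comp (tcat X) (NComp (tEta X) (Cod (tcat X) f)) (FArr (id_ftr (tcat X)) f)"
    using h hD section_arr_natural[OF h] section_arr[OF hD(2)] section_arr[OF hD(3)]
        tm_section_arr[OF hD(2)] tm_section_arr[OF hD(3)]
      tm_K_arr[OF hD(1) refl refl] K_arr[OF hD(1) refl refl] by simp
qed (simp_all add: tEta_def)

lemma ntrans_tEps: "ntrans (cE X) (cE X) (tSig X \<circ>\<^sub>c tDel X) (id_ftr (cE X)) (tEps X)"
proof (rule ntransI[OF func_comp[OF func_tDel func_tSig] func_id[OF p.C.category_axioms]])
  fix f assume f: "f \<in> Arr (cE X)"
  show "Comp (cE X) (FArr (id_ftr (cE X)) f) (NComp (tEps X) (Dom (cE X) f)) =
      Comp (cE X) (NComp (tEps X) (Cod (cE X) f)) (FArr (tSig X \<circ>\<^sub>c tDel X) f)"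
    using f tm_K_arr[OF f refl refl] K_arr[OF f refl refl] by simp
qed (use diag(1) in simp_all, simp_all add: tEps_def)

text \<open>The first triangle is the counit law of the coalgebra given by a section; the second is
  \<open>K_arr_wk_section_arr\<close>.\<close>

lemma adjunction_tSig_tDel: "adjunction (tSig X) (tDel X) (tEta X) (tEps X)"
proof -
  interpret eta: ntrans "tcat X" "tcat X" "id_ftr (tcat X)" "tDel X \<circ>\<^sub>c tSig X" "tEta X"
    by (rule ntrans_tEta)
  interpret eps: ntrans "cE X" "cE X" "tSig X \<circ>\<^sub>c tDel X" "id_ftr (cE X)" "tEps X"
    by (rule ntrans_tEps)
  have "(tEps X \<cdot>\<^sub>r tSig X) \<bullet> (tSig X \<cdot>\<^sub>l tEta X) = id_nat (tSig X)"
  proof (rule ntr_eqI[OF _ ntrans_id[OF func_tSig]])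
    have "ntrans (tcat X) (cE X) (tSig X \<circ>\<^sub>c id_ftr (tcat X)) (id_ftr (cE X) \<circ>\<^sub>c tSig X)
        ((tEps X \<cdot>\<^sub>r tSig X) \<bullet> (tSig X \<cdot>\<^sub>l tEta X))"
      by (rule ntrans_vcomp[OF ntrans_lwhisker[OF ntrans_tEta func_tSig,
              unfolded comp_ftr_assoc[OF func_tSig func_tDel func_tSig]]
            ntrans_rwhisker[OF ntrans_tEps func_tSig]])
    then show "ntrans (tcat X) (cE X) (tSig X) (tSig X) ((tEps X \<cdot>\<^sub>r tSig X) \<bullet> (tSig X \<cdot>\<^sub>l tEta X))"
      by (simp add: comp_ftr_id[OF func_tSig])
    fix x assume "x \<in> Obj (tcat X)"
    then obtain A s where [simp]: "x = enc (A, s)" and s: "sect X A s" by (rule tcat_ObjE)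
    show "NComp ((tEps X \<cdot>\<^sub>r tSig X) \<bullet> (tSig X \<cdot>\<^sub>l tEta X)) x = NComp (id_nat (tSig X)) x"
      using s section_arr[OF s] tm_section_arr[OF s] sectD(1)[OF s] by simp
  qed
  moreover have "(tDel X \<cdot>\<^sub>l tEps X) \<bullet> (tEta X \<cdot>\<^sub>r tDel X) = id_nat (tDel X)"
  proof (rule ntr_eqI[OF _ ntrans_id[OF func_tDel]])
    have "ntrans (cE X) (tcat X) (id_ftr (tcat X) \<circ>\<^sub>c tDel X) (tDel X \<circ>\<^sub>c id_ftr (cE X))
        ((tDel X \<cdot>\<^sub>l tEps X) \<bullet> (tEta X \<cdot>\<^sub>r tDel X))"
      by (rule ntrans_vcomp[OF ntrans_rwhisker[OF ntrans_tEta func_tDel,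
              folded comp_ftr_assoc[OF func_tDel func_tSig func_tDel]]
            ntrans_lwhisker[OF ntrans_tEps func_tDel]])
    then show "ntrans (cE X) (tcat X) (tDel X) (tDel X) ((tDel X \<cdot>\<^sub>l tEps X) \<bullet> (tEta X \<cdot>\<^sub>r tDel X))"
      by (simp add: comp_ftr_id[OF func_tDel])
    fix A assume A: "A \<in> Obj (cE X)"
    show "NComp ((tDel X \<cdot>\<^sub>l tEps X) \<bullet> (tEta X \<cdot>\<^sub>r tDel X)) A = NComp (id_nat (tDel X)) A"
      using A diag(1)[OF A] section_arr[OF diag(1)[OF A]] tm_section_arr[OF diag(1)[OF A]]
          tm_K_arr[OF wk(2-4)[OF A]]
        K_arr[OF wk(2-4)[OF A]] K_arr_wk_section_arr[OF A] by simp
  qed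
  ultimately show ?thesis
    using Sig.is_functor Del.is_functor eta.nat eps.nat by (simp add: adjunction_def)
qed

lemma generalised_cwf_FO: "generalised_cwf (FO X)"
proof (rule generalised_cwf.intro)
  fix f assume "cartesian (Fun (GUd (FO X))) f"
  then show "cartesian (Fun (GU (FO X))) (FArr (GSig (FO X)) f)" using tSig_cartesian by simp
next
  fix x assume "x \<in> Obj (Tot (GUd (FO X)))"
  then have "x \<in> Obj (tcat X)" by simp
  then obtain A s where [simp]: "x = enc (A, s)" and s: "sect X A s" by (rule tcat_ObjE)
  note A = sectD(1)[OF s] and h = section_arr[OF s]
  \<comment> \<open>Its composite with the cartesian \<open>wk A\<close> is an identity.\<close>
  have "cartesian (cp X) (section_arr A s)"
    by (rule p.cart_cancel[OF wk(1)[OF A]]) (use h A in \<open>simp_all add: p.cart_iso\<close>)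
  then show "cartesian (Fun (GUd (FO X))) (NComp (GEta (FO X)) x)"
    using s cartesian_tcat[OF tm_section_arr[OF s]] by simp
qed (simp_all add: CFib_fibration fibration_tfib adjunction_tSig_tDel)

text \<open>The fibration of types is kept together with its cleavage, \<open>wk A\<close> lies over
  the display map of \<open>A\<close>, and \<open>K_arr f\<close> lies over \<open>q X f\<close>;
  hence equality and not just isomorphism.\<close>

lemma GO_FO: "GO (FO X) = X"
proof (rule compcat.equality)
  have "mk_chi (CFib X) (\<lambda>A. FArr (cp X) (NComp (tEps X) A)) (\<lambda>f. FArr (cp X \<circ>\<^sub>c tSig X) (FArr (tDel
      X) f)) =
    mk_chi (CFib X) (dp X) (q X)"
  proof (rule mk_chi_cong)
    fix f assume f: "f \<in> Arr (Tot (CFib X))"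
    then show "FArr (cp X \<circ>\<^sub>c tSig X) (FArr (tDel X) f) = q X f"
      using tm_K_arr[OF f refl refl] K_arr[OF f refl refl] by simp
  qed (simp_all add: p.C.category_axioms)
  then show "CChi (GO (FO X)) = CChi X" by (simp add: GO_def CChi_eq[symmetric])
qed simp_all

end

section \<open>The 2-functor from comprehension categories\<close>

context encoding
begin

text \<open>The local \<open>t\<close> transports sections: the upper side of \<zeta> brings
  \<open>B s\<close> into the extension of the image type.\<close>

definition tMor :: "'u compmor \<Rightarrow> 'u sftr" where
  "tMor M = (let X = CSrc M; Y = CTgt M; t = \<lambda>A s. Comp (cB Y) (tt M A) (FArr (CBase M) s) in
    \<lparr>FDom = tcat X, FCod = tcat Y,
     FObj = restrict (\<lambda>x. enc (FObj (CTot M) (fs x), t (fs x) (sn x))) (Obj (tcat X)),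
     FArr = restrict (\<lambda>x. enc (FArr (CTot M) (fs x), enc (t (Dom (cE X) (fs x)) (fs (sn x)),
       t (Cod (cE X) (fs x)) (sn (sn x))))) (Arr (tcat X))\<rparr>)"

text \<open>\<zeta> can be an identity because \<open>tSig\<close> commutes strictly with
  \<open>tMor\<close>. Identities compose to identities, which makes strict functoriality of
  \<open>FM\<close> possible.\<close>

definition FM :: "'u compmor \<Rightarrow> 'u gmor" where
  "FM M = \<lparr>GSrc = FO (CSrc M), GTgt = FO (CTgt M), GC = CBase M, GH = CTot M, GHd = tMor M,
     GZeta = id_nat (CTot M \<circ>\<^sub>c tSig (CSrc M))\<rparr>"

lemma FM_simps [simp]: "GSrc (FM M) = FO (CSrc M)" "GTgt (FM M) = FO (CTgt M)" "GC (FM M) = CBase M"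
  "GH (FM M) = CTot M" "GHd (FM M) = tMor M" "GZeta (FM M) = id_nat (CTot M \<circ>\<^sub>c tSig (CSrc M))"
  by (simp_all add: FM_def)

end

locale term_mor = lax X Y M + encoding enc
  for X Y and M :: "'u compmor" and enc :: "'u \<times> 'u \<Rightarrow> 'u"
begin

sublocale tX: terms X enc by unfold_locales
sublocale tY: terms Y enc by unfold_locales

abbreviation "tr A s \<equiv> Comp (cB Y) (tt M A) (FArr (CBase M) s)"

lemma sect_tr:
  assumes "sect X A s" shows "sect Y (FObj (CTot M) A) (tr A s)"
proof -
  note s = X.sectD[OF assms]
  have "Comp (cB Y) (dp Y (FObj (CTot M) A)) (tr A s) = Comp (cB Y) (FArr (CBase M) (dp X A)) (FArr
      (CBase M) s)"
    by (rule Y.p.D.reassoc[OF dp_tt]) (use s in simp_all)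
  also have "\<dots> = FArr (CBase M) (Ide (cB X) (FObj (cp X) A))"
    by (rule F.B.comp_eq) (use s in simp_all)
  finally show ?thesis using s by (simp add: sect_def)
qed

lemma tm_tr:
  assumes "tm X f s s'"
  shows "tm Y (FArr (CTot M) f) (tr (Dom (cE X) f) s) (tr (Cod (cE X) f) s')"
proof -
  note f = X.tmD[OF assms] and s = X.sectD[OF X.tmD(2)[OF assms]] and s' =
      X.sectD[OF X.tmD(3)[OF assms]]
  have "Comp (cB Y) (q Y (FArr (CTot M) f)) (tr (Dom (cE X) f) s) =
    Comp (cB Y) (tt M (Cod (cE X) f)) (Comp (cB Y) (FArr (CBase M) (q X f)) (FArr (CBase M) s))"
    by (rule Y.p.D.reassoc2[OF tt_natural]) (use f(1) s in simp_all)
  also have "\<dots> = Comp (cB Y) (tt M (Cod (cE X) f)) (Comp (cB Y) (FArr (CBase M) s') (FArr (CBase M)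
      (FArr (cp X) f)))"
    by (subst F.B.comp_eq2[OF f(4)]) (use f(1) s s' in simp_all)
  finally show ?thesis using f(1) sect_tr[OF f(2)] sect_tr[OF f(3)] s s' by (simp add: tm_def)
qed

lemma tMor_simps [simp]: "FDom (tMor M) = tcat X" "FCod (tMor M) = tcat Y"
  "sect X A s \<Longrightarrow> FObj (tMor M) (enc (A, s)) = enc (FObj (CTot M) A, tr A s)"
  "tm X f s s' \<Longrightarrow> FArr (tMor M) (enc (f, enc (s, s'))) =
    enc (FArr (CTot M) f, enc (tr (Dom (cE X) f) s, tr (Cod (cE X) f) s'))"
  by (simp_all add: tMor_def CSrc CTgt)

lemma func_tMor: "func (tcat X) (tcat Y) (tMor M)"
proof (rule funcI)
  fix f assume "f \<in> Arr (tcat X)"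
  then obtain h s s' where [simp]: "f = enc (h, enc (s, s'))" and h: "tm X h s s'" by (rule tcat_ArrE)
  show "FArr (tMor M) f \<in> Arr (tcat Y) \<and> Dom (tcat Y) (FArr (tMor M) f) =
      FObj (tMor M) (Dom (tcat X) f) \<and>
      Cod (tcat Y) (FArr (tMor M) f) = FObj (tMor M) (Cod (tcat X) f)"
    using h X.tmD[OF h] tm_tr[OF h] by simp
next
  fix f g assume fg: "f \<in> Arr (tcat X)" "g \<in> Arr (tcat X)" "Cod (tcat X) f = Dom (tcat X) g"
  obtain h s s' where [simp]: "f = enc (h, enc (s, s'))" and h: "tm X h s s'"
    using fg(1) by (rule tcat_ArrE)
  obtain k r s'' where g: "g = enc (k, enc (r, s''))" and k': "tm X k r s''"
    using fg(2) by (rule tcat_ArrE)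
  have c: "Cod (cE X) h = Dom (cE X) k" "r = s'" using fg(3) h k' by (simp_all add: g)
  note k = k'[unfolded c(2)]
  show "FArr (tMor M) (Comp (tcat X) g f) = Comp (tcat Y) (FArr (tMor M) g) (FArr (tMor M) f)"
    using h k X.tm_comp[OF h k c(1)] tm_tr[OF h] tm_tr[OF k] X.tmD(1)[OF h] X.tmD(1)[OF k]
    by (simp add: g c)
next
  fix x assume "x \<in> Obj (tcat X)"
  then obtain A s where [simp]: "x = enc (A, s)" and s: "sect X A s" by (rule tcat_ObjE)
  show "FObj (tMor M) x \<in> Obj (tcat Y)" "FArr (tMor M) (Ide (tcat X) x) =
      Ide (tcat Y) (FObj (tMor M) x)"
    using s X.tm_ide[OF s] X.sectD(1)[OF s] sect_tr[OF s] by simp_all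
qed (simp_all add: tX.tcat tY.tcat, simp_all add: tMor_def CSrc CTgt)

lemma tSig_tMor: "tSig Y \<circ>\<^sub>c tMor M = CTot M \<circ>\<^sub>c tSig X"
proof (rule ftr_eqI[OF func_comp[OF func_tMor tY.func_tSig] func_comp[OF tX.func_tSig F.E.func_axioms]])
  fix f assume "f \<in> Arr (tcat X)"
  then obtain h s s' where [simp]: "f = enc (h, enc (s, s'))" and h: "tm X h s s'" by (rule tcat_ArrE)
  show "FArr (tSig Y \<circ>\<^sub>c tMor M) f = FArr (CTot M \<circ>\<^sub>c tSig X) f"
    using h tm_tr[OF h] by simp
qed

lemma gmorphism_FM: "gmorphism (FO X) (FO Y) (FM M)"
proof -
  interpret W: generalised_cwf "FO X" by (rule tX.generalised_cwf_FO)
  interpret W': generalised_cwf "FO Y" by (rule tY.generalised_cwf_FO)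
  interpret H: fib1 "GU (FO X)" "GU (FO Y)" "GC (FM M)" "GH (FM M)" using F.fib1_axioms by simp
  interpret B: func "Base (GUd (FO X))" "Base (GUd (FO Y))" "GC (FM M)" using F.B.func_axioms by simp
  interpret E: func "gV (FO X)" "gV (FO Y)" "GHd (FM M)" using func_tMor by simp
  have S: "func (tcat X) (cE Y) (CTot M \<circ>\<^sub>c tSig X)"
    by (rule func_comp[OF tX.func_tSig F.E.func_axioms])
  interpret z: ntrans "gV (FO X)" "gU (FO Y)" "GSig (FO Y) \<circ>\<^sub>c GHd (FM M)" "GH (FM M) \<circ>\<^sub>c GSig (FO X)"
    "GZeta (FM M)"
    using ntrans_id[OF S] by (simp add: tSig_tMor CSrc)
  show ?thesis
  proof unfold_locales
    fix f assume "f \<in> Arr (gV (FO X))"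
    then have "f \<in> Arr (tcat X)" by simp
    then obtain h s s' where [simp]: "f = enc (h, enc (s, s'))" and h: "tm X h s s'" by (rule tcat_ArrE)
    show "FArr (gv (FO Y)) (FArr (GHd (FM M)) f) = FArr (GC (FM M)) (FArr (gv (FO X)) f)"
      using h tm_tr[OF h] X.tmD(1)[OF h] by simp
  next
    fix f assume c: "cartesian (gv (FO X)) f"
    then have "f \<in> Arr (tcat X)" using W.v.cart_arr[OF c] by simp
    then obtain h s s' where f: "f = enc (h, enc (s, s'))" and h: "tm X h s s'" by (rule tcat_ArrE)
    have "cartesian (cp X) h" using tX.tSig_cartesian[of f] c h by (simp add: f)
    then show "cartesian (gv (FO Y)) (FArr (GHd (FM M)) f)"
      using tY.cartesian_tcat[OF tm_tr[OF h] F.cart] h by (simp add: f)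
  next
    fix a assume "a \<in> Obj (gV (FO X))"
    then have "a \<in> Obj (tcat X)" by simp
    then obtain A s where [simp]: "a = enc (A, s)" and s: "sect X A s" by (rule tcat_ObjE)
    show "is_iso (gU (FO Y)) (NComp (GZeta (FM M)) a)"
      "FArr (gu (FO Y)) (NComp (GZeta (FM M)) a) = Ide (gB (FO Y)) (FObj (GC (FM M)) (FObj (gv (FO
          X)) a))"
      using s X.sectD(1)[OF s] by (simp_all add: CSrc)
  qed (simp_all add: CSrc CTgt)
qed

text \<open>Over the base the mate is \<open>q\<close> of the image of \<open>wk A\<close>, after
  the transported \<open>diag A\<close>. Naturality of \<open>tt\<close> moves \<open>tt M A\<close>
  to the front, and what remains is the image of \<open>q (wk A)\<close> after
  \<open>diag A\<close>, an identity.\<close>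

lemma GM_FM: "GM (FM M) = M"
proof -
  interpret g: gmorphism "FO X" "FO Y" "FM M" by (rule gmorphism_FM)
  show ?thesis
  proof (rule lax_eqI[OF g.lax_GM[unfolded tX.GO_FO tY.GO_FO] lax_axioms])
    fix A assume A: "A \<in> Obj (cE X)"
    note d = X.diag[OF A] and w = X.wk[OF A]
    note tK = sect_tr[OF d(1)]
    let ?HK = "FObj (CTot M) (X.K A)"
    note h = Y.section_arr[OF tK] and h' = Y.tm_section_arr[OF tK]
    have f: "FArr (CTot M) (X.wk A) \<in> Arr (cE Y)" "Dom (cE Y) (FArr (CTot M) (X.wk A)) = ?HK"
      "Cod (cE Y) (FArr (CTot M) (X.wk A)) = FObj (CTot M) A" using w A by simp_all
    note k = Y.K_arr[OF f] and k' = Y.tm_K_arr[OF f]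
    \<comment> \<open>As \<zeta> of \<open>FM M\<close> is an identity, the mate is
      \<open>tDel\<close> of the image of the counit, after the unit.\<close>
    have "g.mate A = Comp (tcat Y) (FArr (tDel Y) (FArr (CTot M) (X.wk A))) (NComp (tEta Y) (enc
        (?HK, tr (X.K A) (X.diag A))))"
      using A d w f by (subst g.mate_eq) (simp_all add: CSrc)
    also have "\<dots> = enc (Comp (cE Y) (Y.K_arr (FArr (CTot M) (X.wk A))) (Y.section_arr ?HK (tr (X.K
        A) (X.diag A))),
        enc (tr (X.K A) (X.diag A), Y.diag (FObj (CTot M) A)))"
      using f tK h h' k k' by simp
    finally have "FArr (gv (FO Y)) (g.mate A) =
        Comp (cB Y) (q Y (FArr (CTot M) (X.wk A))) (tr (X.K A) (X.diag A))"
      using Y.tm_comp[OF h' k'] h k f by simp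
    also have "\<dots> = Comp (cB Y) (tt M A) (Comp (cB Y) (FArr (CBase M) (q X (X.wk A))) (FArr (CBase M)
        (X.diag A)))"
      by (rule Y.p.D.reassoc2[OF tt_natural]) (use A w in simp_all)
    also have "\<dots> = tt M A"
      by (subst F.B.comp_eq[OF d(2)]) (use A w in simp_all)
    finally show "tt (GM (FM M)) A = tt M A" using A by simp
  qed simp_all
qed

end

lemma (in encoding) FM_id1:
  assumes "comprehension_category X" shows "FM (comp_id1 X) = gcwf_id1 (FO X)"
proof -
  interpret X: comprehension_category X by fact
  interpret tX: terms X enc by unfold_locales
  interpret I: term_mor X X "comp_id1 X" enc
    by (intro term_mor.intro lax_comp_id1[OF assms]) unfold_locales
  have c: "CTot (comp_id1 X) = id_ftr (cE X)" "CBase (comp_id1 X) = id_ftr (cB X)"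
    "CSrc (comp_id1 X) = X" "CTgt (comp_id1 X) = X" by (simp_all add: comp_id1_def)
  have "tMor (comp_id1 X) = id_ftr (tcat X)"
  proof (rule ftr_eqI[OF I.func_tMor func_id[OF tX.tcat]])
    fix f assume f: "f \<in> Arr (tcat X)"
    then obtain h s s' where [simp]: "f = enc (h, enc (s, s'))" and h: "tm X h s s'" by (rule tcat_ArrE)
    note hD = X.tmD[OF h] and s = X.sectD[OF X.tmD(2)[OF h]] and s' = X.sectD[OF X.tmD(3)[OF h]]
    show "FArr (tMor (comp_id1 X)) f = FArr (id_ftr (tcat X)) f"
      using h hD(1) s s' f by (simp add: c lax_comp_id1(2)[OF assms])
  qed
  then show ?thesis
    by (simp add: FM_def gcwf_id1_def c comp_ftr_id[OF tX.func_tSig])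
qed

text \<open>Transport of sections is strictly functorial by the formula for \<open>tt\<close> of a
  composite, and the two \<zeta> are identities.\<close>

lemma (in encoding) FM_comp1:
  assumes "lax X Y M" "lax Y Z N" shows "FM (comp_comp1 N M) = gcwf_comp1 (FM N) (FM M)"
proof -
  interpret M: term_mor X Y M enc by (intro term_mor.intro assms(1)) unfold_locales
  interpret N: term_mor Y Z N enc by (intro term_mor.intro assms(2)) unfold_locales
  interpret NM: term_mor X Z "comp_comp1 N M" enc
    by (intro term_mor.intro lax_comp_comp1(1)[OF assms]) unfold_locales
  have c: "CTot (comp_comp1 N M) = CTot N \<circ>\<^sub>c CTot M" "CBase (comp_comp1 N M) = CBase N \<circ>\<^sub>c CBase M"
    by (simp_all add: comp_comp1_def)
  have t: "tMor (comp_comp1 N M) = tMor N \<circ>\<^sub>c tMor M"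
  proof (rule ftr_eqI[OF NM.func_tMor func_comp[OF M.func_tMor N.func_tMor]])
    fix f assume f: "f \<in> Arr (tcat X)"
    then obtain h s s' where [simp]: "f = enc (h, enc (s, s'))" and h: "tm X h s s'" by (rule tcat_ArrE)
    note hD = M.X.tmD[OF h] and s = M.X.sectD[OF M.X.tmD(2)[OF h]] and s' =
        M.X.sectD[OF M.X.tmD(3)[OF h]]
    show "FArr (tMor (comp_comp1 N M)) f = FArr (tMor N \<circ>\<^sub>c tMor M) f"
      using h hD(1) s s' f M.tm_tr[OF h] by (simp add: c lax_comp_comp1(2)[OF assms])
  qed
  have S: "func (tcat X) (cE Z) (CTot N \<circ>\<^sub>c (CTot M \<circ>\<^sub>c tSig X))"
    by (rule func_comp[OF func_comp[OF M.tX.func_tSig M.F.E.func_axioms] N.F.E.func_axioms])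
  have S': "func (tcat X) (cE Y) (CTot M \<circ>\<^sub>c tSig X)"
    by (rule func_comp[OF M.tX.func_tSig M.F.E.func_axioms])
  have "(CTot N \<cdot>\<^sub>l id_nat (CTot M \<circ>\<^sub>c tSig X)) \<bullet> (id_nat (CTot N \<circ>\<^sub>c tSig Y) \<cdot>\<^sub>r tMor M) =
    id_nat (CTot N \<circ>\<^sub>c (CTot M \<circ>\<^sub>c tSig X))"
  proof (rule ntr_eqI[OF _ ntrans_id[OF S]])
    have e: "(CTot N \<circ>\<^sub>c tSig Y) \<circ>\<^sub>c tMor M = CTot N \<circ>\<^sub>c (CTot M \<circ>\<^sub>c tSig X)"
      by (simp add: comp_ftr_assoc[OF M.func_tMor M.tY.func_tSig N.F.E.func_axioms, symmetric]
          M.tSig_tMor)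
    show "ntrans (tcat X) (cE Z) (CTot N \<circ>\<^sub>c (CTot M \<circ>\<^sub>c tSig X)) (CTot N \<circ>\<^sub>c (CTot M \<circ>\<^sub>c tSig X))
       ((CTot N \<cdot>\<^sub>l id_nat (CTot M \<circ>\<^sub>c tSig X)) \<bullet> (id_nat (CTot N \<circ>\<^sub>c tSig Y) \<cdot>\<^sub>r tMor M))"
      by (rule ntrans_vcomp[OF ntrans_rwhisker[OF ntrans_id[OF func_comp[OF M.tY.func_tSig
          N.F.E.func_axioms]]
              M.func_tMor, unfolded e] ntrans_lwhisker[OF ntrans_id[OF S'] N.F.E.func_axioms]])
    fix x assume x: "x \<in> Obj (tcat X)"
    then obtain A s where [simp]: "x = enc (A, s)" and s: "sect X A s" by (rule tcat_ObjE)
    show "NComp ((CTot N \<cdot>\<^sub>l id_nat (CTot M \<circ>\<^sub>c tSig X)) \<bullet> (id_nat (CTot N \<circ>\<^sub>c tSig Y) \<cdot>\<^sub>r tMor M)) x =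
      NComp (id_nat (CTot N \<circ>\<^sub>c (CTot M \<circ>\<^sub>c tSig X))) x"
      using s M.X.sectD(1)[OF s] M.sect_tr[OF s] by simp
  qed
  then show ?thesis
    by (simp add: FM_def gcwf_comp1_def c t NM.CSrc NM.CTgt M.CSrc N.CTgt N.CSrc
        comp_ftr_assoc[OF M.tX.func_tSig M.F.E.func_axioms N.F.E.func_axioms])
qed

context encoding
begin

text \<open>By local bijectivity of \<open>G\<close> there is exactly one candidate over each
  2-cell; it is named by choice and not written out.\<close>

definition FFun :: "('u compcat, 'u compmor, 'u compcell, 'u gcwf, 'u gmor, 'u gcell) two_ftr" where
  "FFun = \<lparr>Map0 = FO, Map1 = FM,
     Map2 = (\<lambda>\<alpha>. SOME \<beta>. \<beta> \<in> Hom2 GCwF (FM (CDom2 \<alpha>)) (FM (CCod2 \<alpha>)) \<and> GC2 \<beta> = \<alpha>)\<rparr>"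

lemma FFun_simps [simp]: "Map0 FFun = FO" "Map1 FFun = FM"
  by (simp_all add: FFun_def)

lemma FM_hom:
  assumes "lax X Y M" shows "gmorphism (FO X) (FO Y) (FM M)" "GM (FM M) = M"
proof -
  interpret M: term_mor X Y M enc by (intro term_mor.intro assms(1)) unfold_locales
  show "gmorphism (FO X) (FO Y) (FM M)" "GM (FM M) = M" by (rule M.gmorphism_FM M.GM_FM)+
qed

lemma FO_obj:
  assumes "comprehension_category X" shows "generalised_cwf (FO X)" "GO (FO X) = X"
proof -
  interpret comprehension_category X by fact
  interpret terms X enc by unfold_locales
  show "generalised_cwf (FO X)" "GO (FO X) = X" by (rule generalised_cwf_FO GO_FO)+
qed

lemma Map2_FFun:
  assumes "\<alpha> \<in> Hom2 CompCat f g"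
  shows "Map2 FFun \<alpha> \<in> Hom2 GCwF (FM f) (FM g) \<and> GC2 (Map2 FFun \<alpha>) = \<alpha>"
proof -
  note a = Hom2_CompCatD[OF assms]
  note fg = ccell2D(1,2)[OF a(1), unfolded a(2,3)]
  interpret local_iso "CompCat :: ('u compcat, 'u compmor, 'u compcell) two_cat" GCwF GFun
    by (rule local_iso_GFun)
  have "\<exists>\<beta> \<in> Hom2 GCwF (FM f) (FM g). Map2 GFun \<beta> = \<alpha>"
    by (rule full2[of _ "FO (CSrc f)" "FO (CTgt f)"])
      (use FM_hom[OF fg(1)] FM_hom[OF fg(2)] assms in simp_all)
  then have "\<exists>\<beta>. \<beta> \<in> Hom2 GCwF (FM (CDom2 \<alpha>)) (FM (CCod2 \<alpha>)) \<and> GC2 \<beta> = \<alpha>" by (auto simp: a)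
  from someI_ex[OF this] show ?thesis by (simp add: FFun_def a)
qed

lemma two_functor_FFun:
  "two_functor (CompCat :: ('u compcat, 'u compmor, 'u compcell) two_cat) GCwF FFun"
proof -
  interpret local_iso "CompCat :: ('u compcat, 'u compmor, 'u compcell) two_cat" GCwF GFun
    by (rule local_iso_GFun)
  show ?thesis
    by (rule section_two_functor)
      (use FM_hom FO_obj FM_id1 FM_comp1 Map2_FFun in auto)
qed

lemma GFun_FFun:
  "two_ftr_eq (CompCat :: ('u compcat, 'u compmor, 'u compcell) two_cat) (comp_two_ftr GFun FFun)
      id_two_ftr"
proof -
  have "GM (FM M) = M" if "comp_lax_morphism M" for M
    using FM_hom(2)[of "CSrc M" "CTgt M" M] that by (simp add: lax_iff)
  moreover have "GC2 (Map2 FFun \<alpha>) = \<alpha>" if "comp_cell2 \<alpha>" for \<alpha>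
    using Map2_FFun[of \<alpha> "CDom2 \<alpha>" "CCod2 \<alpha>"] that by (simp add: Hom2_def)
  ultimately show ?thesis
    by (simp add: two_ftr_eq_def comp_two_ftr_def id_two_ftr_def FO_obj)
qed

end

section \<open>The counit\<close>

context generalised_cwf
begin

lemma transpose_eq:
  assumes l: "l \<in> Arr (gV W)" "Cod (gV W) l = FObj (GDel W) A" and A: "A \<in> Obj (gU W)"
  shows "Comp (gV W) (FArr (GDel W) (Comp (gU W) (NComp (GEps W) A) (FArr (GSig W) l)))
    (NComp (GEta W) (Dom (gV W) l)) = l"
proof (rule transpose_unique[of _ _ A], goal_cases)
  case 7
  show ?case by (rule eps_transpose) (use l A in simp_all)
qed (use l A in simp_all)

lemma sect_GO: "sect (GO W) A s \<longleftrightarrow> A \<in> Obj (gU W) \<and> s \<in> Arr (gB W) \<and>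
    Dom (gB W) s = FObj (gu W) A \<and> Cod (gB W) s = FObj (gv W) (FObj (GDel W) A) \<and>
    Comp (gB W) (FArr (gu W) (NComp (GEps W) A)) s = Ide (gB W) (FObj (gu W) A)"
  by (auto simp: sect_def)

lemma tm_GO: "tm (GO W) f s s' \<longleftrightarrow> f \<in> Arr (gU W) \<and> sect (GO W) (Dom (gU W) f) s \<and>
    sect (GO W) (Cod (gU W) f) s' \<and>
    Comp (gB W) (FArr (gv W) (FArr (GDel W) f)) s = Comp (gB W) s' (FArr (gu W) f)"
  by (auto simp: tm_def)

text \<open>The reindexing \<open>el A s\<close> of \<open>\<Delta> A\<close> along a section \<open>s\<close> of \<open>u \<epsilon>\<^sub>A\<close> is the term that \<open>s\<close> stands
  for: \<open>\<Sigma>\<close> maps it to \<open>A\<close> up to a vertical isomorphism.\<close>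

definition "el_lift A s = Lift (GUd W) s (FObj (GDel W) A)"
definition "el A s = Dom (gV W) (el_lift A s)"
definition "el_iso A s = Comp (gU W) (NComp (GEps W) A) (FArr (GSig W) (el_lift A s))"

text \<open>\<open>el_iso A s\<close> is \<epsilon> after \<Sigma> of a cartesian lift of
  \<open>s\<close>, so it is cartesian, and it lies over \<open>s\<close> followed by the display
  map, an identity; hence it is invertible. Its transpose is the lift itself, which gives the last
  claim: up to this isomorphism the section named by \<open>el A s\<close> is
  \<open>s\<close>.\<close>

lemma el:
  assumes "sect (GO W) A s"
  shows "el A s \<in> Obj (gV W)" "FObj (gv W) (el A s) = FObj (gu W) A"
    "el_iso A s \<in> Arr (gU W)" "Dom (gU W) (el_iso A s) = FObj (GSig W) (el A s)"
        "Cod (gU W) (el_iso A s) = A"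
    "FArr (gu W) (el_iso A s) = Ide (gB W) (FObj (gu W) A)" "is_iso (gU W) (el_iso A s)"
    "Comp (gB W) (FArr (gv W) (FArr (GDel W) (el_iso A s))) (gsig W (el A s)) = s"
proof -
  have s: "A \<in> Obj (gU W)" "s \<in> Arr (gB W)" "Dom (gB W) s = FObj (gu W) A"
    "Cod (gB W) s = FObj (gv W) (FObj (GDel W) A)"
    "Comp (gB W) (FArr (gu W) (NComp (GEps W) A)) s = Ide (gB W) (FObj (gu W) A)"
    using assms by (simp_all add: sect_GO)
  have l: "cartesian (gv W) (el_lift A s)" "el_lift A s \<in> Arr (gV W)" "Dom (gV W) (el_lift A s) =
      el A s"
    "Cod (gV W) (el_lift A s) = FObj (GDel W) A" "FArr (gv W) (el_lift A s) = s"
    using s by (simp_all add: el_lift_def el_def)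
  show 1: "el A s \<in> Obj (gV W)" "FObj (gv W) (el A s) = FObj (gu W) A"
    using v.C.Dom_in[OF l(2)] v.arr(2)[OF l(2)] unfolding l(3,5) s(3) by simp_all
  show z: "el_iso A s \<in> Arr (gU W)" "Dom (gU W) (el_iso A s) = FObj (GSig W) (el A s)"
      "Cod (gU W) (el_iso A s) = A"
    "FArr (gu W) (el_iso A s) = Ide (gB W) (FObj (gu W) A)"
    using s l by (simp_all add: el_iso_def)
  have "cartesian (gu W) (el_iso A s)"
    unfolding el_iso_def by (rule u.cart_comp[OF GSig_cartesian[OF l(1)]
        GEps_cartesian[OF s(1)]]) (use s l in simp)
  then show "is_iso (gU W) (el_iso A s)" by (rule u.cart_over_iso) (use z s in simp)
  have e: "Comp (gV W) (FArr (GDel W) (el_iso A s)) (NComp (GEta W) (el A s)) = el_lift A s"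
    using transpose_eq[OF l(2,4) s(1)] unfolding l(3) el_iso_def[symmetric] .
  show "Comp (gB W) (FArr (gv W) (FArr (GDel W) (el_iso A s))) (gsig W (el A s)) = s"
    using v.comp_eq[OF e] z 1 l(5) by (simp add: gsig_def)
qed

definition "el_arr f s s' = (SOME k. k \<in> Arr (gV W) \<and> Dom (gV W) k = el (Dom (gU W) f) s \<and>
  Cod (gV W) k = el (Cod (gU W) f) s' \<and> FArr (GSig W) k =
    Comp (gU W) (inv_arr (gU W) (el_iso (Cod (gU W) f) s')) (Comp (gU W) f (el_iso (Dom (gU W) f) s)))"

text \<open>Conjugating \<open>f\<close> with the vertical isomorphisms gives an arrow between
  images of \<Sigma>. It respects the named sections because \<open>f\<close> respects
  \<open>s\<close> and \<open>s'\<close>, so \<open>Sig_lift\<close> applies.\<close>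

lemma el_arr:
  assumes f: "tm (GO W) f s s'"
  shows "el_arr f s s' \<in> Arr (gV W)" "Dom (gV W) (el_arr f s s') = el (Dom (gU W) f) s"
    "Cod (gV W) (el_arr f s s') = el (Cod (gU W) f) s'"
    "FArr (GSig W) (el_arr f s s') =
      Comp (gU W) (inv_arr (gU W) (el_iso (Cod (gU W) f) s')) (Comp (gU W) f (el_iso (Dom (gU W) f) s))"
proof -
  let ?x = "Dom (gU W) f" and ?y = "Cod (gU W) f"
  have f': "f \<in> Arr (gU W)" "sect (GO W) ?x s" "sect (GO W) ?y s'"
    "Comp (gB W) (FArr (gv W) (FArr (GDel W) f)) s = Comp (gB W) s' (FArr (gu W) f)"
    using f by (simp_all add: tm_GO)
  note x = el[OF f'(2)] and y = el[OF f'(3)]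
  define m where "m = Comp (gU W) (inv_arr (gU W) (el_iso ?y s')) (Comp (gU W) f (el_iso ?x s))"
  have m: "m \<in> Arr (gU W)" "Dom (gU W) m = FObj (GSig W) (el ?x s)" "Cod (gU W) m =
      FObj (GSig W) (el ?y s')"
    "FArr (gu W) m = FArr (gu W) f" "Comp (gU W) (el_iso ?y s') m = Comp (gU W) f (el_iso ?x s)"
    using f'(1) x y by (simp_all add: m_def)
  let ?g = "\<lambda>h. FArr (gv W) (FArr (GDel W) h)"
  \<comment> \<open>The section condition is checked after the invertible image of
    \<open>el_iso\<close> at the target, where the last part of \<open>el\<close> replaces the named
    sections by \<open>s\<close> and \<open>s'\<close>.\<close>
  have "Comp (gB W) (?g (el_iso ?y s')) (Comp (gB W) (?g m) (gsig W (el ?x s))) =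
    Comp (gB W) (?g f) (Comp (gB W) (?g (el_iso ?x s)) (gsig W (el ?x s)))"
    by (rule u.D.reassoc2[OF v.comp_eq2[OF Del.comp_eq2[OF m(5)]]]) (use m x y f'(1) in simp_all)
  also have "\<dots> = Comp (gB W) s' (FArr (gu W) f)" by (simp add: x(8) f'(4))
  also have "\<dots> = Comp (gB W) (?g (el_iso ?y s')) (Comp (gB W) (gsig W (el ?y s')) (FArr (gu W) f))"
    by (subst u.D.reassoc[OF y(8)]) (use f'(1) y in simp_all)
  finally have s: "Comp (gB W) (?g m) (gsig W (el ?x s)) = Comp (gB W) (gsig W (el ?y s')) (FArr (gu
      W) m)"
    unfolding m(4) by (rule u.D.iso_cancel) (use f'(1) m x y in simp_all)
  have "\<exists>k. k \<in> Arr (gV W) \<and> Dom (gV W) k = el ?x s \<and> Cod (gV W) k = el ?y s' \<and> FArr (GSig W) k = m"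
    by (rule Sig_lift[OF x(1) y(1) m(1-3) s]) blast
  from someI_ex[OF this]
  show "el_arr f s s' \<in> Arr (gV W)" "Dom (gV W) (el_arr f s s') = el ?x s"
      "Cod (gV W) (el_arr f s s') = el ?y s'"
    "FArr (GSig W) (el_arr f s s') = Comp (gU W) (inv_arr (gU W) (el_iso ?y s')) (Comp (gU W) f
        (el_iso ?x s))"
    by (simp_all add: el_arr_def m_def)
qed

text \<open>Reduces functoriality of the reindexing to equations between types.\<close>

lemma el_arr_unique:
  assumes f: "tm (GO W) f s s'" and k: "k \<in> Arr (gV W)" "Dom (gV W) k = el (Dom (gU W) f) s"
    "Cod (gV W) k = el (Cod (gU W) f) s'"
    "Comp (gU W) (el_iso (Cod (gU W) f) s') (FArr (GSig W) k) = Comp (gU W) f (el_iso (Dom (gU W) f) s)"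
  shows "el_arr f s s' = k"
proof (rule Sig_faithful)
  have f': "f \<in> Arr (gU W)" "sect (GO W) (Dom (gU W) f) s" "sect (GO W) (Cod (gU W) f) s'"
    using f by (simp_all add: tm_GO)
  note y = el[OF f'(3)]
  show "FArr (GSig W) (el_arr f s s') = FArr (GSig W) k"
    unfolding el_arr(4)[OF f] k(4)[symmetric] using y k(1-3) by simp
qed (use k el_arr[OF f] in simp_all)

lemma el_iso_natural:
  assumes f: "tm (GO W) f s s'"
  shows "Comp (gU W) (el_iso (Cod (gU W) f) s') (FArr (GSig W) (el_arr f s s')) =
    Comp (gU W) f (el_iso (Dom (gU W) f) s)"
  unfolding el_arr(4)[OF f] using f el[of "Dom (gU W) f" s] el[of "Cod (gU W) f" s']
      by (simp add: tm_GO)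

lemma over_el_arr:
  assumes f: "tm (GO W) f s s'" shows "FArr (gv W) (el_arr f s s') = FArr (gu W) f"
proof -
  have f': "f \<in> Arr (gU W)" "sect (GO W) (Dom (gU W) f) s" "sect (GO W) (Cod (gU W) f) s'"
    using f by (simp_all add: tm_GO)
  have "FArr (gv W) (el_arr f s s') = FArr (gu W) (FArr (GSig W) (el_arr f s s'))"
    using el_arr(1)[OF f] by simp
  also have "\<dots> = FArr (gu W) f"
    unfolding el_arr(4)[OF f] using f'(1) el[OF f'(2)] el[OF f'(3)] by simp
  finally show ?thesis .
qed

end

section \<open>The comparison 1-cells between \<open>F G W\<close> and \<open>W\<close>\<close>

locale cwf_terms = generalised_cwf W + encoding enc for W :: "'u gcwf" and enc :: "'u \<times> 'u \<Rightarrow> 'u"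
begin

sublocale X: comprehension_category "GO W" by (rule comprehension_category_GO)
sublocale T: terms "GO W" enc by unfold_locales

definition el_ftr :: "'u sftr" where
  "el_ftr = \<lparr>FDom = tcat (GO W), FCod = gV W, FObj = restrict (\<lambda>x. el (fs x) (sn x)) (Obj (tcat (GO
      W))),
     FArr = restrict (\<lambda>x. el_arr (fs x) (fs (sn x)) (sn (sn x))) (Arr (tcat (GO W)))\<rparr>"

definition gsig_ftr :: "'u sftr" where
  "gsig_ftr = \<lparr>FDom = gV W, FCod = tcat (GO W),
     FObj = restrict (\<lambda>a. enc (FObj (GSig W) a, gsig W a)) (Obj (gV W)),
     FArr = restrict (\<lambda>f. enc (FArr (GSig W) f, enc (gsig W (Dom (gV W) f), gsig W (Cod (gV W) f))))
       (Arr (gV W))\<rparr>"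

text \<open>The target of \<zeta> is written as \<open>tSig (GO W)\<close>, which equals its
  composite with the identity functor on types.\<close>

definition epsM :: "'u gmor" where
  "epsM = \<lparr>GSrc = FO (GO W), GTgt = W, GC = id_ftr (gB W), GH = id_ftr (gU W), GHd = el_ftr,
     GZeta = \<lparr>NDom = GSig W \<circ>\<^sub>c el_ftr, NCod = tSig (GO W),
       NComp = restrict (\<lambda>x. el_iso (fs x) (sn x)) (Obj (tcat (GO W)))\<rparr>\<rparr>"

definition kapM :: "'u gmor" where
  "kapM = \<lparr>GSrc = W, GTgt = FO (GO W), GC = id_ftr (gB W), GH = id_ftr (gU W), GHd = gsig_ftr,
     GZeta = id_nat (GSig W)\<rparr>"

lemma el_ftr_simps [simp]: "FDom el_ftr = tcat (GO W)" "FCod el_ftr = gV W"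
  "sect (GO W) A s \<Longrightarrow> FObj el_ftr (enc (A, s)) = el A s"
  "tm (GO W) f s s' \<Longrightarrow> FArr el_ftr (enc (f, enc (s, s'))) = el_arr f s s'"
  by (simp_all add: el_ftr_def)

lemma gsig_ftr_simps [simp]: "FDom gsig_ftr = gV W" "FCod gsig_ftr = tcat (GO W)"
  "a \<in> Obj (gV W) \<Longrightarrow> FObj gsig_ftr a = enc (FObj (GSig W) a, gsig W a)"
  "f \<in> Arr (gV W) \<Longrightarrow> FArr gsig_ftr f = enc (FArr (GSig W) f, enc (gsig W (Dom (gV W) f),
      gsig W (Cod (gV W) f)))"
  by (simp_all add: gsig_ftr_def)

lemma func_el_ftr: "func (tcat (GO W)) (gV W) el_ftr"
proof (rule funcI)
  fix f assume "f \<in> Arr (tcat (GO W))"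
  then obtain h s s' where [simp]: "f = enc (h, enc (s, s'))" and h:
      "tm (GO W) h s s'" by (rule tcat_ArrE)
  show "FArr el_ftr f \<in> Arr (gV W) \<and> Dom (gV W) (FArr el_ftr f) = FObj el_ftr (Dom (tcat (GO W)) f) \<and>
      Cod (gV W) (FArr el_ftr f) = FObj el_ftr (Cod (tcat (GO W)) f)"
    using h el_arr[OF h] by (simp add: tm_GO)
next
  fix x assume "x \<in> Obj (tcat (GO W))"
  then obtain A s where [simp]: "x = enc (A, s)" and s: "sect (GO W) A s" by (rule tcat_ObjE)
  have A: "A \<in> Obj (gU W)" using s by (simp add: sect_GO)
  note i = X.tm_ide[OF s, unfolded CFib_GO]
  show "FObj el_ftr x \<in> Obj (gV W)" using s el[OF s] by simp
  have "el_arr (Ide (gU W) A) s s = Ide (gV W) (el A s)"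
    by (rule el_arr_unique[OF i]) (use A el[OF s] in simp_all)
  then show "FArr el_ftr (Ide (tcat (GO W)) x) = Ide (gV W) (FObj el_ftr x)" using s i by simp
next
  fix f g assume fg: "f \<in> Arr (tcat (GO W))" "g \<in> Arr (tcat (GO W))"
    "Cod (tcat (GO W)) f = Dom (tcat (GO W)) g"
  obtain h s s' where f: "f = enc (h, enc (s, s'))" and h: "tm (GO W) h s s'"
    using fg(1) by (rule tcat_ArrE)
  obtain k r s'' where g: "g = enc (k, enc (r, s''))" and k': "tm (GO W) k r s''"
    using fg(2) by (rule tcat_ArrE)
  have c: "Cod (gU W) h = Dom (gU W) k" "r = s'" using fg(3) h k' by (simp_all add: f g)
  note k = k'[unfolded c(2)]
  note hk = X.tm_comp[OF h k, unfolded CFib_GO, OF c(1)]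
  have hU: "h \<in> Arr (gU W)" "k \<in> Arr (gU W)" and s: "sect (GO W) (Dom (gU W) h) s"
    "sect (GO W) (Dom (gU W) k) s'" "sect (GO W) (Cod (gU W) k) s''"
    using h k by (simp_all add: tm_GO)
  note z1 = el[OF s(1)] and z2 = el[OF s(2)] and z3 = el[OF s(3)]
  note eh = el_arr[OF h] and ek = el_arr[OF k]
  have "Comp (gU W) (el_iso (Cod (gU W) k) s'') (Comp (gU W) (FArr (GSig W) (el_arr k s' s'')) (FArr
      (GSig W) (el_arr h s s')))
    = Comp (gU W) k (Comp (gU W) (el_iso (Dom (gU W) k) s') (FArr (GSig W) (el_arr h s s')))"
    by (rule u.C.reassoc2[OF el_iso_natural[OF k]]) (use eh(1-3) ek(1-3) z2 z3 hU c in simp_all)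
  also have "\<dots> = Comp (gU W) k (Comp (gU W) h (el_iso (Dom (gU W) h) s))"
    using el_iso_natural[OF h] by (simp add: c)
  finally have "el_arr (Comp (gU W) k h) s s'' = Comp (gV W) (el_arr k s' s'') (el_arr h s s')"
    by - (rule el_arr_unique[OF hk], use eh(1-3) ek(1-3) z1 z2 z3 hU c in simp_all)
  then show "FArr el_ftr (Comp (tcat (GO W)) g f) = Comp (gV W) (FArr el_ftr g) (FArr el_ftr f)"
    using h k hk by (simp add: f g c)
qed (simp_all add: T.tcat v.C.category_axioms, simp_all add: el_ftr_def)

lemma gmorphism_epsM: "gmorphism (FO (GO W)) W epsM"
proof -
  interpret W': generalised_cwf "FO (GO W)" by (rule T.generalised_cwf_FO)
  interpret H: fib1 "GU (FO (GO W))" "GU W" "GC epsM" "GH epsM"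
    using fib1_id[OF u.fibration_axioms] by (simp add: epsM_def)
  interpret B: func "Base (GUd (FO (GO W)))" "Base (GUd W)" "GC epsM"
    using H.B.func_axioms by simp
  interpret E: func "gV (FO (GO W))" "gV W" "GHd epsM" using func_el_ftr by (simp add: epsM_def)
  have S: "func (tcat (GO W)) (gU W) (tSig (GO W))" using T.func_tSig by simp
  have "ntrans (tcat (GO W)) (gU W) (GSig W \<circ>\<^sub>c el_ftr) (tSig (GO W)) (GZeta epsM)"
  proof (rule ntransI[OF func_comp[OF func_el_ftr Sig.func_axioms] S])
    fix x assume "x \<in> Obj (tcat (GO W))"
    then obtain A s where [simp]: "x = enc (A, s)" and s: "sect (GO W) A s" by (rule tcat_ObjE)
    show "NComp (GZeta epsM) x \<in> Arr (gU W) \<and> Dom (gU W) (NComp (GZeta epsM) x) =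
        FObj (GSig W \<circ>\<^sub>c el_ftr) x \<and>
        Cod (gU W) (NComp (GZeta epsM) x) = FObj (tSig (GO W)) x"
      using s el[OF s] by (simp add: epsM_def)
  next
    fix f assume "f \<in> Arr (tcat (GO W))"
    then obtain h s s' where [simp]: "f = enc (h, enc (s, s'))" and h:
        "tm (GO W) h s s'" by (rule tcat_ArrE)
    show "Comp (gU W) (FArr (tSig (GO W)) f) (NComp (GZeta epsM) (Dom (tcat (GO W)) f)) =
      Comp (gU W) (NComp (GZeta epsM) (Cod (tcat (GO W)) f)) (FArr (GSig W \<circ>\<^sub>c el_ftr) f)"
      using h el_iso_natural[OF h] h[unfolded tm_GO] by (simp add: epsM_def)
  qed (simp_all add: epsM_def)
  then interpret z: ntrans "gV (FO (GO W))" "gU W" "GSig W \<circ>\<^sub>c GHd epsM" "GH epsM \<circ>\<^sub>c GSig (FO (GO W))"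
    "GZeta epsM"
    using comp_ftr_id[OF S] by (simp add: epsM_def)
  show ?thesis
  proof unfold_locales
    fix f assume "f \<in> Arr (gV (FO (GO W)))"
    then have "f \<in> Arr (tcat (GO W))" by simp
    then obtain h s s' where [simp]: "f = enc (h, enc (s, s'))" and h:
        "tm (GO W) h s s'" by (rule tcat_ArrE)
    have h': "h \<in> Arr (gU W)" using h by (simp add: tm_GO)
    show "FArr (gv W) (FArr (GHd epsM) f) = FArr (GC epsM) (FArr (gv (FO (GO W))) f)"
      using over_el_arr[OF h] h h' by (simp add: epsM_def)
  next
    fix f assume c: "cartesian (gv (FO (GO W))) f"
    then have "f \<in> Arr (tcat (GO W))" using W'.v.cart_arr[OF c] by simp
    then obtain h s s' where f: "f = enc (h, enc (s, s'))" and h: "tm (GO W) h s s'" by (rule tcat_ArrE)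
    have h': "h \<in> Arr (gU W)" "sect (GO W) (Dom (gU W) h) s" "sect (GO W) (Cod (gU W) h) s'"
      using h by (simp_all add: tm_GO)
    note z = el[OF h'(2)] and z' = el[OF h'(3)]
    have "cartesian (gu W) h" using T.tSig_cartesian[of f] c h by (simp add: f)
    \<comment> \<open>That terms are sent to terms cartesianly is seen after \<Sigma>, which
      reflects cartesian arrows: there the image is \<open>h\<close> conjugated with
      isomorphisms.\<close>
    then have "cartesian (gu W) (Comp (gU W) h (el_iso (Dom (gU W) h) s))"
      by (rule u.cart_comp[OF u.cart_iso[OF z(7)]]) (use z in simp)
    then have "cartesian (gu W) (FArr (GSig W) (el_arr h s s'))"
      unfolding el_arr(4)[OF h] by (rule u.cart_comp[OF _ u.cart_iso[OF u.C.iso_inv[OF z'(7)]]])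
        (use z z' h' in simp)
    then show "cartesian (gv W) (FArr (GHd epsM) f)"
      using Sig_reflects_cartesian[OF el_arr(1)[OF h]] h by (simp add: f epsM_def)
  next
    fix a assume "a \<in> Obj (gV (FO (GO W)))"
    then have "a \<in> Obj (tcat (GO W))" by simp
    then obtain A s where [simp]: "a = enc (A, s)" and s: "sect (GO W) A s" by (rule tcat_ObjE)
    have A: "A \<in> Obj (gU W)" using s by (simp add: sect_GO)
    show "is_iso (gU W) (NComp (GZeta epsM) a)"
      "FArr (gu W) (NComp (GZeta epsM) a) = Ide (gB W) (FObj (GC epsM) (FObj (gv (FO (GO W))) a))"
      using s el[OF s] A by (simp_all add: epsM_def)
  qed (simp_all add: epsM_def)
qed

text \<open>Over the base the mate is \<open>q\<close> of \<open>wk A\<close> after the section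
  named by the reindexed generic term. By \<open>el\<close> that section corresponds to
  \<open>diag A\<close>, and \<open>q\<close> of \<open>wk A\<close> after \<open>diag A\<close> is
  an identity.\<close>

lemma GM_epsM: "GM epsM = comp_id1 (GO W)"
proof -
  interpret g: gmorphism "FO (GO W)" W epsM by (rule gmorphism_epsM)
  note i = lax_comp_id1[OF comprehension_category_GO]
  show ?thesis
  proof (rule lax_eqI[OF g.lax_GM[unfolded T.GO_FO] i(1)])
    fix A assume "A \<in> Obj (cE (GO W))"
    then have A: "A \<in> Obj (gU W)" by simp
    note A' = A[folded CFib_GO]
    note d = X.diag[OF A'] and w = X.wk[OF A', unfolded CFib_GO]
    note z = el[OF d(1)]
    have "FArr (gv W) (g.mate A) = Comp (gB W) (FArr (gv W) (FArr (GDel W) (X.wk A)))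
        (Comp (gB W) (FArr (gv W) (FArr (GDel W) (el_iso (X.K A) (X.diag A)))) (gsig W (el (X.K A)
            (X.diag A))))"
      using A A' d w z by (subst g.mate_eq) (simp_all add: epsM_def gsig_def)
    also have "\<dots> = Ide (gB W) (FObj (gv W) (FObj (GDel W) A))"
      unfolding z(8) using d(2) A w by simp
    finally show "tt (GM epsM) A = tt (comp_id1 (GO W)) A" using A by (simp add: i(2))
  qed (simp_all add: comp_id1_def epsM_def)
qed

lemma sect_gsig: "a \<in> Obj (gV W) \<Longrightarrow> sect (GO W) (FObj (GSig W) a) (gsig W a)"
  using eps_gsig[of a] by (simp add: sect_GO)

lemma tm_gsig:
  "f \<in> Arr (gV W) \<Longrightarrow> tm (GO W) (FArr (GSig W) f) (gsig W (Dom (gV W) f)) (gsig W (Cod (gV W) f))"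
  using gsig_natural[of f] by (simp add: tm_GO sect_gsig)

lemma func_gsig_ftr: "func (gV W) (tcat (GO W)) gsig_ftr"
proof (rule funcI)
  fix f assume f: "f \<in> Arr (gV W)"
  show "FArr gsig_ftr f \<in> Arr (tcat (GO W)) \<and> Dom (tcat (GO W)) (FArr gsig_ftr f) =
      FObj gsig_ftr (Dom (gV W) f) \<and>
      Cod (tcat (GO W)) (FArr gsig_ftr f) = FObj gsig_ftr (Cod (gV W) f)"
    using f tm_gsig[OF f] by simp
next
  fix a assume a: "a \<in> Obj (gV W)"
  show "FObj gsig_ftr a \<in> Obj (tcat (GO W))" "FArr gsig_ftr (Ide (gV W) a) =
      Ide (tcat (GO W)) (FObj gsig_ftr a)"
    using a sect_gsig[OF a] by simp_all
next
  fix f g assume fg: "f \<in> Arr (gV W)" "g \<in> Arr (gV W)" "Cod (gV W) f = Dom (gV W) g"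
  show "FArr gsig_ftr (Comp (gV W) g f) = Comp (tcat (GO W)) (FArr gsig_ftr g) (FArr gsig_ftr f)"
    using fg tm_gsig[OF fg(1)] tm_gsig[OF fg(2)] by simp
qed (simp_all add: T.tcat v.C.category_axioms, simp_all add: gsig_ftr_def)

lemma gmorphism_kapM: "gmorphism W (FO (GO W)) kapM"
proof -
  interpret W': generalised_cwf "FO (GO W)" by (rule T.generalised_cwf_FO)
  interpret H: fib1 "GU W" "GU (FO (GO W))" "GC kapM" "GH kapM"
    using fib1_id[OF u.fibration_axioms] by (simp add: kapM_def)
  interpret B: func "Base (GUd W)" "Base (GUd (FO (GO W)))" "GC kapM"
    using H.B.func_axioms by simp
  interpret E: func "gV W" "gV (FO (GO W))" "GHd kapM" using func_gsig_ftr by (simp add: kapM_def)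
  have S: "func (tcat (GO W)) (gU W) (tSig (GO W))" using T.func_tSig by simp
  have "tSig (GO W) \<circ>\<^sub>c gsig_ftr = GSig W"
    by (rule ftr_eqI[OF func_comp[OF func_gsig_ftr S] Sig.func_axioms]) (use tm_gsig in simp)
  then interpret z: ntrans "gV W" "gU (FO (GO W))" "GSig (FO (GO W)) \<circ>\<^sub>c GHd kapM" "GH kapM \<circ>\<^sub>c GSig W"
    "GZeta kapM"
    using comp_ftr_id[OF Sig.func_axioms] ntrans_id[OF Sig.func_axioms] by (simp add: kapM_def)
  show ?thesis
  proof unfold_locales
    fix f assume "f \<in> Arr (gV W)"
    then show "FArr (gv (FO (GO W))) (FArr (GHd kapM) f) = FArr (GC kapM) (FArr (gv W) f)"
      using tm_gsig[of f] by (simp add: kapM_def)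
  next
    fix f assume c: "cartesian (gv W) f"
    note f = v.cart_arr[OF c]
    show "cartesian (gv (FO (GO W))) (FArr (GHd kapM) f)"
      using T.cartesian_tcat[OF tm_gsig[OF f]] GSig_cartesian[OF c] f by (simp add: kapM_def)
  qed (simp_all add: kapM_def)
qed

text \<open>Over the base the mate is the image of \<epsilon> under \<open>v \<Delta>\<close>, after
  the section named by \<open>\<Delta> A\<close>; this is the image of the second triangle
  identity.\<close>

lemma GM_kapM: "GM kapM = comp_id1 (GO W)"
proof -
  interpret g: gmorphism W "FO (GO W)" kapM by (rule gmorphism_kapM)
  note i = lax_comp_id1[OF comprehension_category_GO]
  show ?thesis
  proof (rule lax_eqI[OF g.lax_GM[unfolded T.GO_FO] i(1)])
    fix A assume "A \<in> Obj (cE (GO W))"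
    then have A: "A \<in> Obj (gU W)" by simp
    let ?D = "FObj (GDel W) A" and ?S = "FObj (GSig W) (FObj (GDel W) A)"
    have D: "?D \<in> Obj (gV W)" using A by simp
    note s = sect_gsig[OF D]
    have e: "NComp (GEps W) A \<in> Arr (cE (GO W))" "Dom (cE (GO W)) (NComp (GEps W) A) = ?S"
      "Cod (cE (GO W)) (NComp (GEps W) A) = A" using A by simp_all
    note h = X.section_arr[OF s] and h' = X.tm_section_arr[OF s] and k = X.K_arr[OF e] and k' =
        X.tm_K_arr[OF e]
    have "g.mate A = Comp (tcat (GO W)) (FArr (tDel (GO W)) (NComp (GEps W) A))
        (NComp (tEta (GO W)) (enc (?S, gsig W ?D)))"
      using A D s by (subst g.mate_eq) (simp_all add: kapM_def)
    also have "\<dots> = enc (Comp (gU W) (X.K_arr (NComp (GEps W) A)) (X.section_arr ?S (gsig W ?D)),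
        enc (gsig W ?D, X.diag A))"
      using e s h h' k k' A by simp
    finally have "FArr (gv (FO (GO W))) (g.mate A) = Comp (gB W) (FArr (gv W) (FArr (GDel W) (NComp
        (GEps W) A))) (gsig W ?D)"
      using X.tm_comp[OF h' k'] h k e A D by simp
    also have "\<dots> = Ide (gB W) (FObj (gv W) ?D)"
      using v.comp_eq[OF triangle2[OF A]] A by (simp add: gsig_def)
    finally show "tt (GM kapM) A = tt (comp_id1 (GO W)) A" using A by (simp add: i(2))
  qed (simp_all add: comp_id1_def kapM_def)
qed

end

section \<open>The biequivalence\<close>

context encoding
begin

text \<open>Both legs of the naturality square of the counit at \<open>M\<close> are sent by
  \<open>G\<close> to \<open>G M\<close>; the 2-cell chosen is the one over the identity of
  \<open>G M\<close>.\<close>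

definition counit2 :: "'u gmor \<Rightarrow> 'u gcell" where
  "counit2 M = (SOME \<alpha>. \<alpha> \<in> Hom2 GCwF (gcwf_comp1 M (cwf_terms.epsM (GSrc M) enc))
     (gcwf_comp1 (cwf_terms.epsM (GTgt M) enc) (FM (GM M))) \<and> GC2 \<alpha> = Id2 CompCat (GM M))"

definition counitP :: "('u gcwf, 'u gmor, 'u gmor, 'u gcell) pseudo_nat" where
  "counitP = \<lparr>PObj = \<lambda>W. cwf_terms.epsM W enc, PArr = counit2\<rparr>"

lemma counit_facts:
  assumes "generalised_cwf W"
  shows "gmorphism (FO (GO W)) W (cwf_terms.epsM W enc)" "GM (cwf_terms.epsM W enc) = comp_id1 (GO W)"
    "gmorphism W (FO (GO W)) (cwf_terms.kapM W enc)" "GM (cwf_terms.kapM W enc) = comp_id1 (GO W)"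
proof -
  interpret generalised_cwf W by fact
  interpret cwf_terms W enc by unfold_locales
  show "gmorphism (FO (GO W)) W epsM" "GM epsM = comp_id1 (GO W)"
    "gmorphism W (FO (GO W)) kapM" "GM kapM = comp_id1 (GO W)"
    by (rule gmorphism_epsM GM_epsM gmorphism_kapM GM_kapM)+
qed

lemma counit2:
  assumes M: "gmorphism W W' M"
  shows "counit2 M \<in> Hom2 GCwF (gcwf_comp1 M (cwf_terms.epsM W enc))
      (gcwf_comp1 (cwf_terms.epsM W' enc) (FM (GM M))) \<and> GC2 (counit2 M) = Id2 CompCat (GM M)"
proof -
  interpret local_iso "CompCat :: ('u compcat, 'u compmor, 'u compcell) two_cat" GCwF GFun
    by (rule local_iso_GFun)
  interpret M: gmorphism W W' M by fact
  note e = counit_facts[OF M.W.generalised_cwf_axioms] and e' =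
      counit_facts[OF M.W'.generalised_cwf_axioms]
  note FG = FM_hom[OF M.lax_GM]
  have l: "gmorphism (FO (GO W)) W' (gcwf_comp1 M (cwf_terms.epsM W enc))"
    "gmorphism (FO (GO W)) W' (gcwf_comp1 (cwf_terms.epsM W' enc) (FM (GM M)))"
    by (rule gmorphism_comp1[OF e(1) M] gmorphism_comp1[OF FG(1) e'(1)])+
  have g: "GM (gcwf_comp1 M (cwf_terms.epsM W enc)) = GM M"
    "GM (gcwf_comp1 (cwf_terms.epsM W' enc) (FM (GM M))) = GM M"
    by (simp_all add: GM_comp1[OF e(1) M] GM_comp1[OF FG(1) e'(1)] e(2) e'(2) FG(2)
        comp_comp1_id[OF M.lax_GM])
  have "Id2 CompCat (GM M) \<in> Hom2 CompCat (GM M) (GM M)"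
    using K.Id2_Hom2[of "GM M" "GO W" "GO W'"] M.lax_GM by (simp only: Hom1_CompCat)
  then have "\<exists>\<alpha> \<in> Hom2 GCwF (gcwf_comp1 M (cwf_terms.epsM W enc))
      (gcwf_comp1 (cwf_terms.epsM W' enc) (FM (GM M))). Map2 GFun \<alpha> = Id2 CompCat (GM M)"
    by (intro full2[of _ "FO (GO W)" W']) (use l g in \<open>simp_all only: Hom1_GCwF GFun_simps\<close>)
  then have "\<exists>\<alpha>. \<alpha> \<in> Hom2 GCwF (gcwf_comp1 M (cwf_terms.epsM (GSrc M) enc))
     (gcwf_comp1 (cwf_terms.epsM (GTgt M) enc) (FM (GM M))) \<and> GC2 \<alpha> = Id2 CompCat (GM M)"
    by (auto simp only: M.GSrc M.GTgt GFun_simps)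
  from someI_ex[OF this, folded counit2_def] show ?thesis by (simp only: M.GSrc M.GTgt)
qed

lemma local_iso_section_FFun:
  "local_iso_section (CompCat :: ('u compcat, 'u compmor, 'u compcell) two_cat) GCwF FFun GFun counitP
    (\<lambda>W. cwf_terms.kapM W enc)"
proof (intro local_iso_section.intro local_iso_section_axioms.intro)
  show "local_iso (CompCat :: ('u compcat, 'u compmor, 'u compcell) two_cat) GCwF GFun"
    by (rule local_iso_GFun)
  show "two_functor (CompCat :: ('u compcat, 'u compmor, 'u compcell) two_cat) GCwF FFun"
    by (rule two_functor_FFun)
  show "two_ftr_eq (CompCat :: ('u compcat, 'u compmor, 'u compcell) two_cat) (comp_two_ftr GFun
      FFun) id_two_ftr"
    by (rule GFun_FFun)
  fix M W W' assume "M \<in> Hom1 (GCwF :: ('u gcwf, 'u gmor, 'u gcell) two_cat) W W'"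
  then show "PArr counitP M \<in> Hom2 GCwF (Comp1 GCwF M (PObj counitP W))
      (Comp1 GCwF (PObj counitP W') (Map1 FFun (Map1 GFun M)))"
    "Map2 GFun (PArr counitP M) = Id2 CompCat (Map1 GFun M)"
    using counit2[of W W' M] by (simp_all add: counitP_def)
qed (use counit_facts in \<open>simp_all add: counitP_def\<close>)

end

theorem theorem4p1:
  assumes "infinite (UNIV :: 'u set)"
  shows "\<exists>F G \<eta> \<epsilon>.
    adjoint_biequivalence (CompCat :: ('u compcat, 'u compmor, 'u compcell) two_cat)
      (GCwF :: ('u gcwf, 'u gmor, 'u gcell) two_cat) F G \<eta> \<epsilon> \<and>
    two_ftr_eq (CompCat :: ('u compcat, 'u compmor, 'u compcell) two_cat)
      (comp_two_ftr G F) id_two_ftr \<and>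
    adjoint_biequivalence (CompCat_ps :: ('u compcat, 'u compmor, 'u compcell) two_cat)
      (GCwF_ps :: ('u gcwf, 'u gmor, 'u gcell) two_cat) F G \<eta> \<epsilon>"
proof -
  \<comment> \<open>An infinite type is equipotent with its square, which yields the pairing that
    codes terms.\<close>
  obtain enc :: "'u \<times> 'u \<Rightarrow> 'u" where "inj enc"
    using card_of_Times_same_infinite[OF assms] card_of_ordLeq[of "UNIV \<times> UNIV" "UNIV :: 'u set"]
      ordIso_iff_ordLeq by auto
  then interpret encoding enc by unfold_locales
  interpret local_iso_section "CompCat :: ('u compcat, 'u compmor, 'u compcell) two_cat" GCwF FFun GFun
    counitP "\<lambda>W. cwf_terms.kapM W enc" by (rule local_iso_section_FFun)
  \<comment> \<open>\<open>gcwf_pseudo\<close> is the preimage of \<open>comp_pseudo\<close> under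
    \<open>G\<close>, so it remains to see that pseudo lax morphisms contain the identities and are
    closed under composition.\<close>
  interpret ps: local_iso_section "CompCat_ps :: ('u compcat, 'u compmor, 'u compcell) two_cat" GCwF_ps
    FFun GFun counitP "\<lambda>W. cwf_terms.kapM W enc"
    unfolding CompCat_ps_def GCwF_ps_def
  proof (rule wide_2full_sub)
    fix X assume "X \<in> Cell0 (CompCat :: ('u compcat, 'u compmor, 'u compcell) two_cat)"
    then have X: "comprehension_category X" by simp
    then interpret X: comprehension_category X .
    show "comp_pseudo (Id1 CompCat X)"
      using lax.comp_pseudo_iff[OF lax_comp_id1(1)[OF X]] by (simp add: lax_comp_id1(2)[OF X])
  next
    fix M N X Y Z assume "M \<in> Hom1 (CompCat :: ('u compcat, 'u compmor, 'u compcell) two_cat) X Y"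
      "N \<in> Hom1 CompCat Y Z" and p: "comp_pseudo M" "comp_pseudo N"
    then interpret M: lax X Y M + N: lax Y Z N by simp_all
    note c = lax_comp_comp1[OF M.lax_axioms N.lax_axioms]
    show "comp_pseudo (Comp1 CompCat N M)"
      using lax.comp_pseudo_iff[OF c(1)] M.comp_pseudo_iff N.comp_pseudo_iff p
      by (simp add: c(2) N.Y.p.D.iso_comp)
  next
    fix M assume "M \<in> Cell1 (GCwF :: ('u gcwf, 'u gmor, 'u gcell) two_cat)"
    then interpret M: gmorphism "GSrc M" "GTgt M" M by (simp add: gmorphism_iff)
    show "gcwf_pseudo M \<longleftrightarrow> comp_pseudo (Map1 GFun M)"
      using M.gcwf_pseudo_iff_tt lax.comp_pseudo_iff[OF M.lax_GM] by simp
  qed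
  \<comment> \<open>The unit depends on its 2-category only through \<open>Id1\<close> and
    \<open>Id2\<close>, which the sub-2-category inherits; thus the same four data serve both
    biequivalences.\<close>
  have "id_pseudo CompCat_ps id_two_ftr = (id_pseudo CompCat id_two_ftr ::
    ('u compcat, 'u compmor, 'u compmor, 'u compcell) pseudo_nat)"
    by (simp add: id_pseudo_def CompCat_ps_def)
  then show ?thesis
    using adjoint_biequivalence GF ps.adjoint_biequivalence by metis
qed

end
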